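(* Let $X$ be a smooth projective variety over an algebraically closed field $\mathfrak k$, let $L$ be a line bundle on $X$ with $L^{-1}$ ample, and let $E_1,\dots,E_n$ be a full, strong, exceptional collection of line bundles on $X$ which generates a simple spiral with respect to $L$. Let $\pi:V\to X$ be the total space of $L$, let $V_0=\operatorname{Spec}\Gamma(\mathcal O_V)$, let $\mathbf Q$ be the Bondal quiver of the collection $\pi^*E_1,\dots,\pi^*E_n$ on $V$, let $M_0$ be the affine quotient of its representation space with dimension vector $(1,\dots,1)$, and let $\varphi_0:V_0\to M_0$ be the canonical map. Then $\varphi_0$ identifies $V_0$ with the canonical reduced subvariety of an irreducible component of $M_0$. In particular, if $M_0$ is reduced, then $\varphi_0$ is an isomorphism onto an irreducible component of $M_0$.
   Context: **Exceptional collections.** An object $E$ of a $\mathfrak k$-linear abelian category $\mathcal C$ is exceptional if $\operatorname{End}(E)\cong\mathfrak k$ and $\operatorname{Ext}^k(E,E)=0$ for $k\ne0$. A collection $E_1,\dots,E_n$ is exceptional if each $E_i$ is exceptional and $\operatorname{Ext}^\bullet(E_i,E_j)=0$ for $i>j$; it is full if it spans $\mathcal D(\mathcal C)$ (for every nonzero object $\mathcal F$ of $\mathcal{D}(\mathcal{C})$ there is an object $E$ in the set of objects considered with $\operatorname{Hom}_{\mathcal D(\mathcal C)}(E,\mathcal F)\neq0$, shifts of the $E_i$ being allowed), and strong if $\operatorname{Ext}^k(E_i,E_j)=0$ for all $k\neq0$ and all $i,j$. Here $\mathcal C=\operatorname{Coh}(X)$. **Simple spiral.** Extend the collection to all indices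 $i\in\mathbb Z$ by $E_{i-n}=E_i\otimes L$. This infinite collection is the spiral with respect to $L$; it is simple if $\operatorname{Ext}^k_X(E_i,E_j)=0$ for all $k\ne0$ and all $i\le j$ in $\mathbb Z$. **Bondal quiver, $M_0$ and $\varphi_0$.** Let $A=\operatorname{End}_V(\oplus_i\pi^*E_i)^{\mathrm{op}}$. The Bondal quiver $\mathbf Q$ is a quiver with relations with nodes $1,\dots,n$ whose path algebra is isomorphic to $A$; representations of $\mathbf Q$ are left $A$-modules. $R_\alpha(\mathbf Q)$, with $\alpha=(1,\dots,1)$, is the affine scheme whose points are collections of elements $a_{ij}\in\operatorname{Hom}_V(\pi^*E_i,\pi^*E_j)^\vee$ with $a_{ii}(\mathrm{id})=1$ and $a_{ik}(g\circ f)=a_{ij}(f)a_{jk}(g)$ for all $f\in\operatorname{Hom}_V(\pi^*E_i,\pi^*E_j)$, $g\in\operatorname{Hom}_V(\pi^*E_j,\pi^*E_k)$. The torus $G=\mathbb G_m^n/\mathbb G_m^{diag}$ acts by $a_{ij}\mapsto g_ia_{ij}g_j^{-1}$. Put $M_0=\operatorname{Spec}B^G$ where $B$ is the coordinate ring of $R_\alpha(\mathbf Q)$. The tautological map $T:V\to[R_\alpha(\mathbf Q)/G]$ sends $p$ to the fiber at $p$ of $\oplus_i\pi^*E_i^\vee$, on which $f\in\operatorname{Hom}_V(\pi^*E_i,\pi^*E_j)$ acts by its transpose. Pullback of global functions along $T$ gives $B^G\to\Gamma(\mathcal O_V)$, and $\varphi_0:V_0\to M_0$ is the induced map. *)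

theory Defs
  imports
    "HOL-Analysis.Abstract_Topology"
    "HOL-Algebra.QuotRing"
    "HOL-Algebra.Module"
    "HOL-Library.Poly_Mapping"
    "HOL-Combinatorics.Permutations"
    "HOL-Computational_Algebra.Polynomial"
begin

section \<open>Sheaves and locally ringed spaces\<close>

text \<open>\<open>ores X U W\<close> is the restriction map from \<open>U\<close> to \<open>W\<close>. The values of \<open>osec\<close> and \<open>ores\<close>
  matter only on open sets \<open>W \<subseteq> U\<close>.\<close>

record ('p, 'a) rspace =
  tp :: "'p topology"
  osec :: "'p set \<Rightarrow> 'a ring"
  ores :: "'p set \<Rightarrow> 'p set \<Rightarrow> 'a \<Rightarrow> 'a"

abbreviation pts :: "('p, 'a) rspace \<Rightarrow> 'p set"
  where "pts X \<equiv> topspace (tp X)"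

abbreviation opn :: "('p, 'a) rspace \<Rightarrow> 'p set \<Rightarrow> bool"
  where "opn X U \<equiv> openin (tp X) U"

definition is_presheaf ::
  "'p topology \<Rightarrow> ('p set \<Rightarrow> 's set) \<Rightarrow> ('p set \<Rightarrow> 'p set \<Rightarrow> 's \<Rightarrow> 's) \<Rightarrow> bool"
  where "is_presheaf T S res \<longleftrightarrow>
    (\<forall>U W. openin T U \<and> openin T W \<and> W \<subseteq> U \<longrightarrow> res U W \<in> S U \<rightarrow> S W) \<and>
    (\<forall>U. openin T U \<longrightarrow> (\<forall>s\<in>S U. res U U s = s)) \<and>
    (\<forall>U W Z. openin T U \<and> openin T W \<and> openin T Z \<and> Z \<subseteq> W \<and> W \<subseteq> U \<longrightarrow>
      (\<forall>s\<in>S U. res W Z (res U W s) = res U Z s))"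

definition is_sheaf ::
  "'p topology \<Rightarrow> ('p set \<Rightarrow> 's set) \<Rightarrow> ('p set \<Rightarrow> 'p set \<Rightarrow> 's \<Rightarrow> 's) \<Rightarrow> bool"
  where "is_sheaf T S res \<longleftrightarrow> is_presheaf T S res \<and>
    (\<forall>\<C> s. (\<forall>U\<in>\<C>. openin T U \<and> s U \<in> S U) \<and>
       (\<forall>U\<in>\<C>. \<forall>W\<in>\<C>. res U (U \<inter> W) (s U) = res W (U \<inter> W) (s W)) \<longrightarrow>
       (\<exists>!t. t \<in> S (\<Union>\<C>) \<and> (\<forall>U\<in>\<C>. res (\<Union>\<C>) U t = s U)))"

definition ring_sheaf :: "('p, 'a) rspace \<Rightarrow> bool"
  where "ring_sheaf X \<longleftrightarrow>
    (\<forall>U. opn X U \<longrightarrow> cring (osec X U)) \<and>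
    (\<forall>U W. opn X U \<and> opn X W \<and> W \<subseteq> U \<longrightarrow> ores X U W \<in> ring_hom (osec X U) (osec X W)) \<and>
    is_sheaf (tp X) (\<lambda>U. carrier (osec X U)) (ores X)"

text \<open>The germ at \<open>p\<close> of the section \<open>s\<close> over \<open>U\<close>, as an equivalence class of pairs
  (neighbourhood, section). Operations on classes are unions over representatives.\<close>

definition germ ::
  "'p topology \<Rightarrow> ('p set \<Rightarrow> 's set) \<Rightarrow> ('p set \<Rightarrow> 'p set \<Rightarrow> 's \<Rightarrow> 's) \<Rightarrow> 'p \<Rightarrow> 'p set \<Rightarrow> 's \<Rightarrow> ('p set \<times> 's) set"
  where "germ T S res p U s =
    {(U', s'). openin T U' \<and> p \<in> U' \<and> s' \<in> S U' \<and>
       (\<exists>W. openin T W \<and> p \<in> W \<and> W \<subseteq> U \<inter> U' \<and> res U W s = res U' W s')}"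

definition ogerm :: "('p, 'a) rspace \<Rightarrow> 'p \<Rightarrow> 'p set \<Rightarrow> 'a \<Rightarrow> ('p set \<times> 'a) set"
  where "ogerm X = germ (tp X) (\<lambda>U. carrier (osec X U)) (ores X)"

definition ostalk :: "('p, 'a) rspace \<Rightarrow> 'p \<Rightarrow> ('p set \<times> 'a) set ring"
  where "ostalk X p =
    \<lparr>carrier = {ogerm X p U s |U s. opn X U \<and> p \<in> U \<and> s \<in> carrier (osec X U)},
     monoid.mult = (\<lambda>A B. \<Union>(U, s)\<in>A. \<Union>(W, t)\<in>B. ogerm X p (U \<inter> W)
        (ores X U (U \<inter> W) s \<otimes>\<^bsub>osec X (U \<inter> W)\<^esub> ores X W (U \<inter> W) t)),
     one = ogerm X p (pts X) \<one>\<^bsub>osec X (pts X)\<^esub>,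
     zero = ogerm X p (pts X) \<zero>\<^bsub>osec X (pts X)\<^esub>,
     add = (\<lambda>A B. \<Union>(U, s)\<in>A. \<Union>(W, t)\<in>B. ogerm X p (U \<inter> W)
        (ores X U (U \<inter> W) s \<oplus>\<^bsub>osec X (U \<inter> W)\<^esub> ores X W (U \<inter> W) t))\<rparr>"

definition local_ring :: "'a ring \<Rightarrow> bool"
  where "local_ring R \<longleftrightarrow> cring R \<and> (\<exists>!m. maximalideal m R)"

definition lrs :: "('p, 'a) rspace \<Rightarrow> bool"
  where "lrs X \<longleftrightarrow> ring_sheaf X \<and> (\<forall>p\<in>pts X. local_ring (ostalk X p))"

definition open_sub :: "('p, 'a) rspace \<Rightarrow> 'p set \<Rightarrow> ('p, 'a) rspace"
  where "open_sub X U = \<lparr>tp = subtopology (tp X) U, osec = osec X, ores = ores X\<rparr>"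

text \<open>A morphism \<open>X \<rightarrow> Y\<close>: a map on points and the comorphism \<open>\<O>\<^sub>Y(U) \<rightarrow> \<O>\<^sub>X(f\<^sup>-\<^sup>1 U)\<close>.\<close>

record ('p, 'a, 'q, 'b) rmor =
  mpt :: "'p \<Rightarrow> 'q"
  mco :: "'q set \<Rightarrow> 'b \<Rightarrow> 'a"

definition preim :: "('p, 'a) rspace \<Rightarrow> ('p, 'a, 'q, 'b) rmor \<Rightarrow> 'q set \<Rightarrow> 'p set"
  where "preim X f U = {p \<in> pts X. mpt f p \<in> U}"

definition stalk_map ::
  "('p, 'a) rspace \<Rightarrow> ('p, 'a, 'q, 'b) rmor \<Rightarrow> 'p \<Rightarrow> ('q set \<times> 'b) set \<Rightarrow> ('p set \<times> 'a) set"
  where "stalk_map X f p A = (\<Union>(U, s)\<in>A. ogerm X p (preim X f U) (mco f U s))"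

definition lrs_hom :: "('p, 'a) rspace \<Rightarrow> ('q, 'b) rspace \<Rightarrow> ('p, 'a, 'q, 'b) rmor \<Rightarrow> bool"
  where "lrs_hom X Y f \<longleftrightarrow>
    continuous_map (tp X) (tp Y) (mpt f) \<and>
    (\<forall>U. opn Y U \<longrightarrow> mco f U \<in> ring_hom (osec Y U) (osec X (preim X f U))) \<and>
    (\<forall>U W. opn Y U \<and> opn Y W \<and> W \<subseteq> U \<longrightarrow> (\<forall>s\<in>carrier (osec Y U).
       mco f W (ores Y U W s) = ores X (preim X f U) (preim X f W) (mco f U s))) \<and>
    (\<forall>p\<in>pts X. \<forall>A\<in>carrier (ostalk Y (mpt f p)).
       stalk_map X f p A \<in> Units (ostalk X p) \<longrightarrow> A \<in> Units (ostalk Y (mpt f p)))"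

definition mor_eq ::
  "('p, 'a) rspace \<Rightarrow> ('q, 'b) rspace \<Rightarrow> ('p, 'a, 'q, 'b) rmor \<Rightarrow> ('p, 'a, 'q, 'b) rmor \<Rightarrow> bool"
  where "mor_eq X Y f g \<longleftrightarrow> (\<forall>p\<in>pts X. mpt f p = mpt g p) \<and>
    (\<forall>U. opn Y U \<longrightarrow> (\<forall>s\<in>carrier (osec Y U). mco f U s = mco g U s))"

definition mor_id :: "('p, 'a, 'p, 'a) rmor"
  where "mor_id = \<lparr>mpt = (\<lambda>p. p), mco = (\<lambda>U s. s)\<rparr>"

text \<open>\<open>mor_comp Y g f\<close> is \<open>g \<circ> f\<close> for \<open>f : X \<rightarrow> Y\<close> and \<open>g : Y \<rightarrow> Z\<close>.\<close>

definition mor_comp ::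
  "('q, 'b) rspace \<Rightarrow> ('q, 'b, 'r, 'c) rmor \<Rightarrow> ('p, 'a, 'q, 'b) rmor \<Rightarrow> ('p, 'a, 'r, 'c) rmor"
  where "mor_comp Y g f =
    \<lparr>mpt = (\<lambda>p. mpt g (mpt f p)), mco = (\<lambda>U s. mco f (preim Y g U) (mco g U s))\<rparr>"

definition lrs_iso :: "('p, 'a) rspace \<Rightarrow> ('q, 'b) rspace \<Rightarrow> ('p, 'a, 'q, 'b) rmor \<Rightarrow> bool"
  where "lrs_iso X Y f \<longleftrightarrow> lrs_hom X Y f \<and>
    (\<exists>g. lrs_hom Y X g \<and> mor_eq X X (mor_comp Y g f) mor_id \<and> mor_eq Y Y (mor_comp X f g) mor_id)"

definition closed_immersion :: "('p, 'a) rspace \<Rightarrow> ('q, 'b) rspace \<Rightarrow> ('p, 'a, 'q, 'b) rmor \<Rightarrow> bool"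
  where "closed_immersion X Y f \<longleftrightarrow> lrs_hom X Y f \<and>
    closedin (tp Y) (mpt f ` pts X) \<and>
    homeomorphic_map (tp X) (subtopology (tp Y) (mpt f ` pts X)) (mpt f) \<and>
    (\<forall>p\<in>pts X. stalk_map X f p ` carrier (ostalk Y (mpt f p)) = carrier (ostalk X p))"


section \<open>Affine schemes, projective space, varieties\<close>

text \<open>Fractions \<open>a/t\<close> with \<open>(a, t) \<in> D\<close>, where \<open>(a, t)\<close> and \<open>(b, s)\<close> are identified if
  \<open>u(as - bt) = 0\<close> for some \<open>u \<in> M\<close>.\<close>

definition fraction :: "'a ring \<Rightarrow> ('a \<times> 'a) set \<Rightarrow> 'a set \<Rightarrow> 'a \<times> 'a \<Rightarrow> ('a \<times> 'a) set"
  where "fraction R D M x =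
    {(b, s) \<in> D. \<exists>u\<in>M. u \<otimes>\<^bsub>R\<^esub> (fst x \<otimes>\<^bsub>R\<^esub> s \<ominus>\<^bsub>R\<^esub> b \<otimes>\<^bsub>R\<^esub> snd x) = \<zero>\<^bsub>R\<^esub>}"

definition frac_ring :: "'a ring \<Rightarrow> ('a \<times> 'a) set \<Rightarrow> 'a set \<Rightarrow> ('a \<times> 'a) set ring"
  where "frac_ring R D M =
    \<lparr>carrier = fraction R D M ` D,
     monoid.mult = (\<lambda>A B. \<Union>(a, s)\<in>A. \<Union>(b, t)\<in>B. fraction R D M (a \<otimes>\<^bsub>R\<^esub> b, s \<otimes>\<^bsub>R\<^esub> t)),
     one = fraction R D M (\<one>\<^bsub>R\<^esub>, \<one>\<^bsub>R\<^esub>),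
     zero = fraction R D M (\<zero>\<^bsub>R\<^esub>, \<one>\<^bsub>R\<^esub>),
     add = (\<lambda>A B. \<Union>(a, s)\<in>A. \<Union>(b, t)\<in>B.
        fraction R D M (a \<otimes>\<^bsub>R\<^esub> t \<oplus>\<^bsub>R\<^esub> b \<otimes>\<^bsub>R\<^esub> s, s \<otimes>\<^bsub>R\<^esub> t))\<rparr>"

text \<open>The ringed space on a set \<open>P\<close> of prime ideals with the Zariski topology, whose sections over
  \<open>U\<close> are the functions \<open>p \<mapsto> s p\<close>, with \<open>s p\<close> in the localization at \<open>p\<close>, that are locally a
  fraction. It specializes to \<open>Spec\<close> and to \<open>Proj\<close>.\<close>

definition zariski :: "'a ring \<Rightarrow> 'a set set \<Rightarrow> 'a set topology"
  where "zariski R P = topology (\<lambda>U. \<exists>S\<subseteq>carrier R. U = {p \<in> P. \<not> S \<subseteq> p})"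

definition frac_space ::
  "'a ring \<Rightarrow> 'a set set \<Rightarrow> ('a set \<Rightarrow> ('a \<times> 'a) set) \<Rightarrow> ('a set \<Rightarrow> 'a set)
    \<Rightarrow> ('a set, 'a set \<Rightarrow> ('a \<times> 'a) set) rspace"
  where "frac_space R P D M =
    \<lparr>tp = zariski R P,
     osec = (\<lambda>U. \<lparr>
       carrier = {s \<in> extensional U. \<forall>p\<in>U. \<exists>W x. openin (zariski R P) W \<and> p \<in> W \<and> W \<subseteq> U \<and>
         (\<forall>q\<in>W. x \<in> D q \<and> s q = fraction R (D q) (M q) x)},
       monoid.mult = (\<lambda>s t. \<lambda>p\<in>U. s p \<otimes>\<^bsub>frac_ring R (D p) (M p)\<^esub> t p),
       one = (\<lambda>p\<in>U. \<one>\<^bsub>frac_ring R (D p) (M p)\<^esub>),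
       zero = (\<lambda>p\<in>U. \<zero>\<^bsub>frac_ring R (D p) (M p)\<^esub>),
       add = (\<lambda>s t. \<lambda>p\<in>U. s p \<oplus>\<^bsub>frac_ring R (D p) (M p)\<^esub> t p)\<rparr>),
     ores = (\<lambda>U W s. restrict s W)\<rparr>"

definition loc_den :: "'a ring \<Rightarrow> 'a set \<Rightarrow> 'a set"
  where "loc_den R p = carrier R - p"

definition loc_pairs :: "'a ring \<Rightarrow> 'a set \<Rightarrow> ('a \<times> 'a) set"
  where "loc_pairs R p = carrier R \<times> (carrier R - p)"

definition Spec :: "'a ring \<Rightarrow> ('a set, 'a set \<Rightarrow> ('a \<times> 'a) set) rspace"
  where "Spec R = frac_space R {p. primeideal p R} (loc_pairs R) (loc_den R)"

text \<open>The morphism \<open>Spec S \<rightarrow> Spec R\<close> induced by a ring homomorphism \<open>h : R \<rightarrow> S\<close>.\<close>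

definition Spec_map ::
  "'a ring \<Rightarrow> 'b ring \<Rightarrow> ('a \<Rightarrow> 'b)
    \<Rightarrow> ('b set, 'b set \<Rightarrow> ('b \<times> 'b) set, 'a set, 'a set \<Rightarrow> ('a \<times> 'a) set) rmor"
  where "Spec_map R S h =
    \<lparr>mpt = (\<lambda>q. {a \<in> carrier R. h a \<in> q}),
     mco = (\<lambda>U s. \<lambda>q\<in>{q. primeideal q S \<and> {a \<in> carrier R. h a \<in> q} \<in> U}.
        \<Union>(a, t)\<in>s {a \<in> carrier R. h a \<in> q}. fraction S (loc_pairs S q) (loc_den S q) (h a, h t))\<rparr>"

definition affine_open :: "('p, 'a) rspace \<Rightarrow> 'p set \<Rightarrow> bool"
  where "affine_open X U \<longleftrightarrow> opn X U \<and> (\<exists>f. lrs_iso (open_sub X U) (Spec (osec X U)) f)"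

definition scheme :: "('p, 'a) rspace \<Rightarrow> bool"
  where "scheme X \<longleftrightarrow> lrs X \<and> (\<forall>p\<in>pts X. \<exists>U. affine_open X U \<and> p \<in> U)"

definition reduced_scheme :: "('p, 'a) rspace \<Rightarrow> bool"
  where "reduced_scheme X \<longleftrightarrow> scheme X \<and> (\<forall>U. opn X U \<longrightarrow>
    (\<forall>a\<in>carrier (osec X U). \<forall>m::nat. a [^]\<^bsub>osec X U\<^esub> m = \<zero>\<^bsub>osec X U\<^esub> \<longrightarrow> a = \<zero>\<^bsub>osec X U\<^esub>))"

definition integral_scheme :: "('p, 'a) rspace \<Rightarrow> bool"
  where "integral_scheme X \<longleftrightarrow> scheme X \<and> pts X \<noteq> {} \<and>
    (\<forall>U. opn X U \<and> U \<noteq> {} \<longrightarrow> domain (osec X U))"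

text \<open>Polynomials over the field \<open>'k\<close> in variables from \<open>'v\<close> are elements of the monoid algebra
  \<open>('v \<Rightarrow>\<^sub>0 nat) \<Rightarrow>\<^sub>0 'k\<close>; \<open>mpoly_ring S\<close> is the polynomial ring in the variables in \<open>S\<close>.\<close>

type_synonym ('v, 'k) mpol = "('v \<Rightarrow>\<^sub>0 nat) \<Rightarrow>\<^sub>0 'k"

definition mpoly_ring :: "'v set \<Rightarrow> ('v, 'k::field) mpol ring"
  where "mpoly_ring S = \<lparr>carrier = {q. \<forall>m\<in>Poly_Mapping.keys q. Poly_Mapping.keys m \<subseteq> S},
    monoid.mult = (*), one = 1, zero = 0, add = (+)\<rparr>"

definition mConst :: "'k \<Rightarrow> ('v, 'k::field) mpol"
  where "mConst c = Poly_Mapping.single 0 c"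

definition mVar :: "'v \<Rightarrow> ('v, 'k::field) mpol"
  where "mVar v = Poly_Mapping.single (Poly_Mapping.single v 1) 1"

definition mp_eval ::
  "('k \<Rightarrow> 'a) \<Rightarrow> 'a ring \<Rightarrow> ('v \<Rightarrow> 'a) \<Rightarrow> ('v, 'k::field) mpol \<Rightarrow> 'a"
  where "mp_eval c R x q = finsum R
    (\<lambda>m. c (Poly_Mapping.lookup q m) \<otimes>\<^bsub>R\<^esub>
      finprod R (\<lambda>v. x v [^]\<^bsub>R\<^esub> Poly_Mapping.lookup m v) (Poly_Mapping.keys m)) (Poly_Mapping.keys q)"

definition mp_deriv :: "'v \<Rightarrow> ('v, 'k::field) mpol \<Rightarrow> ('v, 'k) mpol"
  where "mp_deriv v q = (\<Sum>m\<in>Poly_Mapping.keys q. Poly_Mapping.single (m - Poly_Mapping.single v 1)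
    (of_nat (Poly_Mapping.lookup m v) * Poly_Mapping.lookup q m))"

definition mono_deg :: "('v \<Rightarrow>\<^sub>0 nat) \<Rightarrow> nat"
  where "mono_deg m = (\<Sum>v\<in>Poly_Mapping.keys m. Poly_Mapping.lookup m v)"

definition homog :: "nat \<Rightarrow> ('v, 'k::field) mpol \<Rightarrow> bool"
  where "homog d q \<longleftrightarrow> (\<forall>m\<in>Poly_Mapping.keys q. mono_deg m = d)"

definition homog_part :: "nat \<Rightarrow> ('v, 'k::field) mpol \<Rightarrow> ('v, 'k) mpol"
  where "homog_part d q =
    (\<Sum>m\<in>{m \<in> Poly_Mapping.keys q. mono_deg m = d}. Poly_Mapping.single m (Poly_Mapping.lookup q m))"

definition proj_points :: "nat \<Rightarrow> (nat, 'k::field) mpol set set"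
  where "proj_points N = {p. primeideal p (mpoly_ring {..N}) \<and>
    (\<forall>q\<in>p. \<forall>d. homog_part d q \<in> p) \<and>
    \<not> {q \<in> carrier (mpoly_ring {..N}). Poly_Mapping.lookup q 0 = 0} \<subseteq> p}"

definition proj_den :: "nat \<Rightarrow> (nat, 'k::field) mpol set \<Rightarrow> (nat, 'k) mpol set"
  where "proj_den N p = {t \<in> carrier (mpoly_ring {..N}) - p. \<exists>d. homog d t}"

definition proj_pairs ::
  "nat \<Rightarrow> (nat, 'k::field) mpol set \<Rightarrow> ((nat, 'k) mpol \<times> (nat, 'k) mpol) set"
  where "proj_pairs N p = {(a, t). a \<in> carrier (mpoly_ring {..N}) \<and>
    t \<in> carrier (mpoly_ring {..N}) - p \<and> (\<exists>d. homog d a \<and> homog d t)}"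

text \<open>Projective space of dimension \<open>N\<close> as \<open>Proj\<close> of the polynomial ring in the variables
  \<open>0, \<dots>, N\<close>.\<close>

definition proj_space ::
  "nat \<Rightarrow> ((nat, 'k::field) mpol set, (nat, 'k) mpol set \<Rightarrow> ((nat, 'k) mpol \<times> (nat, 'k) mpol) set) rspace"
  where "proj_space N = frac_space (mpoly_ring {..N}) (proj_points N) (proj_pairs N) (proj_den N)"

definition proj_const ::
  "nat \<Rightarrow> 'k \<Rightarrow> (nat, 'k::field) mpol set \<Rightarrow> ((nat, 'k) mpol \<times> (nat, 'k) mpol) set"
  where "proj_const N c = (\<lambda>p\<in>proj_points N.
    fraction (mpoly_ring {..N}) (proj_pairs N p) (proj_den N p) (mConst c, 1))"

text \<open>The structure of a scheme over \<open>k\<close> is given by a ring homomorphism from \<open>k\<close>, the universe of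
  the type \<open>'k\<close>, to the global functions.\<close>

definition k_ring :: "'k::field ring"
  where "k_ring = \<lparr>carrier = UNIV, monoid.mult = (*), one = 1, zero = 0, add = (+)\<rparr>"

definition k_scheme :: "('k::field \<Rightarrow> 'a) \<Rightarrow> ('p, 'a) rspace \<Rightarrow> bool"
  where "k_scheme \<kappa> X \<longleftrightarrow> scheme X \<and> \<kappa> \<in> ring_hom k_ring (osec X (pts X))"

definition k_const :: "('k \<Rightarrow> 'a) \<Rightarrow> ('p, 'a) rspace \<Rightarrow> 'p set \<Rightarrow> 'k \<Rightarrow> 'a"
  where "k_const \<kappa> X U c = ores X (pts X) U (\<kappa> c)"

definition projective_over_k :: "('k::field \<Rightarrow> 'a) \<Rightarrow> ('p, 'a) rspace \<Rightarrow> bool"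
  where "projective_over_k \<kappa> X \<longleftrightarrow> (\<exists>N f.
    closed_immersion X (proj_space N) f \<and>
    (\<forall>c::'k. mco f (pts (proj_space N :: ((nat, 'k) mpol set, _) rspace)) (proj_const N c) = \<kappa> c))"

text \<open>Smoothness over \<open>k\<close>: locally \<open>X\<close> is the spectrum of a standard smooth algebra
  \<open>k[x\<^sub>1, \<dots>, x\<^sub>n]/(f\<^sub>1, \<dots>, f\<^sub>c)\<close>, that is, the Jacobian minor \<open>det (\<partial>f\<^sub>i/\<partial>x\<^sub>j)\<close>, \<open>i, j \<le> c\<close>,
  is invertible in it.\<close>

definition smooth_over_k :: "('k::field \<Rightarrow> 'a) \<Rightarrow> ('p, 'a) rspace \<Rightarrow> bool"
  where "smooth_over_k \<kappa> X \<longleftrightarrow> (\<forall>p\<in>pts X. \<exists>U. affine_open X U \<and> p \<in> U \<and>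
    (\<exists>(n::nat) c x f. c \<le> n \<and> x \<in> {..<n} \<rightarrow> carrier (osec X U) \<and>
       f \<in> {..<c} \<rightarrow> carrier (mpoly_ring {..<n}) \<and>
       mp_eval (k_const \<kappa> X U) (osec X U) x ` carrier (mpoly_ring {..<n}) = carrier (osec X U) \<and>
       {q \<in> carrier (mpoly_ring {..<n}). mp_eval (k_const \<kappa> X U) (osec X U) x q = \<zero>\<^bsub>osec X U\<^esub>}
         = genideal (mpoly_ring {..<n}) (f ` {..<c}) \<and>
       mp_eval (k_const \<kappa> X U) (osec X U) x
         (\<Sum>\<tau> | \<tau> permutes {..<c}. of_int (sign \<tau>) * (\<Prod>i<c. mp_deriv (\<tau> i) (f i)))
         \<in> Units (osec X U)))"

text \<open>A variety is an integral separated scheme of finite type over \<open>k\<close>. Separatedness and finite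
  type need not be listed: they follow from the closed immersion into projective space.\<close>

definition smooth_projective_variety :: "('k::field \<Rightarrow> 'a) \<Rightarrow> ('p, 'a) rspace \<Rightarrow> bool"
  where "smooth_projective_variety \<kappa> X \<longleftrightarrow>
    k_scheme \<kappa> X \<and> integral_scheme X \<and> projective_over_k \<kappa> X \<and> smooth_over_k \<kappa> X"


section \<open>Sheaves of modules\<close>

record ('p, 'a, 'm) msheaf =
  msec :: "'p set \<Rightarrow> ('a, 'm) module"
  mres :: "'p set \<Rightarrow> 'p set \<Rightarrow> 'm \<Rightarrow> 'm"

definition mod_sheaf :: "('p, 'a) rspace \<Rightarrow> ('p, 'a, 'm) msheaf \<Rightarrow> bool"
  where "mod_sheaf X F \<longleftrightarrow>
    (\<forall>U. opn X U \<longrightarrow> module (osec X U) (msec F U)) \<and>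
    (\<forall>U W. opn X U \<and> opn X W \<and> W \<subseteq> U \<longrightarrow>
      (\<forall>s\<in>carrier (msec F U). \<forall>t\<in>carrier (msec F U).
         mres F U W (s \<oplus>\<^bsub>msec F U\<^esub> t) = mres F U W s \<oplus>\<^bsub>msec F W\<^esub> mres F U W t) \<and>
      (\<forall>a\<in>carrier (osec X U). \<forall>s\<in>carrier (msec F U).
         mres F U W (a \<odot>\<^bsub>msec F U\<^esub> s) = ores X U W a \<odot>\<^bsub>msec F W\<^esub> mres F U W s)) \<and>
    is_sheaf (tp X) (\<lambda>U. carrier (msec F U)) (mres F)"

text \<open>Homomorphisms of sheaves of modules. They are extensional, so that \<open>mod_hom X F G\<close> is the
  group \<open>Hom(F, G)\<close> without repetitions.\<close>

definition mod_hom ::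
  "('p, 'a) rspace \<Rightarrow> ('p, 'a, 'm) msheaf \<Rightarrow> ('p, 'a, 'n) msheaf \<Rightarrow> ('p set \<Rightarrow> 'm \<Rightarrow> 'n) set"
  where "mod_hom X F G = {f \<in> extensional {U. opn X U}.
    (\<forall>U. opn X U \<longrightarrow>
       f U \<in> carrier (msec F U) \<rightarrow>\<^sub>E carrier (msec G U) \<and>
       (\<forall>s\<in>carrier (msec F U). \<forall>t\<in>carrier (msec F U).
          f U (s \<oplus>\<^bsub>msec F U\<^esub> t) = f U s \<oplus>\<^bsub>msec G U\<^esub> f U t) \<and>
       (\<forall>a\<in>carrier (osec X U). \<forall>s\<in>carrier (msec F U).
          f U (a \<odot>\<^bsub>msec F U\<^esub> s) = a \<odot>\<^bsub>msec G U\<^esub> f U s)) \<and>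
    (\<forall>U W. opn X U \<and> opn X W \<and> W \<subseteq> U \<longrightarrow>
       (\<forall>s\<in>carrier (msec F U). f W (mres F U W s) = mres G U W (f U s)))}"

definition hom_id :: "('p, 'a) rspace \<Rightarrow> ('p, 'a, 'm) msheaf \<Rightarrow> 'p set \<Rightarrow> 'm \<Rightarrow> 'm"
  where "hom_id X F = (\<lambda>U\<in>{U. opn X U}. \<lambda>s\<in>carrier (msec F U). s)"

definition hom_comp ::
  "('p, 'a) rspace \<Rightarrow> ('p, 'a, 'm) msheaf \<Rightarrow> ('p set \<Rightarrow> 'n \<Rightarrow> 'r) \<Rightarrow> ('p set \<Rightarrow> 'm \<Rightarrow> 'n) \<Rightarrow> 'p set \<Rightarrow> 'm \<Rightarrow> 'r"
  where "hom_comp X F g f = (\<lambda>U\<in>{U. opn X U}. \<lambda>s\<in>carrier (msec F U). g U (f U s))"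

definition hom_zero ::
  "('p, 'a) rspace \<Rightarrow> ('p, 'a, 'm) msheaf \<Rightarrow> ('p, 'a, 'n) msheaf \<Rightarrow> 'p set \<Rightarrow> 'm \<Rightarrow> 'n"
  where "hom_zero X F G = (\<lambda>U\<in>{U. opn X U}. \<lambda>s\<in>carrier (msec F U). \<zero>\<^bsub>msec G U\<^esub>)"

definition hom_add ::
  "('p, 'a) rspace \<Rightarrow> ('p, 'a, 'm) msheaf \<Rightarrow> ('p, 'a, 'n) msheaf
    \<Rightarrow> ('p set \<Rightarrow> 'm \<Rightarrow> 'n) \<Rightarrow> ('p set \<Rightarrow> 'm \<Rightarrow> 'n) \<Rightarrow> 'p set \<Rightarrow> 'm \<Rightarrow> 'n"
  where "hom_add X F G f g = (\<lambda>U\<in>{U. opn X U}. \<lambda>s\<in>carrier (msec F U). f U s \<oplus>\<^bsub>msec G U\<^esub> g U s)"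

definition hom_smult ::
  "('p, 'a) rspace \<Rightarrow> ('p, 'a, 'm) msheaf \<Rightarrow> ('p, 'a, 'n) msheaf
    \<Rightarrow> 'a \<Rightarrow> ('p set \<Rightarrow> 'm \<Rightarrow> 'n) \<Rightarrow> 'p set \<Rightarrow> 'm \<Rightarrow> 'n"
  where "hom_smult X F G a f =
    (\<lambda>U\<in>{U. opn X U}. \<lambda>s\<in>carrier (msec F U). ores X (pts X) U a \<odot>\<^bsub>msec G U\<^esub> f U s)"

definition mod_iso :: "('p, 'a) rspace \<Rightarrow> ('p, 'a, 'm) msheaf \<Rightarrow> ('p, 'a, 'n) msheaf \<Rightarrow> bool"
  where "mod_iso X F G \<longleftrightarrow> (\<exists>f\<in>mod_hom X F G. \<forall>U. opn X U \<longrightarrow>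
    bij_betw (f U) (carrier (msec F U)) (carrier (msec G U)))"

text \<open>Module records inherit from \<open>ring\<close> the fields \<open>mult\<close> and \<open>one\<close>, which have no meaning for
  modules and are filled with \<open>undefined\<close> below.\<close>

definition reg_module :: "'a ring \<Rightarrow> ('a, 'a) module"
  where "reg_module R = \<lparr>carrier = carrier R, monoid.mult = undefined, one = undefined,
    zero = zero R, add = add R, module.smult = monoid.mult R\<rparr>"

definition osheaf :: "('p, 'a) rspace \<Rightarrow> ('p, 'a, 'a) msheaf"
  where "osheaf X = \<lparr>msec = (\<lambda>U. reg_module (osec X U)), mres = ores X\<rparr>"

definition pushforward_osheaf ::
  "('q, 'b) rspace \<Rightarrow> ('q, 'b, 'p, 'a) rmor \<Rightarrow> ('p, 'a, 'b) msheaf"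
  where "pushforward_osheaf V f =
    \<lparr>msec = (\<lambda>U. \<lparr>carrier = carrier (osec V (preim V f U)), monoid.mult = undefined, one = undefined,
        zero = \<zero>\<^bsub>osec V (preim V f U)\<^esub>, add = add (osec V (preim V f U)),
        module.smult = (\<lambda>a s. mco f U a \<otimes>\<^bsub>osec V (preim V f U)\<^esub> s)\<rparr>),
     mres = (\<lambda>U W. ores V (preim V f U) (preim V f W))\<rparr>"

text \<open>The dual \<open>\<H>om(L, \<O>)\<close>; for a line bundle \<open>L\<close> this is \<open>L\<^sup>-\<^sup>1\<close>.\<close>

definition dual ::
  "('p, 'a) rspace \<Rightarrow> ('p, 'a, 'm) msheaf \<Rightarrow> ('p, 'a, 'p set \<Rightarrow> 'm \<Rightarrow> 'a) msheaf"
  where "dual X L =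
    \<lparr>msec = (\<lambda>U. \<lparr>carrier = mod_hom (open_sub X U) L (osheaf X),
        monoid.mult = undefined, one = undefined,
        zero = hom_zero (open_sub X U) L (osheaf X),
        add = hom_add (open_sub X U) L (osheaf X),
        module.smult = hom_smult (open_sub X U) L (osheaf X)\<rparr>),
     mres = (\<lambda>U W f. restrict f {Z. opn X Z \<and> Z \<subseteq> W})\<rparr>"

definition free_gen :: "('p, 'a) rspace \<Rightarrow> ('p, 'a, 'm) msheaf \<Rightarrow> 'p set \<Rightarrow> 'm \<Rightarrow> bool"
  where "free_gen X F U e \<longleftrightarrow> opn X U \<and> e \<in> carrier (msec F U) \<and>
    (\<forall>W. opn X W \<and> W \<subseteq> U \<longrightarrow> (\<forall>s\<in>carrier (msec F W).
       \<exists>!a. a \<in> carrier (osec X W) \<and> s = a \<odot>\<^bsub>msec F W\<^esub> mres F U W e))"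

definition line_bundle :: "('p, 'a) rspace \<Rightarrow> ('p, 'a, 'm) msheaf \<Rightarrow> bool"
  where "line_bundle X F \<longleftrightarrow> mod_sheaf X F \<and> (\<forall>p\<in>pts X. \<exists>U e. p \<in> U \<and> free_gen X F U e)"

definition lin_comb ::
  "('p, 'a, 'm) msheaf \<Rightarrow> 'p set \<Rightarrow> 'p set \<Rightarrow> nat \<Rightarrow> (nat \<Rightarrow> 'a) \<Rightarrow> (nat \<Rightarrow> 'm) \<Rightarrow> 'm"
  where "lin_comb F U W n a s =
    finsum (msec F W) (\<lambda>i. a i \<odot>\<^bsub>msec F W\<^esub> mres F U W (s i)) {..<n}"

definition finite_type :: "('p, 'a) rspace \<Rightarrow> ('p, 'a, 'm) msheaf \<Rightarrow> bool"
  where "finite_type X F \<longleftrightarrow> (\<forall>p\<in>pts X. \<exists>U n s. opn X U \<and> p \<in> U \<and>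
    s \<in> {..<n} \<rightarrow> carrier (msec F U) \<and>
    (\<forall>W. opn X W \<and> W \<subseteq> U \<longrightarrow> (\<forall>t\<in>carrier (msec F W). \<forall>q\<in>W. \<exists>Z a.
       opn X Z \<and> q \<in> Z \<and> Z \<subseteq> W \<and> a \<in> {..<n} \<rightarrow> carrier (osec X Z) \<and>
       mres F W Z t = lin_comb F U Z n a s)))"

text \<open>Coherence: finite type, and for every open \<open>U\<close> and every \<open>\<O>\<^sub>U\<^sup>n \<rightarrow> F|\<^sub>U\<close>, given by sections
  \<open>s\<^sub>0, \<dots>, s\<^bsub>n-1\<^esub>\<close>, the kernel is of finite type, i.e. locally generated by finitely many
  relations \<open>r\<^sub>0, \<dots>, r\<^bsub>m-1\<^esub>\<close>.\<close>

definition coherent :: "('p, 'a) rspace \<Rightarrow> ('p, 'a, 'm) msheaf \<Rightarrow> bool"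
  where "coherent X F \<longleftrightarrow> mod_sheaf X F \<and> finite_type X F \<and>
    (\<forall>U n s. opn X U \<and> s \<in> {..<n} \<rightarrow> carrier (msec F U) \<longrightarrow>
      (\<forall>p\<in>U. \<exists>W (m::nat) r. opn X W \<and> p \<in> W \<and> W \<subseteq> U \<and>
        (\<forall>j<m. r j \<in> {..<n} \<rightarrow> carrier (osec X W) \<and>
           lin_comb F U W n (r j) s = \<zero>\<^bsub>msec F W\<^esub>) \<and>
        (\<forall>Z b. opn X Z \<and> Z \<subseteq> W \<and> b \<in> {..<n} \<rightarrow> carrier (osec X Z) \<and>
           lin_comb F U Z n b s = \<zero>\<^bsub>msec F Z\<^esub> \<longrightarrow>
           (\<forall>q\<in>Z. \<exists>Y c. opn X Y \<and> q \<in> Y \<and> Y \<subseteq> Z \<and> c \<in> {..<m} \<rightarrow> carrier (osec X Y) \<and>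
              (\<forall>i<n. ores X Z Y (b i) =
                 finsum (osec X Y) (\<lambda>j. c j \<otimes>\<^bsub>osec X Y\<^esub> ores X W Y (r j i)) {..<m})))))"

definition globally_generated :: "('p, 'a) rspace \<Rightarrow> ('p, 'a, 'm) msheaf \<Rightarrow> bool"
  where "globally_generated X F \<longleftrightarrow>
    (\<forall>U. opn X U \<longrightarrow> (\<forall>s\<in>carrier (msec F U). \<forall>p\<in>U. \<exists>W n t a.
       opn X W \<and> p \<in> W \<and> W \<subseteq> U \<and> t \<in> {..<n} \<rightarrow> carrier (msec F (pts X)) \<and>
       a \<in> {..<n} \<rightarrow> carrier (osec X W) \<and> mres F U W s = lin_comb F (pts X) W n a t))"


section \<open>Tensor products and pullbacks\<close>

definition mgerm :: "('p, 'a) rspace \<Rightarrow> ('p, 'a, 'm) msheaf \<Rightarrow> 'p \<Rightarrow> 'p set \<Rightarrow> 'm \<Rightarrow> ('p set \<times> 'm) set"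
  where "mgerm X F = germ (tp X) (\<lambda>U. carrier (msec F U)) (mres F)"

definition mstalk ::
  "('p, 'a) rspace \<Rightarrow> ('p, 'a, 'm) msheaf \<Rightarrow> 'p \<Rightarrow> (('p set \<times> 'a) set, ('p set \<times> 'm) set) module"
  where "mstalk X F p =
    \<lparr>carrier = {mgerm X F p U s |U s. opn X U \<and> p \<in> U \<and> s \<in> carrier (msec F U)},
     monoid.mult = undefined, one = undefined,
     zero = mgerm X F p (pts X) \<zero>\<^bsub>msec F (pts X)\<^esub>,
     add = (\<lambda>A B. \<Union>(U, s)\<in>A. \<Union>(W, t)\<in>B. mgerm X F p (U \<inter> W)
        (mres F U (U \<inter> W) s \<oplus>\<^bsub>msec F (U \<inter> W)\<^esub> mres F W (U \<inter> W) t)),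
     module.smult = (\<lambda>A B. \<Union>(U, a)\<in>A. \<Union>(W, t)\<in>B. mgerm X F p (U \<inter> W)
        (ores X U (U \<inter> W) a \<odot>\<^bsub>msec F (U \<inter> W)\<^esub> mres F W (U \<inter> W) t))\<rparr>"

text \<open>For a ring homomorphism \<open>h : R \<rightarrow> S\<close>, an \<open>R\<close>-module \<open>M\<close> and an \<open>S\<close>-module \<open>N\<close>, the
  \<open>S\<close>-module \<open>M \<otimes>\<^sub>R N\<close> is the free abelian group on \<open>M \<times> N\<close> modulo \<open>tens_null\<close>. The case
  \<open>h = id\<close> is the usual tensor product and the case \<open>N = S\<close> is extension of scalars.\<close>

inductive_set tens_null ::
  "('r, 'x) ring_scheme \<Rightarrow> ('r \<Rightarrow> 's) \<Rightarrow> ('r, 'm) module \<Rightarrow> ('s, 'n) module \<Rightarrow> ('m \<times> 'n \<Rightarrow>\<^sub>0 int) set"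
  for R h M N where
  zero: "0 \<in> tens_null R h M N"
| diff: "z \<in> tens_null R h M N \<Longrightarrow> w \<in> tens_null R h M N \<Longrightarrow> z - w \<in> tens_null R h M N"
| add_left: "m \<in> carrier M \<Longrightarrow> m' \<in> carrier M \<Longrightarrow> n \<in> carrier N \<Longrightarrow>
    frag_of (m \<oplus>\<^bsub>M\<^esub> m', n) - frag_of (m, n) - frag_of (m', n) \<in> tens_null R h M N"
| add_right: "m \<in> carrier M \<Longrightarrow> n \<in> carrier N \<Longrightarrow> n' \<in> carrier N \<Longrightarrow>
    frag_of (m, n \<oplus>\<^bsub>N\<^esub> n') - frag_of (m, n) - frag_of (m, n') \<in> tens_null R h M N"
| balanced: "r \<in> carrier R \<Longrightarrow> m \<in> carrier M \<Longrightarrow> n \<in> carrier N \<Longrightarrow>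
    frag_of (r \<odot>\<^bsub>M\<^esub> m, n) - frag_of (m, h r \<odot>\<^bsub>N\<^esub> n) \<in> tens_null R h M N"

definition tens_class ::
  "('r, 'x) ring_scheme \<Rightarrow> ('r \<Rightarrow> 's) \<Rightarrow> ('r, 'm) module \<Rightarrow> ('s, 'n) module
    \<Rightarrow> ('m \<times> 'n \<Rightarrow>\<^sub>0 int) \<Rightarrow> ('m \<times> 'n \<Rightarrow>\<^sub>0 int) set"
  where "tens_class R h M N z =
    {w. Poly_Mapping.keys w \<subseteq> carrier M \<times> carrier N \<and> w - z \<in> tens_null R h M N}"

definition tens_module ::
  "('r, 'x) ring_scheme \<Rightarrow> ('r \<Rightarrow> 's) \<Rightarrow> ('r, 'm) module \<Rightarrow> ('s, 'n) module
    \<Rightarrow> ('s, ('m \<times> 'n \<Rightarrow>\<^sub>0 int) set) module"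
  where "tens_module R h M N =
    \<lparr>carrier = tens_class R h M N ` {z. Poly_Mapping.keys z \<subseteq> carrier M \<times> carrier N},
     monoid.mult = undefined, one = undefined,
     zero = tens_class R h M N 0,
     add = (\<lambda>A B. \<Union>z\<in>A. \<Union>w\<in>B. tens_class R h M N (z + w)),
     module.smult = (\<lambda>a A. \<Union>z\<in>A. tens_class R h M N
        (frag_extend (\<lambda>(m, n). frag_of (m, a \<odot>\<^bsub>N\<^esub> n)) z))\<rparr>"

text \<open>The sheaf with stalks \<open>S p\<close> whose sections agree locally with functions in \<open>loc\<close>.\<close>

definition etale_sheaf ::
  "('p, 'a) rspace \<Rightarrow> ('p \<Rightarrow> (('p set \<times> 'a) set, 't) module) \<Rightarrow> ('p set \<Rightarrow> ('p \<Rightarrow> 't) set)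
    \<Rightarrow> ('p, 'a, 'p \<Rightarrow> 't) msheaf"
  where "etale_sheaf X S loc =
    \<lparr>msec = (\<lambda>U. \<lparr>
       carrier = {s \<in> extensional U. \<forall>p\<in>U. \<exists>W t. opn X W \<and> p \<in> W \<and> W \<subseteq> U \<and> t \<in> loc W \<and>
         (\<forall>q\<in>W. s q = t q)},
       monoid.mult = undefined, one = undefined,
       zero = (\<lambda>p\<in>U. \<zero>\<^bsub>S p\<^esub>),
       add = (\<lambda>s t. \<lambda>p\<in>U. s p \<oplus>\<^bsub>S p\<^esub> t p),
       module.smult = (\<lambda>a s. \<lambda>p\<in>U. ogerm X p U a \<odot>\<^bsub>S p\<^esub> s p)\<rparr>),
     mres = (\<lambda>U W s. restrict s W)\<rparr>"

definition tensor_stalk ::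
  "('p, 'a) rspace \<Rightarrow> ('p, 'a, 'm) msheaf \<Rightarrow> ('p, 'a, 'n) msheaf \<Rightarrow> 'p
    \<Rightarrow> (('p set \<times> 'a) set, (('p set \<times> 'm) set \<times> ('p set \<times> 'n) set \<Rightarrow>\<^sub>0 int) set) module"
  where "tensor_stalk X F G p = tens_module (ostalk X p) (\<lambda>a. a) (mstalk X F p) (mstalk X G p)"

definition tensor ::
  "('p, 'a) rspace \<Rightarrow> ('p, 'a, 'm) msheaf \<Rightarrow> ('p, 'a, 'n) msheaf
    \<Rightarrow> ('p, 'a, 'p \<Rightarrow> (('p set \<times> 'm) set \<times> ('p set \<times> 'n) set \<Rightarrow>\<^sub>0 int) set) msheaf"
  where "tensor X F G = etale_sheaf X (tensor_stalk X F G)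
    (\<lambda>W. {(\<lambda>q. finsum (tensor_stalk X F G q)
            (\<lambda>i. tens_class (ostalk X q) (\<lambda>a. a) (mstalk X F q) (mstalk X G q)
                   (frag_of (mgerm X F q W (u i), mgerm X G q W (v i)))) {..<l})
          | l u v. u \<in> {..<l::nat} \<rightarrow> carrier (msec F W) \<and> v \<in> {..<l} \<rightarrow> carrier (msec G W)})"

text \<open>The pullback \<open>f\<^sup>*F\<close> along \<open>f : V \<rightarrow> X\<close>, with stalks \<open>F\<^bsub>f(p)\<^esub> \<otimes> \<O>\<^bsub>V,p\<^esub>\<close> over \<open>\<O>\<^bsub>X,f(p)\<^esub>\<close>.\<close>

definition pullback_stalk ::
  "('q, 'b) rspace \<Rightarrow> ('p, 'a) rspace \<Rightarrow> ('q, 'b, 'p, 'a) rmor \<Rightarrow> ('p, 'a, 'm) msheaf \<Rightarrow> 'q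
    \<Rightarrow> (('q set \<times> 'b) set, (('p set \<times> 'm) set \<times> ('q set \<times> 'b) set \<Rightarrow>\<^sub>0 int) set) module"
  where "pullback_stalk V X f F q =
    tens_module (ostalk X (mpt f q)) (stalk_map V f q) (mstalk X F (mpt f q)) (reg_module (ostalk V q))"

definition pullback ::
  "('q, 'b) rspace \<Rightarrow> ('p, 'a) rspace \<Rightarrow> ('q, 'b, 'p, 'a) rmor \<Rightarrow> ('p, 'a, 'm) msheaf
    \<Rightarrow> ('q, 'b, 'q \<Rightarrow> (('p set \<times> 'm) set \<times> ('q set \<times> 'b) set \<Rightarrow>\<^sub>0 int) set) msheaf"
  where "pullback V X f F = etale_sheaf V (pullback_stalk V X f F)
    (\<lambda>W. {(\<lambda>q. finsum (pullback_stalk V X f F q)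
            (\<lambda>i. tens_class (ostalk X (mpt f q)) (stalk_map V f q)
                   (mstalk X F (mpt f q)) (reg_module (ostalk V q))
                   (frag_of (mgerm X F (mpt f q) U (u i), ogerm V q W (v i)))) {..<l})
          | l U u v. opn X U \<and> mpt f ` W \<subseteq> U \<and>
              u \<in> {..<l::nat} \<rightarrow> carrier (msec F U) \<and> v \<in> {..<l} \<rightarrow> carrier (osec V W)})"

text \<open>Ampleness of the line bundle \<open>A\<close>: for every coherent sheaf \<open>F\<close>, the sheaves
  \<open>F \<otimes> A\<^sup>m\<close> are globally generated for large \<open>m\<close>. The sheaf \<open>P m\<close> is \<open>F \<otimes> A\<^sup>m\<close> up to isomorphism.

  As in the derived category below, coherent sheaves are taken with sections in a fixed type \<open>'m\<close>.
  This is no restriction on a variety over an infinite field \<open>k\<close>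
  if \<open>'m\<close> has at least the cardinality of \<open>k\<close>: the sections of a coherent sheaf over an open set
  are at most as many as the elements of \<open>k\<close>, so every coherent sheaf has an isomorphic copy with
  sections in \<open>'m\<close>. The cardinality condition holds as soon as there is a line bundle with
  sections in \<open>'m\<close>.\<close>

definition ample :: "'m itself \<Rightarrow> ('p, 'a) rspace \<Rightarrow> ('p, 'a, 'l) msheaf \<Rightarrow> bool"
  where "ample (ty :: 'm itself) X A \<longleftrightarrow> line_bundle X A \<and>
    (\<forall>F :: ('p, 'a, 'm) msheaf. coherent X F \<longrightarrow>
      (\<exists>P :: nat \<Rightarrow> ('p, 'a, 'm) msheaf. P 0 = F \<and>
        (\<forall>m. mod_sheaf X (P m) \<and> mod_iso X (P (Suc m)) (tensor X (P m) A)) \<and>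
        (\<exists>m\<^sub>0. \<forall>m\<ge>m\<^sub>0. globally_generated X (P m))))"


section \<open>The bounded derived category of coherent sheaves\<close>

record ('p, 'a, 'm) cplx =
  cob :: "int \<Rightarrow> ('p, 'a, 'm) msheaf"
  cdf :: "int \<Rightarrow> 'p set \<Rightarrow> 'm \<Rightarrow> 'm"

definition bounded_complex :: "('p, 'a) rspace \<Rightarrow> ('p, 'a, 'm) cplx \<Rightarrow> bool"
  where "bounded_complex X C \<longleftrightarrow>
    (\<forall>i. coherent X (cob C i) \<and> cdf C i \<in> mod_hom X (cob C i) (cob C (i + 1)) \<and>
       hom_comp X (cob C i) (cdf C (i + 1)) (cdf C i) = hom_zero X (cob C i) (cob C (i + 1 + 1))) \<and>
    (\<exists>N. \<forall>i. \<bar>i\<bar> > N \<longrightarrow> (\<forall>U. opn X U \<longrightarrow> carrier (msec (cob C i) U) = {\<zero>\<^bsub>msec (cob C i) U\<^esub>}))"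

definition chain_map ::
  "('p, 'a) rspace \<Rightarrow> ('p, 'a, 'm) cplx \<Rightarrow> ('p, 'a, 'm) cplx \<Rightarrow> (int \<Rightarrow> 'p set \<Rightarrow> 'm \<Rightarrow> 'm) \<Rightarrow> bool"
  where "chain_map X C D f \<longleftrightarrow> (\<forall>i. f i \<in> mod_hom X (cob C i) (cob D i) \<and>
    hom_comp X (cob C i) (f (i + 1)) (cdf C i) = hom_comp X (cob C i) (cdf D i) (f i))"

definition chain_comp ::
  "('p, 'a) rspace \<Rightarrow> ('p, 'a, 'm) cplx \<Rightarrow> (int \<Rightarrow> 'p set \<Rightarrow> 'm \<Rightarrow> 'm) \<Rightarrow> (int \<Rightarrow> 'p set \<Rightarrow> 'm \<Rightarrow> 'm)
    \<Rightarrow> int \<Rightarrow> 'p set \<Rightarrow> 'm \<Rightarrow> 'm"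
  where "chain_comp X C g f = (\<lambda>i. hom_comp X (cob C i) (g i) (f i))"

definition chain_homotopic ::
  "('p, 'a) rspace \<Rightarrow> ('p, 'a, 'm) cplx \<Rightarrow> ('p, 'a, 'm) cplx
    \<Rightarrow> (int \<Rightarrow> 'p set \<Rightarrow> 'm \<Rightarrow> 'm) \<Rightarrow> (int \<Rightarrow> 'p set \<Rightarrow> 'm \<Rightarrow> 'm) \<Rightarrow> bool"
  where "chain_homotopic X C D f g \<longleftrightarrow>
    (\<exists>h. (\<forall>i. h i \<in> mod_hom X (cob C i) (cob D (i - 1))) \<and>
      (\<forall>i U. opn X U \<longrightarrow> (\<forall>s\<in>carrier (msec (cob C i) U).
         f i U s = g i U s \<oplus>\<^bsub>msec (cob D i) U\<^esub>
           (cdf D (i - 1) U (h i U s) \<oplus>\<^bsub>msec (cob D i) U\<^esub> h (i + 1) U (cdf C i U s)))))"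

definition cocycle :: "('p, 'a, 'm) cplx \<Rightarrow> int \<Rightarrow> 'p set \<Rightarrow> 'm \<Rightarrow> bool"
  where "cocycle C i U s \<longleftrightarrow> s \<in> carrier (msec (cob C i) U) \<and> cdf C i U s = \<zero>\<^bsub>msec (cob C (i + 1)) U\<^esub>"

text \<open>\<open>s\<close> is a section of the image sheaf of the differential into degree \<open>i\<close>.\<close>

definition coboundary :: "('p, 'a) rspace \<Rightarrow> ('p, 'a, 'm) cplx \<Rightarrow> int \<Rightarrow> 'p set \<Rightarrow> 'm \<Rightarrow> bool"
  where "coboundary X C i U s \<longleftrightarrow> s \<in> carrier (msec (cob C i) U) \<and>
    (\<forall>p\<in>U. \<exists>W. opn X W \<and> p \<in> W \<and> W \<subseteq> U \<and>
       (\<exists>t\<in>carrier (msec (cob C (i - 1)) W). mres (cob C i) U W s = cdf C (i - 1) W t))"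

definition acyclic_complex :: "('p, 'a) rspace \<Rightarrow> ('p, 'a, 'm) cplx \<Rightarrow> bool"
  where "acyclic_complex X C \<longleftrightarrow>
    (\<forall>i U s. opn X U \<and> cocycle C i U s \<longrightarrow> coboundary X C i U s)"

text \<open>The two conditions say that the map induced by \<open>f\<close> on the \<open>i\<close>-th cohomology sheaves is
  injective and surjective.\<close>

definition quasi_iso ::
  "('p, 'a) rspace \<Rightarrow> ('p, 'a, 'm) cplx \<Rightarrow> ('p, 'a, 'm) cplx \<Rightarrow> (int \<Rightarrow> 'p set \<Rightarrow> 'm \<Rightarrow> 'm) \<Rightarrow> bool"
  where "quasi_iso X C D f \<longleftrightarrow> chain_map X C D f \<and>
    (\<forall>i U. opn X U \<longrightarrow>
      (\<forall>s. cocycle C i U s \<and> coboundary X D i U (f i U s) \<longrightarrow> coboundary X C i U s) \<and>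
      (\<forall>t. cocycle D i U t \<longrightarrow> (\<forall>p\<in>U. \<exists>W s. opn X W \<and> p \<in> W \<and> W \<subseteq> U \<and> cocycle C i W s \<and>
         coboundary X D i W (mres (cob D i) U W t \<ominus>\<^bsub>msec (cob D i) W\<^esub> f i W s))))"

text \<open>Morphisms \<open>A \<rightarrow> B\<close> in the derived category are equivalence classes of roofs
  \<open>A \<leftarrow> C \<rightarrow> B\<close> whose left leg is a quasi-isomorphism; two roofs are equivalent if
  they are dominated by a third one up to homotopy.\<close>

definition roofs ::
  "('p, 'a) rspace \<Rightarrow> ('p, 'a, 'm) cplx \<Rightarrow> ('p, 'a, 'm) cplx
    \<Rightarrow> (('p, 'a, 'm) cplx \<times> (int \<Rightarrow> 'p set \<Rightarrow> 'm \<Rightarrow> 'm) \<times> (int \<Rightarrow> 'p set \<Rightarrow> 'm \<Rightarrow> 'm)) set"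
  where "roofs X A B = {(C, s, f). bounded_complex X C \<and> quasi_iso X C A s \<and> chain_map X C B f}"

definition roof_rel ::
  "('p, 'a) rspace \<Rightarrow> ('p, 'a, 'm) cplx \<Rightarrow> ('p, 'a, 'm) cplx
    \<Rightarrow> (('p, 'a, 'm) cplx \<times> (int \<Rightarrow> 'p set \<Rightarrow> 'm \<Rightarrow> 'm) \<times> (int \<Rightarrow> 'p set \<Rightarrow> 'm \<Rightarrow> 'm)) rel"
  where "roof_rel X A B = {((C, s, f), (C', s', f')).
    (C, s, f) \<in> roofs X A B \<and> (C', s', f') \<in> roofs X A B \<and>
    (\<exists>K u u'. bounded_complex X K \<and> chain_map X K C u \<and> chain_map X K C' u' \<and>
       quasi_iso X K A (chain_comp X K s u) \<and>
       chain_homotopic X K A (chain_comp X K s u) (chain_comp X K s' u') \<and>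
       chain_homotopic X K B (chain_comp X K f u) (chain_comp X K f' u'))}"

definition derived_hom ::
  "('p, 'a) rspace \<Rightarrow> ('p, 'a, 'm) cplx \<Rightarrow> ('p, 'a, 'm) cplx
    \<Rightarrow> (('p, 'a, 'm) cplx \<times> (int \<Rightarrow> 'p set \<Rightarrow> 'm \<Rightarrow> 'm) \<times> (int \<Rightarrow> 'p set \<Rightarrow> 'm \<Rightarrow> 'm)) set set"
  where "derived_hom X A B = roofs X A B // roof_rel X A B"

definition derived_zero ::
  "('p, 'a) rspace \<Rightarrow> ('p, 'a, 'm) cplx \<Rightarrow> ('p, 'a, 'm) cplx
    \<Rightarrow> (('p, 'a, 'm) cplx \<times> (int \<Rightarrow> 'p set \<Rightarrow> 'm \<Rightarrow> 'm) \<times> (int \<Rightarrow> 'p set \<Rightarrow> 'm \<Rightarrow> 'm)) set"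
  where "derived_zero X A B =
    roof_rel X A B `` {(A, (\<lambda>i. hom_id X (cob A i)), (\<lambda>i. hom_zero X (cob A i) (cob B i)))}"

text \<open>\<open>shifted X E k\<close> is the object \<open>E[k]\<close>: the sheaf \<open>E\<close> placed in degree \<open>-k\<close>.\<close>

definition zero_sub :: "('p, 'a, 'm) msheaf \<Rightarrow> ('p, 'a, 'm) msheaf"
  where "zero_sub F = F\<lparr>msec := (\<lambda>U. (msec F U)\<lparr>carrier := {\<zero>\<^bsub>msec F U\<^esub>}\<rparr>)\<rparr>"

definition shifted :: "('p, 'a) rspace \<Rightarrow> ('p, 'a, 'm) msheaf \<Rightarrow> int \<Rightarrow> ('p, 'a, 'm) cplx"
  where "shifted X E k =
    (let C = (\<lambda>i. if i = - k then E else zero_sub E)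
     in \<lparr>cob = C, cdf = (\<lambda>i. hom_zero X (C i) (C (i + 1)))\<rparr>)"

definition Ext ::
  "('p, 'a) rspace \<Rightarrow> int \<Rightarrow> ('p, 'a, 'm) msheaf \<Rightarrow> ('p, 'a, 'm) msheaf
    \<Rightarrow> (('p, 'a, 'm) cplx \<times> (int \<Rightarrow> 'p set \<Rightarrow> 'm \<Rightarrow> 'm) \<times> (int \<Rightarrow> 'p set \<Rightarrow> 'm \<Rightarrow> 'm)) set set"
  where "Ext X k E F = derived_hom X (shifted X E 0) (shifted X F k)"

definition Ext_vanishes ::
  "('p, 'a) rspace \<Rightarrow> int \<Rightarrow> ('p, 'a, 'm) msheaf \<Rightarrow> ('p, 'a, 'm) msheaf \<Rightarrow> bool"
  where "Ext_vanishes X k E F \<longleftrightarrow> Ext X k E F = {derived_zero X (shifted X E 0) (shifted X F k)}"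


section \<open>Exceptional collections and spirals\<close>

text \<open>\<open>End(E) \<cong> k\<close> as \<open>k\<close>-algebras means that the structure map \<open>c \<mapsto> c \<cdot> id\<close> is bijective.\<close>

definition exceptional_object ::
  "('k::field \<Rightarrow> 'a) \<Rightarrow> ('p, 'a) rspace \<Rightarrow> ('p, 'a, 'm) msheaf \<Rightarrow> bool"
  where "exceptional_object \<kappa> X E \<longleftrightarrow> coherent X E \<and>
    bij_betw (\<lambda>c. hom_smult X E E (\<kappa> c) (hom_id X E)) UNIV (mod_hom X E E) \<and>
    (\<forall>k. k \<noteq> 0 \<longrightarrow> Ext_vanishes X k E E)"

definition exceptional_collection ::
  "('k::field \<Rightarrow> 'a) \<Rightarrow> ('p, 'a) rspace \<Rightarrow> nat \<Rightarrow> (int \<Rightarrow> ('p, 'a, 'm) msheaf) \<Rightarrow> bool"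
  where "exceptional_collection \<kappa> X n E \<longleftrightarrow>
    (\<forall>i\<in>{1..int n}. exceptional_object \<kappa> X (E i)) \<and>
    (\<forall>i\<in>{1..int n}. \<forall>j\<in>{1..int n}. i > j \<longrightarrow> (\<forall>k. Ext_vanishes X k (E i) (E j)))"

definition full_collection ::
  "('p, 'a) rspace \<Rightarrow> nat \<Rightarrow> (int \<Rightarrow> ('p, 'a, 'm) msheaf) \<Rightarrow> bool"
  where "full_collection X n E \<longleftrightarrow>
    (\<forall>F. bounded_complex X F \<and> \<not> acyclic_complex X F \<longrightarrow>
      (\<exists>i\<in>{1..int n}. \<exists>k. derived_hom X (shifted X (E i) k) F \<noteq> {derived_zero X (shifted X (E i) k) F}))"

definition strong_collection ::
  "('p, 'a) rspace \<Rightarrow> nat \<Rightarrow> (int \<Rightarrow> ('p, 'a, 'm) msheaf) \<Rightarrow> bool"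
  where "strong_collection X n E \<longleftrightarrow>
    (\<forall>i\<in>{1..int n}. \<forall>j\<in>{1..int n}. \<forall>k. k \<noteq> 0 \<longrightarrow> Ext_vanishes X k (E i) (E j))"

text \<open>The members of the spiral outside \<open>1, \<dots>, n\<close> are determined up to isomorphism.\<close>

definition spiral ::
  "('p, 'a) rspace \<Rightarrow> ('p, 'a, 'l) msheaf \<Rightarrow> nat \<Rightarrow> (int \<Rightarrow> ('p, 'a, 'm) msheaf) \<Rightarrow> bool"
  where "spiral X L n E \<longleftrightarrow>
    (\<forall>i. mod_sheaf X (E i) \<and> mod_iso X (E (i - int n)) (tensor X (E i) L))"

definition simple_spiral ::
  "('p, 'a) rspace \<Rightarrow> ('p, 'a, 'l) msheaf \<Rightarrow> nat \<Rightarrow> (int \<Rightarrow> ('p, 'a, 'm) msheaf) \<Rightarrow> bool"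
  where "simple_spiral X L n E \<longleftrightarrow> spiral X L n E \<and>
    (\<forall>i j k. i \<le> j \<and> k \<noteq> 0 \<longrightarrow> Ext_vanishes X k (E i) (E j))"


section \<open>The total space of a line bundle\<close>

text \<open>\<open>\<pi> : V \<rightarrow> X\<close> is the relative spectrum of \<open>Sym(L\<^sup>\<or>)\<close>: it is affine, and the linear map
  \<open>\<sigma> : L\<^sup>\<or> \<rightarrow> \<pi>\<^sub>*\<O>\<^sub>V\<close> identifies \<open>\<pi>\<^sub>*\<O>\<^sub>V\<close> with the symmetric algebra, i.e. over an affine open set
  \<open>U\<close> on which \<open>t\<close> generates \<open>L\<^sup>\<or>\<close> freely, \<open>\<O>\<^sub>V(\<pi>\<^sup>-\<^sup>1 U)\<close> is the polynomial ring over \<open>\<O>\<^sub>X(U)\<close> in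
  \<open>\<sigma>(t)\<close>.\<close>

definition total_space ::
  "('p, 'a) rspace \<Rightarrow> ('p, 'a, 'l) msheaf \<Rightarrow> ('v, 'b) rspace \<Rightarrow> ('v, 'b, 'p, 'a) rmor
    \<Rightarrow> ('p set \<Rightarrow> ('p set \<Rightarrow> 'l \<Rightarrow> 'a) \<Rightarrow> 'b) \<Rightarrow> bool"
  where "total_space X L V \<pi> \<sigma> \<longleftrightarrow> scheme V \<and> lrs_hom V X \<pi> \<and>
    (\<forall>U. affine_open X U \<longrightarrow> affine_open V (preim V \<pi> U)) \<and>
    \<sigma> \<in> mod_hom X (dual X L) (pushforward_osheaf V \<pi>) \<and>
    (\<forall>U t. affine_open X U \<and> free_gen X (dual X L) U t \<longrightarrow>
      (\<forall>s\<in>carrier (osec V (preim V \<pi> U)).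
        \<exists>!c :: nat \<Rightarrow> 'a. c \<in> UNIV \<rightarrow> carrier (osec X U) \<and> finite {m. c m \<noteq> \<zero>\<^bsub>osec X U\<^esub>} \<and>
          s = finsum (osec V (preim V \<pi> U))
            (\<lambda>m. mco \<pi> U (c m) \<otimes>\<^bsub>osec V (preim V \<pi> U)\<^esub> \<sigma> U t [^]\<^bsub>osec V (preim V \<pi> U)\<^esub> m)
            {m. c m \<noteq> \<zero>\<^bsub>osec X U\<^esub>}))"


section \<open>The representation space of the Bondal quiver and its affine quotient\<close>

text \<open>Here \<open>F 1, \<dots>, F n\<close> are line bundles on the \<open>k\<close>-scheme \<open>V\<close>. The variable
  \<open>(i, j, f)\<close> is the coordinate function \<open>a \<mapsto> a\<^sub>i\<^sub>j(f)\<close> on the representation space with dimension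
  vector \<open>(1, \<dots>, 1)\<close>, for \<open>f \<in> Hom\<^sub>V(F i, F j)\<close>.\<close>

type_synonym ('v, 'n) bvar = "int \<times> int \<times> ('v set \<Rightarrow> 'n \<Rightarrow> 'n)"

definition bondal_vars ::
  "('v, 'b) rspace \<Rightarrow> nat \<Rightarrow> (int \<Rightarrow> ('v, 'b, 'n) msheaf) \<Rightarrow> ('v, 'n) bvar set"
  where "bondal_vars V n F =
    {(i, j, f). i \<in> {1..int n} \<and> j \<in> {1..int n} \<and> f \<in> mod_hom V (F i) (F j)}"

inductive_set bondal_relations ::
  "('k::field \<Rightarrow> 'b) \<Rightarrow> ('v, 'b) rspace \<Rightarrow> nat \<Rightarrow> (int \<Rightarrow> ('v, 'b, 'n) msheaf)
    \<Rightarrow> (('v, 'n) bvar, 'k) mpol set"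
  for \<kappa> V n F where
  add: "(i, j, f) \<in> bondal_vars V n F \<Longrightarrow> (i, j, g) \<in> bondal_vars V n F \<Longrightarrow>
    mVar (i, j, hom_add V (F i) (F j) f g) - mVar (i, j, f) - mVar (i, j, g)
      \<in> bondal_relations \<kappa> V n F"
| smult: "(i, j, f) \<in> bondal_vars V n F \<Longrightarrow>
    mVar (i, j, hom_smult V (F i) (F j) (\<kappa> c) f) - mConst c * mVar (i, j, f)
      \<in> bondal_relations \<kappa> V n F"
| ident: "i \<in> {1..int n} \<Longrightarrow> mVar (i, i, hom_id V (F i)) - 1 \<in> bondal_relations \<kappa> V n F"
| comp: "(i, j, f) \<in> bondal_vars V n F \<Longrightarrow> (j, l, g) \<in> bondal_vars V n F \<Longrightarrow>
    mVar (i, l, hom_comp V (F i) g f) - mVar (i, j, f) * mVar (j, l, g)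
      \<in> bondal_relations \<kappa> V n F"

definition rep_ring ::
  "('k::field \<Rightarrow> 'b) \<Rightarrow> ('v, 'b) rspace \<Rightarrow> nat \<Rightarrow> (int \<Rightarrow> ('v, 'b, 'n) msheaf)
    \<Rightarrow> (('v, 'n) bvar, 'k) mpol set ring"
  where "rep_ring \<kappa> V n F = mpoly_ring (bondal_vars V n F) Quot
    genideal (mpoly_ring (bondal_vars V n F)) (bondal_relations \<kappa> V n F)"

text \<open>The torus acts by \<open>a\<^sub>i\<^sub>j \<mapsto> g\<^sub>i a\<^sub>i\<^sub>j g\<^sub>j\<^sup>-\<^sup>1\<close>; on the quotient ring it acts on representatives.
  As \<open>k\<close> is algebraically closed, the invariants of the torus are those of its \<open>k\<close>-points.\<close>

definition torus_act ::
  "('v, 'b) rspace \<Rightarrow> nat \<Rightarrow> (int \<Rightarrow> ('v, 'b, 'n) msheaf) \<Rightarrow> (int \<Rightarrow> 'k::field)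
    \<Rightarrow> (('v, 'n) bvar, 'k) mpol \<Rightarrow> (('v, 'n) bvar, 'k) mpol"
  where "torus_act V n F g = mp_eval mConst (mpoly_ring (bondal_vars V n F))
    (\<lambda>(i, j, f). mConst (g i * inverse (g j)) * mVar (i, j, f))"

definition inv_ring ::
  "('k::field \<Rightarrow> 'b) \<Rightarrow> ('v, 'b) rspace \<Rightarrow> nat \<Rightarrow> (int \<Rightarrow> ('v, 'b, 'n) msheaf)
    \<Rightarrow> (('v, 'n) bvar, 'k) mpol set ring"
  where "inv_ring \<kappa> V n F = (rep_ring \<kappa> V n F)
    \<lparr>carrier := {b \<in> carrier (rep_ring \<kappa> V n F).
       \<forall>g. (\<forall>i\<in>{1..int n}. g i \<noteq> 0) \<longrightarrow> torus_act V n F g ` b = b}\<rparr>"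

text \<open>Pullback of invariant functions along the tautological map. If \<open>e\<^sub>i\<close> generates \<open>F i\<close> over \<open>U\<close>
  for all \<open>i\<close>, then with respect to the dual bases the transpose of \<open>f : F i \<rightarrow> F j\<close> is
  multiplication by the function \<open>c\<close> with \<open>f(e\<^sub>i) = c e\<^sub>j\<close>. This gives a map from \<open>U\<close> to the
  representation space, along which an invariant function pulls back to a function that does not
  depend on the choice of the \<open>e\<^sub>i\<close>.\<close>

definition taut_coord ::
  "('v, 'b) rspace \<Rightarrow> (int \<Rightarrow> ('v, 'b, 'n) msheaf) \<Rightarrow> 'v set \<Rightarrow> (int \<Rightarrow> 'n) \<Rightarrow> ('v, 'n) bvar \<Rightarrow> 'b"
  where "taut_coord V F U e = (\<lambda>(i, j, f).
    THE c. c \<in> carrier (osec V U) \<and> f U (e i) = c \<odot>\<^bsub>msec (F j) U\<^esub> e j)"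

definition taut_pullback ::
  "('k::field \<Rightarrow> 'b) \<Rightarrow> ('v, 'b) rspace \<Rightarrow> nat \<Rightarrow> (int \<Rightarrow> ('v, 'b, 'n) msheaf)
    \<Rightarrow> (('v, 'n) bvar, 'k) mpol set \<Rightarrow> 'b"
  where "taut_pullback \<kappa> V n F b = (THE h. h \<in> carrier (osec V (pts V)) \<and>
    (\<forall>U e. opn V U \<and> (\<forall>i\<in>{1..int n}. free_gen V (F i) U (e i)) \<longrightarrow>
      (\<forall>q\<in>b. ores V (pts V) U h = mp_eval (k_const \<kappa> V U) (osec V U) (taut_coord V F U e) q)))"

definition M\<^sub>0 ::
  "('k::field \<Rightarrow> 'b) \<Rightarrow> ('v, 'b) rspace \<Rightarrow> nat \<Rightarrow> (int \<Rightarrow> ('v, 'b, 'n) msheaf)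
    \<Rightarrow> ((('v, 'n) bvar, 'k) mpol set set,
        (('v, 'n) bvar, 'k) mpol set set \<Rightarrow> ((('v, 'n) bvar, 'k) mpol set \<times> (('v, 'n) bvar, 'k) mpol set) set) rspace"
  where "M\<^sub>0 \<kappa> V n F = Spec (inv_ring \<kappa> V n F)"

definition V\<^sub>0 :: "('v, 'b) rspace \<Rightarrow> ('b set, 'b set \<Rightarrow> ('b \<times> 'b) set) rspace"
  where "V\<^sub>0 V = Spec (osec V (pts V))"

definition \<phi>\<^sub>0 ::
  "('k::field \<Rightarrow> 'b) \<Rightarrow> ('v, 'b) rspace \<Rightarrow> nat \<Rightarrow> (int \<Rightarrow> ('v, 'b, 'n) msheaf)
    \<Rightarrow> ('b set, 'b set \<Rightarrow> ('b \<times> 'b) set, (('v, 'n) bvar, 'k) mpol set set,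
        (('v, 'n) bvar, 'k) mpol set set \<Rightarrow> ((('v, 'n) bvar, 'k) mpol set \<times> (('v, 'n) bvar, 'k) mpol set) set) rmor"
  where "\<phi>\<^sub>0 \<kappa> V n F =
    Spec_map (inv_ring \<kappa> V n F) (osec V (pts V)) (taut_pullback \<kappa> V n F)"


section \<open>Irreducible components and closed subschemes of affine schemes\<close>

definition irreducible_set :: "'p topology \<Rightarrow> 'p set \<Rightarrow> bool"
  where "irreducible_set T Z \<longleftrightarrow> Z \<subseteq> topspace T \<and> Z \<noteq> {} \<and>
    (\<forall>C D. closedin T C \<and> closedin T D \<and> Z \<subseteq> C \<union> D \<longrightarrow> Z \<subseteq> C \<or> Z \<subseteq> D)"

definition irreducible_component :: "'p topology \<Rightarrow> 'p set \<Rightarrow> bool"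
  where "irreducible_component T Z \<longleftrightarrow> irreducible_set T Z \<and>
    (\<forall>Z'. irreducible_set T Z' \<and> Z \<subseteq> Z' \<longrightarrow> Z' = Z)"

text \<open>\<open>f : Y \<rightarrow> Spec R\<close> is an isomorphism onto the closed subscheme \<open>Spec (R/I)\<close>.\<close>

definition iso_onto_closed ::
  "('q, 'b) rspace \<Rightarrow> 'a ring \<Rightarrow> ('q, 'b, 'a set, 'a set \<Rightarrow> ('a \<times> 'a) set) rmor \<Rightarrow> 'a set \<Rightarrow> bool"
  where "iso_onto_closed Y R f I \<longleftrightarrow> ideal I R \<and>
    (\<exists>g. lrs_iso Y (Spec (R Quot I)) g \<and>
      mor_eq Y (Spec R) f
        (mor_comp (Spec (R Quot I)) (Spec_map R (R Quot I) (\<lambda>a. I +>\<^bsub>R\<^esub> a)) g))"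

text \<open>The reduced induced structure on a closed set \<open>Z\<close> of primes is defined by the ideal \<open>\<Inter>Z\<close>.\<close>

definition reduced_ideal :: "'a set set \<Rightarrow> 'a set"
  where "reduced_ideal Z = \<Inter>Z"

text \<open>The scheme structure that an irreducible component \<open>Z\<close> of \<open>Spec R\<close> inherits from \<open>Spec R\<close>:
  its ideal is the kernel of the localization of \<open>R\<close> at the generic point \<open>\<Inter>Z\<close> of \<open>Z\<close>. It may be
  non-reduced, and agrees with the reduced structure if \<open>Spec R\<close> is reduced.\<close>

definition component_ideal :: "'a ring \<Rightarrow> 'a set set \<Rightarrow> 'a set"
  where "component_ideal R Z = {a \<in> carrier R. \<exists>u\<in>carrier R - \<Inter>Z. u \<otimes>\<^bsub>R\<^esub> a = \<zero>\<^bsub>R\<^esub>}"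

end

theory Submission
 imports Defs "HOL-Algebra.UnivPoly" "HOL-Algebra.Free_Abelian_Groups" "HOL-Algebra.Subrings"
begin

text \<open>Let \<open>A = \<Gamma>(\<O>\<^sub>V)\<close>, let \<open>F\<^sub>i = \<pi>\<^sup>*E\<^sub>i\<close>, and let \<open>\<chi>\<^sub>i(a)\<close> be the coordinate function on the representation space
  given by \<open>a \<cdot> id \<in> End(F\<^sub>i)\<close>. It is invariant, and \<open>a \<mapsto> \<chi>\<^sub>1(a)\<close> is a section of the pullback map \<open>B\<^sup>G \<rightarrow> A\<close>,
  which is therefore surjective. As \<open>L\<^sup>-\<^sup>1\<close> is ample, there are nonzero homomorphisms \<open>F\<^sub>1 \<rightarrow> F\<^sub>i \<rightarrow> F\<^sub>1\<close>; their
  composition is multiplication by some \<open>h\<^sub>i \<noteq> 0\<close> in the domain \<open>A\<close>. Moving scalars through these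
  homomorphisms gives \<open>\<chi>\<^sub>1(h\<^sub>i) \<chi>\<^sub>i(a) = \<chi>\<^sub>1(h\<^sub>i) \<chi>\<^sub>1(a)\<close>. An invariant function is a polynomial in closed walks, that is,
  in the \<open>\<chi>\<^sub>i(a)\<close>. Hence \<open>u = \<chi>\<^sub>1(\<Prod>\<^sub>i h\<^sub>i)\<close> annihilates the kernel of \<open>B\<^sup>G \<rightarrow> A\<close>, and it does not lie in this prime
  ideal. So the kernel is a minimal prime, and it is also the kernel of the localization at itself.\<close>

text \<open>The geometric obstacle is the existence of the maps between F_1 and F_i. Ampleness
  provides a global section of Hom(E_1, E_i) twisted by a high power of L^-1. On V the twist is
  undone by the fibre coordinate, because a local generator t of L^-1 is itself a function on V: if
  the section reads \<xi> (e -> f) t^m over an open set, the map of pullbacks sends e to \<xi> t^m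
  f. Two features of the encoding shape this argument. Ampleness quantifies over coherent sheaves
  with sections in one fixed type, so the Hom sheaf is modelled inside the sections of its target
  over a dense open set. Tensor powers are given only up to isomorphism, so the twisted sheaves are
  followed through their transition functions b d^m. The algebraic obstacle is that invariance is
  known only modulo the relations, so that a representative all of whose monomials have weight zero
  has to be produced. That A is a domain comes from covering V by spectra of polynomial rings over
  domains, any two of which meet.\<close>

abbreviation (input) ring_mult ("(_ *[_] _)" [70, 0, 71] 70) where "x *[R] y \<equiv> monoid.mult R x y"
abbreviation (input) ring_add ("(_ +[_] _)" [65, 0, 66] 65) where "x +[R] y \<equiv> ring.add R x y"
abbreviation (input) mod_smult ("(_ *.[_] _)" [70, 0, 71] 70) where "a *.[M] x \<equiv> module.smult M a x"
abbreviation (input) ring_zero ("0[_]") where "0[R] \<equiv> ring.zero R"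
abbreviation (input) ring_one ("1[_]") where "1[R] \<equiv> monoid.one R"
abbreviation (input) keys where "keys \<equiv> Poly_Mapping.keys"
abbreviation (input) lookup where "lookup \<equiv> Poly_Mapping.lookup"
abbreviation (input) single where "single \<equiv> Poly_Mapping.single"
abbreviation (input) ring_pow ("(_ ^[_] _)" [76, 0, 75] 75) where "x ^[R] n \<equiv> x [^]\<^bsub>R\<^esub> n"
abbreviation (input) Os where "Os X U \<equiv> carrier (osec X U)"
abbreviation (input) Ms where "Ms F U \<equiv> carrier (msec F U)"

section \<open>Germs and stalks\<close>

lemma is_presheafD:
 assumes "is_presheaf T S res"
 shows "[|openin T U; openin T W; W <= U; s : S U|] ==> res U W s : S W"
  and "[|openin T U; s : S U|] ==> res U U s = s"
  and "[|openin T U; openin T W; openin T Z; Z <= W; W <= U; s : S U|] ==> res W Z (res U W s) = res U Z s"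
proof -
 show "res U W s : S W" if "openin T U" "openin T W" "W <= U" "s : S U"
  using assms[unfolded is_presheaf_def, THEN conjunct1, rule_format, of U W] that
  by (simp add: Pi_iff)
 show "res U U s = s" if "openin T U" "s : S U"
  using assms[unfolded is_presheaf_def, THEN conjunct2, THEN conjunct1, rule_format, of U s] that by simp
 show "res W Z (res U W s) = res U Z s"
  if "openin T U" "openin T W" "openin T Z" "Z <= W" "W <= U" "s : S U"
  using assms[unfolded is_presheaf_def, THEN conjunct2, THEN conjunct2, rule_format, of U W Z s] that by simp
qed

lemma germ_eqI:
 assumes pre: "is_presheaf T S res"
  and U: "openin T U" "s : S U" and W: "openin T W" "t : S W"
  and Z: "openin T Z" "p : Z" "Z <= U" "Z <= W" and eq: "res U Z s = res W Z t"
 shows "germ T S res p U s = germ T S res p W t"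
proof -
 have *: "germ T S res p U1 s1 <= germ T S res p U2 s2"
  if h: "openin T U1" "s1 : S U1" "openin T U2" "s2 : S U2" "Z <= U1" "Z <= U2" "res U1 Z s1 = res U2 Z s2"
  for U1 U2 s1 s2
 proof (clarsimp simp: germ_def)
  fix U' s' W'
  assume a: "openin T U'" "p : U'" "s' : S U'" "openin T W'" "p : W'" "W' <= U1" "W' <= U'"
   "res U1 W' s1 = res U' W' s'"
  let ?Y = "W' Int Z"
  have o: "openin T ?Y" by (rule openin_Int[OF a(4) Z(1)])
  have "res U2 ?Y s2 = res Z ?Y (res U2 Z s2)"
   using is_presheafD(3)[OF pre h(3) Z(1) o _ h(6) h(4)] by simp
  also have "... = res U1 ?Y s1"
   using is_presheafD(3)[OF pre h(1) Z(1) o _ h(5) h(2)] h(7) by simp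
  also have "... = res W' ?Y (res U1 W' s1)"
   using is_presheafD(3)[OF pre h(1) a(4) o _ a(6) h(2)] by simp
  also have "... = res U' ?Y s'"
   using is_presheafD(3)[OF pre a(1) a(4) o _ a(7) a(3)] a(8) by simp
  finally have "res U2 ?Y s2 = res U' ?Y s'" .
  moreover have "p : ?Y" "?Y <= U2" "?Y <= U'" using a(5,7) Z(2) h(6) by auto
  ultimately show "EX W. openin T W & p : W & W <= U2 & W <= U' & res U2 W s2 = res U' W s'"
   using o by (intro exI[of _ ?Y] conjI)
 qed
 show ?thesis
  by (rule equalityI[OF *[OF U W Z(3,4) eq] *[OF W U Z(4,3) eq[symmetric]]])
qed

lemma germ_self:
 assumes "is_presheaf T S res" "openin T U" "p : U" "s : S U"
 shows "(U, s) : germ T S res p U s"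
 unfolding germ_def using assms(2-4) by (auto intro!: exI[of _ U])

lemma germ_memD:
 assumes "(W, t) : germ T S res p U s"
 shows "openin T W" "p : W" "t : S W"
  and "EX Z. openin T Z & p : Z & Z <= U & Z <= W & res U Z s = res W Z t"
 using assms unfolding germ_def by auto

lemma germ_eqD:
 assumes "is_presheaf T S res" "germ T S res p U s = germ T S res p W t"
  "openin T W" "p : W" "t : S W"
 obtains Z where "openin T Z" "p : Z" "Z <= U" "Z <= W" "res U Z s = res W Z t"
proof -
 have "(W, t) : germ T S res p U s" using germ_self[OF assms(1,3,4,5)] assms(2) by simp
 from germ_memD(4)[OF this] show ?thesis using that by (elim exE conjE)
qed

lemma germ_res:
 assumes "is_presheaf T S res" "openin T U" "openin T W" "W <= U" "p : W" "s : S U"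
 shows "germ T S res p W (res U W s) = germ T S res p U s"
proof -
 have c: "res U W s : S W" by (rule is_presheafD(1)[OF assms(1,2,3,4,6)])
 show ?thesis
  by (rule germ_eqI[OF assms(1,3) c assms(2,6,3,5) order_refl assms(4) is_presheafD(2)[OF assms(1,3) c]])
qed

text \<open>The structure shared by all presheaves of rings and of modules considered below; it is weaker
  than \<^const>\<open>ring_sheaf\<close> because for spectra only these properties are needed.\<close>

definition pre_ring :: "('p, 'a) rspace => bool"
 where "pre_ring X \<longleftrightarrow> is_presheaf (tp X) (%U. Os X U) (ores X) &
  (ALL U. opn X U --> 1[osec X U] : Os X U & 0[osec X U] : Os X U &
   (ALL a:Os X U. ALL b:Os X U.
    a *[osec X U] b : Os X U & a +[osec X U] b : Os X U)) &
  (ALL U W. opn X U & opn X W & W <= U --> ores X U W : ring_hom (osec X U) (osec X W) &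
   ores X U W 0[osec X U] = 0[osec X W])"

definition pre_mod :: "('p, 'a) rspace => ('p, 'a, 'm) msheaf => bool"
 where "pre_mod X F \<longleftrightarrow> is_presheaf (tp X) (%U. Ms F U) (mres F) &
  (ALL U. opn X U --> 0[msec F U] : Ms F U &
   (ALL s:Ms F U. ALL t:Ms F U. s +[msec F U] t : Ms F U) &
   (ALL a:Os X U. ALL s:Ms F U. a *.[msec F U] s : Ms F U)) &
  (ALL U W. opn X U & opn X W & W <= U --> mres F U W 0[msec F U] = 0[msec F W] &
   (ALL s:Ms F U. ALL t:Ms F U.
    mres F U W (s +[msec F U] t) = mres F U W s +[msec F W] mres F U W t) &
   (ALL a:Os X U. ALL s:Ms F U.
    mres F U W (a *.[msec F U] s) = ores X U W a *.[msec F W] mres F U W s))"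

lemma pre_ringD:
 assumes "pre_ring X" "opn X U"
 shows "1[osec X U] : Os X U" "0[osec X U] : Os X U"
  "[|a : Os X U; b : Os X U|] ==> a *[osec X U] b : Os X U"
  "[|a : Os X U; b : Os X U|] ==> a +[osec X U] b : Os X U"
  "[|opn X W; W <= U|] ==> ores X U W : ring_hom (osec X U) (osec X W)"
  "[|opn X W; W <= U|] ==> ores X U W 0[osec X U] = 0[osec X W]"
 using assms unfolding pre_ring_def by simp_all

lemma pre_ring_osheaf: "pre_ring X ==> pre_mod X (osheaf X)"
 unfolding pre_ring_def pre_mod_def osheaf_def reg_module_def
 by (auto simp: ring_hom_mult ring_hom_add)

lemma ring_hom_zero_cring: "h : ring_hom R S ==> cring R ==> cring S ==> h 0[R] = 0[S]"
 by (rule ring_hom_zero) (auto dest: cring.axioms(1))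

lemma ring_sheaf_pre_ring:
 assumes "ring_sheaf X" shows "pre_ring X"
proof -
 have c: "cring (osec X U)" if "opn X U" for U using assms that by (simp add: ring_sheaf_def)
 have r: "ores X U W : ring_hom (osec X U) (osec X W)" if "opn X U" "opn X W" "W <= U" for U W
  using assms that by (simp add: ring_sheaf_def)
 show ?thesis
  unfolding pre_ring_def
 proof (intro conjI allI impI ballI)
  show "is_presheaf (tp X) (%U. Os X U) (ores X)"
   using assms by (simp add: ring_sheaf_def is_sheaf_def)
 next
  fix U assume U: "opn X U"
  interpret cring "osec X U" by (rule c[OF U])
  show "1[osec X U] : Os X U" "0[osec X U] : Os X U" by auto
  fix a b assume "a : Os X U" "b : Os X U"
  thus "a *[osec X U] b : Os X U" "a +[osec X U] b : Os X U" by auto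
 next
  fix U W assume "opn X U & opn X W & W <= U"
  hence o: "opn X U" "opn X W" "W <= U" by auto
  show "ores X U W : ring_hom (osec X U) (osec X W)" by (rule r[OF o])
  show "ores X U W 0[osec X U] = 0[osec X W]"
   by (rule ring_hom_zero_cring[OF r[OF o] c[OF o(1)] c[OF o(2)]])
 qed
qed

lemma mod_sheaf_pre_mod:
 assumes "ring_sheaf X" "mod_sheaf X F" shows "pre_mod X F"
proof -
 have m: "module (osec X U) (msec F U)" if "opn X U" for U using assms that by (simp add: mod_sheaf_def)
 have P: "is_presheaf (tp X) (%U. Ms F U) (mres F)"
  using assms by (simp add: mod_sheaf_def is_sheaf_def)
 have A: "mres F U W (s +[msec F U] t) = mres F U W s +[msec F W] mres F U W t"
  if "opn X U" "opn X W" "W <= U" "s : Ms F U" "t : Ms F U" for U W s t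
  using assms(2) that by (simp add: mod_sheaf_def)
 have M: "mres F U W (a *.[msec F U] s) = ores X U W a *.[msec F W] mres F U W s"
  if "opn X U" "opn X W" "W <= U" "a : Os X U" "s : Ms F U" for U W a s
  using assms(2) that by (simp add: mod_sheaf_def)
 \<comment> \<open>Restriction is additive, so the image of zero equals its own double and cancels
   in the group of sections.\<close>
 have z: "mres F U W 0[msec F U] = 0[msec F W]" if o: "opn X U" "opn X W" "W <= U" for U W
 proof -
  interpret U: module "osec X U" "msec F U" by (rule m[OF o(1)])
  interpret W: module "osec X W" "msec F W" by (rule m[OF o(2)])
  have c: "mres F U W 0[msec F U] : Ms F W"
   using is_presheafD(1)[OF P o] by auto
  have "mres F U W (0[msec F U] +[msec F U] 0[msec F U]) = mres F U W 0[msec F U] +[msec F W] mres F U W 0[msec F U]"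
   by (rule A[OF o U.zero_closed U.zero_closed])
  thus ?thesis using c by simp
 qed
 show ?thesis
  unfolding pre_mod_def
 proof (intro conjI allI impI ballI)
  fix U assume U: "opn X U"
  interpret module "osec X U" "msec F U" by (rule m[OF U])
  show "0[msec F U] : Ms F U" by auto
  fix s assume s: "s : Ms F U"
  show "t : Ms F U ==> s +[msec F U] t : Ms F U" for t using s by auto
  show "a : Os X U ==> a *.[msec F U] s : Ms F U" for a using s by auto
 qed (simp_all add: P z A M)
qed

locale premod =
 fixes X :: "('p, 'a) rspace" and F :: "('p, 'a, 'm) msheaf"
 assumes pre_ring: "pre_ring X" and pre_mod: "pre_mod X F"
begin

lemma presh: "is_presheaf (tp X) (%U. Ms F U) (mres F)"
 and opresh: "is_presheaf (tp X) (%U. Os X U) (ores X)"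
 using pre_ring pre_mod unfolding pre_ring_def pre_mod_def by auto

lemma res_closed: "[|opn X U; opn X W; W <= U; s : Ms F U|] ==> mres F U W s : Ms F W"
 using is_presheafD(1)[OF presh] by blast
lemma res_id: "[|opn X U; s : Ms F U|] ==> mres F U U s = s"
 using is_presheafD(2)[OF presh] by blast
lemma res_res: "[|opn X U; opn X W; opn X Z; Z <= W; W <= U; s : Ms F U|] ==>
  mres F W Z (mres F U W s) = mres F U Z s"
 using is_presheafD(3)[OF presh] by blast
lemma ores_closed: "[|opn X U; opn X W; W <= U; s : Os X U|] ==> ores X U W s : Os X W"
 using is_presheafD(1)[OF opresh] by blast
lemma ores_res: "[|opn X U; opn X W; opn X Z; Z <= W; W <= U; s : Os X U|] ==>
  ores X W Z (ores X U W s) = ores X U Z s"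
 using is_presheafD(3)[OF opresh] by blast

lemma closed:
 assumes "opn X U"
 shows zero_closed: "0[msec F U] : Ms F U"
  and add_closed: "[|s : Ms F U; t : Ms F U|] ==> s +[msec F U] t : Ms F U"
  and smult_closed: "[|a : Os X U; s : Ms F U|] ==> a *.[msec F U] s : Ms F U"
 using assms pre_mod unfolding pre_mod_def by auto

lemma res_hom:
 assumes "opn X U" "opn X W" "W <= U"
 shows res_zero: "mres F U W 0[msec F U] = 0[msec F W]"
  and res_add: "[|s : Ms F U; t : Ms F U|] ==>
    mres F U W (s +[msec F U] t) = mres F U W s +[msec F W] mres F U W t"
  and res_smult: "[|a : Os X U; s : Ms F U|] ==>
    mres F U W (a *.[msec F U] s) = ores X U W a *.[msec F W] mres F U W s"
 using assms pre_mod unfolding pre_mod_def by auto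

lemma mgerm_eqI:
 assumes "opn X U" "s : Ms F U" "opn X W" "t : Ms F W"
  "opn X Z" "p : Z" "Z <= U" "Z <= W" "mres F U Z s = mres F W Z t"
 shows "mgerm X F p U s = mgerm X F p W t"
 using germ_eqI[OF presh assms(1,2,3,4,5,6,7,8,9)] unfolding mgerm_def by simp

lemma mgerm_eqD:
 assumes "mgerm X F p U s = mgerm X F p W t" "opn X W" "p : W" "t : Ms F W"
 obtains Z where "opn X Z" "p : Z" "Z <= U" "Z <= W" "mres F U Z s = mres F W Z t"
 using germ_eqD[OF presh assms(1)[unfolded mgerm_def] assms(2-4)] that .

lemma mgerm_res:
 assumes "opn X U" "opn X W" "W <= U" "p : W" "s : Ms F U"
 shows "mgerm X F p W (mres F U W s) = mgerm X F p U s"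
 using germ_res[OF presh assms] unfolding mgerm_def .

lemma ogerm_res:
 assumes "opn X U" "opn X W" "W <= U" "p : W" "s : Os X U"
 shows "ogerm X p W (ores X U W s) = ogerm X p U s"
 using germ_res[OF opresh assms] unfolding ogerm_def .

lemma mgerm_in: "[|opn X U; p : U; s : Ms F U|] ==> mgerm X F p U s : carrier (mstalk X F p)"
 unfolding mstalk_def by auto

lemma ogerm_in: "[|opn X U; p : U; s : Os X U|] ==> ogerm X p U s : carrier (ostalk X p)"
 unfolding ostalk_def by auto

lemma mstalkE:
 assumes "A : carrier (mstalk X F p)"
 obtains U s where "opn X U" "p : U" "s : Ms F U" "A = mgerm X F p U s"
 using assms unfolding mstalk_def by auto

lemma ostalkE:
 assumes "A : carrier (ostalk X p)"
 obtains U s where "opn X U" "p : U" "s : Os X U" "A = ogerm X p U s"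
 using assms unfolding ostalk_def by auto

text \<open>The sum of two germ classes is by definition a union over all pairs of representatives.
  All members of that union are the same germ, as one sees on a neighbourhood where the
  representatives agree with \<open>s\<close> and \<open>t\<close>, and the union is over a nonempty
  set.\<close>

lemma mstalk_add:
 assumes U: "opn X U" "p : U" and s: "s : Ms F U" and t: "t : Ms F U"
 shows "mgerm X F p U s +[mstalk X F p] mgerm X F p U t = mgerm X F p U (s +[msec F U] t)"
proof -
 have *: "mgerm X F p (U' Int W') (mres F U' (U' Int W') s' +[msec F (U' Int W')] mres F W' (U' Int W') t')
   = mgerm X F p U (s +[msec F U] t)"
  if a: "(U', s') : mgerm X F p U s" and b: "(W', t') : mgerm X F p U t" for U' s' W' t'
 proof -
  note a' = germ_memD[OF a[unfolded mgerm_def]] and b' = germ_memD[OF b[unfolded mgerm_def]]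
  obtain Z1 where Z1: "opn X Z1" "p : Z1" "Z1 <= U" "Z1 <= U'" "mres F U Z1 s = mres F U' Z1 s'" using a'(4) by blast
  obtain Z2 where Z2: "opn X Z2" "p : Z2" "Z2 <= U" "Z2 <= W'" "mres F U Z2 t = mres F W' Z2 t'" using b'(4) by blast
  let ?Z = "Z1 Int Z2" and ?I = "U' Int W'"
  have o: "opn X ?Z" "opn X ?I" using Z1 Z2 a' b' by blast+
  have 1: "mres F U ?Z s = mres F U' ?Z s'"
   using res_res[OF U(1) Z1(1) o(1) _ Z1(3) s] res_res[OF a'(1) Z1(1) o(1) _ Z1(4) a'(3)] Z1(5) by simp
  have 2: "mres F U ?Z t = mres F W' ?Z t'"
   using res_res[OF U(1) Z2(1) o(1) _ Z2(3) t] res_res[OF b'(1) Z2(1) o(1) _ Z2(4) b'(3)] Z2(5) by simp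
  have c: "mres F U' ?I s' : Ms F ?I" "mres F W' ?I t' : Ms F ?I"
   using res_closed a' b' o by auto
  have sub: "?Z <= ?I" "?Z <= U" using Z1 Z2 by auto
  have "mres F ?I ?Z (mres F U' ?I s' +[msec F ?I] mres F W' ?I t') = mres F U' ?Z s' +[msec F ?Z] mres F W' ?Z t'"
   using res_add[OF o(2,1) sub(1) c] res_res[OF a'(1) o(2,1) sub(1) _ a'(3)]
    res_res[OF b'(1) o(2,1) sub(1) _ b'(3)] by simp
  also have "... = mres F U ?Z (s +[msec F U] t)"
   using res_add[OF U(1) o(1) sub(2) s t] 1 2 by simp
  finally show ?thesis
   using mgerm_eqI[OF o(2) add_closed[OF o(2) c] U(1) add_closed[OF U(1) s t] o(1) _ sub] Z1(2) Z2(2) by simp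
 qed
 have n: "(U, s) : mgerm X F p U s" "(U, t) : mgerm X F p U t"
  using germ_self[OF presh U] s t unfolding mgerm_def by auto
 have "mgerm X F p U s +[mstalk X F p] mgerm X F p U t = (UN (U', s'):mgerm X F p U s. UN (W', t'):mgerm X F p U t.
   mgerm X F p (U' Int W') (mres F U' (U' Int W') s' +[msec F (U' Int W')] mres F W' (U' Int W') t'))"
  by (simp add: mstalk_def)
 also have "... = (UN x:mgerm X F p U s. UN y:mgerm X F p U t. mgerm X F p U (s +[msec F U] t))"
  using * by (intro SUP_cong refl) auto
 also have "... = mgerm X F p U (s +[msec F U] t)" using n by auto
 finally show ?thesis .
qed

lemma mstalk_smult:
 assumes U: "opn X U" "p : U" and s: "s : Os X U" and t: "t : Ms F U"
 shows "ogerm X p U s *.[mstalk X F p] mgerm X F p U t = mgerm X F p U (s *.[msec F U] t)"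
proof -
 have *: "mgerm X F p (U' Int W') (ores X U' (U' Int W') s' *.[msec F (U' Int W')] mres F W' (U' Int W') t')
   = mgerm X F p U (s *.[msec F U] t)"
  if a: "(U', s') : ogerm X p U s" and b: "(W', t') : mgerm X F p U t" for U' s' W' t'
 proof -
  note a' = germ_memD[OF a[unfolded ogerm_def]] and b' = germ_memD[OF b[unfolded mgerm_def]]
  obtain Z1 where Z1: "opn X Z1" "p : Z1" "Z1 <= U" "Z1 <= U'" "ores X U Z1 s = ores X U' Z1 s'" using a'(4) by blast
  obtain Z2 where Z2: "opn X Z2" "p : Z2" "Z2 <= U" "Z2 <= W'" "mres F U Z2 t = mres F W' Z2 t'" using b'(4) by blast
  let ?Z = "Z1 Int Z2" and ?I = "U' Int W'"
  have o: "opn X ?Z" "opn X ?I" using Z1 Z2 a' b' by blast+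
  have 1: "ores X U ?Z s = ores X U' ?Z s'"
   using ores_res[OF U(1) Z1(1) o(1) _ Z1(3) s] ores_res[OF a'(1) Z1(1) o(1) _ Z1(4) a'(3)] Z1(5) by simp
  have 2: "mres F U ?Z t = mres F W' ?Z t'"
   using res_res[OF U(1) Z2(1) o(1) _ Z2(3) t] res_res[OF b'(1) Z2(1) o(1) _ Z2(4) b'(3)] Z2(5) by simp
  have c: "ores X U' ?I s' : Os X ?I" "mres F W' ?I t' : Ms F ?I"
   using ores_closed res_closed a' b' o by auto
  have sub: "?Z <= ?I" "?Z <= U" using Z1 Z2 by auto
  have "mres F ?I ?Z (ores X U' ?I s' *.[msec F ?I] mres F W' ?I t') = ores X U' ?Z s' *.[msec F ?Z] mres F W' ?Z t'"
   using res_smult[OF o(2,1) sub(1) c] ores_res[OF a'(1) o(2,1) sub(1) _ a'(3)]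
    res_res[OF b'(1) o(2,1) sub(1) _ b'(3)] by simp
  also have "... = mres F U ?Z (s *.[msec F U] t)"
   using res_smult[OF U(1) o(1) sub(2) s t] 1 2 by simp
  finally show ?thesis
   using mgerm_eqI[OF o(2) smult_closed[OF o(2) c] U(1) smult_closed[OF U(1) s t] o(1) _ sub] Z1(2) Z2(2) by simp
 qed
 have n: "(U, s) : ogerm X p U s" "(U, t) : mgerm X F p U t"
  using germ_self[OF presh U] germ_self[OF opresh U] s t unfolding mgerm_def ogerm_def by auto
 have "ogerm X p U s *.[mstalk X F p] mgerm X F p U t = (UN (U', s'):ogerm X p U s. UN (W', t'):mgerm X F p U t.
   mgerm X F p (U' Int W') (ores X U' (U' Int W') s' *.[msec F (U' Int W')] mres F W' (U' Int W') t'))"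
  by (simp add: mstalk_def)
 also have "... = (UN x:ogerm X p U s. UN y:mgerm X F p U t. mgerm X F p U (s *.[msec F U] t))"
  using * by (intro SUP_cong refl) auto
 also have "... = mgerm X F p U (s *.[msec F U] t)" using n by auto
 finally show ?thesis .
qed

lemma mstalk_zero:
 assumes U: "opn X U" "p : U"
 shows "0[mstalk X F p] = mgerm X F p U 0[msec F U]"
proof -
 have s: "U <= pts X" by (rule openin_subset[OF U(1)])
 have "0[mstalk X F p] = mgerm X F p (pts X) 0[msec F (pts X)]" by (simp add: mstalk_def)
 also have "... = mgerm X F p U (mres F (pts X) U 0[msec F (pts X)])"
  by (rule mgerm_res[OF openin_topspace U(1) s U(2) zero_closed[OF openin_topspace], symmetric])
 also have "... = mgerm X F p U 0[msec F U]" by (simp only: res_zero[OF openin_topspace U(1) s])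
 finally show ?thesis .
qed

end

text \<open>The ring is treated as a module over itself. Through this identification the
  computations for module stalks also give the operations on the stalks of the structure
  sheaf.\<close>

lemma mstalk_osheaf: "mstalk X (osheaf X) p = reg_module (ostalk X p)"
 and mgerm_osheaf: "mgerm X (osheaf X) = ogerm X"
 by (simp_all add: mstalk_def ostalk_def osheaf_def reg_module_def mgerm_def ogerm_def)

lemma premod_osheaf: "pre_ring X ==> premod X (osheaf X)"
 by (simp add: premod_def pre_ring_osheaf)

lemma osheaf_sel [simp]:
 "mres (osheaf X) = ores X" "Ms (osheaf X) U = Os X U"
 "add (msec (osheaf X) U) = add (osec X U)" "ring.zero (msec (osheaf X) U) = ring.zero (osec X U)"
 "module.smult (msec (osheaf X) U) = monoid.mult (osec X U)"
 by (simp_all add: osheaf_def reg_module_def)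

lemma reg_module_sel [simp]:
 "carrier (reg_module R) = carrier R" "add (reg_module R) = add R" "ring.zero (reg_module R) = ring.zero R"
 "module.smult (reg_module R) = monoid.mult R"
 by (simp_all add: reg_module_def)

lemma ostalk_ops:
 assumes "pre_ring X" "opn X U" "p : U" "s : Os X U" "t : Os X U"
 shows "ogerm X p U s +[ostalk X p] ogerm X p U t = ogerm X p U (s +[osec X U] t)"
  and "ogerm X p U s *[ostalk X p] ogerm X p U t = ogerm X p U (s *[osec X U] t)"
 using premod.mstalk_add[OF premod_osheaf[OF assms(1)] assms(2,3), of s t]
  premod.mstalk_smult[OF premod_osheaf[OF assms(1)] assms(2,3), of s t] assms(4,5)
 unfolding mstalk_osheaf mgerm_osheaf by simp_all

lemma ostalk_one:
 assumes "pre_ring X" "opn X U" "p : U"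
 shows "1[ostalk X p] = ogerm X p U 1[osec X U]"
proof -
 interpret premod X "osheaf X" by (rule premod_osheaf[OF assms(1)])
 have s: "U <= pts X" using openin_subset assms by blast
 note 1 = pre_ringD(1)[OF assms(1) openin_topspace] ring_hom_one[OF pre_ringD(5)[OF assms(1) openin_topspace assms(2) s]]
 show ?thesis
  using ogerm_res[OF openin_topspace assms(2) s assms(3) 1(1)] 1(2) by (simp add: ostalk_def)
qed

section \<open>Gluing and separation of sections\<close>

lemma is_sheafD:
 assumes "is_sheaf T S res" "!!U. U : \<C> ==> openin T U" "!!U. U : \<C> ==> s U : S U"
  "!!U W. U : \<C> ==> W : \<C> ==> res U (U Int W) (s U) = res W (U Int W) (s W)"
 shows "EX! t. t : S (\<Union>\<C>) & (ALL U:\<C>. res (\<Union>\<C>) U t = s U)"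
 by (rule assms(1)[unfolded is_sheaf_def, THEN conjunct2, rule_format]) (use assms(2-4) in \<open>intro conjI ballI\<close>)

text \<open>\<open>is_sheaf\<close> glues over a set of open sets, with the sections given as a
  function of the open set. Here the cover is an indexed family that may repeat an open set.
  Compatibility forces repeated indices to carry equal sections, so choosing one index
  \<open>c A\<close> for each open set \<open>A\<close> loses nothing.\<close>

lemma sheaf_glue:
 assumes sh: "is_sheaf T S res"
  and W: "!!i. i : I ==> openin T (W i)" "!!i. i : I ==> s i : S (W i)"
  and eq: "!!i j. i : I ==> j : I ==> res (W i) (W i Int W j) (s i) = res (W j) (W i Int W j) (s j)"
  and U: "U = (UN i:I. W i)"
 obtains t where "t : S U" "!!i. i : I ==> res U (W i) t = s i"
proof -
 have pre: "is_presheaf T S res" using sh by (simp add: is_sheaf_def)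
 define c where "c A = (SOME i. i : I & W i = A)" for A
 have c: "c (W i) : I" "W (c (W i)) = W i" if "i : I" for i
  using someI[of "%j. j : I & W j = W i" i] that by (auto simp: c_def)
 have sc: "s (c (W i)) = s i" if i: "i : I" for i
  using eq[OF c(1)[OF i] i] is_presheafD(2)[OF pre W(1)[OF i]] W(2)[OF i] W(2)[OF c(1)[OF i]] c(2)[OF i] by simp
 have "EX! t. t : S (\<Union>(W ` I)) & (ALL A:W ` I. res (\<Union>(W ` I)) A t = s (c A))"
 proof (rule is_sheafD[OF sh])
  show "openin T A" "s (c A) : S A" if "A : W ` I" for A using that W c sc by auto
  fix A B assume "A : W ` I" "B : W ` I"
  then obtain i j where ij: "i : I" "j : I" "A = W i" "B = W j" by auto
  show "res A (A Int B) (s (c A)) = res B (A Int B) (s (c B))"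
   using eq[OF ij(1,2)] sc ij by simp
 qed
 then obtain t where "t : S (\<Union>(W ` I))" "ALL A:W ` I. res (\<Union>(W ` I)) A t = s (c A)" by (elim ex1E conjE)
 thus ?thesis using sc U by (intro that[of t]) auto
qed

text \<open>The uniqueness half of the sheaf axiom, applied to the family of all open subsets on
  which \<open>s\<close> and \<open>t\<close> agree.\<close>

lemma sheaf_eqI:
 assumes sh: "is_sheaf T S res" and U: "openin T U" "s : S U" "t : S U"
  and loc: "!!p. p : U ==> EX W. openin T W & p : W & W <= U & res U W s = res U W t"
 shows "s = t"
proof -
 have pre: "is_presheaf T S res" using sh by (simp add: is_sheaf_def)
 let ?C = "{W. openin T W & W <= U & res U W s = res U W t}"
 have un: "\<Union>?C = U" using loc by blast
 have "EX! r. r : S (\<Union>?C) & (ALL W:?C. res (\<Union>?C) W r = res U W s)"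
 proof (rule is_sheafD[OF sh])
  show "openin T W" "res U W s : S W" if "W : ?C" for W
  proof -
   from that have o: "openin T W" "W <= U" by auto
   show "openin T W" "res U W s : S W" using o is_presheafD(1)[OF pre U(1) o U(2)] by auto
  qed
  fix W Z assume "W : ?C" "Z : ?C"
  hence *: "openin T W" "W <= U" "openin T Z" "Z <= U" by auto
  thus "res W (W Int Z) (res U W s) = res Z (W Int Z) (res U Z s)"
   using is_presheafD(3)[OF pre U(1) *(1) openin_Int[OF *(1,3)] _ *(2) U(2)]
    is_presheafD(3)[OF pre U(1) *(3) openin_Int[OF *(1,3)] _ *(4) U(2)] by simp
 qed
 thus ?thesis unfolding un using U by (elim ex1E) auto
qed

locale rsheaf =
 fixes X :: "('p, 'a) rspace"
 assumes rs: "ring_sheaf X"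
begin

lemma osh: "is_sheaf (tp X) (%U. Os X U) (ores X)"
 using rs by (simp add: ring_sheaf_def)

lemma cr: "opn X U ==> cring (osec X U)"
 using rs by (simp add: ring_sheaf_def)

lemma res_ring_hom: "[|opn X U; opn X W; W <= U|] ==> ores X U W : ring_hom (osec X U) (osec X W)"
 using rs by (simp add: ring_sheaf_def)

lemma pre_ring_X: "pre_ring X" by (rule ring_sheaf_pre_ring[OF rs])

lemma openin_pts [simp]: "opn X (pts X)" by (rule openin_topspace)

lemma ores_in: "[|opn X U; opn X W; W <= U; s : Os X U|] ==> ores X U W s : Os X W"
 using ring_hom_closed[OF res_ring_hom] .

lemma ores_self: "[|opn X U; s : Os X U|] ==> ores X U U s = s"
 using is_presheafD(2)[OF pre_ring_X[unfolded pre_ring_def, THEN conjunct1]] .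

lemma ores_ores: "[|opn X U; opn X W; opn X Z; Z <= W; W <= U; s : Os X U|] ==>
  ores X W Z (ores X U W s) = ores X U Z s"
 using is_presheafD(3)[OF pre_ring_X[unfolded pre_ring_def, THEN conjunct1]] .

lemma ores_ops:
 assumes "opn X U" "opn X W" "W <= U"
 shows "[|a : Os X U; b : Os X U|] ==> ores X U W (a +[osec X U] b) = ores X U W a +[osec X W] ores X U W b"
  "[|a : Os X U; b : Os X U|] ==> ores X U W (a *[osec X U] b) = ores X U W a *[osec X W] ores X U W b"
  "ores X U W 1[osec X U] = 1[osec X W]" "ores X U W 0[osec X U] = 0[osec X W]"
  "a : Os X U ==> ores X U W (a ^[osec X U] (m::nat)) = ores X U W a ^[osec X W] m"
proof -
 note h = res_ring_hom[OF assms]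
 interpret U: cring "osec X U" by (rule cr[OF assms(1)])
 interpret W: cring "osec X W" by (rule cr[OF assms(2)])
 interpret ring_hom_cring "osec X U" "osec X W" "ores X U W"
  by (intro ring_hom_cring.intro U.is_cring W.is_cring ring_hom_cring_axioms.intro h)
 show "[|a : Os X U; b : Os X U|] ==> ores X U W (a +[osec X U] b) = ores X U W a +[osec X W] ores X U W b"
  "[|a : Os X U; b : Os X U|] ==> ores X U W (a *[osec X U] b) = ores X U W a *[osec X W] ores X U W b"
  "ores X U W 1[osec X U] = 1[osec X W]" "ores X U W 0[osec X U] = 0[osec X W]" by simp_all
 show "a : Os X U ==> ores X U W (a ^[osec X U] m) = ores X U W a ^[osec X W] m"
  by (induction m) auto
qed

text \<open>The sheaf axiom for the empty cover: over the empty set there is exactly one section.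
  Later this settles overlaps of disjoint open sets and shows that a domain cannot be the ring over
  an empty preimage.\<close>

lemma osec_empty: "a : Os X {} ==> b : Os X {} ==> a = b"
 by (rule sheaf_eqI[OF osh, of "{}"]) auto

lemma ogerm_eq_section:
 assumes "opn X U" "a : Os X U" "b : Os X U"
  "!!p. p : U ==> ogerm X p U a = ogerm X p U b"
 shows "a = b"
proof (rule sheaf_eqI[OF osh assms(1-3)])
 fix p assume p: "p : U"
 note P = pre_ring_X[unfolded pre_ring_def, THEN conjunct1]
 obtain Z where "opn X Z" "p : Z" "Z <= U" "ores X U Z a = ores X U Z b"
  by (rule germ_eqD[OF P assms(4)[OF p, unfolded ogerm_def] assms(1) p assms(3)])
 thus "EX W. opn X W & p : W & W <= U & ores X U W a = ores X U W b" by (intro exI[of _ Z] conjI)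
qed

end

section \<open>Sheaves of modules and their stalks\<close>

locale modsheaf = rsheaf X for X :: "('p, 'a) rspace" +
 fixes F :: "('p, 'a, 'm) msheaf"
 assumes ms: "mod_sheaf X F"

sublocale modsheaf \<subseteq> premod X F
 by unfold_locales (rule pre_ring_X, rule mod_sheaf_pre_mod[OF rs ms])

context modsheaf begin

lemma msh: "is_sheaf (tp X) (%U. Ms F U) (mres F)"
 using ms by (simp add: mod_sheaf_def)

lemma md: "opn X U ==> module (osec X U) (msec F U)"
 using ms by (simp add: mod_sheaf_def)

lemma ag: "opn X U ==> abelian_group (msec F U)"
 using md module.axioms(2) by blast

lemma mstalk_module:
 assumes p: "p : pts X" and c: "cring (ostalk X p)"
 shows "module (ostalk X p) (mstalk X F p)"
proof -
 have rep: "EX U s. opn X U & p : U & s : Ms F U & A = mgerm X F p U s" if "A : carrier (mstalk X F p)" for A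
  using mstalkE[OF that] by metis
 have orep: "EX U s. opn X U & p : U & s : Os X U & A = ogerm X p U s" if "A : carrier (ostalk X p)" for A
  using ostalkE[OF that] by metis
 have shrink: "EX s'. s' : Ms F W & mgerm X F p U s = mgerm X F p W s'"
  if "opn X U" "opn X W" "p : W" "W <= U" "s : Ms F U" for U W s
  using mgerm_res[OF that(1,2,4,3,5)] res_closed[OF that(1,2,4,5)] by metis
 have oshrink: "EX s'. s' : Os X W & ogerm X p U s = ogerm X p W s'"
  if "opn X U" "opn X W" "p : W" "W <= U" "s : Os X U" for U W s
  using ogerm_res[OF that(1,2,4,3,5)] ores_closed[OF that(1,2,4,5)] by metis
 \<comment> \<open>Finitely many germs are represented over one common neighbourhood;
   \<open>rep4\<close> does the same for two scalars and two module germs. Every axiom for the stalk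
   is then the corresponding axiom for the sections over that neighbourhood.\<close>
 have rep3: "EX U s t r. opn X U & p : U & s : Ms F U & t : Ms F U & r : Ms F U &
   A = mgerm X F p U s & B = mgerm X F p U t & C = mgerm X F p U r"
  if h: "A : carrier (mstalk X F p)" "B : carrier (mstalk X F p)" "C : carrier (mstalk X F p)" for A B C
 proof -
  obtain U1 s1 where 1: "opn X U1" "p : U1" "s1 : Ms F U1" "A = mgerm X F p U1 s1" using rep[OF h(1)] by blast
  obtain U2 s2 where 2: "opn X U2" "p : U2" "s2 : Ms F U2" "B = mgerm X F p U2 s2" using rep[OF h(2)] by blast
  obtain U3 s3 where 3: "opn X U3" "p : U3" "s3 : Ms F U3" "C = mgerm X F p U3 s3" using rep[OF h(3)] by blast
  let ?U = "U1 Int (U2 Int U3)"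
  have o: "opn X ?U" "p : ?U" using 1 2 3 by auto
  have sub: "?U <= U1" "?U <= U2" "?U <= U3" by auto
  show ?thesis
   using shrink[OF 1(1) o sub(1) 1(3)] shrink[OF 2(1) o sub(2) 2(3)] shrink[OF 3(1) o sub(3) 3(3)] o
   unfolding 1(4) 2(4) 3(4) by blast
 qed
 have rep4: "EX U a b s t. opn X U & p : U & a : Os X U & b : Os X U & s : Ms F U & t : Ms F U &
   A = ogerm X p U a & B = ogerm X p U b & C = mgerm X F p U s & D = mgerm X F p U t"
  if h: "A : carrier (ostalk X p)" "B : carrier (ostalk X p)" "C : carrier (mstalk X F p)" "D : carrier (mstalk X F p)" for A B C D
 proof -
  obtain U1 s1 where 1: "opn X U1" "p : U1" "s1 : Os X U1" "A = ogerm X p U1 s1" using orep[OF h(1)] by blast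
  obtain U2 s2 where 2: "opn X U2" "p : U2" "s2 : Os X U2" "B = ogerm X p U2 s2" using orep[OF h(2)] by blast
  obtain U3 s3 t3 where 3: "opn X U3" "p : U3" "s3 : Ms F U3" "t3 : Ms F U3" "C = mgerm X F p U3 s3" "D = mgerm X F p U3 t3"
   using rep3[OF h(3,4,4)] by blast
  let ?U = "U1 Int (U2 Int U3)"
  have o: "opn X ?U" "p : ?U" using 1 2 3 by auto
  have sub: "?U <= U1" "?U <= U2" "?U <= U3" by auto
  show ?thesis
   using oshrink[OF 1(1) o sub(1) 1(3)] oshrink[OF 2(1) o sub(2) 2(3)] shrink[OF 3(1) o sub(3) 3(3)]
    shrink[OF 3(1) o sub(3) 3(4)] o unfolding 1(4) 2(4) 3(5,6) by blast
 qed
 have z: "0[mstalk X F p] : carrier (mstalk X F p)"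
  using mstalk_zero[OF openin_topspace p] mgerm_in[OF openin_topspace p zero_closed[OF openin_topspace]] by simp
 show ?thesis
 proof (rule moduleI[OF c])
  show "abelian_group (mstalk X F p)"
  proof (rule abelian_groupI)
   show "0[mstalk X F p] : carrier (mstalk X F p)" by (rule z)
   fix A B C assume h: "A : carrier (mstalk X F p)" "B : carrier (mstalk X F p)" "C : carrier (mstalk X F p)"
   obtain U s t r where U: "opn X U" "p : U" and str: "s : Ms F U" "t : Ms F U" "r : Ms F U"
    and [simp]: "A = mgerm X F p U s" "B = mgerm X F p U t" "C = mgerm X F p U r"
    using rep3[OF h] by blast
   interpret abelian_group "msec F U" by (rule ag[OF U(1)])
   show "A +[mstalk X F p] B +[mstalk X F p] C = A +[mstalk X F p] (B +[mstalk X F p] C)"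
    using str by (simp add: mstalk_add[OF U] a_assoc)
  next
   fix A B assume h: "A : carrier (mstalk X F p)" "B : carrier (mstalk X F p)"
   obtain U s t where U: "opn X U" "p : U" and str: "s : Ms F U" "t : Ms F U"
    and [simp]: "A = mgerm X F p U s" "B = mgerm X F p U t"
    using rep3[OF h h(2)] by blast
   interpret abelian_group "msec F U" by (rule ag[OF U(1)])
   show "A +[mstalk X F p] B : carrier (mstalk X F p)"
    using str mgerm_in[OF U] by (simp add: mstalk_add[OF U])
   show "A +[mstalk X F p] B = B +[mstalk X F p] A"
    using str by (simp add: mstalk_add[OF U] a_comm)
   show "0[mstalk X F p] +[mstalk X F p] A = A"
    using str by (simp add: mstalk_zero[OF U] mstalk_add[OF U])
   show "EX y:carrier (mstalk X F p). y +[mstalk X F p] A = 0[mstalk X F p]"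
    using str mgerm_in[OF U] by (intro bexI[of _ "mgerm X F p U (\<ominus>\<^bsub>msec F U\<^esub> s)"])
     (simp_all add: mstalk_zero[OF U] mstalk_add[OF U] l_neg)
  qed
 next
  fix A B C D assume h: "A : carrier (ostalk X p)" "B : carrier (ostalk X p)" "C : carrier (mstalk X F p)"
  obtain U a b s where U: "opn X U" "p : U" and str: "a : Os X U" "b : Os X U" "s : Ms F U"
   and [simp]: "A = ogerm X p U a" "B = ogerm X p U b" "C = mgerm X F p U s"
   using rep4[OF h h(3)] by blast
  interpret module "osec X U" "msec F U" by (rule md[OF U(1)])
  show "A *.[mstalk X F p] C : carrier (mstalk X F p)"
   using str mgerm_in[OF U] by (simp add: mstalk_smult[OF U])
  show "(A +[ostalk X p] B) *.[mstalk X F p] C = A *.[mstalk X F p] C +[mstalk X F p] B *.[mstalk X F p] C"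
   using str by (simp add: mstalk_smult[OF U] mstalk_add[OF U] ostalk_ops[OF pre_ring_X U] smult_l_distr)
  show "A *[ostalk X p] B *.[mstalk X F p] C = A *.[mstalk X F p] (B *.[mstalk X F p] C)"
   using str by (simp add: mstalk_smult[OF U] ostalk_ops[OF pre_ring_X U] smult_assoc1)
 next
  fix C assume "C : carrier (mstalk X F p)"
  then obtain U s where U: "opn X U" "p : U" and str: "s : Ms F U" and [simp]: "C = mgerm X F p U s"
   using rep by blast
  interpret module "osec X U" "msec F U" by (rule md[OF U(1)])
  show "1[ostalk X p] *.[mstalk X F p] C = C"
   using str by (simp add: mstalk_smult[OF U] ostalk_one[OF pre_ring_X U])
 next
  fix A C D assume h: "A : carrier (ostalk X p)" "C : carrier (mstalk X F p)" "D : carrier (mstalk X F p)"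
  obtain U a s t where U: "opn X U" "p : U" and str: "a : Os X U" "s : Ms F U" "t : Ms F U"
   and [simp]: "A = ogerm X p U a" "C = mgerm X F p U s" "D = mgerm X F p U t"
   using rep4[OF h(1) h] by blast
  interpret module "osec X U" "msec F U" by (rule md[OF U(1)])
  show "A *.[mstalk X F p] (C +[mstalk X F p] D) = A *.[mstalk X F p] C +[mstalk X F p] A *.[mstalk X F p] D"
   using str by (simp add: mstalk_smult[OF U] mstalk_add[OF U] smult_r_distr)
 qed
qed

end

lemma reg_module_module:
 assumes "cring R" shows "module R (reg_module R)"
proof -
 interpret cring R by fact
 have "abelian_group (reg_module R)"
  by (rule abelian_groupI) (auto simp: a_ac intro: bexI[of _ "\<ominus>\<^bsub>R\<^esub> _"] l_neg)
 thus ?thesis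
  by (intro moduleI) (auto simp: assms l_distr r_distr m_assoc)
qed

lemma mod_sheaf_osheaf:
 assumes "ring_sheaf X" shows "mod_sheaf X (osheaf X)"
proof -
 interpret rsheaf X by unfold_locales fact
 show ?thesis
  unfolding mod_sheaf_def
 proof (intro conjI allI impI ballI)
  fix U assume "opn X U"
  thus "module (osec X U) (msec (osheaf X) U)"
   using reg_module_module[OF cr] by (simp add: osheaf_def)
 qed (use osh ores_ops in simp_all)
qed

section \<open>Comorphisms on stalks\<close>

text \<open>Morphisms of ringed spaces, that is \<open>lrs_hom\<close> without locality on stalks.
  Separating the two lets isomorphisms be built from comorphisms alone, locality being recovered
  afterwards.\<close>

definition pre_hom :: "('p, 'a) rspace => ('q, 'b) rspace => ('p, 'a, 'q, 'b) rmor => bool"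
 where "pre_hom X Y f \<longleftrightarrow>
  continuous_map (tp X) (tp Y) (mpt f) &
  (ALL U. opn Y U --> mco f U : ring_hom (osec Y U) (osec X (preim X f U))) &
  (ALL U W. opn Y U & opn Y W & W <= U --> (ALL s:Os Y U.
   mco f W (ores Y U W s) = ores X (preim X f U) (preim X f W) (mco f U s)))"

lemma lrs_hom_iff: "lrs_hom X Y f \<longleftrightarrow> pre_hom X Y f &
  (ALL p:pts X. ALL A:carrier (ostalk Y (mpt f p)).
   stalk_map X f p A : Units (ostalk X p) --> A : Units (ostalk Y (mpt f p)))"
 unfolding lrs_hom_def pre_hom_def by blast

lemma pre_homD:
 assumes "pre_hom X Y f"
 shows "opn Y U ==> opn X (preim X f U)"
  "p : pts X ==> mpt f p : pts Y"
  "opn Y U ==> mco f U : ring_hom (osec Y U) (osec X (preim X f U))"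
  "[|opn Y U; opn Y W; W <= U; s : Os Y U|] ==>
   mco f W (ores Y U W s) = ores X (preim X f U) (preim X f W) (mco f U s)"
proof -
 have c: "continuous_map (tp X) (tp Y) (mpt f)" using assms by (simp add: pre_hom_def)
 show "opn Y U ==> opn X (preim X f U)"
  using openin_continuous_map_preimage[OF c] by (simp add: preim_def)
 show "p : pts X ==> mpt f p : pts Y" using continuous_map_image_subset_topspace[OF c] by blast
qed (use assms in \<open>simp_all add: pre_hom_def\<close>)

lemma preim_mono: "W <= U ==> preim X f W <= preim X f U"
 and preim_Int: "preim X f (U Int W) = preim X f U Int preim X f W"
 unfolding preim_def by auto

lemma preim_pts: "pre_hom X Y f ==> preim X f (pts Y) = pts X"
 using pre_homD(2)[of X Y f] by (auto simp: preim_def)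

locale pmor =
 fixes X :: "('p, 'a) rspace" and Y :: "('q, 'b) rspace" and f
 assumes pX: "pre_ring X" and pY: "pre_ring Y" and pf: "pre_hom X Y f"
begin

lemma Xpresh: "is_presheaf (tp X) (%U. Os X U) (ores X)"
 and Ypresh: "is_presheaf (tp Y) (%U. Os Y U) (ores Y)"
 using pX pY by (simp_all add: pre_ring_def)

text \<open>The union over representatives in \<open>stalk_map\<close> is a single germ: two
  representatives agree on some \<open>Z\<close>, and their images agree on the preimage of
  \<open>Z\<close> because the comorphism commutes with restriction.\<close>

lemma stalk_map_germ:
 assumes p: "p : pts X" and U: "opn Y U" "mpt f p : U" and s: "s : Os Y U"
 shows "stalk_map X f p (ogerm Y (mpt f p) U s) = ogerm X p (preim X f U) (mco f U s)"
proof -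
 have "ogerm X p (preim X f W) (mco f W t) = ogerm X p (preim X f U) (mco f U s)"
  if a: "(W, t) : ogerm Y (mpt f p) U s" for W t
 proof -
  note a' = germ_memD[OF a[unfolded ogerm_def]]
  obtain Z where Z: "opn Y Z" "mpt f p : Z" "Z <= U" "Z <= W" "ores Y U Z s = ores Y W Z t" using a'(4) by blast
  have eq: "ores X (preim X f W) (preim X f Z) (mco f W t) = ores X (preim X f U) (preim X f Z) (mco f U s)"
   using pre_homD(4)[OF pf U(1) Z(1,3) s] pre_homD(4)[OF pf a'(1) Z(1,4) a'(3)] Z(5) by simp
  have pz: "p : preim X f Z" using p Z by (simp add: preim_def)
  show ?thesis unfolding ogerm_def
   by (rule germ_eqI[OF Xpresh pre_homD(1)[OF pf a'(1)] ring_hom_closed[OF pre_homD(3)[OF pf a'(1)] a'(3)]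
    pre_homD(1)[OF pf U(1)] ring_hom_closed[OF pre_homD(3)[OF pf U(1)] s] pre_homD(1)[OF pf Z(1)] pz
    preim_mono[OF Z(4)] preim_mono[OF Z(3)] eq])
 qed
 hence "stalk_map X f p (ogerm Y (mpt f p) U s)
   = (UN x:ogerm Y (mpt f p) U s. ogerm X p (preim X f U) (mco f U s))"
  unfolding stalk_map_def by (intro SUP_cong refl) auto
 moreover have "(U, s) : ogerm Y (mpt f p) U s"
  using germ_self[OF Ypresh U s] by (simp add: ogerm_def)
 ultimately show ?thesis by auto
qed

lemma stalk_map_hom:
 assumes p: "p : pts X"
 shows "stalk_map X f p : ring_hom (ostalk Y (mpt f p)) (ostalk X p)"
proof -
 interpret X: premod X "osheaf X" by (rule premod_osheaf[OF pX])
 interpret Y: premod Y "osheaf Y" by (rule premod_osheaf[OF pY])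
 have rep2: "EX U s t. opn Y U & mpt f p : U & s : Os Y U & t : Os Y U &
   A = ogerm Y (mpt f p) U s & B = ogerm Y (mpt f p) U t"
  if h: "A : carrier (ostalk Y (mpt f p))" "B : carrier (ostalk Y (mpt f p))" for A B
 proof -
  obtain U s where 1: "opn Y U" "mpt f p : U" "s : Os Y U" "A = ogerm Y (mpt f p) U s"
   by (rule Y.ostalkE[OF h(1)])
  obtain W t where 2: "opn Y W" "mpt f p : W" "t : Os Y W" "B = ogerm Y (mpt f p) W t"
   by (rule Y.ostalkE[OF h(2)])
  have o: "opn Y (U Int W)" "mpt f p : U Int W" "U Int W <= U" "U Int W <= W" using 1 2 by auto
  show ?thesis
   using o Y.ogerm_res[OF 1(1) o(1) o(3) o(2) 1(3)] Y.ogerm_res[OF 2(1) o(1) o(4) o(2) 2(3)]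
    Y.ores_closed[OF 1(1) o(1,3) 1(3)] Y.ores_closed[OF 2(1) o(1,4) 2(3)] 1(4) 2(4)
   by (intro exI[of _ "U Int W"]) metis
 qed
 have q: "mpt f p : pts Y" by (rule pre_homD(2)[OF pf p])
 show ?thesis
 proof (rule ring_hom_memI)
  fix A B assume h: "A : carrier (ostalk Y (mpt f p))" "B : carrier (ostalk Y (mpt f p))"
  obtain U s t where U: "opn Y U" "mpt f p : U" and st: "s : Os Y U" "t : Os Y U"
   and [simp]: "A = ogerm Y (mpt f p) U s" "B = ogerm Y (mpt f p) U t" using rep2[OF h] by blast
  note m = pre_homD(3)[OF pf U(1)]
  have V: "opn X (preim X f U)" "p : preim X f U"
   using pre_homD(1)[OF pf U(1)] p U by (auto simp: preim_def)
  have ms: "mco f U s : Os X (preim X f U)" "mco f U t : Os X (preim X f U)"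
   using ring_hom_closed[OF m] st by auto
  show "stalk_map X f p A : carrier (ostalk X p)"
   using X.ogerm_in[OF V ms(1)] st by (simp add: stalk_map_germ[OF p U])
  show "stalk_map X f p (A *[ostalk Y (mpt f p)] B) = stalk_map X f p A *[ostalk X p] stalk_map X f p B"
   using st ms pre_ringD(3)[OF pY U(1)] by (simp add: stalk_map_germ[OF p U] ostalk_ops[OF pY U] ostalk_ops[OF pX V] ring_hom_mult[OF m])
  show "stalk_map X f p (A +[ostalk Y (mpt f p)] B) = stalk_map X f p A +[ostalk X p] stalk_map X f p B"
   using st ms pre_ringD(4)[OF pY U(1)] by (simp add: stalk_map_germ[OF p U] ostalk_ops[OF pY U] ostalk_ops[OF pX V] ring_hom_add[OF m])
 next
  have "preim X f (pts Y) = pts X" by (rule preim_pts[OF pf])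
  thus "stalk_map X f p 1[ostalk Y (mpt f p)] = 1[ostalk X p]"
   using stalk_map_germ[OF p openin_topspace q pre_ringD(1)[OF pY openin_topspace]]
    ostalk_one[OF pY openin_topspace q] ostalk_one[OF pX openin_topspace p]
    ring_hom_one[OF pre_homD(3)[OF pf openin_topspace]] by simp
 qed
qed

end

text \<open>If \<open>f\<close> has an inverse as a morphism of ringed spaces, then it is automatically local on stalks,
  because the stalk maps are invertible.\<close>

lemma lrs_isoI:
 assumes pX: "pre_ring X" and pY: "pre_ring Y" and f: "pre_hom X Y f" and g: "pre_hom Y X g"
  and gf: "mor_eq X X (mor_comp Y g f) mor_id" and fg: "mor_eq Y Y (mor_comp X f g) mor_id"
 shows "lrs_iso X Y f"
proof -
 have *: "lrs_hom X Y f"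
  if pX: "pre_ring X" and pY: "pre_ring Y" and f: "pre_hom X Y f" and g: "pre_hom Y X g"
   and gf: "mor_eq X X (mor_comp Y g f) mor_id" and fg: "mor_eq Y Y (mor_comp X f g) mor_id"
  for X :: "('x, 'y) rspace" and Y :: "('z, 'w) rspace" and f g
 proof -
  interpret f: pmor X Y f using that by unfold_locales
  interpret g: pmor Y X g using that by unfold_locales
  interpret Y: premod Y "osheaf Y" by (rule premod_osheaf[OF pY])
  show ?thesis unfolding lrs_hom_iff
  proof (intro conjI ballI impI f)
   fix p A assume p: "p : pts X" and A: "A : carrier (ostalk Y (mpt f p))"
    and u: "stalk_map X f p A : Units (ostalk X p)"
   have q: "mpt f p : pts Y" by (rule pre_homD(2)[OF f p])
   have gfp: "mpt g (mpt f p) = p" using gf p by (simp add: mor_eq_def mor_comp_def mor_id_def)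
   have fg': "mpt f (mpt g y) = y" if "y : pts Y" for y
    using fg that by (simp add: mor_eq_def mor_comp_def mor_id_def)
   have hom: "stalk_map Y g (mpt f p) : ring_hom (ostalk X p) (ostalk Y (mpt f p))"
    using g.stalk_map_hom[OF q] gfp by simp
   obtain U s where U: "opn Y U" "mpt f p : U" "s : Os Y U" "A = ogerm Y (mpt f p) U s"
    by (rule Y.ostalkE[OF A])
   have V: "opn X (preim X f U)" "mpt g (mpt f p) : preim X f U"
    using pre_homD(1)[OF f U(1)] p U gfp by (auto simp: preim_def)
   have pp: "preim Y g (preim X f U) = U"
    using openin_subset[OF U(1)] fg' pre_homD(2)[OF g] by (auto simp: preim_def)
   have mm: "mco g (preim X f U) (mco f U s) = s"
    using fg U by (simp add: mor_eq_def mor_comp_def mor_id_def)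
   have gfA: "stalk_map Y g (mpt f p) (stalk_map X f p A) = A"
    using f.stalk_map_germ[OF p U(1-3)] g.stalk_map_germ[OF q V ring_hom_closed[OF pre_homD(3)[OF f U(1)] U(3)]]
     gfp pp mm U(4) by simp
   obtain B where B: "B : carrier (ostalk X p)" "B *[ostalk X p] stalk_map X f p A = 1[ostalk X p]"
    "stalk_map X f p A *[ostalk X p] B = 1[ostalk X p]"
    using u by (auto simp: Units_def)
   have sA: "stalk_map X f p A : carrier (ostalk X p)" using u by (simp add: Units_def)
   show "A : Units (ostalk Y (mpt f p))"
    unfolding Units_def using A ring_hom_closed[OF hom B(1)] gfA ring_hom_one[OF hom] B
     ring_hom_mult[OF hom B(1) sA] ring_hom_mult[OF hom sA B(1)]
    by (auto intro!: bexI[of _ "stalk_map Y g (mpt f p) B"])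
  qed
 qed
 show ?thesis unfolding lrs_iso_def
  using *[OF pX pY f g gf fg] *[OF pY pX g f fg gf] gf fg by blast
qed

section \<open>Affine schemes\<close>

text \<open>\<open>zariski\<close> is defined through \<open>topology\<close>, which is meaningful
  only after its predicate is shown to be a topology. Primality is needed for the intersection of
  two open sets.\<close>

lemma zariski_openin:
 assumes "P <= {p. primeideal p R}" "cring R"
 shows "openin (zariski R P) U \<longleftrightarrow> (EX S<=carrier R. U = {p : P. \<not> S <= p})"
proof -
 interpret cring R by fact
 let ?L = "%U. EX S<=carrier R. U = {p : P. \<not> S <= p}"
 have "istopology ?L"
  unfolding istopology_def
 proof (intro conjI allI impI)
  fix A B assume "?L A" "?L B"
  then obtain S T where S: "S <= carrier R" "A = {p : P. \<not> S <= p}" and T: "T <= carrier R" "B = {p : P. \<not> T <= p}"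
   by auto
  \<comment> \<open>A prime ideal misses some product \<open>s t\<close> exactly if it misses some
    \<open>s\<close> in \<open>S\<close> and some \<open>t\<close> in \<open>T\<close>, so the
    products define the intersection.\<close>
  let ?ST = "{s *[R] t | s t. s : S & t : T}"
  have "\<not> ?ST <= p \<longleftrightarrow> \<not> S <= p & \<not> T <= p" if "p : P" for p
  proof -
   interpret p: primeideal p R using that assms by auto
   show ?thesis
   proof
    assume "\<not> ?ST <= p"
    then obtain s t where st: "s : S" "t : T" "s *[R] t \<notin> p" by auto
    thus "\<not> S <= p & \<not> T <= p" using S T p.I_l_closed[of t s] p.I_r_closed[of s t] by auto
   next
    assume "\<not> S <= p & \<not> T <= p"
    then obtain s t where "s : S" "t : T" "s \<notin> p" "t \<notin> p" by auto
    moreover from this have "s *[R] t \<notin> p" using p.I_prime[of s t] S T by auto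
    ultimately show "\<not> ?ST <= p" by auto
   qed
  qed
  hence "{p : P. \<not> ?ST <= p} = {p : P. \<not> S <= p & \<not> T <= p}" by (intro Collect_cong conj_cong refl)
  hence "A Int B = {p : P. \<not> ?ST <= p}" unfolding S(2) T(2) by (simp add: Int_def conj_ac)
  moreover have "?ST <= carrier R" using S T by auto
  ultimately show "?L (A Int B)" by blast
 next
  fix \<K> assume "ALL A:\<K>. ?L A"
  hence "ALL A:\<K>. EX S. S <= carrier R & A = {p : P. \<not> S <= p}" .
  from bchoice[OF this] obtain S where S: "ALL A:\<K>. S A <= carrier R & A = {p : P. \<not> S A <= p}" by (elim exE) (rule that)
  have "(UN A:\<K>. A) = (UN A:\<K>. {p : P. \<not> S A <= p})" by (rule SUP_cong[OF refl conjunct2[OF bspec[OF S]]])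
  hence "\<Union>\<K> = (UN A:\<K>. {p : P. \<not> S A <= p})" by simp
  also have "... = {p : P. \<not> (UN A:\<K>. S A) <= p}" by blast
  finally have "\<Union>\<K> = {p : P. \<not> (UN A:\<K>. S A) <= p}" .
  moreover have "(UN A:\<K>. S A) <= carrier R" using bspec[OF S, THEN conjunct1] by blast
  ultimately show "?L (\<Union>\<K>)" by (intro exI conjI)
 qed
 thus ?thesis unfolding zariski_def by (simp add: topology_inverse')
qed

abbreviation lfrac :: "'a ring => 'a set => 'a \<times> 'a => ('a \<times> 'a) set"
 where "lfrac R p \<equiv> fraction R (loc_pairs R p) (loc_den R p)"

text \<open>Operations on classes are unions over representatives. This evaluates such a union once
  the value is known not to depend on the representatives; the members \<open>x\<close> and
  \<open>y\<close> ensure that it is not empty.\<close>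

lemma UN_pairs_const:
 assumes "x : A" "y : B" and C: "!!a s b t. (a, s) : A ==> (b, t) : B ==> g a s b t = C"
 shows "(UN (a, s):A. UN (b, t):B. g a s b t) = C"
proof -
 have 1: "(case x of (a, s) => UN (b, t):B. g a s b t) = (UN y:B. C)" if x: "x : A" for x
 proof -
  have 2: "(case y of (b, t) => g (fst x) (snd x) b t) = C" if "y : B" for y
   using C[of "fst x" "snd x" "fst y" "snd y"] x that by (simp add: case_prod_beta)
  show ?thesis unfolding case_prod_beta[of _ x] by (rule SUP_cong[OF refl 2])
 qed
 have "(UN (a, s):A. UN (b, t):B. g a s b t) = (UN x:A. UN y:B. C)" by (rule SUP_cong[OF refl 1])
 thus ?thesis using assms(1,2) by auto
qed

lemma UN_pair_const:
 assumes "x : A" and C: "!!a s. (a, s) : A ==> g a s = C"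
 shows "(UN (a, s):A. g a s) = C"
proof -
 have "(case y of (a, s) => g a s) = C" if "y : A" for y
  using C[of "fst y" "snd y"] that by (simp add: case_prod_beta)
 from SUP_cong[OF refl this] have "(UN (a, s):A. g a s) = (UN y:A. C)" .
 thus ?thesis using assms(1) by auto
qed

lemma (in cring) mult_minus_eq_zero_iff:
 assumes "u : carrier R" "x : carrier R" "y : carrier R"
 shows "u \<otimes> (x \<ominus> y) = \<zero> \<longleftrightarrow> u \<otimes> x = u \<otimes> y"
proof
 assume "u \<otimes> (x \<ominus> y) = \<zero>"
 moreover have "u \<otimes> x = u \<otimes> (x \<ominus> y) \<oplus> u \<otimes> y"
  using assms by (simp add: minus_eq r_distr[symmetric] a_assoc l_neg)
 ultimately show "u \<otimes> x = u \<otimes> y" using assms by simp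
next
 assume "u \<otimes> x = u \<otimes> y"
 thus "u \<otimes> (x \<ominus> y) = \<zero>" using assms by (simp add: minus_eq r_distr r_minus r_neg)
qed

section \<open>Localization at a prime ideal\<close>

locale prime_at = primeideal p R for p and R :: "'a ring"
begin

lemma one_notin: "1[R] \<notin> p"
 using one_imp_carrier I_notcarr by blast

lemma den_mult: "[|s : carrier R - p; t : carrier R - p|] ==> s *[R] t : carrier R - p"
 using I_prime[of s t] by auto

lemma lfrac_mem:
 assumes "(a, s) : loc_pairs R p"
 shows "(b, t) : lfrac R p (a, s) \<longleftrightarrow> (b, t) : loc_pairs R p & (EX u:carrier R - p. u *[R] (a *[R] t) = u *[R] (b *[R] s))"
proof -
 have "u *[R] (a *[R] t \<ominus>\<^bsub>R\<^esub> b *[R] s) = 0[R] \<longleftrightarrow> u *[R] (a *[R] t) = u *[R] (b *[R] s)"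
  if "u : carrier R" "(b, t) : loc_pairs R p" for u
  using that assms mult_minus_eq_zero_iff[of u "a *[R] t" "b *[R] s"] by (simp add: loc_pairs_def)
 thus ?thesis unfolding fraction_def loc_den_def by auto
qed

lemma lfrac_eq:
 assumes x: "(a, s) : loc_pairs R p" and y: "(b, t) : loc_pairs R p"
 shows "lfrac R p (a, s) = lfrac R p (b, t) \<longleftrightarrow> (EX u:carrier R - p. u *[R] (a *[R] t) = u *[R] (b *[R] s))"
proof
 assume "lfrac R p (a, s) = lfrac R p (b, t)"
 moreover have "(b, t) : lfrac R p (b, t)"
  using y one_notin by (auto simp: lfrac_mem[OF y] intro!: bexI[of _ "1[R]"])
 ultimately have "(b, t) : lfrac R p (a, s)" by simp
 thus "EX u:carrier R - p. u *[R] (a *[R] t) = u *[R] (b *[R] s)"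
  unfolding lfrac_mem[OF x] by (rule conjunct2)
next
 assume a: "EX u:carrier R - p. u *[R] (a *[R] t) = u *[R] (b *[R] s)"
 have *: "lfrac R p (a, s) <= lfrac R p (b, t)"
  if x: "(a, s) : loc_pairs R p" and y: "(b, t) : loc_pairs R p"
   and ex: "EX u:carrier R - p. u *[R] (a *[R] t) = u *[R] (b *[R] s)" for a b s t
 proof
  fix z assume "z : lfrac R p (a, s)"
  then obtain c w v where z: "z = (c, w)" "(c, w) : loc_pairs R p" and v: "v : carrier R - p"
   "v *[R] (a *[R] w) = v *[R] (c *[R] s)"
   using lfrac_mem[OF x] by (cases z) auto
  obtain u where u: "u : carrier R - p" "u *[R] (a *[R] t) = u *[R] (b *[R] s)" using ex by blast
  have c: "a : carrier R" "b : carrier R" "c : carrier R" "s : carrier R - p" "t : carrier R" "w : carrier R"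
   "u : carrier R" "v : carrier R"
   using x y z u v by (auto simp: loc_pairs_def)
  \<comment> \<open>Transitivity of the fraction relation. From a/s = b/t with multiplier
    \<open>u\<close> and a/s = c/w with multiplier \<open>v\<close> one gets b/t = c/w with
    multiplier \<open>s u v\<close>, which stays outside \<open>p\<close> because \<open>p\<close>
    is prime.\<close>
  have "(s *[R] (u *[R] v)) *[R] (b *[R] w) = (v *[R] w) *[R] (u *[R] (b *[R] s))" using c by (simp add: m_ac)
  also have "... = (u *[R] t) *[R] (v *[R] (a *[R] w))" unfolding u(2)[symmetric] using c by (simp add: m_ac)
  also have "... = (s *[R] (u *[R] v)) *[R] (c *[R] t)" unfolding v(2) using c by (simp add: m_ac)
  finally show "z : lfrac R p (b, t)"
   unfolding z(1) lfrac_mem[OF y] by (intro conjI z(2) bexI[OF _ den_mult[OF c(4) den_mult[OF u(1) v(1)]]])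
 qed
 obtain u where u: "u : carrier R - p" "u *[R] (a *[R] t) = u *[R] (b *[R] s)" using a by auto
 show "lfrac R p (a, s) = lfrac R p (b, t)"
  by (rule equalityI[OF *[OF x y a] *[OF y x bexI[where x = u, OF _ u(1)]]]) (simp add: u(2))
qed

lemma lfrac_memD:
 assumes "(a, s) : loc_pairs R p" "(b, t) : lfrac R p (a, s)"
 shows "(b, t) : loc_pairs R p" "lfrac R p (b, t) = lfrac R p (a, s)"
proof -
 show p: "(b, t) : loc_pairs R p" using assms(2) unfolding lfrac_mem[OF assms(1)] by (rule conjunct1)
 have "EX u:carrier R - p. u *[R] (a *[R] t) = u *[R] (b *[R] s)"
  using assms(2) unfolding lfrac_mem[OF assms(1)] by (rule conjunct2)
 thus "lfrac R p (b, t) = lfrac R p (a, s)" using lfrac_eq[OF assms(1) p] by simp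
qed

lemma lfrac_self: "x : loc_pairs R p ==> x : lfrac R p x"
 using lfrac_mem[of "fst x" "snd x" "fst x" "snd x"] one_notin by (auto intro!: bexI[of _ "1[R]"])

lemma loc_pairs_ops:
 assumes "(a, s) : loc_pairs R p" "(b, t) : loc_pairs R p"
 shows "(a *[R] b, s *[R] t) : loc_pairs R p" "(a *[R] t +[R] b *[R] s, s *[R] t) : loc_pairs R p"
 using assms den_mult[of s t] by (auto simp: loc_pairs_def)

lemma frac_mult:
 assumes x: "(a, s) : loc_pairs R p" and y: "(b, t) : loc_pairs R p"
 shows "lfrac R p (a, s) *[frac_ring R (loc_pairs R p) (loc_den R p)] lfrac R p (b, t) = lfrac R p (a *[R] b, s *[R] t)"
proof -
 have "lfrac R p (a' *[R] b', s' *[R] t') = lfrac R p (a *[R] b, s *[R] t)"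
  if m: "(a', s') : lfrac R p (a, s)" "(b', t') : lfrac R p (b, t)" for a' s' b' t'
 proof -
  have p: "(a', s') : loc_pairs R p" "(b', t') : loc_pairs R p" by (rule lfrac_memD(1)[OF x that(1)], rule lfrac_memD(1)[OF y that(2)])
  obtain u v where u: "u : carrier R - p" "u *[R] (a *[R] s') = u *[R] (a' *[R] s)"
   and v: "v : carrier R - p" "v *[R] (b *[R] t') = v *[R] (b' *[R] t)"
   using m unfolding lfrac_mem[OF x] lfrac_mem[OF y] by (elim conjE bexE) (rule that)
  have c: "a : carrier R" "b : carrier R" "a' : carrier R" "b' : carrier R" "s : carrier R" "t : carrier R"
   "s' : carrier R" "t' : carrier R" "u : carrier R" "v : carrier R"
   using x y p u v by (auto simp: loc_pairs_def)
  have "(u *[R] v) *[R] (a' *[R] b' *[R] (s *[R] t)) = (u *[R] (a' *[R] s)) *[R] (v *[R] (b' *[R] t))"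
   using c by (simp add: m_ac)
  also have "... = (u *[R] v) *[R] (a *[R] b *[R] (s' *[R] t'))"
   unfolding u(2)[symmetric] v(2)[symmetric] using c by (simp add: m_ac)
  finally show ?thesis
   using iffD2[OF lfrac_eq[OF loc_pairs_ops(1)[OF p] loc_pairs_ops(1)[OF x y]] bexI] den_mult[OF u(1) v(1)] by simp
 qed
 thus ?thesis
  unfolding frac_ring_def monoid.simps ring.simps by (rule UN_pairs_const[where g = "%a s b t. lfrac R p (a *[R] b, s *[R] t)", OF lfrac_self[OF x] lfrac_self[OF y]])
qed

lemma frac_add:
 assumes x: "(a, s) : loc_pairs R p" and y: "(b, t) : loc_pairs R p"
 shows "lfrac R p (a, s) +[frac_ring R (loc_pairs R p) (loc_den R p)] lfrac R p (b, t)
  = lfrac R p (a *[R] t +[R] b *[R] s, s *[R] t)"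
proof -
 have "lfrac R p (a' *[R] t' +[R] b' *[R] s', s' *[R] t') = lfrac R p (a *[R] t +[R] b *[R] s, s *[R] t)"
  if m: "(a', s') : lfrac R p (a, s)" "(b', t') : lfrac R p (b, t)" for a' s' b' t'
 proof -
  have p: "(a', s') : loc_pairs R p" "(b', t') : loc_pairs R p" by (rule lfrac_memD(1)[OF x that(1)], rule lfrac_memD(1)[OF y that(2)])
  obtain u v where u: "u : carrier R - p" "u *[R] (a *[R] s') = u *[R] (a' *[R] s)"
   and v: "v : carrier R - p" "v *[R] (b *[R] t') = v *[R] (b' *[R] t)"
   using m unfolding lfrac_mem[OF x] lfrac_mem[OF y] by (elim conjE bexE) (rule that)
  have c: "a : carrier R" "b : carrier R" "a' : carrier R" "b' : carrier R" "s : carrier R" "t : carrier R"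
   "s' : carrier R" "t' : carrier R" "u : carrier R" "v : carrier R"
   using x y p u v by (auto simp: loc_pairs_def)
  have "(u *[R] v) *[R] ((a' *[R] t' +[R] b' *[R] s') *[R] (s *[R] t))
    = (u *[R] (a' *[R] s)) *[R] (v *[R] (t *[R] t')) +[R] (v *[R] (b' *[R] t)) *[R] (u *[R] (s *[R] s'))"
   using c by (simp add: m_ac l_distr r_distr)
  also have "... = (u *[R] v) *[R] ((a *[R] t +[R] b *[R] s) *[R] (s' *[R] t'))"
   unfolding u(2)[symmetric] v(2)[symmetric] using c by (simp add: m_ac l_distr r_distr)
  finally show ?thesis
   using iffD2[OF lfrac_eq[OF loc_pairs_ops(2)[OF p] loc_pairs_ops(2)[OF x y]] bexI] den_mult[OF u(1) v(1)] by simp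
 qed
 thus ?thesis
  unfolding frac_ring_def monoid.simps ring.simps by (rule UN_pairs_const[where g = "%a s b t. lfrac R p (a *[R] t +[R] b *[R] s, s *[R] t)", OF lfrac_self[OF x] lfrac_self[OF y]])
qed

end

lemma frac_one_zero:
 "1[frac_ring R (loc_pairs R p) (loc_den R p)] = lfrac R p (1[R], 1[R])"
 "0[frac_ring R (loc_pairs R p) (loc_den R p)] = lfrac R p (0[R], 1[R])"
 by (simp_all add: frac_ring_def)

section \<open>The structure presheaf of a spectrum\<close>

lemma Spec_sel:
 "tp (Spec R) = zariski R {p. primeideal p R}"
 "ores (Spec R) = (%U W s. restrict s W)"
 "s *[osec (Spec R) U] t = (\<lambda>p\<in>U. s p *[frac_ring R (loc_pairs R p) (loc_den R p)] t p)"
 "s +[osec (Spec R) U] t = (\<lambda>p\<in>U. s p +[frac_ring R (loc_pairs R p) (loc_den R p)] t p)"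
 "1[osec (Spec R) U] = (\<lambda>p\<in>U. lfrac R p (1[R], 1[R]))"
 "0[osec (Spec R) U] = (\<lambda>p\<in>U. lfrac R p (0[R], 1[R]))"
 by (simp_all add: Spec_def frac_space_def frac_one_zero)

lemma Spec_section:
 "s : Os (Spec R) U \<longleftrightarrow> s : extensional U & (ALL p:U. EX W a t. opn (Spec R) W & p : W & W <= U &
  (ALL q:W. (a, t) : loc_pairs R q & s q = lfrac R q (a, t)))"
 by (auto simp: Spec_def frac_space_def)

lemma Spec_section_at:
 assumes "s : Os (Spec R) U" "q : U"
 obtains W a t where "opn (Spec R) W" "q : W" "W <= U"
  "!!r. r : W ==> (a, t) : loc_pairs R r" "!!r. r : W ==> s r = lfrac R r (a, t)"
proof -
 from bspec[OF conjunct2[OF iffD1[OF Spec_section assms(1)]] assms(2)]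
 show ?thesis by (elim exE conjE) (rule that, auto)
qed

lemma Spec_pts:
 assumes "cring R" shows "pts (Spec R) = {p. primeideal p R}"
proof
 show "pts (Spec R) <= {p. primeideal p R}"
  using openin_topspace[of "tp (Spec R)"] unfolding Spec_sel(1) zariski_openin[OF order_refl assms] by auto
 have "opn (Spec R) {p. primeideal p R}"
  unfolding Spec_sel(1) zariski_openin[OF order_refl assms]
 proof (intro exI[of _ "carrier R"] conjI order_refl)
  show "{p. primeideal p R} = {p : {p. primeideal p R}. \<not> carrier R <= p}"
  proof -
   have "\<not> carrier R <= p" if "primeideal p R" for p
   proof -
    interpret primeideal p R by fact
    show ?thesis using I_notcarr Icarr by blast
   qed
   thus ?thesis by auto
  qed
 qed
 thus "{p. primeideal p R} <= pts (Spec R)" by (rule openin_subset)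
qed

lemma Spec_opn:
 assumes "cring R" shows "opn (Spec R) U \<longleftrightarrow> (EX S<=carrier R. U = {p. primeideal p R & \<not> S <= p})"
 unfolding Spec_sel(1) zariski_openin[OF order_refl assms] by simp

lemma Spec_prime: "cring R ==> opn (Spec R) U ==> p : U ==> prime_at p R"
 using openin_subset[of "tp (Spec R)" U] Spec_pts[of R] by (auto simp: prime_at_def)

lemma Spec_pre_ring:
 assumes R: "cring R" shows "pre_ring (Spec R)"
proof -
 interpret cring R by fact
 have P: "is_presheaf (tp (Spec R)) (%U. Os (Spec R) U) (ores (Spec R))"
  unfolding is_presheaf_def
 proof (intro conjI allI impI ballI)
  fix U W assume "opn (Spec R) U & opn (Spec R) W & W <= U"
  hence UW: "opn (Spec R) W" "W <= U" by auto
  show "ores (Spec R) U W : Os (Spec R) U \<rightarrow> Os (Spec R) W"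
  proof
   fix s assume s: "s : Os (Spec R) U"
   show "ores (Spec R) U W s : Os (Spec R) W"
    unfolding Spec_section
   proof (intro conjI ballI)
    fix p assume "p : W"
    hence "p : U" using UW by auto
    obtain Z a t where Z: "opn (Spec R) Z" "p : Z" "ALL q:Z. (a, t) : loc_pairs R q & s q = lfrac R q (a, t)"
     by (rule Spec_section_at[OF s \<open>p : U\<close>]) (rule that, auto)
    show "EX Z a t. opn (Spec R) Z & p : Z & Z <= W &
     (ALL q:Z. (a, t) : loc_pairs R q & ores (Spec R) U W s q = lfrac R q (a, t))"
     by (rule exI[of _ "Z Int W"], rule exI[of _ a], rule exI[of _ t])
      (use Z UW \<open>p : W\<close> in \<open>simp add: Spec_sel(2) openin_Int\<close>)
   qed (simp add: Spec_sel)
  qed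
 next
  fix U s assume "s : Os (Spec R) U"
  thus "ores (Spec R) U U s = s" by (simp add: Spec_section Spec_sel extensional_restrict)
 next
  fix U W Z s assume "opn (Spec R) U & opn (Spec R) W & opn (Spec R) Z & Z <= W & W <= U"
  thus "ores (Spec R) W Z (ores (Spec R) U W s) = ores (Spec R) U Z s"
   by (auto simp: Spec_sel restrict_def fun_eq_iff)
 qed
 have const: "(\<lambda>p\<in>U. lfrac R p (a, 1[R])) : Os (Spec R) U" if U: "opn (Spec R) U" "a : carrier R" for U a
  unfolding Spec_section
 proof (intro conjI ballI)
  fix p assume "p : U"
  have "(a, 1[R]) : loc_pairs R q" if "q : U" for q
   using prime_at.one_notin[OF Spec_prime[OF R U(1) that]] U(2) by (simp add: loc_pairs_def)
  thus "EX W b t. opn (Spec R) W & p : W & W <= U & (ALL q:W. (b, t) : loc_pairs R q & (\<lambda>p\<in>U. lfrac R p (a, 1[R])) q = lfrac R q (b, t))"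
   by (intro exI[of _ U] exI[of _ a] exI[of _ "1[R]"]) (simp add: U \<open>p : U\<close>)
 qed simp
 have ops: "s *[osec (Spec R) U] t : Os (Spec R) U & s +[osec (Spec R) U] t : Os (Spec R) U"
  if U: "opn (Spec R) U" and s: "s : Os (Spec R) U" and t: "t : Os (Spec R) U" for U s t
 proof -
  have *: "EX W a u b v. opn (Spec R) W & p : W & W <= U & (ALL q:W. (a, u) : loc_pairs R q & s q = lfrac R q (a, u) &
    (b, v) : loc_pairs R q & t q = lfrac R q (b, v))" if pU: "p : U" for p
  proof -
   obtain W a u where 1: "opn (Spec R) W" "p : W" "W <= U" "ALL q:W. (a, u) : loc_pairs R q & s q = lfrac R q (a, u)"
    by (rule Spec_section_at[OF s pU]) (rule that, auto)
   obtain Z b v where 2: "opn (Spec R) Z" "p : Z" "Z <= U" "ALL q:Z. (b, v) : loc_pairs R q & t q = lfrac R q (b, v)"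
    by (rule Spec_section_at[OF t pU]) (rule that, auto)
   show ?thesis
    by (intro exI[of _ "W Int Z"] exI[of _ a] exI[of _ u] exI[of _ b] exI[of _ v])
     (use 1 2 in \<open>simp add: openin_Int le_infI1\<close>)
  qed
  have "EX W c w. opn (Spec R) W & p : W & W <= U & (ALL q:W. (c, w) : loc_pairs R q & (s *[osec (Spec R) U] t) q = lfrac R q (c, w))"
   "EX W c w. opn (Spec R) W & p : W & W <= U & (ALL q:W. (c, w) : loc_pairs R q & (s +[osec (Spec R) U] t) q = lfrac R q (c, w))"
   if pU: "p : U" for p
  proof -
   obtain W a u b v where W: "opn (Spec R) W" "p : W" "W <= U"
    and q: "!!q. q:W ==> (a, u) : loc_pairs R q & s q = lfrac R q (a, u) & (b, v) : loc_pairs R q & t q = lfrac R q (b, v)"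
    using *[OF pU] by (elim exE conjE) (rule that, assumption+, erule (1) bspec)
   have "(a *[R] b, u *[R] v) : loc_pairs R q & (s *[osec (Spec R) U] t) q = lfrac R q (a *[R] b, u *[R] v)"
    "(a *[R] v +[R] b *[R] u, u *[R] v) : loc_pairs R q & (s +[osec (Spec R) U] t) q = lfrac R q (a *[R] v +[R] b *[R] u, u *[R] v)"
    if qW: "q : W" for q
   proof -
    interpret q: prime_at q R by (rule Spec_prime[OF R W(1) qW])
    have qU: "q : U" using W qW by auto
    show "(a *[R] b, u *[R] v) : loc_pairs R q & (s *[osec (Spec R) U] t) q = lfrac R q (a *[R] b, u *[R] v)"
     using q[OF qW] q.frac_mult q.loc_pairs_ops qU by (simp add: Spec_sel)
    show "(a *[R] v +[R] b *[R] u, u *[R] v) : loc_pairs R q & (s +[osec (Spec R) U] t) q = lfrac R q (a *[R] v +[R] b *[R] u, u *[R] v)"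
     using q[OF qW] q.frac_add q.loc_pairs_ops qU by (simp add: Spec_sel)
   qed
   note * = this
   show "EX W c w. opn (Spec R) W & p : W & W <= U & (ALL q:W. (c, w) : loc_pairs R q & (s *[osec (Spec R) U] t) q = lfrac R q (c, w))"
    by (rule exI[of _ W], rule exI[of _ "a *[R] b"], rule exI[of _ "u *[R] v"]) (intro conjI W ballI *(1))
   show "EX W c w. opn (Spec R) W & p : W & W <= U & (ALL q:W. (c, w) : loc_pairs R q & (s +[osec (Spec R) U] t) q = lfrac R q (c, w))"
    by (rule exI[of _ W], rule exI[of _ "a *[R] v +[R] b *[R] u"], rule exI[of _ "u *[R] v"]) (intro conjI W ballI *(2))
  qed
  moreover have "s *[osec (Spec R) U] t : extensional U" "s +[osec (Spec R) U] t : extensional U" by (simp_all add: Spec_sel)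
  ultimately show ?thesis unfolding Spec_section by (intro conjI ballI)
 qed
 show ?thesis
  unfolding pre_ring_def
 proof (intro conjI allI impI ballI P)
  fix U assume U: "opn (Spec R) U"
  show "1[osec (Spec R) U] : Os (Spec R) U" "0[osec (Spec R) U] : Os (Spec R) U"
   using const[OF U] by (simp_all add: Spec_sel)
  fix s t assume "s : Os (Spec R) U" "t : Os (Spec R) U"
  thus "s *[osec (Spec R) U] t : Os (Spec R) U" "s +[osec (Spec R) U] t : Os (Spec R) U"
   using ops[OF U] by auto
 next
  fix U W assume "opn (Spec R) U & opn (Spec R) W & W <= U"
  hence UW: "opn (Spec R) U" "opn (Spec R) W" "W <= U" by auto
  show "ores (Spec R) U W : ring_hom (osec (Spec R) U) (osec (Spec R) W)"
  proof (rule ring_hom_memI)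
   show "ores (Spec R) U W s : Os (Spec R) W" if "s : Os (Spec R) U" for s
    by (rule is_presheafD(1)[OF P UW that])
  qed (use UW(3) in \<open>auto simp: Spec_sel restrict_def fun_eq_iff subset_iff\<close>)
  show "ores (Spec R) U W 0[osec (Spec R) U] = 0[osec (Spec R) W]"
   using UW(3) by (auto simp: Spec_sel restrict_def fun_eq_iff)
 qed
qed

subsection \<open>The morphism induced by a ring homomorphism\<close>

lemma primeideal_preimage:
 assumes "cring R" "cring S" "h : ring_hom R S" "primeideal q S"
 shows "primeideal {a : carrier R. h a : q} R"
proof -
 interpret R: cring R by fact
 interpret S: cring S by fact
 interpret h: ring_hom_cring R S h by (intro ring_hom_cring.intro assms ring_hom_cring_axioms.intro)
 interpret q: primeideal q S by fact
 have ne: "1[S] \<notin> q" using q.one_imp_carrier q.I_notcarr by blast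
 show ?thesis
 proof (rule primeidealI[OF idealI[OF R.ring_axioms]])
  show "subgroup {a : carrier R. h a : q} (add_monoid R)"
   by (rule subgroup.intro) (auto simp: a_inv_def[symmetric])
 next
  show "carrier R ~= {a : carrier R. h a : q}" 
  proof
   assume "carrier R = {a : carrier R. h a : q}"
   hence "1[R] : {a : carrier R. h a : q}" using R.one_closed by simp
   thus False using ne by simp
  qed
  show "a : {a : carrier R. h a : q} \<or> b : {a : carrier R. h a : q}"
   if "a : carrier R" "b : carrier R" "a *[R] b : {a : carrier R. h a : q}" for a b
   using that q.I_prime[of "h a" "h b"] by auto
 qed (auto simp: assms intro: q.I_l_closed q.I_r_closed)
qed

text \<open>Well-definedness of the comorphism in \<open>Spec_map\<close>: a multiplier
  \<open>u\<close> outside the contracted prime is sent to \<open>h u\<close> outside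
  \<open>q\<close>, so equal fractions have equal images and the union over representatives
  collapses.\<close>

lemma lfrac_map:
 assumes R: "cring R" and S: "cring S" and h: "h : ring_hom R S" and q: "primeideal q S"
  and x: "(a, t) : loc_pairs R {a : carrier R. h a : q}"
 shows "(h a, h t) : loc_pairs S q"
  and "(UN (b, s):lfrac R {a : carrier R. h a : q} (a, t). lfrac S q (h b, h s)) = lfrac S q (h a, h t)"
proof -
 let ?p = "{a : carrier R. h a : q}"
 have P: "prime_at ?p R" unfolding prime_at_def by (rule primeideal_preimage[OF R S h q])
 have Q: "prime_at q S" unfolding prime_at_def by (rule q)
 have pr: "(h b, h s) : loc_pairs S q" if "(b, s) : loc_pairs R ?p" for b s
  using that ring_hom_closed[OF h] by (auto simp: loc_pairs_def)
 show "(h a, h t) : loc_pairs S q" by (rule pr[OF x])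
 have "lfrac S q (h b, h s) = lfrac S q (h a, h t)" if bs: "(b, s) : lfrac R ?p (a, t)" for b s
 proof -
  have b: "(b, s) : loc_pairs R ?p" by (rule prime_at.lfrac_memD(1)[OF P x bs])
  obtain u where u: "u : carrier R - ?p" "u *[R] (a *[R] s) = u *[R] (b *[R] t)" using bs unfolding prime_at.lfrac_mem[OF P x] by (elim conjE bexE) (rule that)
  have c: "u : carrier R" "a : carrier R" "s : carrier R" "b : carrier R" "t : carrier R"
   using u x b by (auto simp: loc_pairs_def)
  have "h (u *[R] (a *[R] s)) = h (u *[R] (b *[R] t))" using u by simp
  hence "h u *[S] (h b *[S] h t) = h u *[S] (h a *[S] h s)" using c by (simp add: ring_hom_mult[OF h] cring.cring_simprules(5)[OF R])
  moreover have "h u : carrier S - q" using u ring_hom_closed[OF h] by auto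
  ultimately show ?thesis by (intro iffD2[OF prime_at.lfrac_eq[OF Q pr[OF b] pr[OF x]]] bexI)
 qed
 thus "(UN (b, s):lfrac R ?p (a, t). lfrac S q (h b, h s)) = lfrac S q (h a, h t)"
  by (rule UN_pair_const[where g = "%b s. lfrac S q (h b, h s)", OF prime_at.lfrac_self[OF P x]])
qed

lemma Spec_map_sel:
 "mpt (Spec_map R S h) q = {a : carrier R. h a : q}"
 "cring S ==> preim (Spec S) (Spec_map R S h) U = {q. primeideal q S & {a : carrier R. h a : q} : U}"
 by (auto simp: Spec_map_def preim_def Spec_pts)

lemma Spec_map_val:
 assumes "cring R" "cring S" "h : ring_hom R S" "primeideal q S" "{a : carrier R. h a : q} : U"
  "(a, t) : loc_pairs R {a : carrier R. h a : q}" "s {a : carrier R. h a : q} = lfrac R {a : carrier R. h a : q} (a, t)"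
 shows "mco (Spec_map R S h) U s q = lfrac S q (h a, h t)"
 using assms lfrac_map(2)[OF assms(1-4,6)] by (simp add: Spec_map_def)

lemma Spec_map_ext: "cring S ==> mco (Spec_map R S h) U s : extensional (preim (Spec S) (Spec_map R S h) U)"
 unfolding Spec_map_sel(2) by (simp add: Spec_map_def)

lemma Spec_map_pre_hom:
 assumes R: "cring R" and S: "cring S" and h: "h : ring_hom R S"
 shows "pre_hom (Spec S) (Spec R) (Spec_map R S h)"
proof -
 let ?f = "Spec_map R S h" and ?p = "%q. {a : carrier R. h a : q}"
 note prm = primeideal_preimage[OF R S h]
 have op: "opn (Spec S) (preim (Spec S) ?f U)" if U: "opn (Spec R) U" for U
 proof -
  obtain T where T: "T <= carrier R" "U = {p. primeideal p R & \<not> T <= p}" 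
   using U unfolding Spec_opn[OF R] by (elim exE conjE) (rule that)
  have "preim (Spec S) ?f U = {q. primeideal q S & \<not> h ` T <= q}"
   unfolding Spec_map_sel(2)[OF S] T(2) using T(1) prm by auto
  moreover have "h ` T <= carrier S" using T(1) ring_hom_closed[OF h] by auto
  ultimately show ?thesis unfolding Spec_opn[OF S] by (intro exI conjI)
 qed
 have cont: "continuous_map (tp (Spec S)) (tp (Spec R)) (mpt ?f)"
  unfolding continuous_map_def
 proof (intro conjI allI impI)
  show "mpt ?f : pts (Spec S) \<rightarrow> pts (Spec R)"
   using prm by (auto simp: Spec_pts[OF R] Spec_pts[OF S] Spec_map_sel)
 qed (use op in \<open>auto simp: preim_def\<close>)
 have val: "EX W a t. opn (Spec R) W & ?p q : W & W <= U & (ALL r:W. (a, t) : loc_pairs R r & s r = lfrac R r (a, t))"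
  if "s : Os (Spec R) U" "q : preim (Spec S) ?f U" for s U q
 proof -
  have "?p q : U" using that(2) unfolding Spec_map_sel(2)[OF S] by simp
  from bspec[OF conjunct2[OF iffD1[OF Spec_section that(1)]] this] show ?thesis .
 qed
 have pt: "primeideal q S" "?p q : U" if "q : preim (Spec S) ?f U" for q U
  using that unfolding Spec_map_sel(2)[OF S] by auto
 have rep: "EX a t. (a, t) : loc_pairs R (?p q) & s (?p q) = lfrac R (?p q) (a, t)"
  if "s : Os (Spec R) U" "q : preim (Spec S) ?f U" for s U q
  using val[OF that] by (elim exE conjE) (rule exI, rule exI, erule (1) bspec)
 have hom: "mco ?f U : ring_hom (osec (Spec R) U) (osec (Spec S) (preim (Spec S) ?f U))" if U: "opn (Spec R) U" for U
 proof (rule ring_hom_memI)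
  fix s assume s: "s : Os (Spec R) U"
  show "mco ?f U s : Os (Spec S) (preim (Spec S) ?f U)"
   unfolding Spec_section
  proof (intro conjI ballI Spec_map_ext[OF S])
   fix q assume q: "q : preim (Spec S) ?f U"
   obtain W a t where W: "opn (Spec R) W" "?p q : W" "W <= U" and at: "ALL r:W. (a, t) : loc_pairs R r & s r = lfrac R r (a, t)"
    using val[OF s q] by (elim exE conjE) (rule that)
   have "(h a, h t) : loc_pairs S r & mco ?f U s r = lfrac S r (h a, h t)" if r: "r : preim (Spec S) ?f W" for r
   proof -
    have pr: "primeideal r S" "?p r : W" using pt[OF r] by auto
    have x: "(a, t) : loc_pairs R (?p r)" "s (?p r) = lfrac R (?p r) (a, t)" using at pr by auto
    have "?p r : U" using pr W by auto
    from Spec_map_val[where s = s, OF R S h pr(1) this x] lfrac_map(1)[OF R S h pr(1) x(1)] show ?thesis by blast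
   qed
   note * = this
   have qW: "q : preim (Spec S) ?f W" using W pt[OF q] unfolding Spec_map_sel(2)[OF S] by auto
   show "EX W a t. opn (Spec S) W & q : W & W <= preim (Spec S) ?f U &
     (ALL r:W. (a, t) : loc_pairs S r & mco ?f U s r = lfrac S r (a, t))"
    by (rule exI[of _ "preim (Spec S) ?f W"], rule exI[of _ "h a"], rule exI[of _ "h t"])
     (intro conjI ballI * op[OF W(1)] qW preim_mono[OF W(3)])
  qed
  fix s' assume s': "s' : Os (Spec R) U"
  have "mco ?f U (s *[osec (Spec R) U] s') q = mco ?f U s q *[frac_ring S (loc_pairs S q) (loc_den S q)] mco ?f U s' q
    & mco ?f U (s +[osec (Spec R) U] s') q = mco ?f U s q +[frac_ring S (loc_pairs S q) (loc_den S q)] mco ?f U s' q"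
   if q: "q : preim (Spec S) ?f U" for q
  proof -
   have pr: "primeideal q S" "?p q : U" using pt[OF q] by auto
   have Q: "prime_at q S" unfolding prime_at_def by (rule pr(1))
   have P: "prime_at (?p q) R" unfolding prime_at_def by (rule prm[OF pr(1)])
   obtain a t where x: "(a, t) : loc_pairs R (?p q)" "s (?p q) = lfrac R (?p q) (a, t)" using rep[OF s q] by (elim exE conjE) (rule that)
   obtain b u where y: "(b, u) : loc_pairs R (?p q)" "s' (?p q) = lfrac R (?p q) (b, u)" using rep[OF s' q] by (elim exE conjE) (rule that)
   have c: "a : carrier R" "t : carrier R" "b : carrier R" "u : carrier R" using x y by (auto simp: loc_pairs_def)
   have 1: "(s *[osec (Spec R) U] s') (?p q) = lfrac R (?p q) (a *[R] b, t *[R] u)"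
    "(s +[osec (Spec R) U] s') (?p q) = lfrac R (?p q) (a *[R] u +[R] b *[R] t, t *[R] u)"
    using prime_at.frac_mult[OF P x(1) y(1)] prime_at.frac_add[OF P x(1) y(1)] x(2) y(2) pr(2) by (simp_all add: Spec_sel)
   note 2 = Spec_map_val[where s = "s *[osec (Spec R) U] s'", OF R S h pr prime_at.loc_pairs_ops(1)[OF P x(1) y(1)] 1(1)]
    Spec_map_val[where s = "s +[osec (Spec R) U] s'", OF R S h pr prime_at.loc_pairs_ops(2)[OF P x(1) y(1)] 1(2)]
   note 3 = prime_at.frac_mult[OF Q lfrac_map(1)[OF R S h pr(1) x(1)] lfrac_map(1)[OF R S h pr(1) y(1)]]
    prime_at.frac_add[OF Q lfrac_map(1)[OF R S h pr(1) x(1)] lfrac_map(1)[OF R S h pr(1) y(1)]]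
   have cc: "a *[R] u : carrier R" "b *[R] t : carrier R" using c by (simp_all add: cring.cring_simprules(5)[OF R])
   note 4 = ring_hom_mult[OF h c(1,3)] ring_hom_mult[OF h c(2,4)] ring_hom_add[OF h cc] ring_hom_mult[OF h c(1,4)]
    ring_hom_mult[OF h c(3,2)]
   show ?thesis
    unfolding Spec_map_val[where s = s, OF R S h pr x] Spec_map_val[where s = s', OF R S h pr y] 2 3 4
    by (rule conjI[OF refl refl])
  qed
  hence m: "!!q. q : preim (Spec S) ?f U ==> mco ?f U (s *[osec (Spec R) U] s') q = (mco ?f U s *[osec (Spec S) (preim (Spec S) ?f U)] mco ?f U s') q"
   "!!q. q : preim (Spec S) ?f U ==> mco ?f U (s +[osec (Spec R) U] s') q = (mco ?f U s +[osec (Spec S) (preim (Spec S) ?f U)] mco ?f U s') q"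
   unfolding Spec_sel by simp_all
  show "mco ?f U (s *[osec (Spec R) U] s') = mco ?f U s *[osec (Spec S) (preim (Spec S) ?f U)] mco ?f U s'"
   by (rule extensionalityI[OF Spec_map_ext[OF S] _ m(1)]) (simp only: Spec_sel restrict_extensional)
  show "mco ?f U (s +[osec (Spec R) U] s') = mco ?f U s +[osec (Spec S) (preim (Spec S) ?f U)] mco ?f U s'"
   by (rule extensionalityI[OF Spec_map_ext[OF S] _ m(2)]) (simp only: Spec_sel restrict_extensional)
 next
  show "mco ?f U 1[osec (Spec R) U] = 1[osec (Spec S) (preim (Spec S) ?f U)]"
  proof (rule extensionalityI[OF Spec_map_ext[OF S]])
   fix q assume q: "q : preim (Spec S) ?f U"
   have pr: "primeideal q S" "?p q : U" using pt[OF q] by auto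
   have P: "prime_at (?p q) R" unfolding prime_at_def by (rule prm[OF pr(1)])
   have "(1[R], 1[R]) : loc_pairs R (?p q)" using prime_at.one_notin[OF P] cring.cring_simprules(6)[OF R] by (simp add: loc_pairs_def)
   from Spec_map_val[OF R S h pr this, of "1[osec (Spec R) U]"]
   show "mco ?f U 1[osec (Spec R) U] q = 1[osec (Spec S) (preim (Spec S) ?f U)] q"
    using pr(2) q ring_hom_one[OF h] by (simp add: Spec_sel)
  qed (simp add: Spec_sel)
 qed
 show ?thesis
  unfolding pre_hom_def
 proof (intro conjI allI impI ballI cont hom)
  fix U W s assume "opn (Spec R) U & opn (Spec R) W & W <= U"
  hence W: "W <= U" by simp
  show "mco ?f W (ores (Spec R) U W s) = ores (Spec S) (preim (Spec S) ?f U) (preim (Spec S) ?f W) (mco ?f U s)"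
   unfolding Spec_map_sel(2)[OF S] using W by (auto simp: Spec_map_def Spec_sel fun_eq_iff restrict_def)
 qed
qed

text \<open>The composite is given by a third function \<open>h\<close> that agrees with
  \<open>g\<close> after \<open>f\<close> on the carrier only. This is the form in which a
  homomorphism factors through its quotient by the kernel.\<close>

lemma Spec_map_comp:
 assumes R: "cring R" and Q: "cring Q" and A: "cring A" and f: "f : ring_hom R Q" and g: "g : ring_hom Q A"
  and h: "h : ring_hom R A" and hgf: "!!a. a : carrier R ==> h a = g (f a)"
 shows "mor_eq (Spec A) (Spec R) (Spec_map R A h) (mor_comp (Spec Q) (Spec_map R Q f) (Spec_map Q A g))"
proof -
 have pp: "{a : carrier R. f a : {b : carrier Q. g b : q}} = {a : carrier R. h a : q}" for q
  using hgf ring_hom_closed[OF f] by auto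
 show ?thesis
  unfolding mor_eq_def
 proof (intro conjI ballI allI impI)
  fix q show "mpt (Spec_map R A h) q = mpt (mor_comp (Spec Q) (Spec_map R Q f) (Spec_map Q A g)) q"
   by (simp add: mor_comp_def Spec_map_sel pp[unfolded mem_Collect_eq])
 next
  fix U s assume U: "opn (Spec R) U" and s: "s : Os (Spec R) U"
  let ?W = "preim (Spec Q) (Spec_map R Q f) U"
  have pre: "preim (Spec A) (Spec_map Q A g) ?W = preim (Spec A) (Spec_map R A h) U"
   using primeideal_preimage[OF Q A g]
   unfolding Spec_map_sel(2)[OF A] Spec_map_sel(2)[OF Q] mem_Collect_eq by (simp add: pp[unfolded mem_Collect_eq]) auto
  show "mco (Spec_map R A h) U s = mco (mor_comp (Spec Q) (Spec_map R Q f) (Spec_map Q A g)) U s"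
   unfolding mor_comp_def rmor.simps
  proof (rule extensionalityI[OF Spec_map_ext[OF A]])
   show "mco (Spec_map Q A g) ?W (mco (Spec_map R Q f) U s) : extensional (preim (Spec A) (Spec_map R A h) U)"
    using Spec_map_ext[OF A, of Q g ?W] unfolding pre .
   fix q assume q0: "q : preim (Spec A) (Spec_map R A h) U"
   hence q: "primeideal q A" "{a : carrier R. h a : q} : U" unfolding Spec_map_sel(2)[OF A] by auto
   let ?q = "{b : carrier Q. g b : q}"
   have r: "primeideal ?q Q" by (rule primeideal_preimage[OF Q A g q(1)])
   have rU: "{a : carrier R. f a : ?q} : U" using q(2) unfolding pp .
   obtain a t where x: "(a, t) : loc_pairs R {a : carrier R. h a : q}" "s {a : carrier R. h a : q} = lfrac R {a : carrier R. h a : q} (a, t)"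
    by (rule Spec_section_at[OF s q(2)]) (rule that, auto)
   have c: "a : carrier R" "t : carrier R" using x by (auto simp: loc_pairs_def)
   have 1: "mco (Spec_map R Q f) U s ?q = lfrac Q ?q (f a, f t)"
    by (rule Spec_map_val[OF R Q f r rU]) (use x pp in simp_all)
   have 2: "(f a, f t) : loc_pairs Q ?q"
    by (rule lfrac_map(1)[OF R Q f r]) (use x pp in simp)
   have 3: "?q : ?W" using r rU unfolding Spec_map_sel(2)[OF Q] by simp
   show "mco (Spec_map R A h) U s q = mco (Spec_map Q A g) ?W (mco (Spec_map R Q f) U s) q"
    using Spec_map_val[where s = "mco (Spec_map R Q f) U s", OF Q A g q(1) 3 2 1] Spec_map_val[where s = s, OF R A h q x] hgf c by simp
  qed
 qed
qed

lemma Spec_map_id: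
 assumes R: "cring R" and h: "h : ring_hom R R" and hid: "!!a. a : carrier R ==> h a = a"
 shows "mor_eq (Spec R) (Spec R) (Spec_map R R h) mor_id"
proof -
 have pp: "{a : carrier R. h a : q} = q" if "primeideal q R" for q
 proof -
  interpret primeideal q R by fact
  show ?thesis using hid by auto
 qed
 show ?thesis
  unfolding mor_eq_def
 proof (intro conjI ballI allI impI)
  fix q assume "q : pts (Spec R)"
  thus "mpt (Spec_map R R h) q = mpt mor_id q" by (simp add: Spec_pts[OF R] mor_id_def Spec_map_sel pp)
 next
  fix U s assume U: "opn (Spec R) U" and s: "s : Os (Spec R) U"
  have sub: "primeideal q R" if "q : U" for q using openin_subset[OF U] Spec_pts[OF R] that by auto
  have pre: "preim (Spec R) (Spec_map R R h) U = U"
   unfolding Spec_map_sel(2)[OF R] using sub pp by auto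
  show "mco (Spec_map R R h) U s = mco mor_id U s"
   unfolding mor_id_def rmor.simps
  proof (rule extensionalityI)
   show "mco (Spec_map R R h) U s : extensional U" using Spec_map_ext[OF R, of R h U s] unfolding pre .
   show "s : extensional U" by (rule conjunct1[OF iffD1[OF Spec_section s]])
   fix q assume q: "q : U"
   obtain a t where x: "(a, t) : loc_pairs R q" "s q = lfrac R q (a, t)"
    by (rule Spec_section_at[OF s q]) (rule that, auto)
   have c: "a : carrier R" "t : carrier R" using x by (auto simp: loc_pairs_def)
   show "mco (Spec_map R R h) U s q = s q"
    using Spec_map_val[OF R R h sub[OF q], of U a t s] pp[OF sub[OF q]] q x hid c by simp
  qed
 qed
qed

lemma mor_eq_trans: "mor_eq X Y f g ==> mor_eq X Y g k ==> mor_eq X Y f k"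
 and mor_eq_sym: "mor_eq X Y f g ==> mor_eq X Y g f"
 unfolding mor_eq_def by auto

lemma Spec_map_iso:
 assumes Q: "cring Q" and A: "cring A" and k: "k : ring_iso Q A"
 shows "lrs_iso (Spec A) (Spec Q) (Spec_map Q A k)"
proof -
 let ?k' = "inv_into (carrier Q) k"
 have k': "?k' : ring_iso A Q" by (rule ring_iso_set_sym[OF cring.axioms(1)[OF Q] k])
 have h: "k : ring_hom Q A" "?k' : ring_hom A Q" and b: "bij_betw k (carrier Q) (carrier A)"
  using k k' by (auto simp: ring_iso_def)
 have 1: "(%a. k (?k' a)) : ring_hom A A" "(%a. ?k' (k a)) : ring_hom Q Q"
  using ring_hom_trans[OF h(2,1)] ring_hom_trans[OF h] by (simp_all add: comp_def)
 show ?thesis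
 proof (rule lrs_isoI[OF Spec_pre_ring[OF A] Spec_pre_ring[OF Q] Spec_map_pre_hom[OF Q A h(1)] Spec_map_pre_hom[OF A Q h(2)]])
  show "mor_eq (Spec A) (Spec A) (mor_comp (Spec Q) (Spec_map A Q ?k') (Spec_map Q A k)) mor_id"
   by (rule mor_eq_trans[OF mor_eq_sym[OF Spec_map_comp[OF A Q A h(2,1) 1(1) refl]] Spec_map_id[OF A 1(1)]])
    (use b in \<open>simp add: bij_betw_inv_into_right\<close>)
  show "mor_eq (Spec Q) (Spec Q) (mor_comp (Spec A) (Spec_map Q A k) (Spec_map A Q ?k')) mor_id"
   by (rule mor_eq_trans[OF mor_eq_sym[OF Spec_map_comp[OF Q A Q h 1(2) refl]] Spec_map_id[OF Q 1(2)]])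
    (use b in \<open>simp add: bij_betw_inv_into_left\<close>)
 qed
qed

subsection \<open>Components cut out by a kernel that is killed generically\<close>

text \<open>A homomorphism onto a domain whose kernel is annihilated by one element \<open>u\<close>
  outside the kernel. After inverting \<open>u\<close> the kernel vanishes, so Spec A -> Spec R is a
  closed immersion that is an isomorphism over the nonempty open set where \<open>u\<close> does not
  vanish. This is why its image \<open>Z\<close> is a whole irreducible component.\<close>

locale generic_kernel =
 fixes R :: "'a ring" and A :: "'b ring" and h :: "'a => 'b" and u :: 'a and Z :: "'a set set"
 assumes R: "cring R" and A: "domain A" and h: "h : ring_hom R A" and surj: "h ` carrier R = carrier A"
  and u: "u : carrier R" "h u ~= 0[A]"
  and kill: "!!b. b : carrier R ==> h b = 0[A] ==> u *[R] b = 0[R]"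
 defines "Z \<equiv> {p. primeideal p R & a_kernel R A h <= p}"
begin

interpretation R: cring R by (rule R)
interpretation A: domain A by (rule A)
interpretation h: ring_hom_cring R A h
 by (intro ring_hom_cring.intro R A.is_cring ring_hom_cring_axioms.intro h)

lemma hr: "ring_hom_ring R A h" by (rule ring_hom_ringI2[OF R.ring_axioms A.ring_axioms h])

lemma kernel: "a_kernel R A h = {a : carrier R. h a = 0[A]}"
 by (rule a_kernel_def')

lemma kernel_prime: "primeideal (a_kernel R A h) R"
proof (rule primeidealI[OF ring_hom_ring.kernel_is_ideal[OF hr] R])
 show "carrier R ~= a_kernel R A h" using u by (auto simp: kernel)
 fix a b assume "a : carrier R" "b : carrier R" "a *[R] b : a_kernel R A h"
 thus "a : a_kernel R A h \<or> b : a_kernel R A h" using A.integral[of "h a" "h b"] by (auto simp: kernel)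
qed

lemma Inter_Z: "\<Inter>Z = a_kernel R A h"
 using kernel_prime unfolding Z_def by auto

text \<open>An element killed by something outside the kernel lies in the kernel by primality.
  Conversely the single element \<open>u\<close> kills the whole kernel.\<close>

lemma component_ideal_Z: "component_ideal R Z = a_kernel R A h"
proof -
 interpret primeideal "a_kernel R A h" R by (rule kernel_prime)
 show ?thesis
  unfolding component_ideal_def Inter_Z
 proof (intro equalityI subsetI)
  fix a assume "a : {a : carrier R. EX v:carrier R - a_kernel R A h. v *[R] a = 0[R]}"
  then obtain v where v: "a : carrier R" "v : carrier R" "v \<notin> a_kernel R A h" "v *[R] a = 0[R]" by blast
  have "v *[R] a : a_kernel R A h" unfolding v(4) by (rule additive_subgroup.zero_closed[OF is_additive_subgroup])
  from I_prime[OF v(2,1) this] show "a : a_kernel R A h" using v(3) by blast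
 next
  fix a assume "a : a_kernel R A h"
  hence a: "a : carrier R" "h a = 0[A]" unfolding kernel by blast+
  have "u : carrier R - a_kernel R A h" using u unfolding kernel by blast
  thus "a : {a : carrier R. EX v:carrier R - a_kernel R A h. v *[R] a = 0[R]}"
   using a(1) kill[OF a] by blast
 qed
qed

lemma Spec_closedin: "S <= carrier R ==> closedin (tp (Spec R)) {p. primeideal p R & S <= p}"
 unfolding closedin_def Spec_pts[OF R] Spec_opn[OF R]
 by (intro conjI exI[of _ S]) auto

text \<open>The kernel is the generic point of \<open>Z\<close>: a closed set that contains it
  contains \<open>Z\<close>, which gives irreducibility. Maximality comes from
  \<open>u\<close>.\<close>

lemma component_Z: "irreducible_component (tp (Spec R)) Z"
proof -
 have kZ: "a_kernel R A h : Z" using kernel_prime by (simp add: Z_def)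
 have ku: "u \<notin> a_kernel R A h" using u by (simp add: kernel)
 have cl: "EX S<=carrier R. C = {p. primeideal p R & S <= p}" if "closedin (tp (Spec R)) C" for C
 proof -
  have 1: "opn (Spec R) ({p. primeideal p R} - C)" and 2: "C <= {p. primeideal p R}"
   using that unfolding closedin_def Spec_pts[OF R] by simp_all
  obtain S where S: "S <= carrier R" "{p. primeideal p R} - C = {p. primeideal p R & \<not> S <= p}"
   using 1 unfolding Spec_opn[OF R] by (elim exE conjE) (rule that)
  have "C = {p. primeideal p R} - {p. primeideal p R & \<not> S <= p}" using 2 unfolding S(2)[symmetric] by (simp add: double_diff)
  thus ?thesis using S(1) by (intro exI[of _ S]) auto
 qed
 have "irreducible_set (tp (Spec R)) Z"
  unfolding irreducible_set_def
 proof (intro conjI allI impI)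
  fix C D assume CD: "closedin (tp (Spec R)) C & closedin (tp (Spec R)) D & Z <= C Un D"
  have *: "Z <= C" if "closedin (tp (Spec R)) C" "a_kernel R A h : C" for C
   using cl[OF that(1)] that(2) unfolding Z_def by (elim exE conjE) auto
  have "a_kernel R A h : C \<or> a_kernel R A h : D" using CD kZ by blast
  thus "Z <= C \<or> Z <= D" using *[of C] *[of D] CD by blast
 next
  show "Z <= pts (Spec R)" unfolding Spec_pts[OF R] Z_def by blast
  show "Z ~= {}" using kZ by blast
 qed
 moreover have "Z' = Z" if Z': "irreducible_set (tp (Spec R)) Z'" "Z <= Z'" for Z'
 proof -
  \<comment> \<open>For \<open>a\<close> in the kernel, \<open>u a = 0\<close> lies in every prime.
    A prime that does not contain \<open>u\<close> therefore contains the kernel, so the whole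
    spectrum is the union of \<open>Z\<close> and the zero set of \<open>u\<close>.\<close>
  have sub: "Z' <= {p. primeideal p R & a_kernel R A h <= p} Un {p. primeideal p R & {u} <= p}"
  proof
   fix p assume "p : Z'"
   hence p: "primeideal p R" using Z'(1)[unfolded irreducible_set_def, THEN conjunct1] unfolding Spec_pts[OF R] by blast
   interpret p: primeideal p R by (rule p)
   have "a : p" if "u \<notin> p" "a : a_kernel R A h" for a
    using that kill[of a] p.I_prime[of u a] u additive_subgroup.zero_closed[OF p.is_additive_subgroup]
    by (auto simp: kernel)
   thus "p : {p. primeideal p R & a_kernel R A h <= p} Un {p. primeideal p R & {u} <= p}" using p by blast
  qed
  have "Z' <= {p. primeideal p R & a_kernel R A h <= p} \<or> Z' <= {p. primeideal p R & {u} <= p}"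
   using Z'(1)[unfolded irreducible_set_def, THEN conjunct2, THEN conjunct2, rule_format,
     OF conjI[OF Spec_closedin[of "a_kernel R A h"] conjI[OF Spec_closedin[of "{u}"] sub]]] u(1)
   by (simp add: kernel subset_eq)
  \<comment> \<open>The generic point of \<open>Z\<close> lies in \<open>Z'\<close> and does not
    contain \<open>u\<close>, so irreducibility of \<open>Z'\<close> leaves only the first
    alternative.\<close>
  moreover have "\<not> Z' <= {p. primeideal p R & {u} <= p}" using Z'(2) kZ ku by blast
  ultimately show ?thesis using Z'(2) unfolding Z_def by blast
 qed
 ultimately show ?thesis unfolding irreducible_component_def by blast
qed

text \<open>The first isomorphism theorem for rings, carried to spectra by functoriality.\<close>

lemma iso_onto: "iso_onto_closed (Spec A) R (Spec_map R A h) (a_kernel R A h)"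
proof -
 let ?I = "a_kernel R A h" and ?g = "%X. the_elem (h ` X)"
 interpret I: ideal ?I R by (rule ring_hom_ring.kernel_is_ideal[OF hr])
 have Q: "cring (R Quot ?I)" by (rule I.quotient_is_cring[OF R])
 have g: "?g : ring_iso (R Quot ?I) A" by (rule ring_hom_ring.FactRing_iso_set[OF hr surj])
 have pi: "(%a. ?I +>\<^bsub>R\<^esub> a) : ring_hom R (R Quot ?I)" by (rule I.rcos_ring_hom)
 have gpi: "h a = ?g (?I +>\<^bsub>R\<^esub> a)" if a: "a : carrier R" for a
 proof -
  have "h ` (?I +>\<^bsub>R\<^esub> a) = {h a}"
  proof -
   have 1: "h b = h a" if b: "b : ?I +>\<^bsub>R\<^esub> a" for b
   proof -
    obtain k where k: "k : ?I" "b = k +[R] a" using b unfolding a_r_coset_def' by (elim UN_E singletonE) (rule that)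
    have "k : carrier R" "h k = 0[A]" using k(1) unfolding kernel by simp_all
    thus ?thesis unfolding k(2) using h.hom_add[OF _ a, of k] h.hom_closed[OF a] by simp
   qed
   show ?thesis
   proof (intro equalityI image_subsetI)
    fix b assume "b : ?I +>\<^bsub>R\<^esub> a" from 1[OF this] show "h b : {h a}" by (rule singleton_iff[THEN iffD2])
   next
    show "{h a} <= h ` (?I +>\<^bsub>R\<^esub> a)" using imageI[OF I.a_rcos_self[OF a], of h] by (simp only: insert_subset empty_subsetI simp_thms)
   qed
  qed
  thus ?thesis by (simp only: the_elem_eq)
 qed
 show ?thesis
  unfolding iso_onto_closed_def
  by (intro conjI I.is_ideal exI[of _ "Spec_map (R Quot ?I) A ?g"] Spec_map_iso[OF Q A.is_cring g]
   Spec_map_comp[OF R Q A.is_cring pi _ h gpi]) (use g in \<open>auto simp: ring_iso_def\<close>)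
qed

end

section \<open>Tensor products with a free module of rank one\<close>

lemma UN_const2:
 assumes "x : A" "y : B" "!!z w. z : A ==> w : B ==> g z w = C"
 shows "(UN z:A. UN w:B. g z w) = C"
proof -
 have "(UN w:B. g z w) = (UN w:B. C)" if "z : A" for z by (rule SUP_cong[OF refl assms(3)[OF that]])
 from SUP_cong[OF refl this] have "(UN z:A. UN w:B. g z w) = (UN z:A. UN w:B. C)" .
 thus ?thesis using assms(1,2) by auto
qed

lemma tens_null_uminus: "z : tens_null R h M N ==> - z : tens_null R h M N"
 using tens_null.diff[OF tens_null.zero] by fastforce

lemma tens_null_plus: "z : tens_null R h M N ==> w : tens_null R h M N ==> z + w : tens_null R h M N"
 using tens_null.diff[OF _ tens_null_uminus] by fastforce

lemma tens_null_cong: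
 assumes "!!r. r : carrier R ==> h r = k r"
 shows "tens_null R h M N = tens_null R k M N"
proof -
 have "z : tens_null R k M N" if "z : tens_null R h M N" "!!r. r : carrier R ==> h r = k r" for z h k
  using that(1) by (induction rule: tens_null.induct) (simp_all add: that(2) tens_null.intros)
 from this[of _ h k] this[of _ k h] show ?thesis using assms by (auto simp only:)
qed

text \<open>The scalar map enters only through its values on the carrier. This allows the stalk map
  of the identity morphism, which is the identity on actual germs only, to be replaced by the
  identity function.\<close>

lemma tens_module_cong:
 assumes "!!r. r : carrier R ==> h r = k r"
 shows "tens_module R h M N = tens_module R k M N" "tens_class R h M N = tens_class R k M N"
proof -
 have "tens_null R h M N = tens_null R k M N" by (rule tens_null_cong) (rule assms)
 thus "tens_module R h M N = tens_module R k M N" "tens_class R h M N = tens_class R k M N"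
  unfolding tens_module_def tens_class_def by simp_all
qed

section \<open>Computation with classes of tensors\<close>

locale tens =
 fixes R :: "'r ring" and S :: "'s ring" and h :: "'r => 's"
  and M :: "('r, 'm) module" and N :: "('s, 'n) module"
 assumes mM: "module R M" and mN: "module S N" and hom: "h : ring_hom R S"
begin

abbreviation T where "T \<equiv> tens_module R h M N"
abbreviation cl where "cl \<equiv> tens_class R h M N"
abbreviation null where "null \<equiv> tens_null R h M N"
abbreviation CC where "CC \<equiv> carrier M \<times> carrier N"

lemma cl_mem: "v : cl z \<longleftrightarrow> keys v <= CC & v - z : null"
 by (simp add: tens_class_def)

lemma cl_self: "keys z <= CC ==> z : cl z"
 by (simp add: cl_mem tens_null.zero)

lemma cl_eqI:
 assumes "z - w : null" shows "cl z = cl w"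
proof -
 have *: "cl z <= cl w" if "z - w : null" for z w
 proof
  fix v assume "v : cl z"
  hence v: "keys v <= CC" "v - z : null" by (simp_all add: cl_mem)
  have "v - w = (v - z) + (z - w)" by simp
  thus "v : cl w" using v tens_null_plus[OF v(2) that] by (simp add: cl_mem)
 qed
 have "w - z : null" using tens_null_uminus[OF assms] by simp
 from *[OF assms] *[OF this] show ?thesis by (rule equalityI)
qed

lemma cl_eqD: "cl z = cl w ==> keys z <= CC ==> z - w : null"
 using cl_self[of z] cl_mem[of z w] by simp

lemma T_carrier: "A : carrier T \<longleftrightarrow> (EX z. keys z <= CC & A = cl z)"
 by (auto simp: tens_module_def)

lemma T_add:
 assumes "keys z <= CC" "keys w <= CC"
 shows "cl z +[T] cl w = cl (z + w)"
proof -
 have "cl z +[T] cl w = (UN z':cl z. UN w':cl w. cl (z' + w'))" by (simp add: tens_module_def)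
 also have "... = cl (z + w)"
 proof (rule UN_const2[OF cl_self[OF assms(1)] cl_self[OF assms(2)]])
  fix z' w' assume "z' : cl z" "w' : cl w"
  hence "z' - z : null" "w' - w : null" by (simp_all add: cl_mem)
  from tens_null_plus[OF this] show "cl (z' + w') = cl (z + w)"
   by (intro cl_eqI) (simp add: algebra_simps)
 qed
 finally show ?thesis .
qed

lemma T_zero: "0[T] = cl 0" by (simp add: tens_module_def)

lemma keys_plus: "keys z <= CC ==> keys w <= CC ==> keys (z + w) <= CC"
 using keys_add[of z w] by (metis (no_types, lifting) Un_subset_iff order_trans sup.bounded_iff)

lemma T_abelian: "abelian_group T"
proof (rule abelian_groupI)
 show "0[T] : carrier T" unfolding T_zero T_carrier by (rule exI[of _ 0]) simp
 fix A B C assume "A : carrier T" "B : carrier T" "C : carrier T"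
 then obtain z w v where z: "keys z <= CC" "A = cl z" and w: "keys w <= CC" "B = cl w"
  and v: "keys v <= CC" "C = cl v" unfolding T_carrier by (elim exE conjE) (rule that)
 show "A +[T] B +[T] C = A +[T] (B +[T] C)"
  unfolding z(2) w(2) v(2) by (simp only: T_add z(1) w(1) v(1) keys_plus add.assoc)
next
 fix A B assume "A : carrier T" "B : carrier T"
 then obtain z w where z: "keys z <= CC" "A = cl z" and w: "keys w <= CC" "B = cl w"
  unfolding T_carrier by (elim exE conjE) (rule that)
 show "A +[T] B : carrier T"
  unfolding z(2) w(2) T_add[OF z(1) w(1)] T_carrier by (rule exI[of _ "z + w"]) (simp add: keys_plus z w)
 show "A +[T] B = B +[T] A"
  unfolding z(2) w(2) by (simp only: T_add z(1) w(1) add.commute)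
next
 fix A assume "A : carrier T"
 then obtain z where z: "keys z <= CC" "A = cl z" unfolding T_carrier by (elim exE conjE) (rule that)
 have k: "keys (0 :: 'm \<times> 'n \<Rightarrow>\<^sub>0 int) <= CC" by simp
 show "0[T] +[T] A = A" unfolding z(2) T_zero T_add[OF k z(1)] by simp
 have m: "keys (- z) <= CC" using z(1) by simp
 show "EX y:carrier T. y +[T] A = 0[T]"
 proof (rule bexI[of _ "cl (- z)"])
  show "cl (- z) +[T] A = 0[T]" unfolding z(2) T_zero T_add[OF m z(1)] by simp
  show "cl (- z) : carrier T" unfolding T_carrier using m by (intro exI[of _ "- z"] conjI refl)
 qed
qed

lemma cl_of_in: "m : carrier M ==> n : carrier N ==> cl (frag_of (m, n)) : carrier T"
 unfolding T_carrier by (rule exI[of _ "frag_of (m, n)"]) simp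

text \<open>Makes the action of \<open>S\<close> on classes well defined. For the balanced relations
  the scalars \<open>a\<close> and \<open>h r\<close> have to be exchanged, by commutativity of
  \<open>S\<close>.\<close>

lemma null_smult:
 assumes a: "a : carrier S" and z: "z : null"
 shows "frag_extend (%(m, n). frag_of (m, a *.[N] n)) z : null"
proof -
 interpret N: module S N by (rule mN)
 show ?thesis
  using z
 proof (induction rule: tens_null.induct)
  case (balanced r m n)
  have "h r : carrier S" using ring_hom_closed[OF hom balanced(1)] .
  hence "a *.[N] (h r *.[N] n) = h r *.[N] (a *.[N] n)"
   using a balanced(3) N.smult_assoc1[symmetric] N.R.m_comm by simp
  thus ?case using tens_null.balanced[OF balanced(1,2) N.smult_closed[OF a balanced(3)], of h]
   by (simp add: frag_extend_diff)
 next
  case (add_right m n n')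
  thus ?case using tens_null.add_right[OF add_right(1) N.smult_closed[OF a add_right(2)] N.smult_closed[OF a add_right(3)]] a
   by (simp add: frag_extend_diff N.smult_r_distr)
 next
  case (add_left m m' n)
  thus ?case using tens_null.add_left[OF add_left(1,2) N.smult_closed[OF a add_left(3)]]
   by (simp add: frag_extend_diff)
 qed (simp_all add: frag_extend_diff tens_null.intros)
qed

lemma T_smult:
 assumes a: "a : carrier S" and z: "keys z <= CC"
 shows "a *.[T] cl z = cl (frag_extend (%(m, n). frag_of (m, a *.[N] n)) z)"
proof -
 let ?e = "frag_extend (%(m, n). frag_of (m, a *.[N] n))"
 have "cl (?e w) = cl (?e z)" if "w : cl z" for w
 proof (rule cl_eqI)
  show "?e w - ?e z : null" using null_smult[OF a, of "w - z"] that by (simp add: cl_mem frag_extend_diff)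
 qed
 from SUP_cong[OF refl this] have "(UN w:cl z. cl (?e w)) = (UN w:cl z. cl (?e z))" .
 thus ?thesis using cl_self[OF z] by (auto simp: tens_module_def)
qed

lemma cl_balanced:
 assumes "r : carrier R" "m : carrier M" "n : carrier N"
 shows "cl (frag_of (r *.[M] m, n)) = cl (frag_of (m, h r *.[N] n))"
 by (rule cl_eqI[OF tens_null.balanced[OF assms]])

lemma cl_add:
 assumes "m : carrier M" "n : carrier N" "n' : carrier N"
 shows "cl (frag_of (m, n)) +[T] cl (frag_of (m, n')) = cl (frag_of (m, n +[N] n'))"
proof -
 have "cl (frag_of (m, n)) +[T] cl (frag_of (m, n')) = cl (frag_of (m, n) + frag_of (m, n'))"
  by (rule T_add) (use assms in simp_all)
 also have "... = cl (frag_of (m, n +[N] n'))"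
  by (rule cl_eqI[symmetric]) (use tens_null.add_right[OF assms] in \<open>simp add: algebra_simps\<close>)
 finally show ?thesis .
qed

lemma cl_smult:
 assumes "a : carrier S" "m : carrier M" "n : carrier N"
 shows "a *.[T] cl (frag_of (m, n)) = cl (frag_of (m, a *.[N] n))"
 using T_smult[OF assms(1), of "frag_of (m, n)"] assms(2,3) by simp

lemma cl_zero:
 assumes m: "m : carrier M" shows "0[T] = cl (frag_of (m, 0[N]))"
proof -
 interpret N: module S N by (rule mN)
 have "- frag_of (m, 0[N]) : null"
  using tens_null.add_right[OF m N.zero_closed N.zero_closed, of R h] by simp
 thus ?thesis unfolding T_zero by (intro cl_eqI) simp
qed

end

locale rank_one = tens R S h M N for R :: "'r ring" and S :: "'s ring" and h :: "'r => 's"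
  and M :: "('r, 'm) module" and N :: "('s, 'n) module" +
 fixes e :: 'm
 assumes e: "e : carrier M" and gen: "!!m. m : carrier M ==> EX! r. r : carrier R & m = r *.[M] e"
begin

text \<open>On generators m (x) n with m = r e, the balanced relation gives e (x) h(r) n.
  Differences of elements of the form e (x) n have that form again, so induction over the free
  abelian group covers everything.\<close>

lemma cl_surj:
 assumes "A : carrier T" shows "EX n:carrier N. A = cl (frag_of (e, n))"
proof -
 interpret N: module S N by (rule mN)
 obtain z where z: "keys z <= CC" "A = cl z" using assms unfolding T_carrier by (elim exE conjE) (rule that)
 have "EX n:carrier N. z - frag_of (e, n) : null"
  using z(1)
 proof (induction z rule: frag_induction)
  case zero
  have "- frag_of (e, 0[N]) : null"
   using tens_null.add_right[OF e N.zero_closed N.zero_closed, of R h] by simp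
  thus ?case by (intro bexI[of _ "0[N]"]) simp_all
 next
  case (one x)
  obtain m n where x: "x = (m, n)" "m : carrier M" "n : carrier N" using one by auto
  obtain r where r: "r : carrier R" "m = r *.[M] e" using gen[OF x(2)] by (elim ex1E conjE) (rule that)
  have hr: "h r : carrier S" by (rule ring_hom_closed[OF hom r(1)])
  show ?case using tens_null.balanced[OF r(1) e x(3), of h] N.smult_closed[OF hr x(3)]
   unfolding x(1) r(2) by (rule bexI)
 next
  case (diff a b)
  obtain n n' where n: "n : carrier N" "a - frag_of (e, n) : null" and n': "n' : carrier N" "b - frag_of (e, n') : null"
   using diff by (elim bexE) (rule that)
  have c: "n \<ominus>\<^bsub>N\<^esub> n' : carrier N" using n n' by simp
  have "(n \<ominus>\<^bsub>N\<^esub> n') +[N] n' = n" using n n' by (simp add: N.minus_eq N.a_assoc N.l_neg)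
  with tens_null.add_right[OF e c n'(1), of R h]
  have 1: "frag_of (e, n) - frag_of (e, n \<ominus>\<^bsub>N\<^esub> n') - frag_of (e, n') : null" by simp
  have "a - b - frag_of (e, n \<ominus>\<^bsub>N\<^esub> n') = (a - frag_of (e, n)) - (b - frag_of (e, n'))
    + (frag_of (e, n) - frag_of (e, n \<ominus>\<^bsub>N\<^esub> n') - frag_of (e, n'))" by simp
  also have "... : null" by (intro tens_null_plus tens_null.diff n(2) n'(2) 1)
  finally show ?case using c by (rule bexI)
 qed
 then obtain n where "n : carrier N" "z - frag_of (e, n) : null" by (elim bexE) (rule that)
 thus ?thesis using cl_eqI[of z "frag_of (e, n)"] z(2) by (intro bexI[of _ n]) simp_all
qed

text \<open>The map n -> e (x) n has the left inverse m (x) n -> h(co m) n. It is obtained from the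
  universal property of the free abelian group and shown to vanish on the relations, since the
  coordinate \<open>co\<close> is additive and linear.\<close>

lemma cl_inj:
 assumes n: "n : carrier N" "n' : carrier N" and eq: "cl (frag_of (e, n)) = cl (frag_of (e, n'))"
 shows "n = n'"
proof -
 interpret N: module S N by (rule mN)
 interpret M: module R M by (rule mM)
 \<comment> \<open>The coordinate of an element of \<open>M\<close> with respect to the free
   generator \<open>e\<close>.\<close>
 define co where "co m = (THE r. r : carrier R & m = r *.[M] e)" for m
 have co: "co m : carrier R" "m = co m *.[M] e" if "m : carrier M" for m
  using theI'[OF gen[OF that]] by (simp_all add: co_def)
 have coI: "co m = r" if "r : carrier R" "m = r *.[M] e" for m r
  unfolding co_def by (rule the1_equality[OF gen]) (use that e in simp_all)
 have hco: "h (co m) : carrier S" if "m : carrier M" for m using ring_hom_closed[OF hom co(1)[OF that]] .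
 have "(%(m, n). h (co m) *.[N] n) ` CC <= carrier (add_monoid N)" using hco by auto
 then obtain E where E: "E : Group.hom (free_Abelian_group CC) (add_monoid N)"
  and Eof: "!!x. x : CC ==> E (frag_of x) = (%(m, n). h (co m) *.[N] n) x"
  using comm_group.free_Abelian_group_universal[OF N.a_comm_group] by metis
 have Ein: "E z : carrier N" if "keys z <= CC" for z
  using E that by (auto simp: hom_def)
 have Eadd: "E (z + w) = E z +[N] E w" if "keys z <= CC" "keys w <= CC" for z w
  using E that by (simp add: hom_def)
 have kd: "keys (z - w) <= CC" if "keys z <= CC" "keys w <= CC" for z w
  using keys_diff[of z w] that by (meson Un_least order_trans)
 have Ediff: "E (z - w) = E z \<ominus>\<^bsub>N\<^esub> E w" if "keys z <= CC" "keys w <= CC" for z w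
  using Eadd[OF kd[OF that] that(2)] Ein[OF kd[OF that]] Ein[OF that(2)] by (simp add: N.minus_eq N.a_assoc N.r_neg)
 \<comment> \<open>The induction carries the support condition along, since \<open>E\<close> is a
   homomorphism only on combinations supported in \<open>CC\<close>.\<close>
 have "keys z <= CC & E z = 0[N]" if "z : null" for z
  using that
 proof (induction rule: tens_null.induct)
  case zero
  have "E 0 +[N] E 0 = E 0" using Eadd[of 0 0] by simp
  thus ?case using Ein[of 0] by simp
 next
  case (diff z w)
  thus ?case using kd[of z w] Ediff[of z w] by (simp add: N.minus_eq)
 next
  case (add_left m m' n)
  have "m +[M] m' = (co m +[R] co m') *.[M] e"
   using M.smult_l_distr[OF co(1)[OF add_left(1)] co(1)[OF add_left(2)] e] co(2)[OF add_left(1)] co(2)[OF add_left(2)] by simp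
  hence c: "co (m +[M] m') = co m +[R] co m'" using co(1)[OF add_left(1)] co(1)[OF add_left(2)] by (intro coI) simp_all
  have k: "keys (frag_of (m +[M] m', n)) <= CC" "keys (frag_of (m, n)) <= CC" "keys (frag_of (m', n)) <= CC"
   using add_left by simp_all
  have x: "h (co m) *.[N] n : carrier N" "h (co m') *.[N] n : carrier N" using hco add_left by simp_all
  have "E (frag_of (m +[M] m', n)) = h (co m) *.[N] n +[N] h (co m') *.[N] n"
   using Eof[of "(m +[M] m', n)"] add_left c hco ring_hom_add[OF hom co(1)[OF add_left(1)] co(1)[OF add_left(2)]]
   by (simp add: N.smult_l_distr)
  moreover have "E (frag_of (m, n)) = h (co m) *.[N] n" "E (frag_of (m', n)) = h (co m') *.[N] n"
   using Eof[of "(m, n)"] Eof[of "(m', n)"] add_left by simp_all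
  ultimately have "E (frag_of (m +[M] m', n) - frag_of (m, n) - frag_of (m', n)) = 0[N]"
   using Ediff[OF kd[OF k(1,2)] k(3)] Ediff[OF k(1,2)] x by (simp add: N.minus_eq N.a_ac N.r_neg)
  thus ?case using kd[OF kd[OF k(1,2)] k(3)] by blast
 next
  case (add_right m n n')
  have k: "keys (frag_of (m, n +[N] n')) <= CC" "keys (frag_of (m, n)) <= CC" "keys (frag_of (m, n')) <= CC"
   using add_right by simp_all
  have x: "h (co m) *.[N] n : carrier N" "h (co m) *.[N] n' : carrier N" using hco add_right by simp_all
  have "E (frag_of (m, n +[N] n')) = h (co m) *.[N] n +[N] h (co m) *.[N] n'"
   using Eof[of "(m, n +[N] n')"] add_right hco by (simp add: N.smult_r_distr)
  moreover have "E (frag_of (m, n)) = h (co m) *.[N] n" "E (frag_of (m, n')) = h (co m) *.[N] n'"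
   using Eof[of "(m, n)"] Eof[of "(m, n')"] add_right by simp_all
  ultimately have "E (frag_of (m, n +[N] n') - frag_of (m, n) - frag_of (m, n')) = 0[N]"
   using Ediff[OF kd[OF k(1,2)] k(3)] Ediff[OF k(1,2)] x by (simp add: N.minus_eq N.a_ac N.r_neg)
  thus ?case using kd[OF kd[OF k(1,2)] k(3)] by blast
 next
  case (balanced r m n)
  have hr: "h r : carrier S" by (rule ring_hom_closed[OF hom balanced(1)])
  have "r *.[M] m = (r *[R] co m) *.[M] e"
   using M.smult_assoc1[OF balanced(1) co(1)[OF balanced(2)] e] co(2)[OF balanced(2)] by simp
  hence c: "co (r *.[M] m) = r *[R] co m" using balanced co(1)[OF balanced(2)] by (intro coI) simp_all
  have k: "keys (frag_of (r *.[M] m, n)) <= CC" "keys (frag_of (m, h r *.[N] n)) <= CC"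
   using balanced hr by simp_all
  have "E (frag_of (r *.[M] m, n)) = (h r *[S] h (co m)) *.[N] n"
   using Eof[of "(r *.[M] m, n)"] balanced c ring_hom_mult[OF hom balanced(1) co(1)[OF balanced(2)]] by simp
  moreover have "E (frag_of (m, h r *.[N] n)) = (h (co m) *[S] h r) *.[N] n"
   using Eof[of "(m, h r *.[N] n)"] balanced hr hco by (simp add: N.smult_assoc1)
  moreover have "(h r *[S] h (co m)) *.[N] n : carrier N" using hr hco balanced by simp
  ultimately have "E (frag_of (r *.[M] m, n) - frag_of (m, h r *.[N] n)) = 0[N]"
   using Ediff[OF k] hr hco[OF balanced(2)] by (simp add: N.R.m_comm N.minus_eq N.r_neg)
  thus ?case using kd[OF k] by blast
 qed
 note E0 = this
 have k: "keys (frag_of (e, n)) <= CC" "keys (frag_of (e, n')) <= CC" using e n by simp_all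
 have c1: "co e = 1[R]" using e by (intro coI) simp_all
 have "E (frag_of (e, n)) = n" "E (frag_of (e, n')) = n'"
  using Eof[of "(e, n)"] Eof[of "(e, n')"] e n c1 ring_hom_one[OF hom] by simp_all
 moreover have "E (frag_of (e, n) - frag_of (e, n')) = 0[N]" using E0[OF cl_eqD[OF eq k(1)]] by blast
 ultimately have "n \<ominus>\<^bsub>N\<^esub> n' = 0[N]" using Ediff[OF k] by simp
 hence "n \<ominus>\<^bsub>N\<^esub> n' +[N] n' = n'" using n by simp
 thus ?thesis using n by (simp add: N.minus_eq N.a_assoc N.l_neg)
qed

text \<open>Every class has the form e (x) n with the same \<open>e\<close>, and addition and
  scalars act on \<open>n\<close> alone. The axioms are therefore those of \<open>N\<close>.\<close>

lemma T_module: "module S T"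
proof -
 interpret N: module S N by (rule mN)
 have rep: "EX n. n : carrier N & A = cl (frag_of (e, n))" if "A : carrier T" for A using cl_surj[OF that] by (elim bexE) (intro exI conjI)
 show ?thesis
 proof (rule moduleI[OF N.R.is_cring T_abelian])
  fix a b A assume ab: "a : carrier S" "b : carrier S" "A : carrier T"
  obtain n where n: "n : carrier N" and A: "A = cl (frag_of (e, n))" using rep[OF ab(3)] by (elim exE conjE) (rule that)
  have s: "a *.[N] n : carrier N" "b *.[N] n : carrier N" using ab n by simp_all
  show "(a +[S] b) *.[T] A = a *.[T] A +[T] b *.[T] A"
   unfolding A cl_smult[OF ab(1) e n] cl_smult[OF ab(2) e n] cl_add[OF e s] cl_smult[OF N.R.add.m_closed[OF ab(1,2)] e n]
   by (simp only: N.smult_l_distr[OF ab(1,2) n])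
  show "a *[S] b *.[T] A = a *.[T] (b *.[T] A)"
   unfolding A cl_smult[OF ab(2) e n] cl_smult[OF ab(1) e s(2)] cl_smult[OF N.R.m_closed[OF ab(1,2)] e n]
   by (simp only: N.smult_assoc1[OF ab(1,2) n])
 next
  fix a A assume ab: "a : carrier S" "A : carrier T"
  obtain n where n: "n : carrier N" and A: "A = cl (frag_of (e, n))" using rep[OF ab(2)] by (elim exE conjE) (rule that)
  show "a *.[T] A : carrier T" unfolding A cl_smult[OF ab(1) e n] by (rule cl_of_in[OF e N.smult_closed[OF ab(1) n]])
 next
  fix A assume A: "A : carrier T"
  obtain n where n: "n : carrier N" and A: "A = cl (frag_of (e, n))" using rep[OF A] by (elim exE conjE) (rule that)
  show "1[S] *.[T] A = A" unfolding A cl_smult[OF N.R.one_closed e n] by (simp only: N.smult_one[OF n])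
 next
  fix a A B assume ab: "a : carrier S" "A : carrier T" "B : carrier T"
  obtain n where n: "n : carrier N" and A: "A = cl (frag_of (e, n))" using rep[OF ab(2)] by (elim exE conjE) (rule that)
  obtain n' where n': "n' : carrier N" and B: "B = cl (frag_of (e, n'))" using rep[OF ab(3)] by (elim exE conjE) (rule that)
  have s: "a *.[N] n : carrier N" "a *.[N] n' : carrier N" using ab n n' by simp_all
  show "a *.[T] (A +[T] B) = a *.[T] A +[T] a *.[T] B"
   unfolding A B cl_add[OF e n n'] cl_smult[OF ab(1) e n] cl_smult[OF ab(1) e n'] cl_add[OF e s] cl_smult[OF ab(1) e N.add.m_closed[OF n n']]
   by (simp only: N.smult_r_distr[OF ab(1) n n'])
 qed
qed

end

section \<open>Tensor products and pullbacks of line bundles\<close>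

lemma free_genD:
 assumes "free_gen X F U e"
 shows "opn X U" "e : Ms F U"
  "[|opn X W; W <= U; s : Ms F W|] ==> EX! a. a : Os X W & s = a *.[msec F W] mres F U W e"
 using assms unfolding free_gen_def by simp_all

lemma free_gen_coef:
 assumes "free_gen X F U e" "opn X W" "W <= U" "s : Ms F W"
 obtains a where "a : Os X W" "s = a *.[msec F W] mres F U W e"
 using free_genD(3)[OF assms] by (elim ex1E conjE) (rule that)

lemma free_gen_unique:
 assumes "free_gen X F U e" "opn X W" "W <= U" "a : Os X W" "b : Os X W"
  "a *.[msec F W] mres F U W e = b *.[msec F W] mres F U W e"
  "a *.[msec F W] mres F U W e : Ms F W"
 shows "a = b"
proof -
 from free_genD(3)[OF assms(1-3) assms(7)] obtain c where
  "!!y. y : Os X W & a *.[msec F W] mres F U W e = y *.[msec F W] mres F U W e ==> y = c"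
  by (elim ex1E) (rule that, blast)
 from this[of a] this[of b] show ?thesis using assms(4-6) by simp
qed

context modsheaf begin

lemma free_gen_res:
 assumes "free_gen X F U e" "opn X W" "W <= U"
 shows "free_gen X F W (mres F U W e)"
 unfolding free_gen_def
proof (intro conjI allI impI ballI)
 note U = free_genD[OF assms(1)]
 show "opn X W" by fact
 show "mres F U W e : Ms F W" by (rule res_closed[OF U(1) assms(2,3) U(2)])
 fix Z s assume "opn X Z & Z <= W" "s : Ms F Z"
 hence Z: "opn X Z" "Z <= W" "Z <= U" "s : Ms F Z" using assms(3) by auto
 show "EX! a. a : Os X Z & s = a *.[msec F Z] mres F W Z (mres F U W e)"
  unfolding res_res[OF U(1) assms(2) Z(1,2) assms(3) U(2)] by (rule U(3)[OF Z(1,3,4)])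
qed

text \<open>All germs involved are restricted to one neighbourhood inside \<open>U\<close>. There
  the coefficient of the generator exists and is unique, and taking germs gives both claims.\<close>

lemma free_gen_stalk:
 assumes g: "free_gen X F U e" and p: "p : U"
 shows "!!m. m : carrier (mstalk X F p) ==> EX a. a : carrier (ostalk X p) & m = a *.[mstalk X F p] mgerm X F p U e"
  and "!!a b. [|a : carrier (ostalk X p); b : carrier (ostalk X p);
   a *.[mstalk X F p] mgerm X F p U e = b *.[mstalk X F p] mgerm X F p U e|] ==> a = b"
proof -
 note U = free_genD(1,2)[OF g]
 fix m assume "m : carrier (mstalk X F p)"
 then obtain W s where W: "opn X W" "p : W" "s : Ms F W" "m = mgerm X F p W s" by (rule mstalkE)
 let ?Z = "U Int W"
 have Z: "opn X ?Z" "p : ?Z" "?Z <= U" "?Z <= W" using U W p by auto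
 obtain a where a: "a : Os X ?Z" "mres F W ?Z s = a *.[msec F ?Z] mres F U ?Z e"
  by (rule free_gen_coef[OF g Z(1,3) res_closed[OF W(1) Z(1,4) W(3)]])
 have "m = ogerm X p ?Z a *.[mstalk X F p] mgerm X F p ?Z (mres F U ?Z e)"
  using mstalk_smult[OF Z(1,2) a(1) res_closed[OF U(1) Z(1,3) U(2)]] mgerm_res[OF W(1) Z(1,4,2) W(3)] a(2) W(4) by simp
 hence "m = ogerm X p ?Z a *.[mstalk X F p] mgerm X F p U e" using mgerm_res[OF U(1) Z(1,3,2) U(2)] by simp
 thus "EX a. a : carrier (ostalk X p) & m = a *.[mstalk X F p] mgerm X F p U e"
  using ogerm_in[OF Z(1,2) a(1)] by blast
next
 note U = free_genD(1,2)[OF g]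
 fix a b assume ab: "a : carrier (ostalk X p)" "b : carrier (ostalk X p)"
  and eq: "a *.[mstalk X F p] mgerm X F p U e = b *.[mstalk X F p] mgerm X F p U e"
 obtain W s where W: "opn X W" "p : W" "s : Os X W" "a = ogerm X p W s" by (rule ostalkE[OF ab(1)])
 obtain Y t where Y: "opn X Y" "p : Y" "t : Os X Y" "b = ogerm X p Y t" by (rule ostalkE[OF ab(2)])
 let ?Z = "U Int (W Int Y)"
 have Z: "opn X ?Z" "p : ?Z" "?Z <= U" "?Z <= W" "?Z <= Y" using U W Y p by auto
 let ?s = "ores X W ?Z s" and ?t = "ores X Y ?Z t" and ?e = "mres F U ?Z e"
 have c: "?s : Os X ?Z" "?t : Os X ?Z" "?e : Ms F ?Z"
  by (rule ores_closed[OF W(1) Z(1,4) W(3)], rule ores_closed[OF Y(1) Z(1,5) Y(3)], rule res_closed[OF U(1) Z(1,3) U(2)])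
 have g1: "a = ogerm X p ?Z ?s" "b = ogerm X p ?Z ?t" "mgerm X F p U e = mgerm X F p ?Z ?e"
  using ogerm_res[OF W(1) Z(1,4,2) W(3)] ogerm_res[OF Y(1) Z(1,5,2) Y(3)] mgerm_res[OF U(1) Z(1,3,2) U(2)] W(4) Y(4) by simp_all
 have sm: "?s *.[msec F ?Z] ?e : Ms F ?Z" "?t *.[msec F ?Z] ?e : Ms F ?Z"
  using smult_closed[OF Z(1)] c by simp_all
 have "mgerm X F p ?Z (?s *.[msec F ?Z] ?e) = mgerm X F p ?Z (?t *.[msec F ?Z] ?e)"
  using eq unfolding g1 mstalk_smult[OF Z(1,2) c(1,3)] mstalk_smult[OF Z(1,2) c(2,3)] .
 then obtain Q where Q: "opn X Q" "p : Q" "Q <= ?Z" "mres F ?Z Q (?s *.[msec F ?Z] ?e) = mres F ?Z Q (?t *.[msec F ?Z] ?e)"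
  by (rule mgerm_eqD[OF _ Z(1,2) sm(2)])
 have QU: "Q <= U" using Q Z by auto
 have "ores X ?Z Q ?s *.[msec F Q] mres F U Q e = ores X ?Z Q ?t *.[msec F Q] mres F U Q e"
  using Q(4) res_smult[OF Z(1) Q(1,3) c(1,3)] res_smult[OF Z(1) Q(1,3) c(2,3)] res_res[OF U(1) Z(1) Q(1,3) Z(3) U(2)] by simp
 hence "ores X ?Z Q ?s = ores X ?Z Q ?t"
  by (rule free_gen_unique[OF g Q(1) QU ores_closed[OF Z(1) Q(1,3) c(1)] ores_closed[OF Z(1) Q(1,3) c(2)]])
   (rule smult_closed[OF Q(1) ores_closed[OF Z(1) Q(1,3) c(1)] res_closed[OF U(1) Q(1) QU U(2)]])
 thus "a = b" unfolding g1(1,2)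
  using ogerm_res[OF Z(1) Q(1,3,2) c(1)] ogerm_res[OF Z(1) Q(1,3,2) c(2)] by simp
qed

end

lemma is_sheafI:
 assumes "is_presheaf T S res"
  and "!!\<C> s. (!!U. U : \<C> ==> openin T U & s U : S U) ==>
   (!!U W. U : \<C> ==> W : \<C> ==> res U (U Int W) (s U) = res W (U Int W) (s W)) ==>
   EX! t. t : S (\<Union>\<C>) & (ALL U:\<C>. res (\<Union>\<C>) U t = s U)"
 shows "is_sheaf T S res"
 unfolding is_sheaf_def
proof (intro conjI allI impI)
 fix \<C> s assume "(ALL U:\<C>. openin T U & s U : S U) & (ALL U:\<C>. ALL W:\<C>. res U (U Int W) (s U) = res W (U Int W) (s W))"
 thus "EX! t. t : S (\<Union>\<C>) & (ALL U:\<C>. res (\<Union>\<C>) U t = s U)" by (intro assms(2)) auto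
qed (rule assms(1))

text \<open>A common generalisation of the tensor product (\<open>f = id\<close>) and of the pullback (\<open>G = \<O>\<close>):
  the sheaf \<open>f\<^sup>*F \<otimes> G\<close>.\<close>

definition gp_stalk ::
 "('q, 'b) rspace => ('p, 'a) rspace => ('q, 'b, 'p, 'a) rmor => ('p, 'a, 'm) msheaf => ('q, 'b, 'n) msheaf => 'q
  => (('q set \<times> 'b) set, (('p set \<times> 'm) set \<times> ('q set \<times> 'n) set \<Rightarrow>\<^sub>0 int) set) module"
 where "gp_stalk V X f F G q =
  tens_module (ostalk X (mpt f q)) (stalk_map V f q) (mstalk X F (mpt f q)) (mstalk V G q)"

text \<open>The value at \<open>q\<close> of the elementary tensor of \<open>u\<close> over
  \<open>U\<close> and \<open>v\<close> over \<open>W\<close>.\<close>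

definition gp_cls ::
 "('q, 'b) rspace => ('p, 'a) rspace => ('q, 'b, 'p, 'a) rmor => ('p, 'a, 'm) msheaf => ('q, 'b, 'n) msheaf
  => 'p set => 'm => 'q set => 'n => 'q => (('p set \<times> 'm) set \<times> ('q set \<times> 'n) set \<Rightarrow>\<^sub>0 int) set"
 where "gp_cls V X f F G U u W v q = tens_class (ostalk X (mpt f q)) (stalk_map V f q) (mstalk X F (mpt f q))
  (mstalk V G q) (frag_of (mgerm X F (mpt f q) U u, mgerm V G q W v))"

definition gp ::
 "('q, 'b) rspace => ('p, 'a) rspace => ('q, 'b, 'p, 'a) rmor => ('p, 'a, 'm) msheaf => ('q, 'b, 'n) msheaf
  => ('q, 'b, 'q => (('p set \<times> 'm) set \<times> ('q set \<times> 'n) set \<Rightarrow>\<^sub>0 int) set) msheaf"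
 where "gp V X f F G = etale_sheaf V (gp_stalk V X f F G)
  (%W. {(%q. finsum (gp_stalk V X f F G q) (%i. gp_cls V X f F G U (u i) W (v i) q) {..<l})
     | l U u v. opn X U & mpt f ` W <= U &
       u : {..<l::nat} \<rightarrow> Ms F U & v : {..<l} \<rightarrow> Ms G W})"

lemma pullback_eq_gp: "pullback V X f F = gp V X f F (osheaf V)"
 unfolding pullback_def gp_def pullback_stalk_def gp_stalk_def gp_cls_def mstalk_osheaf mgerm_osheaf osheaf_sel
 by simp

lemma etale_sel:
 "s : Ms (etale_sheaf X S loc) U \<longleftrightarrow> s : extensional U & (ALL p:U. EX W t. opn X W & p : W & W <= U & t : loc W & (ALL q:W. s q = t q))"
 "0[msec (etale_sheaf X S loc) U] = (\<lambda>p\<in>U. 0[S p])"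
 "s +[msec (etale_sheaf X S loc) U] t = (\<lambda>p\<in>U. s p +[S p] t p)"
 "a *.[msec (etale_sheaf X S loc) U] s = (\<lambda>p\<in>U. ogerm X p U a *.[S p] s p)"
 "mres (etale_sheaf X S loc) U W s = restrict s W"
 by (simp_all add: etale_sheaf_def)

lemma line_bundleD:
 assumes "line_bundle X F"
 shows "mod_sheaf X F" "p : pts X ==> EX U e. p : U & free_gen X F U e"
 using assms by (simp_all add: line_bundle_def)

section \<open>Local form of the sections of f^*F (x) G\<close>

locale gpl =
 fixes V :: "('q, 'b) rspace" and X :: "('p, 'a) rspace" and f :: "('q, 'b, 'p, 'a) rmor"
  and F :: "('p, 'a, 'm) msheaf" and G :: "('q, 'b, 'n) msheaf"
 assumes lV: "lrs V" and lX: "lrs X" and pf: "pre_hom V X f" and lbF: "line_bundle X F" and lbG: "line_bundle V G"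

sublocale gpl \<subseteq> F: modsheaf X F
 by unfold_locales (use lX line_bundleD(1)[OF lbF] in \<open>simp_all add: lrs_def\<close>)

sublocale gpl \<subseteq> G: modsheaf V G
 by unfold_locales (use lV line_bundleD(1)[OF lbG] in \<open>simp_all add: lrs_def\<close>)

sublocale gpl \<subseteq> pf: pmor V X f
 by unfold_locales (rule G.pre_ring_X, rule F.pre_ring_X, rule pf)

context gpl begin

abbreviation St where "St \<equiv> gp_stalk V X f F G"
abbreviation cls where "cls \<equiv> gp_cls V X f F G"

lemma fq: "q : pts V ==> mpt f q : pts X" by (rule pre_homD(2)[OF pf])

lemma crings: assumes "q : pts V" shows "cring (ostalk V q)" "cring (ostalk X (mpt f q))"
 using lV lX assms fq[OF assms] by (simp_all add: lrs_def local_ring_def)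

lemma tens_at: assumes "q : pts V"
 shows "tens (ostalk X (mpt f q)) (ostalk V q) (stalk_map V f q) (mstalk X F (mpt f q)) (mstalk V G q)"
 by (rule tens.intro[OF F.mstalk_module[OF fq[OF assms] crings(2)[OF assms]]
  G.mstalk_module[OF assms crings(1)[OF assms]] pf.stalk_map_hom[OF assms]])

lemma rank_at:
 assumes q: "q : pts V" and g: "free_gen X F U e" and U: "mpt f q : U"
 shows "rank_one (ostalk X (mpt f q)) (ostalk V q) (stalk_map V f q) (mstalk X F (mpt f q)) (mstalk V G q) (mgerm X F (mpt f q) U e)"
proof (intro rank_one.intro tens_at[OF q] rank_one_axioms.intro)
 show "mgerm X F (mpt f q) U e : carrier (mstalk X F (mpt f q))"
  by (rule F.mgerm_in[OF free_genD(1)[OF g] U free_genD(2)[OF g]])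
 fix m assume m: "m : carrier (mstalk X F (mpt f q))"
 show "EX! r. r : carrier (ostalk X (mpt f q)) & m = r *.[mstalk X F (mpt f q)] mgerm X F (mpt f q) U e"
 proof (rule ex_ex1I[OF F.free_gen_stalk(1)[OF g U m]])
  fix a b assume "a : carrier (ostalk X (mpt f q)) & m = a *.[mstalk X F (mpt f q)] mgerm X F (mpt f q) U e"
   "b : carrier (ostalk X (mpt f q)) & m = b *.[mstalk X F (mpt f q)] mgerm X F (mpt f q) U e"
  thus "a = b" by (intro F.free_gen_stalk(2)[OF g U]) simp_all
 qed
qed

lemma St_module: assumes "q : pts V" shows "module (ostalk V q) (St q)"
proof -
 obtain U e where "mpt f q : U" "free_gen X F U e" using line_bundleD(2)[OF lbF fq[OF assms]] by (elim exE conjE) (rule that)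
 from rank_one.T_module[OF rank_at[OF assms this(2,1)]] show ?thesis by (simp add: gp_stalk_def)
qed

lemma cls_in:
 assumes "opn V W" "q : W" "v : Ms G W" "opn X U" "mpt f q : U" "u : Ms F U"
 shows "cls U u W v q : carrier (St q)"
proof -
 have q: "q : pts V" using openin_subset[OF assms(1)] assms(2) by blast
 show ?thesis unfolding gp_cls_def gp_stalk_def
  by (rule tens.cl_of_in[OF tens_at[OF q] F.mgerm_in[OF assms(4-6)] G.mgerm_in[OF assms(1-3)]])
qed

lemma cls_ops:
 assumes W: "opn V W" "q : W" and U: "opn X U" "mpt f q : U" "u : Ms F U"
 shows cls_add: "[|v : Ms G W; w : Ms G W|] ==> cls U u W v q +[St q] cls U u W w q = cls U u W (v +[msec G W] w) q"
  and cls_smult: "[|v : Ms G W; a : Os V W|] ==> ogerm V q W a *.[St q] cls U u W v q = cls U u W (a *.[msec G W] v) q"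
  and cls_zero: "0[St q] = cls U u W 0[msec G W] q"
proof -
 have q: "q : pts V" using openin_subset[OF W(1)] W(2) by blast
 note t = tens_at[OF q] and u = F.mgerm_in[OF U] and v = G.mgerm_in[OF W]
 show "cls U u W v q +[St q] cls U u W w q = cls U u W (v +[msec G W] w) q" if "v : Ms G W" "w : Ms G W"
  unfolding gp_cls_def gp_stalk_def tens.cl_add[OF t u v[OF that(1)] v[OF that(2)]] G.mstalk_add[OF W that] by (rule refl)
 show "ogerm V q W a *.[St q] cls U u W v q = cls U u W (a *.[msec G W] v) q" if "v : Ms G W" "a : Os V W"
  unfolding gp_cls_def gp_stalk_def tens.cl_smult[OF t G.ogerm_in[OF W that(2)] u v[OF that(1)]] G.mstalk_smult[OF W that(2,1)] by (rule refl)
 show "0[St q] = cls U u W 0[msec G W] q"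
  unfolding gp_cls_def gp_stalk_def tens.cl_zero[OF t u] G.mstalk_zero[OF W] by (rule refl)
qed

lemma cls_res:
 assumes "opn V W" "opn V W'" "W' <= W" "q : W'" "v : Ms G W"
  "opn X U" "opn X U'" "U' <= U" "mpt f q : U'" "u : Ms F U"
 shows "cls U' (mres F U U' u) W' (mres G W W' v) q = cls U u W v q"
 unfolding gp_cls_def F.mgerm_res[OF assms(6-10)] G.mgerm_res[OF assms(1-5)] by (rule refl)

text \<open>A function on \<open>X\<close> moves from the first factor to the second, where it
  becomes its pullback along \<open>f\<close>. On stalks this is the balanced relation, with the
  stalk map computed on the germ of \<open>a\<close>.\<close>

lemma cls_balance:
 assumes W: "opn V W" "q : W" "W <= preim V f U" and v: "v : Ms G W"
  and U: "opn X U" and u: "u : Ms F U" and a: "a : Os X U"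
 shows "cls U (a *.[msec F U] u) W v q = cls U u W (ores V (preim V f U) W (mco f U a) *.[msec G W] v) q"
proof -
 have q: "q : pts V" and fU: "mpt f q : U" using W by (auto simp: preim_def)
 have pU: "opn V (preim V f U)" by (rule pre_homD(1)[OF pf U])
 have ma: "mco f U a : Os V (preim V f U)" by (rule ring_hom_closed[OF pre_homD(3)[OF pf U] a])
 have "stalk_map V f q (ogerm X (mpt f q) U a) = ogerm V q W (ores V (preim V f U) W (mco f U a))"
  unfolding pf.stalk_map_germ[OF q U fU a] by (rule G.ogerm_res[OF pU W(1,3,2) ma, symmetric])
 thus ?thesis
  unfolding gp_cls_def F.mstalk_smult[OF U fU a u, symmetric] G.mstalk_smult[OF W(1,2) G.ores_closed[OF pU W(1,3) ma] v, symmetric]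
  using tens.cl_balanced[OF tens_at[OF q] F.ogerm_in[OF U fU a] F.mgerm_in[OF U fU u] G.mgerm_in[OF W(1,2) v]] by simp
qed

text \<open>By definition a section is locally a finite sum of elementary tensors. Near a point
  \<open>F\<close> has a generator \<open>e\<close>, every left factor is a multiple of
  \<open>e\<close>, and its coefficient moves to the right factor. The sum thus collapses to one
  tensor e (x) g, and sections of the tensor product become sections of \<open>G\<close>.\<close>

lemma gp_section:
 assumes Z: "opn V Z"
 shows "s : Ms (gp V X f F G) Z \<longleftrightarrow> s : extensional Z & (ALL p:Z. EX W U e g. opn V W & p : W & W <= Z &
  free_gen X F U e & W <= preim V f U & g : Ms G W & (ALL q:W. s q = cls U e W g q))"
  (is "_ \<longleftrightarrow> _ & (ALL p:Z. ?P p)")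
proof -
 let ?loc = "%W. {(%q. finsum (St q) (%i. cls U (u i) W (v i) q) {..<l})
     | l U u v. opn X U & mpt f ` W <= U & u : {..<l::nat} \<rightarrow> Ms F U & v : {..<l} \<rightarrow> Ms G W}"
 have mono: "abelian_monoid (St q)" if "q : pts V" for q
  using module.axioms(2)[OF St_module[OF that]] by (rule abelian_group.axioms(1))
 have "?P p \<longleftrightarrow> (EX W t. opn V W & p : W & W <= Z & t : ?loc W & (ALL q:W. s q = t q))" if p: "p : Z" for p
 proof
  assume "?P p"
  then obtain W U e g where W: "opn V W" "p : W" "W <= Z" "free_gen X F U e" "W <= preim V f U" "g : Ms G W"
   and s: "ALL q:W. s q = cls U e W g q" by (elim exE conjE) (rule that)
  \<comment> \<open>A single tensor in the shape that the definition asks for: a sum of length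
    1.\<close>
  let ?t = "%q. finsum (St q) (%i::nat. cls U e W g q) {..<1}"
  have "s q = ?t q" if q: "q : W" for q
  proof -
   have qV: "q : pts V" "mpt f q : U" using q W(5) by (auto simp: preim_def)
   interpret abelian_monoid "St q" by (rule mono[OF qV(1)])
   have "cls U e W g q : carrier (St q)" by (rule cls_in[OF W(1) q W(6) free_genD(1)[OF W(4)] qV(2) free_genD(2)[OF W(4)]])
   hence "?t q = cls U e W g q" by (simp add: lessThan_Suc)
   thus ?thesis using bspec[OF s q] by simp
  qed
  moreover have "?t : ?loc W"
   using W(5,6) free_genD(1,2)[OF W(4)] unfolding mem_Collect_eq
   by (intro exI[of _ 1] exI[of _ U] exI[of _ "%i. e"] exI[of _ "%i. g"]) (auto simp: preim_def)
  ultimately show "EX W t. opn V W & p : W & W <= Z & t : ?loc W & (ALL q:W. s q = t q)"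
   using W(1-3) by (intro exI[of _ W] exI[of _ ?t] conjI ballI)
 next
  assume "EX W t. opn V W & p : W & W <= Z & t : ?loc W & (ALL q:W. s q = t q)"
  then obtain W t where W: "opn V W" "p : W" "W <= Z" "t : ?loc W" "ALL q:W. s q = t q" by (elim exE conjE) (rule that)
  obtain l :: nat and U u v where t: "t = (%q. finsum (St q) (%i. cls U (u i) W (v i) q) {..<l})"
   and U: "opn X U" "mpt f ` W <= U" "u : {..<l} \<rightarrow> Ms F U" "v : {..<l} \<rightarrow> Ms G W"
   using W(4) unfolding mem_Collect_eq by (elim exE conjE) (rule that)
  have pV: "p : pts V" using W openin_subset[OF W(1)] by blast
  obtain U0 e where e: "mpt f p : U0" "free_gen X F U0 e" using line_bundleD(2)[OF lbF fq[OF pV]] by (elim exE conjE) (rule that)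
  let ?U = "U0 Int U" and ?W = "W Int preim V f U0"
  note e0 = free_genD(1,2)[OF e(2)]
  have oU: "opn X ?U" "?U <= U0" "?U <= U" using e0 U by auto
  have oW: "opn V ?W" "p : ?W" "?W <= W" "?W <= Z" "?W <= preim V f ?U"
   using W pre_homD(1)[OF pf e0(1)] pV e(1) U(2) by (auto simp: preim_def)
  let ?e = "mres F U0 ?U e"
  have e1: "free_gen X F ?U ?e" by (rule F.free_gen_res[OF e(2) oU(1,2)])
  have qq: "q : pts V" "mpt f q : ?U" "q : W" if "q : ?W" for q using that oW(5) by (auto simp: preim_def)
  \<comment> \<open>The summand with left factor \<open>u i = a e\<close> becomes e (x) (a v_i),
    with \<open>a\<close> pulled back to \<open>V\<close>.\<close>
  have one: "EX g. g : Ms G ?W & (ALL q:?W. cls U (u i) W (v i) q = cls ?U ?e ?W g q)" if i: "i < l" for i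
  proof -
   have ui: "u i : Ms F U" "v i : Ms G W" using U(3,4) i by auto
   obtain a where a: "a : Os X ?U" "mres F U ?U (u i) = a *.[msec F ?U] mres F ?U ?U ?e"
    by (rule free_gen_coef[OF e1 oU(1) order_refl F.res_closed[OF U(1) oU(1,3) ui(1)]])
   have a2: "mres F U ?U (u i) = a *.[msec F ?U] ?e" using a(2) F.res_id[OF oU(1) free_genD(2)[OF e1]] by simp
   let ?v = "mres G W ?W (v i)"
   have v: "?v : Ms G ?W" by (rule G.res_closed[OF W(1) oW(1,3) ui(2)])
   have pU: "opn V (preim V f ?U)" by (rule pre_homD(1)[OF pf oU(1)])
   have ma: "ores V (preim V f ?U) ?W (mco f ?U a) : Os V ?W"
    by (rule G.ores_closed[OF pU oW(1,5) ring_hom_closed[OF pre_homD(3)[OF pf oU(1)] a(1)]])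
   have "cls U (u i) W (v i) q = cls ?U ?e ?W (ores V (preim V f ?U) ?W (mco f ?U a) *.[msec G ?W] ?v) q" if q: "q : ?W" for q
    using cls_res[OF W(1) oW(1,3) q ui(2) U(1) oU(1,3) qq(2)[OF q] ui(1)]
     cls_balance[OF oW(1) q oW(5) v oU(1) free_genD(2)[OF e1] a(1)] a2 by simp
   thus ?thesis using G.smult_closed[OF oW(1) ma v] by blast
  qed
  have "EX g. g : Ms G ?W & (ALL q:?W. finsum (St q) (%i. cls U (u i) W (v i) q) {..<k} = cls ?U ?e ?W g q)" if "k \<le> l" for k
   using that
  proof (induction k)
   case 0
   show ?case
   proof (intro exI[of _ "0[msec G ?W]"] conjI ballI G.zero_closed[OF oW(1)])
    fix q assume q: "q : ?W"
    interpret abelian_monoid "St q" by (rule mono[OF qq(1)[OF q]])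
    show "finsum (St q) (%i. cls U (u i) W (v i) q) {..<0} = cls ?U ?e ?W 0[msec G ?W] q"
     using cls_zero[OF oW(1) q oU(1) qq(2)[OF q] free_genD(2)[OF e1]] by simp
   qed
  next
   case (Suc k)
   obtain g where g: "g : Ms G ?W" "ALL q:?W. finsum (St q) (%i. cls U (u i) W (v i) q) {..<k} = cls ?U ?e ?W g q"
    using Suc by auto
   obtain g' where g': "g' : Ms G ?W" "ALL q:?W. cls U (u k) W (v k) q = cls ?U ?e ?W g' q"
    using one[of k] Suc by auto
   show ?case
   proof (intro exI[of _ "g' +[msec G ?W] g"] conjI ballI G.add_closed[OF oW(1) g'(1) g(1)])
    fix q assume q: "q : ?W"
    interpret abelian_monoid "St q" by (rule mono[OF qq(1)[OF q]])
    have c: "cls U (u i) W (v i) q : carrier (St q)" if "i < Suc k" for i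
    proof -
     have il: "i : {..<l}" using that Suc(2) by simp
     have "mpt f q : U" using qq(2)[OF q] by simp
     thus ?thesis by (rule cls_in[OF W(1) qq(3)[OF q] funcset_mem[OF U(4) il] U(1) _ funcset_mem[OF U(3) il]])
    qed
    have "finsum (St q) (%i. cls U (u i) W (v i) q) {..<Suc k}
      = cls U (u k) W (v k) q +[St q] finsum (St q) (%i. cls U (u i) W (v i) q) {..<k}"
     unfolding lessThan_Suc by (rule finsum_insert) (use c in auto)
    also have "... = cls ?U ?e ?W g' q +[St q] cls ?U ?e ?W g q" using bspec[OF g(2) q] bspec[OF g'(2) q] by simp
    also have "... = cls ?U ?e ?W (g' +[msec G ?W] g) q"
     by (rule cls_add[OF oW(1) q oU(1) qq(2)[OF q] free_genD(2)[OF e1] g'(1) g(1)])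
    finally show "finsum (St q) (%i. cls U (u i) W (v i) q) {..<Suc k} = cls ?U ?e ?W (g' +[msec G ?W] g) q" .
   qed
  qed
  from this[OF order_refl] obtain g where g: "g : Ms G ?W"
   "ALL q:?W. finsum (St q) (%i. cls U (u i) W (v i) q) {..<l} = cls ?U ?e ?W g q" by (elim exE conjE) (rule that)
  have "s q = cls ?U ?e ?W g q" if q: "q : ?W" for q
   using bspec[OF g(2) q] bspec[OF W(5) qq(3)[OF q]] t by simp
  thus "?P p" using oW e1 g(1)
   by (intro exI[of _ ?W] exI[of _ ?U] exI[of _ ?e] exI[of _ g] conjI ballI)
 qed
 thus ?thesis unfolding gp_def etale_sel(1) by (intro conj_cong refl ball_cong) simp
qed

text \<open>The generator in the local form may be prescribed. The one found before is a multiple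
  \<open>b\<close> of the prescribed one on the overlap, and \<open>b\<close> is absorbed into the
  second factor.\<close>

lemma gp_local:
 assumes Z: "opn V Z" and s: "s : Ms (gp V X f F G) Z" and p: "p : Z"
  and e: "free_gen X F U e" and pU: "mpt f p : U"
 shows "EX W g. opn V W & p : W & W <= Z & W <= preim V f U & g : Ms G W & (ALL q:W. s q = cls U e W g q)"
proof -
 obtain W U' e' g where W: "opn V W" "p : W" "W <= Z" "free_gen X F U' e'" "W <= preim V f U'" "g : Ms G W"
  "ALL q:W. s q = cls U' e' W g q"
  using bspec[OF conjunct2[OF s[unfolded gp_section[OF Z]]] p] by (elim exE conjE) (rule that)
 note e0 = free_genD(1,2)[OF e] and e0' = free_genD(1,2)[OF W(4)]
 let ?U = "U Int U'" and ?W = "W Int preim V f U"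
 have oU: "opn X ?U" "?U <= U" "?U <= U'" using e0 e0' by auto
 have oW: "opn V ?W" "p : ?W" "?W <= W" "?W <= Z" "?W <= preim V f ?U" "?W <= preim V f U"
  using W pre_homD(1)[OF pf e0(1)] pU by (auto simp: preim_def)
 have qq: "q : W" "mpt f q : ?U" "mpt f q : U" if "q : ?W" for q using that oW(5) by (auto simp: preim_def)
 obtain b where b: "b : Os X ?U" "mres F U' ?U e' = b *.[msec F ?U] mres F U ?U e"
  by (rule free_gen_coef[OF e oU(1,2) F.res_closed[OF e0'(1) oU(1,3) e0'(2)]])
 let ?g = "mres G W ?W g" and ?e = "mres F U ?U e"
 have g: "?g : Ms G ?W" by (rule G.res_closed[OF W(1) oW(1,3) W(6)])
 have ec: "?e : Ms F ?U" by (rule F.res_closed[OF e0(1) oU(1,2) e0(2)])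
 have pUo: "opn V (preim V f ?U)" by (rule pre_homD(1)[OF pf oU(1)])
 let ?h = "ores V (preim V f ?U) ?W (mco f ?U b) *.[msec G ?W] ?g"
 have h: "?h : Ms G ?W"
  by (rule G.smult_closed[OF oW(1) G.ores_closed[OF pUo oW(1,5) ring_hom_closed[OF pre_homD(3)[OF pf oU(1)] b(1)]] g])
 have "s q = cls U e ?W ?h q" if q: "q : ?W" for q
 proof -
  have "s q = cls U' e' W g q" by (rule bspec[OF W(7) qq(1)[OF q]])
  also have "... = cls ?U (b *.[msec F ?U] ?e) ?W ?g q"
   using cls_res[OF W(1) oW(1,3) q W(6) e0'(1) oU(1,3) qq(2)[OF q] e0'(2)] b(2) by simp
  also have "... = cls ?U ?e ?W ?h q" by (rule cls_balance[OF oW(1) q oW(5) g oU(1) ec b(1)])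
  also have "... = cls U e ?W ?h q"
   using cls_res[OF oW(1) oW(1) order_refl q h e0(1) oU(1,2) qq(2)[OF q] e0(2)] G.res_id[OF oW(1) h] by simp
  finally show ?thesis .
 qed
 thus ?thesis using oW h by (intro exI[of _ ?W] exI[of _ ?h] conjI ballI)
qed

lemma gp_sectionI:
 assumes "opn V Z" "s : extensional Z"
  and "!!p. p : Z ==> EX W U e g. opn V W & p : W & W <= Z & free_gen X F U e & W <= preim V f U & g : Ms G W & (ALL q:W. s q = cls U e W g q)"
 shows "s : Ms (gp V X f F G) Z"
 unfolding gp_section[OF assms(1)] using assms(2,3) by (intro conjI ballI)

lemma gp_value:
 assumes Z: "opn V Z" and s: "s : Ms (gp V X f F G) Z" and p: "p : Z"
 shows "s p : carrier (St p)"
proof -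
 have pV: "p : pts V" using Z p openin_subset by blast
 obtain U e where e: "mpt f p : U" "free_gen X F U e" using line_bundleD(2)[OF lbF fq[OF pV]] by (elim exE conjE) (rule that)
 obtain W g where W: "opn V W" "p : W" "g : Ms G W" "ALL q:W. s q = cls U e W g q"
  using gp_local[OF Z s p e(2,1)] by (elim exE conjE) (rule that)
 show ?thesis using bspec[OF W(4,2)] cls_in[OF W(1-3) free_genD(1)[OF e(2)] e(1) free_genD(2)[OF e(2)]] by simp
qed

text \<open>Two sections are written with the same generator over the same neighbourhood. Operations
  on them then take place in \<open>G\<close> alone.\<close>

lemma gp_common:
 assumes Z: "opn V Z" and s: "s : Ms (gp V X f F G) Z" "t : Ms (gp V X f F G) Z" and p: "p : Z"
 obtains W U e g h where "opn V W" "p : W" "W <= Z" "free_gen X F U e" "W <= preim V f U" "g : Ms G W" "h : Ms G W"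
  "ALL q:W. s q = cls U e W g q" "ALL q:W. t q = cls U e W h q"
proof -
 have pV: "p : pts V" using Z p openin_subset by blast
 obtain U e where e: "mpt f p : U" "free_gen X F U e" using line_bundleD(2)[OF lbF fq[OF pV]] by (elim exE conjE) (rule that)
 obtain W g where W: "opn V W" "p : W" "W <= Z" "W <= preim V f U" "g : Ms G W" "ALL q:W. s q = cls U e W g q"
  using gp_local[OF Z s(1) p e(2,1)] by (elim exE conjE) (rule that)
 obtain Y h where Y: "opn V Y" "p : Y" "h : Ms G Y" "ALL q:Y. t q = cls U e Y h q"
  using gp_local[OF Z s(2) p e(2,1)] by (elim exE conjE) (rule that)
 let ?I = "W Int Y"
 have I: "opn V ?I" "p : ?I" "?I <= Z" "?I <= W" "?I <= Y" "?I <= preim V f U" using W Y by auto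
 note e0 = free_genD(1,2)[OF e(2)]
 have 1: "ALL q:?I. s q = cls U e ?I (mres G W ?I g) q"
 proof
  fix q assume q: "q : ?I"
  have fU: "mpt f q : U" using q I(6) by (auto simp: preim_def)
  show "s q = cls U e ?I (mres G W ?I g) q"
   using cls_res[OF W(1) I(1,4) q W(5) e0(1) e0(1) order_refl fU e0(2)] F.res_id[OF e0] bspec[OF W(6)] q by simp
 qed
 have 2: "ALL q:?I. t q = cls U e ?I (mres G Y ?I h) q"
 proof
  fix q assume q: "q : ?I"
  have fU: "mpt f q : U" using q I(6) by (auto simp: preim_def)
  show "t q = cls U e ?I (mres G Y ?I h) q"
   using cls_res[OF Y(1) I(1,5) q Y(3) e0(1) e0(1) order_refl fU e0(2)] F.res_id[OF e0] bspec[OF Y(4)] q by simp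
 qed
 show ?thesis by (rule that[OF I(1-3) e(2) I(6) G.res_closed[OF W(1) I(1,4) W(5)] G.res_closed[OF Y(1) I(1,5) Y(3)] 1 2])
qed

lemma gp_sel:
 "0[msec (gp V X f F G) U] = (\<lambda>p\<in>U. 0[St p])"
 "s +[msec (gp V X f F G) U] t = (\<lambda>p\<in>U. s p +[St p] t p)"
 "a *.[msec (gp V X f F G) U] s = (\<lambda>p\<in>U. ogerm V p U a *.[St p] s p)"
 "mres (gp V X f F G) U W s = restrict s W"
 by (simp_all add: gp_def etale_sel)

lemma gp_ext: "opn V Z ==> s : Ms (gp V X f F G) Z ==> s : extensional Z"
 using gp_section by blast

section \<open>The module and sheaf axioms for f^*F (x) G\<close>

lemma gp_add_closed:
 assumes Z: "opn V Z" and s: "s : Ms (gp V X f F G) Z" "t : Ms (gp V X f F G) Z"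
 shows "s +[msec (gp V X f F G) Z] t : Ms (gp V X f F G) Z"
proof (rule gp_sectionI[OF Z])
 fix p assume p: "p : Z"
 obtain W U e g h where W: "opn V W" "p : W" "W <= Z" "free_gen X F U e" "W <= preim V f U" "g : Ms G W" "h : Ms G W"
  "ALL q:W. s q = cls U e W g q" "ALL q:W. t q = cls U e W h q" by (rule gp_common[OF Z s p])
 have "ALL q:W. (s +[msec (gp V X f F G) Z] t) q = cls U e W (g +[msec G W] h) q"
 proof
  fix q assume q: "q : W"
  have fU: "mpt f q : U" "q : Z" using q W(3,5) by (auto simp: preim_def)
  show "(s +[msec (gp V X f F G) Z] t) q = cls U e W (g +[msec G W] h) q"
   using cls_add[OF W(1) q free_genD(1)[OF W(4)] fU(1) free_genD(2)[OF W(4)] W(6,7)] bspec[OF W(8) q] bspec[OF W(9) q] fU(2)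
   by (simp add: gp_sel)
 qed
 thus "EX W U e g. opn V W & p : W & W <= Z & free_gen X F U e & W <= preim V f U & g : Ms G W &
   (ALL q:W. (s +[msec (gp V X f F G) Z] t) q = cls U e W g q)"
  using W(1-5) G.add_closed[OF W(1,6,7)] by (intro exI[of _ W] exI[of _ U] exI[of _ e] exI[of _ "g +[msec G W] h"] conjI)
qed (simp add: gp_sel)

lemma gp_smult_closed:
 assumes Z: "opn V Z" and s: "s : Ms (gp V X f F G) Z" and a: "a : Os V Z"
 shows "a *.[msec (gp V X f F G) Z] s : Ms (gp V X f F G) Z"
proof (rule gp_sectionI[OF Z])
 fix p assume p: "p : Z"
 obtain W U e g h where W: "opn V W" "p : W" "W <= Z" "free_gen X F U e" "W <= preim V f U" "g : Ms G W" "h : Ms G W"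
  "ALL q:W. s q = cls U e W g q" "ALL q:W. s q = cls U e W h q" by (rule gp_common[OF Z s s p])
 let ?a = "ores V Z W a"
 have aW: "?a : Os V W" by (rule G.ores_closed[OF Z W(1,3) a])
 have "ALL q:W. (a *.[msec (gp V X f F G) Z] s) q = cls U e W (?a *.[msec G W] g) q"
 proof
  fix q assume q: "q : W"
  have fU: "mpt f q : U" "q : Z" using q W(3,5) by (auto simp: preim_def)
  show "(a *.[msec (gp V X f F G) Z] s) q = cls U e W (?a *.[msec G W] g) q"
   using cls_smult[OF W(1) q free_genD(1)[OF W(4)] fU(1) free_genD(2)[OF W(4)] W(6) aW] bspec[OF W(8) q] fU(2)
    G.ogerm_res[OF Z W(1,3) q a] by (simp add: gp_sel)
 qed
 thus "EX W U e g. opn V W & p : W & W <= Z & free_gen X F U e & W <= preim V f U & g : Ms G W &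
   (ALL q:W. (a *.[msec (gp V X f F G) Z] s) q = cls U e W g q)"
  using W(1-5) G.smult_closed[OF W(1) aW W(6)] by (intro exI[of _ W] exI[of _ U] exI[of _ e] exI[of _ "?a *.[msec G W] g"] conjI)
qed (simp add: gp_sel)

lemma psec_in:
 assumes W: "opn V W" "W <= preim V f U" and e: "free_gen X F U e" and g: "g : Ms G W"
 shows "(\<lambda>q\<in>W. cls U e W g q) : Ms (gp V X f F G) W"
proof (rule gp_sectionI[OF W(1)])
 fix p assume "p : W"
 thus "EX Z U' e' g'. opn V Z & p : Z & Z <= W & free_gen X F U' e' & Z <= preim V f U' & g' : Ms G Z &
   (ALL q:Z. (\<lambda>q\<in>W. cls U e W g q) q = cls U' e' Z g' q)"
  using W e g by (intro exI[of _ W] exI[of _ U] exI[of _ e] exI[of _ g] conjI) simp_all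
qed simp

lemma gp_zero_closed:
 assumes Z: "opn V Z" shows "0[msec (gp V X f F G) Z] : Ms (gp V X f F G) Z"
proof (rule gp_sectionI[OF Z])
 fix p assume p: "p : Z"
 hence pV: "p : pts V" using Z openin_subset by blast
 obtain U e where e: "mpt f p : U" "free_gen X F U e" using line_bundleD(2)[OF lbF fq[OF pV]] by (elim exE conjE) (rule that)
 note e0 = free_genD(1,2)[OF e(2)]
 let ?W = "Z Int preim V f U"
 have W: "opn V ?W" "p : ?W" "?W <= Z" "?W <= preim V f U" using Z p pre_homD(1)[OF pf e0(1)] pV e(1) by (auto simp: preim_def)
 have "ALL q:?W. 0[msec (gp V X f F G) Z] q = cls U e ?W 0[msec G ?W] q"
 proof
  fix q assume q: "q : ?W"
  hence fU: "mpt f q : U" "q : Z" by (auto simp: preim_def)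
  show "0[msec (gp V X f F G) Z] q = cls U e ?W 0[msec G ?W] q"
   using cls_zero[OF W(1) q e0(1) fU(1) e0(2)] fU(2) by (simp add: gp_sel)
 qed
 thus "EX W U e g. opn V W & p : W & W <= Z & free_gen X F U e & W <= preim V f U & g : Ms G W &
   (ALL q:W. 0[msec (gp V X f F G) Z] q = cls U e W g q)"
  using W e(2) G.zero_closed[OF W(1)] by (intro exI[of _ ?W] exI[of _ U] exI[of _ e] exI[of _ "0[msec G ?W]"] conjI)
qed (simp add: gp_sel)

lemma gp_module: assumes Z: "opn V Z" shows "module (osec V Z) (msec (gp V X f F G) Z)"
proof -
 let ?M = "msec (gp V X f F G) Z"
 interpret OZ: cring "osec V Z" by (rule G.cr[OF Z])
 have pV: "p : pts V" if "p : Z" for p using Z that openin_subset by blast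
 have val: "s p : carrier (St p)" if "s : carrier ?M" "p : Z" for s p by (rule gp_value[OF Z that])
 have og: "ogerm V p Z a : carrier (ostalk V p)" if "a : Os V Z" "p : Z" for a p by (rule G.ogerm_in[OF Z that(2,1)])
 have ext: "s : extensional Z" if "s : carrier ?M" for s by (rule gp_ext[OF Z that])
 have eqI: "s = t" if "s : extensional Z" "t : extensional Z" "!!p. p : Z ==> s p = t p" for s t
  by (rule extensionalityI[OF that])
 note ops = ostalk_ops[OF G.pre_ring_X Z] and one = ostalk_one[OF G.pre_ring_X Z]
 have smd: "module (ostalk V p) (St p)" if "p : Z" for p by (rule St_module[OF pV[OF that]])
 show ?thesis
 proof (rule moduleI[OF OZ.is_cring])
  show "abelian_group ?M"
  proof (rule abelian_groupI)
   show "0[?M] : carrier ?M" by (rule gp_zero_closed[OF Z])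
   show "x +[?M] y : carrier ?M" if "x : carrier ?M" "y : carrier ?M" for x y by (rule gp_add_closed[OF Z that])
   show "x +[?M] y +[?M] z = x +[?M] (y +[?M] z)" if "x : carrier ?M" "y : carrier ?M" "z : carrier ?M" for x y z
   proof (rule eqI)
    fix p assume p: "p : Z"
    interpret module "ostalk V p" "St p" by (rule smd[OF p])
    show "(x +[?M] y +[?M] z) p = (x +[?M] (y +[?M] z)) p"
     using val[OF that(1) p] val[OF that(2) p] val[OF that(3) p] p by (simp add: gp_sel M.a_assoc)
   qed (simp_all add: gp_sel)
   show "x +[?M] y = y +[?M] x" if "x : carrier ?M" "y : carrier ?M" for x y
   proof (rule eqI)
    fix p assume p: "p : Z"
    interpret module "ostalk V p" "St p" by (rule smd[OF p])
    show "(x +[?M] y) p = (y +[?M] x) p"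
     using val[OF that(1) p] val[OF that(2) p] p by (simp add: gp_sel M.a_comm)
   qed (simp_all add: gp_sel)
   fix x assume x: "x : carrier ?M"
   show "0[?M] +[?M] x = x"
   proof (rule eqI)
    fix p assume p: "p : Z"
    interpret module "ostalk V p" "St p" by (rule smd[OF p])
    show "(0[?M] +[?M] x) p = x p" using val[OF x p] p by (simp add: gp_sel)
   qed (simp_all add: gp_sel ext[OF x])
   \<comment> \<open>The negative of \<open>x\<close> is taken as -1 times \<open>x\<close>, because
     closure under scalars is already known. That it cancels \<open>x\<close> is checked in the
     stalks.\<close>
   let ?y = "(\<ominus>\<^bsub>osec V Z\<^esub> 1[osec V Z]) *.[?M] x"
   have "?y +[?M] x = 0[?M]"
   proof (rule eqI)
    fix p assume p: "p : Z"
    interpret module "ostalk V p" "St p" by (rule smd[OF p])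
    note v = val[OF x p]
    have "ogerm V p Z (\<ominus>\<^bsub>osec V Z\<^esub> 1[osec V Z]) *.[St p] x p +[St p] x p
      = (ogerm V p Z (\<ominus>\<^bsub>osec V Z\<^esub> 1[osec V Z]) +[ostalk V p] 1[ostalk V p]) *.[St p] x p"
     using v og[of "\<ominus>\<^bsub>osec V Z\<^esub> 1[osec V Z]", OF _ p] by (simp add: smult_l_distr)
    also have "ogerm V p Z (\<ominus>\<^bsub>osec V Z\<^esub> 1[osec V Z]) +[ostalk V p] 1[ostalk V p] = ogerm V p Z 0[osec V Z]"
     unfolding one[OF p] using ops(1)[OF p, of "\<ominus>\<^bsub>osec V Z\<^esub> 1[osec V Z]" "1[osec V Z]"] by (simp add: OZ.l_neg)
    also have "ogerm V p Z 0[osec V Z] = 0[ostalk V p]"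
     using premod.mstalk_zero[OF premod_osheaf[OF G.pre_ring_X] Z p] by (simp add: mstalk_osheaf mgerm_osheaf)
    finally show "(?y +[?M] x) p = 0[?M] p" using p v by (simp add: gp_sel)
   qed (simp_all add: gp_sel)
   moreover have "?y : carrier ?M" by (rule gp_smult_closed[OF Z x]) simp
   ultimately show "EX y:carrier ?M. y +[?M] x = 0[?M]" by (rule bexI)
  qed
 next
  show "a *.[?M] x : carrier ?M" if "a : Os V Z" "x : carrier ?M" for a x by (rule gp_smult_closed[OF Z that(2,1)])
 next
  fix a b x assume abx: "a : Os V Z" "b : Os V Z" "x : carrier ?M"
  show "(a +[osec V Z] b) *.[?M] x = a *.[?M] x +[?M] b *.[?M] x"
  proof (rule eqI)
   fix p assume p: "p : Z"
   interpret module "ostalk V p" "St p" by (rule smd[OF p])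
   show "((a +[osec V Z] b) *.[?M] x) p = (a *.[?M] x +[?M] b *.[?M] x) p"
    using val[OF abx(3) p] og[OF abx(1) p] og[OF abx(2) p] p ops(1)[OF p abx(1,2), symmetric] by (simp add: gp_sel smult_l_distr)
  qed (simp_all add: gp_sel)
  show "(a *[osec V Z] b) *.[?M] x = a *.[?M] (b *.[?M] x)"
  proof (rule eqI)
   fix p assume p: "p : Z"
   interpret module "ostalk V p" "St p" by (rule smd[OF p])
   show "((a *[osec V Z] b) *.[?M] x) p = (a *.[?M] (b *.[?M] x)) p"
    using val[OF abx(3) p] og[OF abx(1) p] og[OF abx(2) p] p ops(2)[OF p abx(1,2), symmetric] by (simp add: gp_sel smult_assoc1)
  qed (simp_all add: gp_sel)
 next
  fix a x y assume abx: "a : Os V Z" "x : carrier ?M" "y : carrier ?M"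
  show "a *.[?M] (x +[?M] y) = a *.[?M] x +[?M] a *.[?M] y"
  proof (rule eqI)
   fix p assume p: "p : Z"
   interpret module "ostalk V p" "St p" by (rule smd[OF p])
   show "(a *.[?M] (x +[?M] y)) p = (a *.[?M] x +[?M] a *.[?M] y) p"
    using val[OF abx(2) p] val[OF abx(3) p] og[OF abx(1) p] p by (simp add: gp_sel smult_r_distr)
  qed (simp_all add: gp_sel)
 next
  fix x assume x: "x : carrier ?M"
  show "1[osec V Z] *.[?M] x = x"
  proof (rule eqI)
   fix p assume p: "p : Z"
   interpret module "ostalk V p" "St p" by (rule smd[OF p])
   show "(1[osec V Z] *.[?M] x) p = x p" using val[OF x p] p one[OF p, symmetric] by (simp add: gp_sel)
  qed (simp_all add: gp_sel ext[OF x])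
 qed
qed

lemma gp_res_closed:
 assumes UW: "opn V U" "opn V W" "W <= U" and s: "s : Ms (gp V X f F G) U"
 shows "restrict s W : Ms (gp V X f F G) W"
proof (rule gp_sectionI[OF UW(2)])
 fix p assume p: "p : W"
 hence pU: "p : U" using UW by auto
 obtain Y A e g h where Y: "opn V Y" "p : Y" "Y <= U" "free_gen X F A e" "Y <= preim V f A" "g : Ms G Y" "h : Ms G Y"
  "ALL q:Y. s q = cls A e Y g q" "ALL q:Y. s q = cls A e Y h q" by (rule gp_common[OF UW(1) s s pU])
 let ?I = "Y Int W"
 have I: "opn V ?I" "p : ?I" "?I <= W" "?I <= Y" "?I <= preim V f A" using Y UW p by auto
 note e0 = free_genD(1,2)[OF Y(4)]
 have "ALL q:?I. restrict s W q = cls A e ?I (mres G Y ?I g) q"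
 proof
  fix q assume q: "q : ?I"
  have fU: "mpt f q : A" using q I(5) by (auto simp: preim_def)
  show "restrict s W q = cls A e ?I (mres G Y ?I g) q"
   using cls_res[OF Y(1) I(1,4) q Y(6) e0(1) e0(1) order_refl fU e0(2)] F.res_id[OF e0] bspec[OF Y(8)] q by simp
 qed
 thus "EX Z U e g. opn V Z & p : Z & Z <= W & free_gen X F U e & Z <= preim V f U & g : Ms G Z &
   (ALL q:Z. restrict s W q = cls U e Z g q)"
  using I Y(4) G.res_closed[OF Y(1) I(1,4) Y(6)] by (intro exI[of _ ?I] exI[of _ A] exI[of _ e] exI[of _ "mres G Y ?I g"] conjI)
qed simp

lemma gp_mod_sheaf: "mod_sheaf V (gp V X f F G)"
proof -
 let ?P = "gp V X f F G"
 have pre: "is_presheaf (tp V) (%U. Ms ?P U) (mres ?P)"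
  unfolding is_presheaf_def gp_sel(4)
 proof (intro conjI allI impI ballI)
  fix U W assume "opn V U & opn V W & W <= U"
  thus "(%s. restrict s W) : Ms ?P U \<rightarrow> Ms ?P W" using gp_res_closed[of U W] by (simp add: Pi_iff)
 next
  fix U s assume "opn V U" "s : Ms ?P U"
  thus "restrict s U = s" using gp_ext by (simp add: extensional_restrict)
 next
  fix U W Z s assume "opn V U & opn V W & opn V Z & Z <= W & W <= U"
  thus "restrict (restrict s W) Z = restrict s Z" by (simp add: Int_absorb1)
 qed
 have sh: "is_sheaf (tp V) (%U. Ms ?P U) (mres ?P)"
 proof (rule is_sheafI[OF pre])
  fix \<C> s assume C: "!!U. U : \<C> ==> opn V U & s U : Ms ?P U"
   and eq: "!!U W. U : \<C> ==> W : \<C> ==> mres ?P U (U Int W) (s U) = mres ?P W (U Int W) (s W)"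
  have o: "opn V (\<Union>\<C>)" using C by blast
  \<comment> \<open>Sections are functions on points, so gluing is gluing of functions: at
    \<open>p\<close> any member of the cover that contains \<open>p\<close> may be used, and
    compatibility makes the choice irrelevant.\<close>
  define t where "t = (\<lambda>p\<in>\<Union>\<C>. s (SOME U. U : \<C> & p : U) p)"
  have tv: "t p = s U p" if "U : \<C>" "p : U" for U p
  proof -
   let ?W = "SOME U. U : \<C> & p : U"
   have W: "?W : \<C>" "p : ?W" using someI[of "%U. U : \<C> & p : U" U] that by auto
   from fun_cong[OF eq[OF that(1) W(1)], of p] have "s U p = s ?W p" using that(2) W(2) by (simp add: gp_sel(4))
   thus ?thesis using that by (auto simp: t_def)
  qed
  have tin: "t : Ms ?P (\<Union>\<C>)"
  proof (rule gp_sectionI[OF o])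
   fix p assume "p : \<Union>\<C>"
   then obtain U where U: "U : \<C>" "p : U" by blast
   obtain W A e g h where W: "opn V W" "p : W" "W <= U" "free_gen X F A e" "W <= preim V f A" "g : Ms G W" "h : Ms G W"
    "ALL q:W. s U q = cls A e W g q" "ALL q:W. s U q = cls A e W h q"
    by (rule gp_common[OF conjunct1[OF C[OF U(1)]] conjunct2[OF C[OF U(1)]] conjunct2[OF C[OF U(1)]] U(2)])
   have "ALL q:W. t q = cls A e W g q" using W(3,8) tv[OF U(1)] by (simp add: subset_iff)
   moreover have "W <= \<Union>\<C>" using W(3) U(1) by blast
   ultimately show "EX W U e g. opn V W & p : W & W <= \<Union>\<C> & free_gen X F U e & W <= preim V f U & g : Ms G W & (ALL q:W. t q = cls U e W g q)"
    using W(1,2,4,5,6) by (intro exI[of _ W] exI[of _ A] exI[of _ e] exI[of _ g] conjI)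
  qed (simp add: t_def)
  have tr: "mres ?P (\<Union>\<C>) U t = s U" if U: "U : \<C>" for U
   unfolding gp_sel(4)
  proof (rule extensionalityI[OF restrict_extensional gp_ext[OF conjunct1[OF C[OF U]] conjunct2[OF C[OF U]]]])
   fix p assume "p : U" thus "restrict t U p = s U p" using tv[OF U] by simp
  qed
  show "EX! t. t : Ms ?P (\<Union>\<C>) & (ALL U:\<C>. mres ?P (\<Union>\<C>) U t = s U)"
  proof (rule ex1I[of _ t])
   show "t : Ms ?P (\<Union>\<C>) & (ALL U:\<C>. mres ?P (\<Union>\<C>) U t = s U)" using tin tr by (intro conjI ballI)
   fix r assume r: "r : Ms ?P (\<Union>\<C>) & (ALL U:\<C>. mres ?P (\<Union>\<C>) U r = s U)"
   show "r = t"
   proof (rule extensionalityI[OF gp_ext[OF o conjunct1[OF r]] gp_ext[OF o tin]])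
    fix p assume "p : \<Union>\<C>"
    then obtain U where U: "U : \<C>" "p : U" by blast
    from fun_cong[OF bspec[OF conjunct2[OF r] U(1)], of p] show "r p = t p"
     using U(2) tv[OF U] by (simp add: gp_sel(4))
   qed
  qed
 qed
 show ?thesis
  unfolding mod_sheaf_def
 proof (intro conjI allI impI ballI sh gp_module)
  fix U W s t assume UW: "opn V U & opn V W & W <= U"
  hence sub: "!!x. x : W ==> x : U" by auto
  show "mres ?P U W (s +[msec ?P U] t) = mres ?P U W s +[msec ?P W] mres ?P U W t"
   unfolding gp_sel by (rule ext) (simp add: restrict_def sub)
  fix a assume a: "a : Os V U"
  have "ogerm V p W (ores V U W a) = ogerm V p U a" if "p : W" for p using G.ogerm_res[OF _ _ _ that a] UW by simp
  thus "mres ?P U W (a *.[msec ?P U] s) = ores V U W a *.[msec ?P W] mres ?P U W s"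
   unfolding gp_sel by (intro ext) (simp add: restrict_def sub)
 qed
qed

section \<open>Elementary tensors and local generators\<close>

lemma psec_smult:
 assumes W: "opn V W" "W <= preim V f U" and e: "free_gen X F U e" and g: "g : Ms G W" and a: "a : Os V W"
 shows "(\<lambda>q\<in>W. cls U e W (a *.[msec G W] g) q) = a *.[msec (gp V X f F G) W] (\<lambda>q\<in>W. cls U e W g q)"
proof (rule ext)
 fix q
 have "cls U e W (a *.[msec G W] g) q = ogerm V q W a *.[St q] cls U e W g q" if q: "q : W"
 proof -
  have "mpt f q : U" using W(2) q by (auto simp: preim_def)
  from cls_smult[OF W(1) q free_genD(1)[OF e] this free_genD(2)[OF e] g a] show ?thesis by simp
 qed
 thus "(\<lambda>q\<in>W. cls U e W (a *.[msec G W] g) q) q = (a *.[msec (gp V X f F G) W] (\<lambda>q\<in>W. cls U e W g q)) q"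
  by (simp add: gp_sel)
qed

lemma psec_res:
 assumes W: "opn V W" "opn V W'" "W' <= W" "W' <= preim V f U'" and g: "g : Ms G W"
  and U: "opn X U" "opn X U'" "U' <= U" and u: "u : Ms F U"
 shows "mres (gp V X f F G) W W' (\<lambda>q\<in>W. cls U u W g q) = (\<lambda>q\<in>W'. cls U' (mres F U U' u) W' (mres G W W' g) q)"
proof (rule ext)
 fix q
 have "cls U u W g q = cls U' (mres F U U' u) W' (mres G W W' g) q" if q: "q : W'"
 proof -
  have "mpt f q : U'" using W(4) q by (auto simp: preim_def)
  from cls_res[OF W(1-3) q g U this u] show ?thesis by simp
 qed
 thus "mres (gp V X f F G) W W' (\<lambda>q\<in>W. cls U u W g q) q = (\<lambda>q\<in>W'. cls U' (mres F U U' u) W' (mres G W W' g) q) q"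
  using W(3) by (auto simp: gp_sel restrict_def)
qed

lemma psec_balance:
 assumes W: "opn V W" "W <= preim V f U" and v: "v : Ms G W"
  and U: "opn X U" and u: "u : Ms F U" and a: "a : Os X U"
 shows "(\<lambda>q\<in>W. cls U (a *.[msec F U] u) W v q) = (\<lambda>q\<in>W. cls U u W (ores V (preim V f U) W (mco f U a) *.[msec G W] v) q)"
proof (rule ext)
 fix q
 show "(\<lambda>q\<in>W. cls U (a *.[msec F U] u) W v q) q = (\<lambda>q\<in>W. cls U u W (ores V (preim V f U) W (mco f U a) *.[msec G W] v) q) q"
  using cls_balance[OF W(1) _ W(2) v U u a, of q] by simp
qed

text \<open>Locally a section is e (x) v with v a multiple of g, which provides local coefficients.
  Uniqueness holds in every stalk, since n -> e (x) n is injective and the germ of g is a free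
  generator. Hence the local coefficients agree on overlaps and glue.\<close>

lemma psec_free_gen:
 assumes W: "opn V W" "W <= preim V f U" and e: "free_gen X F U e" and g: "free_gen V G W g"
 shows "free_gen V (gp V X f F G) W (\<lambda>q\<in>W. cls U e W g q)"
proof -
 let ?P = "gp V X f F G" and ?E = "\<lambda>q\<in>W. cls U e W g q"
 note e0 = free_genD(1,2)[OF e] and g0 = free_genD(1,2)[OF g]
 have fU: "mpt f q : U" "q : pts V" if "q : W" for q using that W(2) by (auto simp: preim_def)
 \<comment> \<open>Scalars can be cancelled against the germ of e (x) g, first by injectivity of n
   -> e (x) n and then by freeness of \<open>g\<close>.\<close>
 have cancel: "A = B" if q: "q : W" and AB: "A : carrier (ostalk V q)" "B : carrier (ostalk V q)"
  and eq: "A *.[St q] cls U e W g q = B *.[St q] cls U e W g q" for q A B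
 proof -
  note r = rank_at[OF fU(2)[OF q] e fU(1)[OF q]] and t = tens_at[OF fU(2)[OF q]]
  have eg: "mgerm X F (mpt f q) U e : carrier (mstalk X F (mpt f q))" by (rule F.mgerm_in[OF e0(1) fU(1)[OF q] e0(2)])
  have gg: "mgerm V G q W g : carrier (mstalk V G q)" by (rule G.mgerm_in[OF W(1) q g0(2)])
  interpret N: module "ostalk V q" "mstalk V G q" by (rule G.mstalk_module[OF fU(2)[OF q] crings(1)[OF fU(2)[OF q]]])
  have "A *.[mstalk V G q] mgerm V G q W g = B *.[mstalk V G q] mgerm V G q W g"
   by (rule rank_one.cl_inj[OF r N.smult_closed[OF AB(1) gg] N.smult_closed[OF AB(2) gg]])
    (use eq in \<open>simp only: gp_cls_def gp_stalk_def tens.cl_smult[OF t AB(1) eg gg] tens.cl_smult[OF t AB(2) eg gg]\<close>)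
  from G.free_gen_stalk(2)[OF g q AB this] show ?thesis .
 qed
 show ?thesis
  unfolding free_gen_def
 proof (intro conjI allI impI ballI W(1) psec_in[OF W e g0(2)])
  fix Z s assume "opn V Z & Z <= W" and s: "s : Ms ?P Z"
  hence Z: "opn V Z" "Z <= W" by auto
  have val: "(a *.[msec ?P Z] mres ?P W Z ?E) q = ogerm V q Z a *.[St q] cls U e W g q" if "q : Z" for a q
   using that Z(2) by (auto simp: gp_sel)
  have loc: "EX Y a. opn V Y & p : Y & Y <= Z & a : Os V Y & (ALL q:Y. s q = ogerm V q Y a *.[St q] cls U e W g q)" if p: "p : Z" for p
  proof -
   have pW: "p : W" using p Z by auto
   obtain Y v where Y: "opn V Y" "p : Y" "Y <= Z" "Y <= preim V f U" "v : Ms G Y" "ALL q:Y. s q = cls U e Y v q"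
    using gp_local[OF Z(1) s p e fU(1)[OF pW]] by (elim exE conjE) (rule that)
   have YW: "Y <= W" using Y Z by auto
   obtain a where a: "a : Os V Y" "v = a *.[msec G Y] mres G W Y g" by (rule free_gen_coef[OF g Y(1) YW Y(5)])
   have "ALL q:Y. s q = ogerm V q Y a *.[St q] cls U e W g q"
   proof
    fix q assume q: "q : Y"
    have qU: "mpt f q : U" using q Y(4) by (auto simp: preim_def)
    have "s q = ogerm V q Y a *.[St q] cls U e Y (mres G W Y g) q"
     using bspec[OF Y(6) q] a(2) cls_smult[OF Y(1) q e0(1) qU e0(2) G.res_closed[OF W(1) Y(1) YW g0(2)] a(1)] by simp
    also have "cls U e Y (mres G W Y g) q = cls U e W g q"
     using cls_res[OF W(1) Y(1) YW q g0(2) e0(1) e0(1) order_refl qU e0(2)] F.res_id[OF e0] by simp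
    finally show "s q = ogerm V q Y a *.[St q] cls U e W g q" .
   qed
   thus ?thesis using Y(1-3) a(1) by (intro exI[of _ Y] exI[of _ a] conjI)
  qed
  have "ALL p:Z. EX Y a. opn V Y & p : Y & Y <= Z & a : Os V Y & (ALL q:Y. s q = ogerm V q Y a *.[St q] cls U e W g q)"
   by (rule ballI) (rule loc)
  from bchoice[OF this] obtain Y where "ALL p:Z. EX a. opn V (Y p) & p : Y p & Y p <= Z & a : Os V (Y p) & (ALL q:Y p. s q = ogerm V q (Y p) a *.[St q] cls U e W g q)"
   by (elim exE) (rule that)
  from bchoice[OF this] obtain a where "ALL p:Z. opn V (Y p) & p : Y p & Y p <= Z & a p : Os V (Y p) & (ALL q:Y p. s q = ogerm V q (Y p) (a p) *.[St q] cls U e W g q)"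
   by (elim exE) (rule that)
  note Ya = bspec[OF this]
  have Y: "opn V (Y p)" "p : Y p" "Y p <= Z" "a p : Os V (Y p)" if "p : Z" for p using Ya[OF that] by simp_all
  have Yv: "s q = ogerm V q (Y p) (a p) *.[St q] cls U e W g q" if "p : Z" "q : Y p" for p q using Ya[OF that(1)] that(2) by simp
  have un: "Z = (UN p:Z. Y p)" using Y(2,3) by blast
  \<comment> \<open>Two local coefficients have the same germs on the overlap by
    \<open>cancel\<close>, hence are equal there.\<close>
  obtain b where b: "b : Os V Z" "!!p. p : Z ==> ores V Z (Y p) b = a p"
  proof (rule sheaf_glue[OF G.osh, where I = Z and W = Y and s = a and U = Z])
   fix p r assume pr: "p : Z" "r : Z"
   let ?I = "Y p Int Y r"
   have I: "opn V ?I" "?I <= Y p" "?I <= Y r" using Y(1) pr by auto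
   show "ores V (Y p) ?I (a p) = ores V (Y r) ?I (a r)"
   proof (rule G.ogerm_eq_section[OF I(1) G.ores_closed[OF Y(1)[OF pr(1)] I(1,2) Y(4)[OF pr(1)]] G.ores_closed[OF Y(1)[OF pr(2)] I(1,3) Y(4)[OF pr(2)]]])
    fix q assume q: "q : ?I"
    have qY: "q : Y p" "q : Y r" and qW: "q : W" using q Y(3)[OF pr(1)] Z(2) by auto
    have "ogerm V q (Y p) (a p) = ogerm V q (Y r) (a r)"
     by (rule cancel[OF qW G.ogerm_in[OF Y(1)[OF pr(1)] qY(1) Y(4)[OF pr(1)]] G.ogerm_in[OF Y(1)[OF pr(2)] qY(2) Y(4)[OF pr(2)]]])
      (use Yv[OF pr(1) qY(1)] Yv[OF pr(2) qY(2)] in simp)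
    thus "ogerm V q ?I (ores V (Y p) ?I (a p)) = ogerm V q ?I (ores V (Y r) ?I (a r))"
     unfolding G.ogerm_res[OF Y(1)[OF pr(1)] I(1,2) q Y(4)[OF pr(1)]] G.ogerm_res[OF Y(1)[OF pr(2)] I(1,3) q Y(4)[OF pr(2)]] .
   qed
  qed (use Y un that in simp_all)
  have ext: "s = b *.[msec ?P Z] mres ?P W Z ?E"
  proof (rule extensionalityI[OF gp_ext[OF Z(1) s]])
   show "b *.[msec ?P Z] mres ?P W Z ?E : extensional Z" by (simp add: gp_sel)
   fix p assume p: "p : Z"
   have "ogerm V p (Y p) (a p) = ogerm V p Z b"
    using G.ogerm_res[OF Z(1) Y(1,3,2)[OF p] b(1)] b(2)[OF p] by simp
   thus "s p = (b *.[msec ?P Z] mres ?P W Z ?E) p" using val[OF p] Yv[OF p Y(2)[OF p]] by simp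
  qed
  show "EX! a. a : Os V Z & s = a *.[msec ?P Z] mres ?P W Z ?E"
  proof (rule ex1I[of _ b])
   show "b : Os V Z & s = b *.[msec ?P Z] mres ?P W Z ?E" using b(1) ext by blast
   fix c assume c: "c : Os V Z & s = c *.[msec ?P Z] mres ?P W Z ?E"
   show "c = b"
   proof (rule G.ogerm_eq_section[OF Z(1) conjunct1[OF c] b(1)])
    fix p assume p: "p : Z"
    have pW: "p : W" using p Z by auto
    show "ogerm V p Z c = ogerm V p Z b"
     by (rule cancel[OF pW G.ogerm_in[OF Z(1) p conjunct1[OF c]] G.ogerm_in[OF Z(1) p b(1)]])
      (use val[OF p, of c] val[OF p, of b] fun_cong[OF conjunct2[OF c], of p] fun_cong[OF ext, of p] in simp)
   qed
  qed
 qed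
qed

lemma gp_line_bundle: "line_bundle V (gp V X f F G)"
 unfolding line_bundle_def
proof (intro conjI ballI gp_mod_sheaf)
 fix p assume p: "p : pts V"
 obtain U e where e: "mpt f p : U" "free_gen X F U e" using line_bundleD(2)[OF lbF fq[OF p]] by (elim exE conjE) (rule that)
 obtain W g where g: "p : W" "free_gen V G W g" using line_bundleD(2)[OF lbG p] by (elim exE conjE) (rule that)
 let ?W = "W Int preim V f U"
 have W: "opn V ?W" "?W <= preim V f U" "?W <= W" "p : ?W"
  using free_genD(1)[OF g(2)] pre_homD(1)[OF pf free_genD(1)[OF e(2)]] p e(1) g(1) by (auto simp: preim_def)
 from psec_free_gen[OF W(1,2) e(2) G.free_gen_res[OF g(2) W(1,3)]] W(4)
 show "EX U e. p : U & free_gen V (gp V X f F G) U e" by (intro exI conjI)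
qed

end

subsection \<open>The tensor product as a special case\<close>

lemma mor_id_pre_hom: "ring_sheaf X ==> pre_hom X X mor_id"
proof -
 assume rs: "ring_sheaf X"
 have p: "preim X mor_id U = U" if "opn X U" for U using openin_subset[OF that] by (auto simp: preim_def mor_id_def)
 have "(%s. s) : ring_hom (osec X U) (osec X U)" for U by (rule ring_hom_memI) simp_all
 thus ?thesis unfolding pre_hom_def using p by (simp add: mor_id_def continuous_map_id[unfolded id_def] eta_contract_eq)
qed

text \<open>The two definitions differ in two points. \<open>tensor\<close> uses the identity
  function where \<open>gp\<close> has the stalk map of the identity morphism, and it takes left
  factors over \<open>W\<close> itself where \<open>gp\<close> allows any open \<open>U\<close>
  containing \<open>W\<close>. The first is settled by congruence of the tensor construction, the
  second by restricting the left factors to \<open>W\<close>.\<close>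

lemma tensor_eq_gp:
 fixes X :: "('p, 'a) rspace" and F :: "('p, 'a, 'm) msheaf" and G :: "('p, 'a, 'n) msheaf"
 assumes lX: "lrs X" and F: "line_bundle X F" and G: "line_bundle X G"
 shows "tensor X F G = gp X X mor_id F G"
proof -
 have rs: "ring_sheaf X" using lX by (simp add: lrs_def)
 interpret gpl X X mor_id F G by (rule gpl.intro[OF lX lX mor_id_pre_hom[OF rs] F G])
 have id: "mpt (mor_id :: ('p, 'a, 'p, 'a) rmor) q = q" for q by (simp add: mor_id_def)
 have sm: "stalk_map X mor_id q A = A" if A: "A : carrier (ostalk X q)" for q A
 proof -
  obtain U s where U: "opn X U" "q : U" "s : Os X U" "A = ogerm X q U s" by (rule F.ostalkE[OF A])
  have q: "q : pts X" using U openin_subset by blast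
  have pU: "preim X mor_id U = U" using openin_subset[OF U(1)] by (auto simp: preim_def mor_id_def)
  show ?thesis using pf.stalk_map_germ[OF q U(1), of s] U pU by (simp add: id) (simp add: mor_id_def)
 qed
 have st: "tensor_stalk X F G q = gp_stalk X X mor_id F G q" for q
  unfolding tensor_stalk_def gp_stalk_def id by (rule tens_module_cong(1)) (simp add: sm)
 have cl: "tens_class (ostalk X q) (%a. a) (mstalk X F q) (mstalk X G q) (frag_of (mgerm X F q U u, mgerm X G q W v)) = cls U u W v q" for q U u W v
  unfolding gp_cls_def id by (rule fun_cong[OF tens_module_cong(2)]) (simp add: sm)
 let ?loc1 = "%W. {(%q. finsum (St q) (%i. cls W (u i) W (v i) q) {..<l})
     | l u v. u : {..<l::nat} \<rightarrow> Ms F W & v : {..<l} \<rightarrow> Ms G W}"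
 let ?loc2 = "%W. {(%q. finsum (St q) (%i. cls U (u i) W (v i) q) {..<l})
     | l U u v. opn X U & mpt (mor_id :: ('p, 'a, 'p, 'a) rmor) ` W <= U & u : {..<l::nat} \<rightarrow> Ms F U & v : {..<l} \<rightarrow> Ms G W}"
 have 12: "t : ?loc2 W" if h: "t : ?loc1 W" "opn X W" for t W
 proof -
  obtain l :: nat and u v where t: "t = (%q. finsum (St q) (%i. cls W (u i) W (v i) q) {..<l})"
   "u : {..<l} \<rightarrow> Ms F W" "v : {..<l} \<rightarrow> Ms G W"
   using h(1) unfolding mem_Collect_eq by (elim exE conjE) (rule that)
  have "mpt (mor_id :: ('p, 'a, 'p, 'a) rmor) ` W <= W" by (simp add: mor_id_def)
  with t h(2) show ?thesis unfolding mem_Collect_eq by (intro exI[of _ l] exI[of _ W] exI[of _ u] exI[of _ v] conjI)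
 qed
 have 21: "EX t':?loc1 W. ALL q:W. t q = t' q" if h: "t : ?loc2 W" "opn X W" for t W
 proof -
  obtain l :: nat and U u v where t: "t = (%q. finsum (St q) (%i. cls U (u i) W (v i) q) {..<l})"
   "opn X U" "mpt (mor_id :: ('p, 'a, 'p, 'a) rmor) ` W <= U" "u : {..<l} \<rightarrow> Ms F U" "v : {..<l} \<rightarrow> Ms G W"
   using h(1) unfolding mem_Collect_eq by (elim exE conjE) (rule that)
  have WU: "W <= U" using t(3) by (simp add: mor_id_def)
  let ?u = "%i. mres F U W (u i)"
  have u: "?u : {..<l} \<rightarrow> Ms F W" by (rule funcsetI) (rule F.res_closed[OF t(2) h(2) WU funcset_mem[OF t(4)]])
  have "t q = finsum (St q) (%i. cls W (?u i) W (v i) q) {..<l}" if q: "q : W" for q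
  proof -
   have qX: "q : pts X" using q h(2) openin_subset by blast
   interpret module "ostalk X q" "St q" by (rule St_module[OF qX])
   have in2: "cls W (?u i) W (v i) q : carrier (St q)" if "i : {..<l}" for i
    using cls_in[OF h(2) q funcset_mem[OF t(5) that] h(2) _ funcset_mem[OF u that]] q by (simp add: id)
   have eq: "cls U (u i) W (v i) q = cls W (?u i) W (v i) q" if "i : {..<l}" for i
    using cls_res[OF h(2) h(2) order_refl q funcset_mem[OF t(5) that] t(2) h(2) WU _ funcset_mem[OF t(4) that]] q
     G.res_id[OF h(2) funcset_mem[OF t(5) that]] by (simp add: id)
   show ?thesis unfolding t(1) by (rule M.finsum_cong') (use in2 eq in auto)
  qed
  moreover have "(%q. finsum (St q) (%i. cls W (?u i) W (v i) q) {..<l}) : ?loc1 W"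
   unfolding mem_Collect_eq using u t(5) by (intro exI[of _ l] exI[of _ ?u] exI[of _ v] conjI refl)
  ultimately show ?thesis by (intro bexI ballI)
 qed
 have ex: "(EX W t. opn X W & p : W & W <= U & t : ?loc1 W & (ALL q:W. s q = t q)) \<longleftrightarrow> (EX W t. opn X W & p : W & W <= U & t : ?loc2 W & (ALL q:W. s q = t q))" for p U s
 proof
  assume "EX W t. opn X W & p : W & W <= U & t : ?loc1 W & (ALL q:W. s q = t q)"
  then obtain W t where W: "opn X W" "p : W" "W <= U" "t : ?loc1 W" "ALL q:W. s q = t q" by (elim exE conjE) (rule that)
  show "EX W t. opn X W & p : W & W <= U & t : ?loc2 W & (ALL q:W. s q = t q)"
   using W(1-3,5) 12[OF W(4,1)] by (intro exI[of _ W] exI[of _ t] conjI)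
 next
  assume "EX W t. opn X W & p : W & W <= U & t : ?loc2 W & (ALL q:W. s q = t q)"
  then obtain W t where W: "opn X W" "p : W" "W <= U" "t : ?loc2 W" "ALL q:W. s q = t q" by (elim exE conjE) (rule that)
  obtain t' where t': "t' : ?loc1 W" "ALL q:W. t q = t' q" using 21[OF W(4,1)] by (elim bexE) (rule that)
  have "ALL q:W. s q = t' q" using W(5) t'(2) by simp
  thus "EX W t. opn X W & p : W & W <= U & t : ?loc1 W & (ALL q:W. s q = t q)"
   using W(1-3) t'(1) by (intro exI[of _ W] exI[of _ t'] conjI)
 qed
 show ?thesis
  unfolding tensor_def gp_def st[abs_def] cl etale_sheaf_def ex by (rule refl)
qed

section \<open>Integral schemes\<close>

lemma lfrac_eq_domain:
 assumes R: "domain R" and p: "prime_at p R" and x: "(a, s) : loc_pairs R p" "(b, t) : loc_pairs R p"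
 shows "lfrac R p (a, s) = lfrac R p (b, t) \<longleftrightarrow> a *[R] t = b *[R] s"
proof -
 interpret domain R by fact
 interpret p: prime_at p R by fact
 have c: "a *[R] t : carrier R" "b *[R] s : carrier R" using x by (simp_all add: loc_pairs_def)
 have z: "0[R] : p" by (rule additive_subgroup.zero_closed[OF p.is_additive_subgroup])
 show ?thesis unfolding p.lfrac_eq[OF x]
 proof
  assume "EX u:carrier R - p. u *[R] (a *[R] t) = u *[R] (b *[R] s)"
  then obtain u where u: "u : carrier R - p" "u *[R] (a *[R] t) = u *[R] (b *[R] s)" by (elim bexE) (rule that)
  have "u ~= 0[R]" using u(1) z by auto
  thus "a *[R] t = b *[R] s" using m_lcancel[OF _ _ c, of u] u by simp
 next
  assume "a *[R] t = b *[R] s"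
  thus "EX u:carrier R - p. u *[R] (a *[R] t) = u *[R] (b *[R] s)"
   using p.one_notin by (intro bexI[of _ "1[R]"]) simp_all
 qed
qed

lemma generic_point:
 assumes R: "domain R" shows "primeideal {0[R]} R" "opn (Spec R) W ==> W ~= {} ==> {0[R]} : W"
proof -
 interpret domain R by fact
 show pr: "primeideal {0[R]} R" by (rule zeroprimeideal)
 assume W: "opn (Spec R) W" "W ~= {}"
 obtain S where S: "S <= carrier R" "W = {p. primeideal p R & \<not> S <= p}" using W(1) unfolding Spec_opn[OF is_cring] by (elim exE conjE) (rule that)
 obtain p where p: "primeideal p R" "\<not> S <= p" using W(2) S(2) by blast
 have "0[R] : p" by (rule additive_subgroup.zero_closed[OF ideal.axioms(1)[OF primeideal.axioms(1)[OF p(1)]]])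
 hence "\<not> S <= {0[R]}" using p(2) by blast
 thus "{0[R]} : W" using pr S(2) by simp
qed

text \<open>Over a domain, equality of two fractions is the same cross-multiplication identity at
  every prime. Every nonempty open set contains the generic point, so equality at any point is
  equivalent to equality there, and therefore to equality at all points.\<close>

lemma Spec_sections_eq:
 assumes R: "domain R" and s: "s : Os (Spec R) U" and t: "t : Os (Spec R) U"
  and p: "p : U" "s p = t p"
 shows "s = t"
proof -
 interpret domain R by fact
 let ?g = "{0[R]}"
 have key: "s q = t q \<longleftrightarrow> s ?g = t ?g" if q: "q : U" for q
 proof -
  obtain W a u where W: "opn (Spec R) W" "q : W" "W <= U" "!!r. r : W ==> (a, u) : loc_pairs R r" "!!r. r : W ==> s r = lfrac R r (a, u)"
   by (rule Spec_section_at[OF s q]) (rule that, auto)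
  obtain Y b v where Y: "opn (Spec R) Y" "q : Y" "Y <= U" "!!r. r : Y ==> (b, v) : loc_pairs R r" "!!r. r : Y ==> t r = lfrac R r (b, v)"
   by (rule Spec_section_at[OF t q]) (rule that, auto)
  have g: "?g : W" "?g : Y" using generic_point(2)[OF R] W Y by auto
  note P = Spec_prime[OF is_cring W(1)]
  show ?thesis
   unfolding W(5)[OF W(2)] Y(5)[OF Y(2)] W(5)[OF g(1)] Y(5)[OF g(2)]
    lfrac_eq_domain[OF R P[OF W(2)] W(4)[OF W(2)] Y(4)[OF Y(2)]] lfrac_eq_domain[OF R P[OF g(1)] W(4)[OF g(1)] Y(4)[OF g(2)]] by (rule refl)
 qed
 have e: "s : extensional U" "t : extensional U" using s t unfolding Spec_section by simp_all
 have "s q = t q" if "q : U" for q using key[OF that] key[OF p(1)] p(2) by simp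
 thus ?thesis by (rule extensionalityI[OF e])
qed

subsection \<open>Isomorphisms as homeomorphisms with bijective comorphisms\<close>

text \<open>Isomorphisms, described by a homeomorphism and bijective maps on sections instead of an
  inverse morphism. In this form they are easy to restrict to open subsets and to verify for
  spectra; the next two lemmas compare it with \<open>lrs_iso\<close>.\<close>

definition bij_mor :: "('p, 'a) rspace => ('q, 'b) rspace => ('p, 'a, 'q, 'b) rmor => bool"
 where "bij_mor X Y f \<longleftrightarrow> pre_hom X Y f &
  (EX k. continuous_map (tp Y) (tp X) k & (ALL x:pts X. k (mpt f x) = x) & (ALL y:pts Y. mpt f (k y) = y)) &
  (ALL U. opn Y U --> bij_betw (mco f U) (Os Y U) (Os X (preim X f U)))"

lemma bij_morD:
 assumes "bij_mor X Y f"
 shows "pre_hom X Y f" "opn Y U ==> bij_betw (mco f U) (Os Y U) (Os X (preim X f U))"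
 using assms by (simp_all add: bij_mor_def)

lemma bij_mor_lrs_iso:
 assumes pX: "pre_ring X" and pY: "pre_ring Y" and f: "bij_mor X Y f"
 shows "lrs_iso X Y f"
proof -
 note pf = bij_morD(1)[OF f] and bij = bij_morD(2)[OF f]
 obtain k where k: "continuous_map (tp Y) (tp X) k" "ALL x:pts X. k (mpt f x) = x" "ALL y:pts Y. mpt f (k y) = y"
  using f unfolding bij_mor_def by (elim conjE exE) (rule that)
 define pk where "pk U = {y : pts Y. k y : U}" for U
 \<comment> \<open>The inverse comorphism is the set-theoretic inverse on sections. It is a ring
   homomorphism and commutes with restriction because \<open>f\<close> does and is injective on
   sections.\<close>
 define g where "g = \<lparr>mpt = k, mco = (%U s. inv_into (Os Y (pk U)) (mco f (pk U)) s)\<rparr>"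
 have pg: "preim Y g U = pk U" for U by (simp add: preim_def pk_def g_def)
 have opk: "opn Y (pk U)" if "opn X U" for U using openin_continuous_map_preimage[OF k(1) that] by (simp add: pk_def)
 have fpk: "preim X f (pk U) = U" if "opn X U" for U
  using openin_subset[OF that] k(2) pre_homD(2)[OF pf] by (auto simp: preim_def pk_def)
 have b: "bij_betw (mco f (pk U)) (Os Y (pk U)) (Os X U)" if "opn X U" for U
  using bij[OF opk[OF that]] fpk[OF that] by simp
 have gin: "mco g U s : Os Y (pk U)" and fg: "mco f (pk U) (mco g U s) = s" if "opn X U" "s : Os X U" for U s
  using inv_into_into[of s "mco f (pk U)" "Os Y (pk U)"] f_inv_into_f[of s "mco f (pk U)" "Os Y (pk U)"] b[OF that(1)] that(2)
  by (simp_all add: g_def bij_betw_def)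
 have gf: "mco g U (mco f (pk U) t) = t" if "opn X U" "t : Os Y (pk U)" for U t
  using inv_into_f_f[of "mco f (pk U)" "Os Y (pk U)" t] b[OF that(1)] that(2) by (simp add: g_def bij_betw_def)
 have inj: "s = t" if "opn X U" "s : Os Y (pk U)" "t : Os Y (pk U)" "mco f (pk U) s = mco f (pk U) t" for U s t
  using b[OF that(1)] that(2-4) by (simp add: bij_betw_def inj_on_def)
 have hom: "mco f (pk U) : ring_hom (osec Y (pk U)) (osec X U)" if "opn X U" for U
  using pre_homD(3)[OF pf opk[OF that]] fpk[OF that] by simp
 have "pre_hom Y X g"
  unfolding pre_hom_def pg
 proof (intro conjI allI impI ballI)
  show "continuous_map (tp Y) (tp X) (mpt g)" using k(1) by (simp add: g_def)
  fix U assume U: "opn X U"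
  show "mco g U : ring_hom (osec X U) (osec Y (pk U))"
  proof (rule ring_hom_memI)
   fix s t assume st: "s : Os X U" "t : Os X U"
   note g = gin[OF U st(1)] gin[OF U st(2)] and o = opk[OF U]
   show "mco g U s : Os Y (pk U)" by (rule g(1))
   show "mco g U (s *[osec X U] t) = mco g U s *[osec Y (pk U)] mco g U t"
    using gf[OF U pre_ringD(3)[OF pY o g]] ring_hom_mult[OF hom[OF U] g] fg[OF U st(1)] fg[OF U st(2)] by simp
   show "mco g U (s +[osec X U] t) = mco g U s +[osec Y (pk U)] mco g U t"
    using gf[OF U pre_ringD(4)[OF pY o g]] ring_hom_add[OF hom[OF U] g] fg[OF U st(1)] fg[OF U st(2)] by simp
  next
   show "mco g U 1[osec X U] = 1[osec Y (pk U)]"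
    using gf[OF U pre_ringD(1)[OF pY opk[OF U]]] ring_hom_one[OF hom[OF U]] by simp
  qed
 next
  fix U W s assume "opn X U & opn X W & W <= U" and s: "s : Os X U"
  hence UW: "opn X U" "opn X W" "W <= U" by auto
  have sub: "pk W <= pk U" using UW(3) by (auto simp: pk_def)
  interpret X: premod X "osheaf X" by (rule premod_osheaf[OF pX])
  interpret Y: premod Y "osheaf Y" by (rule premod_osheaf[OF pY])
  have r: "ores X U W s : Os X W" by (rule X.ores_closed[OF UW s])
  show "mco g W (ores X U W s) = ores Y (pk U) (pk W) (mco g U s)"
   by (rule inj[OF UW(2) gin[OF UW(2) r] Y.ores_closed[OF opk[OF UW(1)] opk[OF UW(2)] sub gin[OF UW(1) s]]])
    (use fg[OF UW(2) r] pre_homD(4)[OF pf opk[OF UW(1)] opk[OF UW(2)] sub gin[OF UW(1) s]] fpk[OF UW(1)] fpk[OF UW(2)] fg[OF UW(1) s] in simp)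
 qed
 moreover have "mor_eq X X (mor_comp Y g f) mor_id"
  using k(2) fg by (simp add: mor_eq_def mor_comp_def mor_id_def pg) (simp add: g_def)
 moreover have "mor_eq Y Y (mor_comp X f g) mor_id"
 proof -
  have "pk (preim X f U) = U" if "opn Y U" for U
   using openin_subset[OF that] k(3) continuous_map_image_subset_topspace[OF k(1)] by (auto simp: preim_def pk_def)
  hence "mco g (preim X f U) (mco f U s) = s" if "opn Y U" "s : Os Y U" for U s
   using gf[OF pre_homD(1)[OF pf that(1)], of s] that by simp
  thus ?thesis using k(3) by (simp add: mor_eq_def mor_comp_def mor_id_def) (simp add: g_def)
 qed
 ultimately show ?thesis by (rule lrs_isoI[OF pX pY pf])
qed

lemma lrs_iso_bij_mor:
 assumes "lrs_iso X Y f" shows "bij_mor X Y f"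
proof -
 obtain g where pf: "pre_hom X Y f" and pg: "pre_hom Y X g" and gf: "mor_eq X X (mor_comp Y g f) mor_id"
  and fg: "mor_eq Y Y (mor_comp X f g) mor_id"
  using assms unfolding lrs_iso_def lrs_hom_iff by (elim conjE exE) (rule that)
 have 1: "mpt g (mpt f x) = x" if "x : pts X" for x using gf that by (simp add: mor_eq_def mor_comp_def mor_id_def)
 have 2: "mpt f (mpt g y) = y" if "y : pts Y" for y using fg that by (simp add: mor_eq_def mor_comp_def mor_id_def)
 have 3: "mco f (preim Y g U) (mco g U s) = s" if "opn X U" "s : Os X U" for U s
  using gf that by (simp add: mor_eq_def mor_comp_def mor_id_def)
 have 4: "mco g (preim X f U) (mco f U s) = s" if "opn Y U" "s : Os Y U" for U s
  using fg that by (simp add: mor_eq_def mor_comp_def mor_id_def)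
 have bij: "bij_betw (mco f U) (Os Y U) (Os X (preim X f U))" if U: "opn Y U" for U
 proof (rule bij_betwI[where g = "mco g (preim X f U)"])
  have pp: "preim Y g (preim X f U) = U"
   using openin_subset[OF U] 2 pre_homD(2)[OF pg] by (auto simp: preim_def)
  note o = pre_homD(1)[OF pf U]
  show "mco f U : Os Y U \<rightarrow> Os X (preim X f U)" using ring_hom_closed[OF pre_homD(3)[OF pf U]] by auto
  show "mco g (preim X f U) : Os X (preim X f U) \<rightarrow> Os Y U"
   using ring_hom_closed[OF pre_homD(3)[OF pg o]] pp by auto
  show "mco g (preim X f U) (mco f U x) = x" if "x : Os Y U" for x by (rule 4[OF U that])
  show "mco f U (mco g (preim X f U) y) = y" if "y : Os X (preim X f U)" for y using 3[OF o that] pp by simp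
 qed
 have c: "continuous_map (tp Y) (tp X) (mpt g)" using pg by (simp add: pre_hom_def)
 show ?thesis unfolding bij_mor_def
  by (intro conjI pf exI[of _ "mpt g"] c ballI allI impI 1 2 bij)
qed

lemma lrs_iso_sym: "lrs_iso X Y f ==> EX g. lrs_iso Y X g"
 unfolding lrs_iso_def by (elim conjE exE) (intro exI conjI)

lemma open_sub_sel [simp]:
 "osec (open_sub X U) = osec X" "ores (open_sub X U) = ores X" "tp (open_sub X U) = subtopology (tp X) U"
 by (simp_all add: open_sub_def)

lemma open_sub_opn: "opn X U ==> opn (open_sub X U) W \<longleftrightarrow> opn X W & W <= U"
 by (simp add: openin_open_subtopology)

lemma open_sub_pre_ring:
 assumes "pre_ring X" "opn X U" shows "pre_ring (open_sub X U)"
 using assms(1) unfolding pre_ring_def is_presheaf_def open_sub_sel by (simp add: openin_open_subtopology[OF assms(2)])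

lemma bij_mor_restrict:
 assumes f: "bij_mor X Y f" and D: "opn Y D"
 shows "bij_mor (open_sub X (preim X f D)) (open_sub Y D) f"
proof -
 note pf = bij_morD(1)[OF f] and bij = bij_morD(2)[OF f]
 obtain k where k: "continuous_map (tp Y) (tp X) k" "ALL x:pts X. k (mpt f x) = x" "ALL y:pts Y. mpt f (k y) = y"
  using f unfolding bij_mor_def by (elim conjE exE) (rule that)
 let ?E = "preim X f D"
 have E: "opn X ?E" by (rule pre_homD(1)[OF pf D])
 have sE: "?E <= pts X" "D <= pts Y" using openin_subset[OF E] openin_subset[OF D] by auto
 have pts: "pts (open_sub X ?E) = ?E" "pts (open_sub Y D) = D" using sE by auto
 have pr: "preim (open_sub X ?E) f U = preim X f U" if "U <= D" for U
  using that by (auto simp: preim_def)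
 have cf: "continuous_map (tp X) (tp Y) (mpt f)" using pf by (simp add: pre_hom_def)
 have c1: "continuous_map (subtopology (tp X) ?E) (subtopology (tp Y) D) (mpt f)"
  using continuous_map_from_subtopology[OF cf] by (auto simp: continuous_map_in_subtopology preim_def)
 have c2: "continuous_map (subtopology (tp Y) D) (subtopology (tp X) ?E) k"
  using continuous_map_from_subtopology[OF k(1)] k(3) sE(2) continuous_map_image_subset_topspace[OF k(1)]
  by (auto simp: continuous_map_in_subtopology preim_def)
 have ph: "pre_hom (open_sub X ?E) (open_sub Y D) f"
  unfolding pre_hom_def open_sub_opn[OF D] unfolding open_sub_sel
 proof (intro conjI allI impI ballI c1)
  fix U assume U: "opn Y U & U <= D"
  show "mco f U : ring_hom (osec Y U) (osec X (preim (open_sub X ?E) f U))" using pre_homD(3)[OF pf] U pr by simp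
 next
  fix U W s assume UW: "(opn Y U & U <= D) & (opn Y W & W <= D) & W <= U" and s: "s : Os Y U"
  show "mco f W (ores Y U W s) = ores X (preim (open_sub X ?E) f U) (preim (open_sub X ?E) f W) (mco f U s)"
   using pre_homD(4)[OF pf, of U W s] UW s pr by simp
 qed
 show ?thesis unfolding bij_mor_def open_sub_opn[OF D] pts unfolding open_sub_sel
 proof (intro conjI ph exI[of _ k] allI impI ballI c2)
  show "k (mpt f x) = x" if "x : ?E" for x using k(2) that sE by auto
  show "mpt f (k y) = y" if "y : D" for y using k(3) that sE by auto
  show "bij_betw (mco f U) (Os Y U) (Os X (preim (open_sub X ?E) f U))" if "opn Y U & U <= D" for U
   using bij that pr by simp
 qed
qed

lemma bij_mor_comp:
 assumes f: "bij_mor X Y f" and g: "bij_mor Y Z g"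
 shows "bij_mor X Z (mor_comp Y g f)"
proof -
 note pf = bij_morD(1)[OF f] and pg = bij_morD(1)[OF g]
 obtain k where k: "continuous_map (tp Y) (tp X) k" "ALL x:pts X. k (mpt f x) = x" "ALL y:pts Y. mpt f (k y) = y"
  using f unfolding bij_mor_def by (elim conjE exE) (rule that)
 obtain j where j: "continuous_map (tp Z) (tp Y) j" "ALL x:pts Y. j (mpt g x) = x" "ALL y:pts Z. mpt g (j y) = y"
  using g unfolding bij_mor_def by (elim conjE exE) (rule that)
 have sel: "mpt (mor_comp Y g f) = mpt g \<circ> mpt f" "!!U. mco (mor_comp Y g f) U = mco f (preim Y g U) \<circ> mco g U"
  by (auto simp: mor_comp_def)
 have pr: "preim X (mor_comp Y g f) U = preim X f (preim Y g U)" for U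
  using pre_homD(2)[OF pf] by (auto simp: preim_def sel)
 have c: "continuous_map (tp X) (tp Z) (mpt g \<circ> mpt f)" "continuous_map (tp Z) (tp X) (k \<circ> j)"
  using continuous_map_compose[OF conjunct1[OF pf[unfolded pre_hom_def]] conjunct1[OF pg[unfolded pre_hom_def]]]
   continuous_map_compose[OF j(1) k(1)] by auto
 have ph: "pre_hom X Z (mor_comp Y g f)"
  unfolding pre_hom_def pr sel
 proof (intro conjI allI impI ballI c(1))
  fix U assume U: "opn Z U"
  show "mco f (preim Y g U) \<circ> mco g U : ring_hom (osec Z U) (osec X (preim X f (preim Y g U)))"
   by (rule ring_hom_trans[OF pre_homD(3)[OF pg U] pre_homD(3)[OF pf pre_homD(1)[OF pg U]]])
 next
  fix U W s assume "opn Z U & opn Z W & W <= U" and s: "s : Os Z U"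
  hence UW: "opn Z U" "opn Z W" "W <= U" by auto
  show "(mco f (preim Y g W) \<circ> mco g W) (ores Z U W s)
    = ores X (preim X f (preim Y g U)) (preim X f (preim Y g W)) ((mco f (preim Y g U) \<circ> mco g U) s)"
   using pre_homD(4)[OF pg UW s] pre_homD(4)[OF pf pre_homD(1)[OF pg UW(1)] pre_homD(1)[OF pg UW(2)] preim_mono[OF UW(3)]
    ring_hom_closed[OF pre_homD(3)[OF pg UW(1)] s]] by simp
 qed
 have mt: "mpt f x : pts Y" if "x : pts X" for x by (rule pre_homD(2)[OF pf that])
 have jt: "j z : pts Y" if "z : pts Z" for z using continuous_map_image_subset_topspace[OF j(1)] that by blast
 show ?thesis unfolding bij_mor_def pr sel
 proof (intro conjI ph[unfolded sel] exI[of _ "k \<circ> j"] c(2) ballI allI impI)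
  show "(k \<circ> j) ((mpt g \<circ> mpt f) x) = x" if "x : pts X" for x using k(2) j(2) mt[OF that] that by simp
  show "(mpt g \<circ> mpt f) ((k \<circ> j) z) = z" if "z : pts Z" for z using k(3) j(3) jt[OF that] that by simp
  show "bij_betw (mco f (preim Y g U) \<circ> mco g U) (Os Z U) (Os X (preim X f (preim Y g U)))" if "opn Z U" for U
   by (rule bij_betw_trans[OF bij_morD(2)[OF g that] bij_morD(2)[OF f pre_homD(1)[OF pg that]]])
 qed
qed

subsection \<open>Basic open subsets of affine integral schemes\<close>

text \<open>An abstract form of the localization of \<open>R\<close> at \<open>x\<close>. The
  condition \<open>frac\<close> is pointwise: an element of \<open>S\<close> is a fraction near each
  prime of the basic open set, with a denominator that may depend on the prime. This is how sections
  of the structure sheaf over a basic open set are given.\<close>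

locale basic_open =
 fixes R :: "'r ring" and S :: "'s ring" and i :: "'r => 's" and x :: 'r
 assumes R: "domain R" and S: "domain S" and i: "i : ring_hom R S" and inj: "inj_on i (carrier R)"
  and x: "x : carrier R" and ix: "i x : Units S"
  and frac: "!!s q. s : carrier S ==> primeideal q R ==> x \<notin> q ==> EX a t. a : carrier R & t : carrier R - q & i t *[S] s = i a"
begin

definition D :: "'r set set" where "D = {q. primeideal q R & x \<notin> q}"

lemma fracD: "s : carrier S ==> q : D ==> EX a t. a : carrier R & t : carrier R - q & i t *[S] s = i a"
 using frac by (simp add: D_def)

interpretation R: domain R by (rule R)
interpretation S: domain S by (rule S)

lemma i_closed: "a : carrier R ==> i a : carrier S" by (rule ring_hom_closed[OF i])

lemma i_eq: "a : carrier R ==> b : carrier R ==> i a = i b \<longleftrightarrow> a = b"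
 using inj by (simp add: inj_on_eq_iff)

lemma D_prime: "q : D ==> primeideal q R" by (simp add: D_def)

lemma basic_open_opn: "g : carrier R ==> opn (Spec R) {q. primeideal q R & g \<notin> q}"
 unfolding Spec_opn[OF R.is_cring] by (rule exI[of _ "{g}"]) simp

lemma D_open: "opn (Spec R) D" unfolding D_def by (rule basic_open_opn[OF x])

text \<open>The extension of the prime \<open>q\<close> to \<open>S\<close>: all fractions with
  numerator in \<open>q\<close> and denominator outside \<open>q\<close>. It is the inverse of
  contraction along \<open>i\<close>.\<close>

definition k :: "'r set => 's set"
 where "k q = {s : carrier S. EX a:q. EX t:carrier R - q. i t *[S] s = i a}"

text \<open>Membership in \<open>k q\<close> can be tested on any one fraction. Two fractions of
  \<open>s\<close> satisfy t' a = t a' in \<open>R\<close> by injectivity of \<open>i\<close>, and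
  primality of \<open>q\<close> transfers membership between the numerators.\<close>

lemma k_iff:
 assumes q: "q : D" and s: "s : carrier S" and a: "a : carrier R" and t: "t : carrier R - q" and eq: "i t *[S] s = i a"
 shows "s : k q \<longleftrightarrow> a : q"
proof
 interpret q: primeideal q R by (rule D_prime[OF q])
 assume "s : k q"
 then obtain a' t' where a': "a' : q" "t' : carrier R - q" "i t' *[S] s = i a'" unfolding k_def by blast
 have c: "a' : carrier R" "t : carrier R" "t' : carrier R" using a' t q.Icarr by auto
 have "i (t' *[R] a) = i t' *[S] (i t *[S] s)" using eq c a by (simp add: ring_hom_mult[OF i])
 also have "... = i t *[S] (i t' *[S] s)" using i_closed c s by (simp add: S.m_lcomm)
 also have "... = i (t *[R] a')" using a'(3) c by (simp add: ring_hom_mult[OF i])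
 finally have "t' *[R] a = t *[R] a'" using i_eq c a by simp
 moreover have "t *[R] a' : q" using q.I_l_closed[OF a'(1) c(2)] .
 ultimately have "t' : q \<or> a : q" using q.I_prime[OF c(3) a] by simp
 thus "a : q" using a'(2) by simp
next
 assume "a : q" thus "s : k q" unfolding k_def using s t eq by blast
qed

lemma k_prime: assumes q: "q : D" shows "primeideal (k q) S"
proof -
 interpret q: prime_at q R using D_prime[OF q] by (simp add: prime_at_def)
 have z: "0[R] : q" by (rule additive_subgroup.zero_closed[OF q.is_additive_subgroup])
 have fr: "EX a t. a : carrier R & t : carrier R & t \<notin> q & i t *[S] s = i a & (s : k q \<longleftrightarrow> a : q)" if s: "s : carrier S" for s
 proof -
  obtain a t where "a : carrier R" "t : carrier R - q" "i t *[S] s = i a" using fracD[OF s q] by (elim exE conjE) (rule that)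
  with k_iff[OF q s this] show ?thesis by (intro exI[of _ a] exI[of _ t]) simp
 qed
 have mult: "s *[S] s' : k q \<longleftrightarrow> s : k q \<or> s' : k q" if s: "s : carrier S" "s' : carrier S" for s s'
 proof -
  obtain a t where a: "a : carrier R" "t : carrier R" "t \<notin> q" "i t *[S] s = i a" "s : k q \<longleftrightarrow> a : q" using fr[OF s(1)] by (elim exE conjE) (rule that)
  obtain a' t' where a': "a' : carrier R" "t' : carrier R" "t' \<notin> q" "i t' *[S] s' = i a'" "s' : k q \<longleftrightarrow> a' : q" using fr[OF s(2)] by (elim exE conjE) (rule that)
  have "i (t *[R] t') *[S] (s *[S] s') = (i t *[S] s) *[S] (i t' *[S] s')"
   using a(1,2) a'(1,2) s i_closed by (simp add: ring_hom_mult[OF i] S.m_ac)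
  hence "i (t *[R] t') *[S] (s *[S] s') = i (a *[R] a')" using a(1,4) a'(1,4) by (simp add: ring_hom_mult[OF i])
  moreover have "t *[R] t' : carrier R - q" using q.den_mult[of t t'] a a' by simp
  ultimately have "s *[S] s' : k q \<longleftrightarrow> a *[R] a' : q" using k_iff[OF q, of "s *[S] s'" "a *[R] a'" "t *[R] t'"] s a(1) a'(1) by simp
  also have "... \<longleftrightarrow> a : q \<or> a' : q" using q.I_prime[OF a(1) a'(1)] q.I_l_closed[OF _ a(1)] q.I_r_closed[OF _ a'(1)] by blast
  finally show ?thesis using a(5) a'(5) by simp
 qed
 have add: "s +[S] s' : k q" if s: "s : k q" "s' : k q" for s s'
 proof -
  have sc: "s : carrier S" "s' : carrier S" using s by (simp_all add: k_def)
  obtain a t where a: "a : carrier R" "t : carrier R" "t \<notin> q" "i t *[S] s = i a" "s : k q \<longleftrightarrow> a : q" using fr[OF sc(1)] by (elim exE conjE) (rule that)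
  obtain a' t' where a': "a' : carrier R" "t' : carrier R" "t' \<notin> q" "i t' *[S] s' = i a'" "s' : k q \<longleftrightarrow> a' : q" using fr[OF sc(2)] by (elim exE conjE) (rule that)
  have "i (t *[R] t') *[S] (s +[S] s') = i t' *[S] (i t *[S] s) +[S] i t *[S] (i t' *[S] s')"
   using a(1,2) a'(1,2) sc i_closed by (simp add: ring_hom_mult[OF i] S.m_ac S.r_distr)
  hence "i (t *[R] t') *[S] (s +[S] s') = i (t' *[R] a +[R] t *[R] a')"
   using a(1,2,4) a'(1,2,4) by (simp add: ring_hom_mult[OF i] ring_hom_add[OF i])
  moreover have "t *[R] t' : carrier R - q" using q.den_mult[of t t'] a a' by simp
  moreover have "t' *[R] a +[R] t *[R] a' : q"
   using s a(5) a'(5) q.I_l_closed[of a t'] q.I_l_closed[of a' t] a(2) a'(2)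
   by (intro additive_subgroup.a_closed[OF q.is_additive_subgroup]) simp_all
  ultimately show ?thesis using sc unfolding k_def by blast
 qed
 have neg1: "\<ominus>\<^bsub>S\<^esub> s = (\<ominus>\<^bsub>S\<^esub> 1[S]) *[S] s" if "s : carrier S" for s using that by (simp add: S.l_minus)
 have sub: "k q <= carrier S" by (auto simp: k_def)
 show ?thesis
 proof (rule primeidealI[OF idealI[OF S.ring_axioms]])
  show "subgroup (k q) (add_monoid S)"
  proof (rule subgroup.intro)
   show "k q <= carrier (add_monoid S)" using sub by simp
   show "a *[add_monoid S] b : k q" if "a : k q" "b : k q" for a b using add[OF that] by simp
   show "1[add_monoid S] : k q"
    using k_iff[OF q, of "0[S]" "0[R]" "1[R]"] z q.one_notin ring_hom_zero_cring[OF i R.is_cring S.is_cring] ring_hom_one[OF i] by simp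
   fix a assume a: "a : k q"
   have "\<ominus>\<^bsub>S\<^esub> a : k q" unfolding neg1[OF subsetD[OF sub a]] using mult[of "\<ominus>\<^bsub>S\<^esub> 1[S]" a] a sub by auto
   thus "inv\<^bsub>add_monoid S\<^esub> a : k q" by (simp add: a_inv_def)
  qed
  show "y *[S] a : k q" "a *[S] y : k q" if "a : k q" "y : carrier S" for a y using mult that sub by auto
  show "cring S" by (rule S.is_cring)
  have "1[S] \<notin> k q" using k_iff[OF q, of "1[S]" "1[R]" "1[R]"] q.one_notin ring_hom_one[OF i] by simp
  thus "carrier S ~= k q" using S.one_closed by (metis (no_types))
  show "a : k q \<or> b : k q" if "a : carrier S" "b : carrier S" "a *[S] b : k q" for a b using mult[OF that(1,2)] that(3) by simp
 qed
qed

lemma i_k: assumes q: "q : D" shows "{a : carrier R. i a : k q} = q"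
proof -
 interpret q: prime_at q R using D_prime[OF q] by (simp add: prime_at_def)
 have "i a : k q \<longleftrightarrow> a : q" if "a : carrier R" for a
  using k_iff[OF q i_closed[OF that] that, of "1[R]"] q.one_notin ring_hom_one[OF i] i_closed[OF that] by simp
 thus ?thesis using q.Icarr by blast
qed

lemma pre_in_D: assumes P: "primeideal P S" shows "{a : carrier R. i a : P} : D"
proof -
 interpret P: primeideal P S by (rule P)
 have "i x \<notin> P"
 proof
  assume "i x : P"
  moreover obtain y where "y : carrier S" "y *[S] i x = 1[S]" using ix by (auto simp: Units_def)
  ultimately have "1[S] : P" using P.I_l_closed by metis
  thus False using P.one_imp_carrier P.I_notcarr by blast
 qed
 thus ?thesis unfolding D_def using primeideal_preimage[OF R.is_cring S.is_cring i P] by simp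
qed

lemma k_i: assumes P: "primeideal P S" shows "k {a : carrier R. i a : P} = P"
proof -
 interpret P: primeideal P S by (rule P)
 let ?q = "{a : carrier R. i a : P}"
 have q: "?q : D" by (rule pre_in_D[OF P])
 have "s : k ?q \<longleftrightarrow> s : P" if s: "s : carrier S" for s
 proof -
  obtain a t where a: "a : carrier R" "t : carrier R - ?q" "i t *[S] s = i a" using fracD[OF s q] by (elim exE conjE) (rule that)
  have t: "i t : carrier S" "i t \<notin> P" using a(2) i_closed by auto
  have "s : k ?q \<longleftrightarrow> i a : P" using k_iff[OF q s a] a(1) by simp
  also have "... \<longleftrightarrow> s : P" unfolding a(3)[symmetric] using P.I_prime[OF t(1) s] t(2) P.I_l_closed[OF _ t(1)] by blast
  finally show ?thesis .
 qed
 thus ?thesis using P.Icarr by (auto simp: k_def)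
qed

lemma val:
 assumes q: "q : Y" "Y <= D" and \<sigma>: "\<sigma> : Os (Spec R) Y"
 obtains a t where "(a, t) : loc_pairs R q" "\<sigma> q = lfrac R q (a, t)" "(i a, i t) : loc_pairs S (k q)"
  "mco (Spec_map R S i) Y \<sigma> (k q) = lfrac S (k q) (i a, i t)"
proof -
 have qD: "q : D" using q by auto
 obtain W a t where "q : W" and at: "!!r. r : W ==> (a, t) : loc_pairs R r" "!!r. r : W ==> \<sigma> r = lfrac R r (a, t)"
  by (rule Spec_section_at[OF \<sigma> q(1)]) (rule that, auto)
 hence x: "(a, t) : loc_pairs R q" "\<sigma> q = lfrac R q (a, t)" by auto
 show ?thesis
  using that[OF x] lfrac_map(1)[OF R.is_cring S.is_cring i k_prime[OF qD], of a t]
   Spec_map_val[where s = \<sigma>, OF R.is_cring S.is_cring i k_prime[OF qD], of Y a t] x q(1) unfolding i_k[OF qD] by simp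
qed

lemma bij: "bij_mor (Spec S) (open_sub (Spec R) D) (Spec_map R S i)"
proof -
 let ?f = "Spec_map R S i"
 have pf: "pre_hom (Spec S) (Spec R) ?f" by (rule Spec_map_pre_hom[OF R.is_cring S.is_cring i])
 have cf: "continuous_map (tp (Spec S)) (tp (Spec R)) (mpt ?f)" using pf by (simp add: pre_hom_def)
 have imD: "mpt ?f P : D" if "P : pts (Spec S)" for P using pre_in_D that by (simp add: Spec_pts[OF S.is_cring] Spec_map_sel)
 have c1: "continuous_map (tp (Spec S)) (subtopology (tp (Spec R)) D) (mpt ?f)"
  using cf imD by (auto simp: continuous_map_in_subtopology)
 have Dpts: "pts (open_sub (Spec R) D) = D" using openin_subset[OF D_open] by auto
 have kopen: "opn (Spec R) {q : D. k q : W}" if W: "opn (Spec S) W" for W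
 proof (subst openin_subopen, rule ballI)
  fix q assume q: "q : {q : D. k q : W}"
  obtain T where T: "T <= carrier S" "W = {P. primeideal P S & \<not> T <= P}" using W unfolding Spec_opn[OF S.is_cring] by (elim exE conjE) (rule that)
  obtain s where s: "s : T" "s \<notin> k q" using q T(2) by auto
  have sc: "s : carrier S" using s T by auto
  have qD: "q : D" using q by simp
  obtain a t where a: "a : carrier R" "t : carrier R - q" "i t *[S] s = i a" using fracD[OF sc qD] by (elim exE conjE) (rule that)
  have aq: "a \<notin> q" using k_iff[OF qD sc a] s(2) by simp
  \<comment> \<open>On this neighbourhood a/t is still a fraction for \<open>s\<close> with
    numerator outside the prime, so \<open>s\<close> stays outside \<open>k r\<close>. This gives
    continuity of \<open>k\<close>.\<close>
  let ?N = "D Int ({q. primeideal q R & a \<notin> q} Int {q. primeideal q R & t \<notin> q})"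
  have "opn (Spec R) ?N" using a by (intro openin_Int D_open basic_open_opn) simp_all
  moreover have "q : ?N" using qD aq a(2) D_prime by simp
  moreover have "?N <= {q : D. k q : W}"
  proof
   fix r assume r: "r : ?N"
   hence rD: "r : D" and ar: "a \<notin> r" and tr: "t : carrier R - r" using a(2) by auto
   have "s \<notin> k r" using k_iff[OF rD sc a(1) tr a(3)] ar by simp
   hence "\<not> T <= k r" using s(1) by auto
   thus "r : {q : D. k q : W}" using T(2) k_prime[OF rD] rD by simp
  qed
  ultimately show "EX N. opn (Spec R) N & q : N & N <= {q : D. k q : W}" by (intro exI[of _ ?N] conjI)
 qed
 have c2: "continuous_map (subtopology (tp (Spec R)) D) (tp (Spec S)) k"
  unfolding continuous_map_def
 proof (intro conjI allI impI)
  show "k : topspace (subtopology (tp (Spec R)) D) \<rightarrow> pts (Spec S)"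
   using k_prime by (auto simp: Spec_pts[OF S.is_cring])
  fix W assume W: "opn (Spec S) W"
  have "{q : topspace (subtopology (tp (Spec R)) D). k q : W} = {q : D. k q : W}" using Dpts by auto
  thus "openin (subtopology (tp (Spec R)) D) {q : topspace (subtopology (tp (Spec R)) D). k q : W}"
   using kopen[OF W] by (simp add: openin_open_subtopology[OF D_open])
 qed
 have pre: "P : preim (Spec S) ?f Y \<longleftrightarrow> primeideal P S & {a : carrier R. i a : P} : Y" for P Y
  unfolding Spec_map_sel(2)[OF S.is_cring] by simp
 have bj: "bij_betw (mco ?f Y) (Os (Spec R) Y) (Os (Spec S) (preim (Spec S) ?f Y))"
  if Y: "opn (Spec R) Y" "Y <= D" for Y
  unfolding bij_betw_def
 proof (intro conjI inj_onI)
  fix \<sigma> \<sigma>' assume \<sigma>: "\<sigma> : Os (Spec R) Y" "\<sigma>' : Os (Spec R) Y" and eq: "mco ?f Y \<sigma> = mco ?f Y \<sigma>'"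
  have "\<sigma> q = \<sigma>' q" if q: "q : Y" for q
  proof -
   have qD: "q : D" using q Y by auto
   obtain a t where a: "(a, t) : loc_pairs R q" "\<sigma> q = lfrac R q (a, t)" "(i a, i t) : loc_pairs S (k q)"
    "mco ?f Y \<sigma> (k q) = lfrac S (k q) (i a, i t)" by (rule val[OF q Y(2) \<sigma>(1)])
   obtain b u where b: "(b, u) : loc_pairs R q" "\<sigma>' q = lfrac R q (b, u)" "(i b, i u) : loc_pairs S (k q)"
    "mco ?f Y \<sigma>' (k q) = lfrac S (k q) (i b, i u)" by (rule val[OF q Y(2) \<sigma>(2)])
   have c: "a : carrier R" "t : carrier R" "b : carrier R" "u : carrier R" using a(1) b(1) by (auto simp: loc_pairs_def)
   have pk: "prime_at (k q) S" "prime_at q R" using k_prime[OF qD] D_prime[OF qD] by (simp_all add: prime_at_def)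
   have "lfrac S (k q) (i a, i t) = lfrac S (k q) (i b, i u)" using eq a(4) b(4) by simp
   hence "i a *[S] i u = i b *[S] i t" unfolding lfrac_eq_domain[OF S pk(1) a(3) b(3)] .
   hence "a *[R] u = b *[R] t" using i_eq[of "a *[R] u" "b *[R] t"] c by (simp add: ring_hom_mult[OF i])
   thus ?thesis unfolding a(2) b(2) lfrac_eq_domain[OF R pk(2) a(1) b(1)] .
  qed
  moreover have "\<sigma> : extensional Y" "\<sigma>' : extensional Y" using \<sigma> unfolding Spec_section by simp_all
  ultimately show "\<sigma> = \<sigma>'" by (intro extensionalityI)
 next
  show "mco ?f Y ` Os (Spec R) Y = Os (Spec S) (preim (Spec S) ?f Y)"
  proof (intro equalityI image_subsetI)
   show "mco ?f Y \<sigma> : Os (Spec S) (preim (Spec S) ?f Y)" if "\<sigma> : Os (Spec R) Y" for \<sigma>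
    by (rule ring_hom_closed[OF pre_homD(3)[OF pf Y(1)] that])
   show "Os (Spec S) (preim (Spec S) ?f Y) <= mco ?f Y ` Os (Spec R) Y"
   proof
    fix \<tau> assume \<tau>: "\<tau> : Os (Spec S) (preim (Spec S) ?f Y)"
    have kY: "k q : preim (Spec S) ?f Y" if "q : Y" for q
    proof -
     have "q : D" using that Y by auto
     thus ?thesis using pre k_prime i_k that by simp
    qed
    have loc: "EX N a t. opn (Spec R) N & q : N & N <= Y & (ALL r:N. (a, t) : loc_pairs R r & \<tau> (k r) = lfrac S (k r) (i a, i t))" if q: "q : Y" for q
    proof -
     have qD: "q : D" using q Y by auto
     interpret q: prime_at q R using D_prime[OF qD] by (simp add: prime_at_def)
     obtain W s1 s2 where W: "opn (Spec S) W" "k q : W" "W <= preim (Spec S) ?f Y"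
      and s: "!!P. P : W ==> (s1, s2) : loc_pairs S P" "!!P. P : W ==> \<tau> P = lfrac S P (s1, s2)"
      by (rule Spec_section_at[OF \<tau> kY[OF q]]) (rule that, auto)
     have sc: "s1 : carrier S" "s2 : carrier S" "s2 \<notin> k q" using s(1)[OF W(2)] by (auto simp: loc_pairs_def)
     obtain a1 t1 where 1: "a1 : carrier R" "t1 : carrier R - q" "i t1 *[S] s1 = i a1" using fracD[OF sc(1) qD] by (elim exE conjE) (rule that)
     obtain a2 t2 where 2: "a2 : carrier R" "t2 : carrier R - q" "i t2 *[S] s2 = i a2" using fracD[OF sc(2) qD] by (elim exE conjE) (rule that)
     have a2: "a2 : carrier R - q" using k_iff[OF qD sc(2) 2] sc(3) 2(1) by simp
     \<comment> \<open>Clearing denominators in s1/s2 with s1 = a1/t1 and s2 = a2/t2 gives (a1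
       t2)/(t1 a2). As s2 is outside \<open>k q\<close>, its numerator a2 is outside
       \<open>q\<close>, so the new denominator is admissible.\<close>
     let ?a = "a1 *[R] t2" and ?t = "t1 *[R] a2"
     have t: "?t : carrier R - q" by (rule q.den_mult[OF 1(2) a2])
     have ac: "?a : carrier R" using 1 2 by simp
     have ic: "i a1 : carrier S" "i t1 : carrier S" "i a2 : carrier S" "i t2 : carrier S" using i_closed 1 2 by auto
     have "s1 *[S] i ?t = (i t1 *[S] s1) *[S] i a2" using 1(1,2) 2(1,2) sc ic by (simp add: ring_hom_mult[OF i] S.m_ac)
     also have "... = i a1 *[S] (i t2 *[S] s2)" unfolding 1(3) 2(3) by (rule refl)
     also have "... = i ?a *[S] s2" using 1(1,2) 2(1,2) sc ic by (simp add: ring_hom_mult[OF i] S.m_ac)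
     finally have eq: "s1 *[S] i ?t = i ?a *[S] s2" .
     let ?N = "Y Int ({r : D. k r : W} Int {r. primeideal r R & ?t \<notin> r})"
     have "opn (Spec R) ?N" using t by (intro openin_Int Y(1) kopen[OF W(1)] basic_open_opn) simp
     moreover have "q : ?N" using q qD W(2) t D_prime by simp
     moreover have "ALL r:?N. (?a, ?t) : loc_pairs R r & \<tau> (k r) = lfrac S (k r) (i ?a, i ?t)"
     proof
      fix r assume r: "r : ?N"
      hence rD: "r : D" and kW: "k r : W" and tr: "?t \<notin> r" by auto
      have at: "(?a, ?t) : loc_pairs R r" using ac t tr by (simp add: loc_pairs_def)
      have at2: "(i ?a, i ?t) : loc_pairs S (k r)"
       using lfrac_map(1)[OF R.is_cring S.is_cring i k_prime[OF rD], of ?a ?t] at unfolding i_k[OF rD] .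
      have pk: "prime_at (k r) S" using k_prime[OF rD] by (simp add: prime_at_def)
      have "lfrac S (k r) (s1, s2) = lfrac S (k r) (i ?a, i ?t)"
       unfolding lfrac_eq_domain[OF S pk s(1)[OF kW] at2] by (rule eq)
      with s(2)[OF kW] at show "(?a, ?t) : loc_pairs R r & \<tau> (k r) = lfrac S (k r) (i ?a, i ?t)" by simp
     qed
     ultimately show ?thesis by (intro exI[of _ ?N] exI[of _ ?a] exI[of _ ?t] conjI) auto
    qed
    \<comment> \<open>At each point some fraction over \<open>R\<close> that maps to the value of
      \<tau> is chosen. Injectivity of \<open>i\<close> makes its class independent of the choice,
      which is \<open>\<sigma>v\<close>.\<close>
    define \<sigma> where "\<sigma> = (\<lambda>q\<in>Y. lfrac R q (SOME z. z : loc_pairs R q & \<tau> (k q) = lfrac S (k q) (i (fst z), i (snd z))))"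
    have \<sigma>v: "\<sigma> q = lfrac R q (a, t)" if q: "q : Y" and at: "(a, t) : loc_pairs R q" "\<tau> (k q) = lfrac S (k q) (i a, i t)" for q a t
    proof -
     let ?z = "SOME z. z : loc_pairs R q & \<tau> (k q) = lfrac S (k q) (i (fst z), i (snd z))"
     have qD: "q : D" using q Y by auto
     have z: "?z : loc_pairs R q" "\<tau> (k q) = lfrac S (k q) (i (fst ?z), i (snd ?z))"
      using someI[of "%z. z : loc_pairs R q & \<tau> (k q) = lfrac S (k q) (i (fst z), i (snd z))" "(a, t)"] at by simp_all
     obtain b u where bu: "?z = (b, u)" by (cases ?z)
     have b: "(b, u) : loc_pairs R q" "\<tau> (k q) = lfrac S (k q) (i b, i u)" using z unfolding bu by simp_all
     have pk: "prime_at (k q) S" "prime_at q R" using k_prime[OF qD] D_prime[OF qD] by (simp_all add: prime_at_def)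
     have m: "(i c, i v) : loc_pairs S (k q)" if "(c, v) : loc_pairs R q" for c v
      using lfrac_map(1)[OF R.is_cring S.is_cring i k_prime[OF qD], of c v] that unfolding i_k[OF qD] .
     have c: "a : carrier R" "t : carrier R" "b : carrier R" "u : carrier R" using at(1) b(1) by (auto simp: loc_pairs_def)
     have "lfrac S (k q) (i b, i u) = lfrac S (k q) (i a, i t)" using b(2) at(2) by simp
     hence "i b *[S] i t = i a *[S] i u" unfolding lfrac_eq_domain[OF S pk(1) m[OF b(1)] m[OF at(1)]] .
     hence "b *[R] t = a *[R] u" using i_eq[of "b *[R] t" "a *[R] u"] c by (simp add: ring_hom_mult[OF i])
     hence "lfrac R q (b, u) = lfrac R q (a, t)" unfolding lfrac_eq_domain[OF R pk(2) b(1) at(1)] .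
     thus ?thesis using q bu by (simp add: \<sigma>_def)
    qed
    have \<sigma>: "\<sigma> : Os (Spec R) Y"
     unfolding Spec_section
    proof (intro conjI ballI)
     fix q assume q: "q : Y"
     obtain N a t where N: "opn (Spec R) N" "q : N" "N <= Y" "ALL r:N. (a, t) : loc_pairs R r & \<tau> (k r) = lfrac S (k r) (i a, i t)"
      using loc[OF q] by (elim exE conjE) (rule that)
     have "ALL r:N. (a, t) : loc_pairs R r & \<sigma> r = lfrac R r (a, t)"
     proof
      fix r assume r: "r : N"
      show "(a, t) : loc_pairs R r & \<sigma> r = lfrac R r (a, t)" using bspec[OF N(4) r] \<sigma>v[of r a t] r N(3) by auto
     qed
     thus "EX W a t. opn (Spec R) W & q : W & W <= Y & (ALL r:W. (a, t) : loc_pairs R r & \<sigma> r = lfrac R r (a, t))"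
      using N(1-3) by (intro exI[of _ N] exI[of _ a] exI[of _ t] conjI)
    qed (simp add: \<sigma>_def)
    have "mco ?f Y \<sigma> = \<tau>"
    proof (rule extensionalityI[OF Spec_map_ext[OF S.is_cring]])
     show "\<tau> : extensional (preim (Spec S) ?f Y)" using \<tau> unfolding Spec_section by simp
     fix P assume "P : preim (Spec S) ?f Y"
     hence P: "primeideal P S" "{a : carrier R. i a : P} : Y" unfolding pre by simp_all
     let ?q = "{a : carrier R. i a : P}"
     obtain N a t where "?q : N" "ALL r:N. (a, t) : loc_pairs R r & \<tau> (k r) = lfrac S (k r) (i a, i t)"
      using loc[OF P(2)] by (elim exE conjE) (rule that)
     hence at: "(a, t) : loc_pairs R ?q" "\<tau> P = lfrac S P (i a, i t)" using k_i[OF P(1)] by (metis (no_types, lifting))+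
     have "\<sigma> ?q = lfrac R ?q (a, t)" by (rule \<sigma>v[OF P(2) at(1)]) (use at(2) k_i[OF P(1)] in simp)
     from Spec_map_val[where s = \<sigma>, OF R.is_cring S.is_cring i P at(1) this] at(2)
     show "mco ?f Y \<sigma> P = \<tau> P" by simp
    qed
    thus "\<tau> : mco ?f Y ` Os (Spec R) Y" using \<sigma> by (intro image_eqI[of _ _ \<sigma>]) simp_all
   qed
  qed
 qed
 have ph: "pre_hom (Spec S) (open_sub (Spec R) D) ?f"
  unfolding pre_hom_def open_sub_opn[OF D_open] unfolding open_sub_sel
 proof (intro conjI allI impI ballI c1)
  fix U assume "opn (Spec R) U & U <= D"
  thus "mco ?f U : ring_hom (osec (Spec R) U) (osec (Spec S) (preim (Spec S) ?f U))" using pre_homD(3)[OF pf] by simp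
 next
  fix U W s assume UW: "(opn (Spec R) U & U <= D) & (opn (Spec R) W & W <= D) & W <= U" and s: "s : Os (Spec R) U"
  show "mco ?f W (ores (Spec R) U W s) = ores (Spec S) (preim (Spec S) ?f U) (preim (Spec S) ?f W) (mco ?f U s)"
   by (rule pre_homD(4)[OF pf _ _ _ s]) (use UW in simp_all)
 qed
 show ?thesis unfolding bij_mor_def open_sub_opn[OF D_open] Dpts unfolding open_sub_sel
 proof (intro conjI ph exI[of _ k] c2 ballI allI impI)
  show "k (mpt ?f P) = P" if "P : pts (Spec S)" for P using k_i that by (simp add: Spec_pts[OF S.is_cring] Spec_map_sel)
  show "mpt ?f (k q) = q" if "q : D" for q using i_k[OF that] by (simp add: Spec_map_sel)
  show "bij_betw (mco ?f U) (Os (Spec R) U) (Os (Spec S) (preim (Spec S) ?f U))" if "opn (Spec R) U & U <= D" for U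
   using bj that by simp
 qed
qed

end


subsection \<open>Irreducibility and injectivity of restriction\<close>

lemma affine_transport:
 assumes "affine_open X U"
 obtains f k where "bij_mor (open_sub X U) (Spec (osec X U)) f"
  "ALL Y. opn X Y & Y <= U --> opn (Spec (osec X U)) {q : pts (Spec (osec X U)). k q : Y}"
  "ALL Y. opn X Y & Y <= U --> preim (open_sub X U) f {q : pts (Spec (osec X U)). k q : Y} = Y"
  "ALL x:U. mpt f x : pts (Spec (osec X U)) & k (mpt f x) = x"
proof -
 have U: "opn X U" using assms by (simp add: affine_open_def)
 obtain f where f: "lrs_iso (open_sub X U) (Spec (osec X U)) f" using assms unfolding affine_open_def by (elim conjE exE) (rule that)
 note b = lrs_iso_bij_mor[OF f]
 obtain k where k: "continuous_map (tp (Spec (osec X U))) (tp (open_sub X U)) k" "ALL x:pts (open_sub X U). k (mpt f x) = x"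
  using b unfolding bij_mor_def by (elim conjE exE) (rule that)
 have pU: "pts (open_sub X U) = U" using openin_subset[OF U] by auto
 have m: "mpt f x : pts (Spec (osec X U))" if "x : U" for x using pre_homD(2)[OF bij_morD(1)[OF b]] that unfolding pU .
 have 1: "opn (Spec (osec X U)) {q : pts (Spec (osec X U)). k q : Y}" if "opn X Y & Y <= U" for Y
  by (rule openin_continuous_map_preimage[OF k(1)]) (use that open_sub_opn[OF U] in simp)
 have 2: "preim (open_sub X U) f {q : pts (Spec (osec X U)). k q : Y} = Y" if "opn X Y & Y <= U" for Y
  unfolding preim_def pU using m k(2) that unfolding pU by auto
 show ?thesis by (rule that[OF b]) (use 1 2 m k(2) pU in auto)
qed

text \<open>Carried over to the spectrum, where equality at a single point of \<open>W\<close>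
  already forces equality everywhere.\<close>

lemma affine_sections_eq:
 assumes rs: "ring_sheaf X" and U: "affine_open X U" and dom: "domain (osec X U)"
  and Y: "opn X Y" "Y <= U" and W: "opn X W" "W <= Y" "W ~= {}"
  and st: "s : Os X Y" "t : Os X Y" "ores X Y W s = ores X Y W t"
 shows "s = t"
proof -
 let ?R = "osec X U"
 obtain f k where f: "bij_mor (open_sub X U) (Spec ?R) f"
  and 1: "ALL Y. opn X Y & Y <= U --> opn (Spec ?R) {q : pts (Spec ?R). k q : Y}"
  and 2: "ALL Y. opn X Y & Y <= U --> preim (open_sub X U) f {q : pts (Spec ?R). k q : Y} = Y"
  and 3: "ALL x:U. mpt f x : pts (Spec ?R) & k (mpt f x) = x"
  by (rule affine_transport[OF U])
 let ?Q = "%Y. {q : pts (Spec ?R). k q : Y}"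
 note pf = bij_morD(1)[OF f] and bij = bij_morD(2)[OF f]
 have WU: "W <= U" using W Y by auto
 have oY: "opn (Spec ?R) (?Q Y)" "preim (open_sub X U) f (?Q Y) = Y" using 1 2 Y by auto
 have oW: "opn (Spec ?R) (?Q W)" "preim (open_sub X U) f (?Q W) = W" using 1 2 W WU by auto
 have sub: "?Q W <= ?Q Y" using W(2) by auto
 have bY: "mco f (?Q Y) ` Os (Spec ?R) (?Q Y) = Os X Y" using bij[OF oY(1)] oY(2) by (simp add: bij_betw_def)
 have bW: "inj_on (mco f (?Q W)) (Os (Spec ?R) (?Q W))" using bij[OF oW(1)] by (simp add: bij_betw_def)
 obtain \<sigma> where \<sigma>: "\<sigma> : Os (Spec ?R) (?Q Y)" "s = mco f (?Q Y) \<sigma>" using st(1) bY by auto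
 obtain \<tau> where \<tau>: "\<tau> : Os (Spec ?R) (?Q Y)" "t = mco f (?Q Y) \<tau>" using st(2) bY by auto
 interpret P: premod "Spec ?R" "osheaf (Spec ?R)" by (rule premod_osheaf[OF Spec_pre_ring[OF domain.axioms(1)[OF dom]]])
 have "mco f (?Q W) (ores (Spec ?R) (?Q Y) (?Q W) \<sigma>) = mco f (?Q W) (ores (Spec ?R) (?Q Y) (?Q W) \<tau>)"
  using pre_homD(4)[OF pf oY(1) oW(1) sub \<sigma>(1)] pre_homD(4)[OF pf oY(1) oW(1) sub \<tau>(1)] oY(2) oW(2) st(3) \<sigma>(2) \<tau>(2) by simp
 hence eq: "ores (Spec ?R) (?Q Y) (?Q W) \<sigma> = ores (Spec ?R) (?Q Y) (?Q W) \<tau>"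
  by (rule inj_onD[OF bW _ P.ores_closed[OF oY(1) oW(1) sub \<sigma>(1)] P.ores_closed[OF oY(1) oW(1) sub \<tau>(1)]])
 obtain w where w: "w : W" using W(3) by blast
 have q: "mpt f w : ?Q W" using 3 w WU by auto
 have "\<sigma> (mpt f w) = \<tau> (mpt f w)" using fun_cong[OF eq, of "mpt f w"] q by (simp add: Spec_sel)
 with Spec_sections_eq[OF dom \<sigma>(1) \<tau>(1), of "mpt f w"] have "\<sigma> = \<tau>" using q sub by auto
 thus ?thesis using \<sigma> \<tau> by simp
qed

text \<open>Both sets contain the point of \<open>U\<close> that corresponds to the zero
  ideal.\<close>

lemma affine_meet:
 assumes U: "affine_open X U" and dom: "domain (osec X U)"
  and Y: "opn X Y" "Y <= U" "Y ~= {}" and W: "opn X W" "W <= U" "W ~= {}"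
 shows "Y Int W ~= {}"
proof -
 let ?R = "osec X U"
 obtain f k where "bij_mor (open_sub X U) (Spec ?R) f"
  and 1: "ALL Y. opn X Y & Y <= U --> opn (Spec ?R) {q : pts (Spec ?R). k q : Y}"
  and "ALL Y. opn X Y & Y <= U --> preim (open_sub X U) f {q : pts (Spec ?R). k q : Y} = Y"
  and 3: "ALL x:U. mpt f x : pts (Spec ?R) & k (mpt f x) = x"
  by (rule affine_transport[OF U])
 have "k {0[?R]} : Z" if Z: "opn X Z" "Z <= U" "Z ~= {}" for Z
 proof -
  obtain z where z: "z : Z" using Z by blast
  have o: "opn (Spec ?R) {q : pts (Spec ?R). k q : Z}" using 1 Z by simp
  have "mpt f z : {q : pts (Spec ?R). k q : Z}" using 3 z Z(2) by auto
  with generic_point(2)[OF dom o] show ?thesis by blast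
 qed
 from this[OF Y] this[OF W] show ?thesis by blast
qed

text \<open>The consequences of integrality that are used: nonempty open sets are dense, and
  restriction to them is injective. They are singled out because for \<open>V\<close> they come from
  a suitable affine cover.\<close>

locale irr = rsheaf X for X :: "('p, 'a) rspace" +
 assumes sections_eq: "[|opn X U; opn X W; W <= U; W ~= {}; s : Os X U; t : Os X U;
   ores X U W s = ores X U W t|] ==> s = t"
  and meet: "[|opn X U; opn X W; U ~= {}; W ~= {}|] ==> U Int W ~= {}"

text \<open>Within one affine set of the cover both properties follow from the generic point. Since
  any two sets of the cover meet, density spreads from one to the other, and injectivity of
  restriction is then local.\<close>

lemma irrI:
 assumes rs: "ring_sheaf X" and A: "!!U. U : \<U> ==> affine_open X U" "!!U. U : \<U> ==> domain (osec X U)"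
  and cover: "!!p. p : pts X ==> EX U:\<U>. p : U" and int: "!!U W. U : \<U> ==> W : \<U> ==> U Int W ~= {}"
 shows "irr X"
proof -
 interpret rsheaf X by unfold_locales (rule rs)
 have Ao: "opn X U" if "U : \<U>" for U using A(1)[OF that] by (simp add: affine_open_def)
 have meet: "U Int W ~= {}" if U: "opn X U" "U ~= {}" and W: "opn X W" "W ~= {}" for U W
 proof -
  obtain u where u: "u : U" using U by blast
  obtain w where w: "w : W" using W by blast
  obtain A1 where A1: "A1 : \<U>" "u : A1" using cover[of u] openin_subset[OF U(1)] u by blast
  obtain A2 where A2: "A2 : \<U>" "w : A2" using cover[of w] openin_subset[OF W(1)] w by blast
  \<comment> \<open>From \<open>U\<close> one passes inside \<open>A1\<close> to the intersection of
    \<open>A1\<close> and \<open>A2\<close>, and from there inside \<open>A2\<close> to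
    \<open>W\<close>.\<close>
  have 1: "(U Int A1) Int (A1 Int A2) ~= {}"
   by (rule affine_meet[OF A(1,2)[OF A1(1)]]) (use U Ao A1 A2 u int in auto)
  have "(U Int A1 Int A2) Int (W Int A2) ~= {}"
   by (rule affine_meet[OF A(1,2)[OF A2(1)]]) (use U W Ao A1 A2 w 1 in auto)
  thus ?thesis by blast
 qed
 show ?thesis
 proof (unfold_locales, rule sheaf_eqI[OF osh])
  fix U W s t p assume h: "opn X U" "opn X W" "W <= U" "W ~= {}" "s : Os X U" "t : Os X U" "ores X U W s = ores X U W t"
  show "opn X U" "s : Os X U" "t : Os X U" by fact+
  assume p: "p : U"
  obtain B where B: "B : \<U>" "p : B" using cover[of p] openin_subset[OF h(1)] p by blast
  let ?Y = "U Int B" and ?Z = "W Int B"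
  have o: "opn X ?Y" "opn X ?Z" "?Y <= U" "?Z <= W" "?Z <= ?Y" "?Z <= U" using h Ao[OF B(1)] by auto
  have ne: "?Z ~= {}" using meet[OF h(2,4) Ao[OF B(1)]] B(2) by blast
  have "ores X U ?Y s = ores X U ?Y t"
  proof (rule affine_sections_eq[OF rs A(1,2)[OF B(1)] o(1) _ o(2,5) ne])
   show "?Y <= B" by simp
   show "ores X U ?Y s : Os X ?Y" "ores X U ?Y t : Os X ?Y"
    by (rule ores_in[OF h(1) o(1,3) h(5)], rule ores_in[OF h(1) o(1,3) h(6)])
   show "ores X ?Y ?Z (ores X U ?Y s) = ores X ?Y ?Z (ores X U ?Y t)"
    unfolding ores_ores[OF h(1) o(1,2,5,3) h(5)] ores_ores[OF h(1) o(1,2,5,3) h(6)]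
    using ores_ores[OF h(1,2) o(2,4) h(3,5)] ores_ores[OF h(1,2) o(2,4) h(3,6)] h(7) by simp
  qed
  thus "EX Y. opn X Y & p : Y & Y <= U & ores X U Y s = ores X U Y t" using o p B(2) by (intro exI[of _ ?Y] conjI) auto
 next
  show "U Int W ~= {}" if "opn X U" "opn X W" "U ~= {}" "W ~= {}" for U W using meet that by blast
 qed
qed

text \<open>Restriction embeds the ring over \<open>Y\<close> into the domain over
  \<open>U\<close>.\<close>

lemma (in irr) domain_sections:
 assumes Y: "opn X Y" and U: "opn X U" "U <= Y" "U ~= {}" and dom: "domain (osec X U)"
 shows "domain (osec X Y)"
proof -
 interpret Y: cring "osec X Y" by (rule cr[OF Y])
 interpret U: domain "osec X U" by (rule dom)
 note r = ores_ops[OF Y U(1,2)] and ri = ores_in[OF Y U(1,2)]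
 have z: "a = 0[osec X Y]" if "a : Os X Y" "ores X Y U a = 0[osec X U]" for a
  by (rule sections_eq[OF Y U that(1) Y.zero_closed]) (use that(2) r(4) in simp)
 show ?thesis
 proof (unfold_locales)
  show "1[osec X Y] ~= 0[osec X Y]" using r(3,4) U.one_not_zero by metis
  fix a b assume ab: "a *[osec X Y] b = 0[osec X Y]" "a : Os X Y" "b : Os X Y"
  hence "ores X Y U a *[osec X U] ores X Y U b = 0[osec X U]" using r(2)[OF ab(2,3)] r(4) by simp
  hence "ores X Y U a = 0[osec X U] \<or> ores X Y U b = 0[osec X U]" using U.integral[OF _ ri[OF ab(2)] ri[OF ab(3)]] by simp
  thus "a = 0[osec X Y] \<or> b = 0[osec X Y]" using z ab by blast
 qed
qed

lemma integral_schemeD: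
 assumes "integral_scheme X"
 shows "lrs X" "ring_sheaf X" "pts X ~= {}" "[|opn X U; U ~= {}|] ==> domain (osec X U)" "p : pts X ==> EX U. affine_open X U & p : U"
 using assms by (simp_all add: integral_scheme_def scheme_def lrs_def)

text \<open>If two nonempty open sets were disjoint, the ring over their union would contain the
  sections (1, 0) and (0, 1), which are nonzero with product zero.\<close>

lemma integral_irr:
 assumes X: "integral_scheme X" shows "irr X"
proof -
 interpret rsheaf X by unfold_locales (rule integral_schemeD(2)[OF X])
 show ?thesis
 proof (rule irrI[OF rs, where \<U> = "{U. affine_open X U & U ~= {}}"])
  fix U W assume "U : {U. affine_open X U & U ~= {}}" "W : {U. affine_open X U & U ~= {}}"
  hence U: "opn X U" "U ~= {}" and W: "opn X W" "W ~= {}" by (auto simp: affine_open_def)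
  show "U Int W ~= {}"
  proof
   assume e: "U Int W = {}"
   let ?Y = "U Un W"
   have o: "opn X ?Y" "U <= ?Y" "W <= ?Y" "?Y ~= {}" using U W by auto
   interpret Y: domain "osec X ?Y" by (rule integral_schemeD(4)[OF X o(1,4)])
   interpret U: domain "osec X U" by (rule integral_schemeD(4)[OF X U])
   interpret W: domain "osec X W" by (rule integral_schemeD(4)[OF X W])
   have glue: "EX c. c : Os X ?Y & ores X ?Y U c = a & ores X ?Y W c = b"
    if ab: "a : Os X U" "b : Os X W" for a b
   proof -
    have ne: "U ~= W" using e U(2) by blast
    have "EX! c. c : Os X (\<Union>{U, W}) & (ALL Z:{U, W}. ores X (\<Union>{U, W}) Z c = (if Z = U then a else b))"
    proof (rule is_sheafD[OF osh])
     fix A B assume AB: "A : {U, W}" "B : {U, W}"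
     hence oA: "opn X A" "opn X B" and c: "(if A = U then a else b) : Os X A" "(if B = U then a else b) : Os X B" using U W ab ne by auto
     show "ores X A (A Int B) (if A = U then a else b) = ores X B (A Int B) (if B = U then a else b)"
     proof (cases "A = B")
      case False
      hence "A Int B = {}" using AB e by auto
      thus ?thesis using osec_empty ores_in[OF oA(1) openin_empty _ c(1)] ores_in[OF oA(2) openin_empty _ c(2)] by auto
     qed simp
    qed (use U W ab ne in auto)
    thus ?thesis using ne by (elim ex1E) auto
   qed
   obtain c where c: "c : Os X ?Y" "ores X ?Y U c = 1[osec X U]" "ores X ?Y W c = 0[osec X W]"
    using glue[OF U.one_closed W.zero_closed] by (elim exE conjE) (rule that)
   obtain d where d: "d : Os X ?Y" "ores X ?Y U d = 0[osec X U]" "ores X ?Y W d = 1[osec X W]"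
    using glue[OF U.zero_closed W.one_closed] by (elim exE conjE) (rule that)
   note rU = ores_ops[OF o(1) U(1) o(2)] and rW = ores_ops[OF o(1) W(1) o(3)]
   have "c *[osec X ?Y] d = 0[osec X ?Y]"
   proof (rule sheaf_eqI[OF osh o(1)])
    fix p assume "p : ?Y"
    thus "EX Z. opn X Z & p : Z & Z <= ?Y & ores X ?Y Z (c *[osec X ?Y] d) = ores X ?Y Z 0[osec X ?Y]"
    proof
     assume "p : U"
     thus ?thesis using U o rU(2)[OF c(1) d(1)] rU(4) c(2) d(2) by (intro exI[of _ U]) simp
    next
     assume "p : W"
     thus ?thesis using W o rW(2)[OF c(1) d(1)] rW(4) c(3) d(3) by (intro exI[of _ W]) simp
    qed
   qed (use c d in simp_all)
   hence "c = 0[osec X ?Y] \<or> d = 0[osec X ?Y]" using Y.integral[OF _ c(1) d(1)] by simp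
   thus False using c(2) d(3) rU(4) rW(4) by auto
  qed
 next
  fix U assume "U : {U. affine_open X U & U ~= {}}"
  thus "affine_open X U" "domain (osec X U)" using integral_schemeD(4)[OF X, of U] by (simp_all add: affine_open_def)
 next
  fix p assume "p : pts X"
  from integral_schemeD(5)[OF X this] show "EX U:{U. affine_open X U & U ~= {}}. p : U" by blast
 qed
qed

text \<open>Affine open sets form a base: inside an affine open set, the basic open subset defined by \<open>x\<close> is again
  affine. Since the ring is a domain, a section is a quotient of elements of the ring near a point, and
  clearing the denominator is an identity of global sections.\<close>

lemma affine_base:
 assumes X: "integral_scheme X" and N: "opn X N" "p : N"
 obtains W where "affine_open X W" "p : W" "W <= N"
proof -
 interpret irr X by (rule integral_irr[OF X])
 have "p : pts X" using N openin_subset by blast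
 from integral_schemeD(5)[OF X this] obtain U where U: "affine_open X U" "p : U" by (elim exE conjE) (rule that)
 have oU: "opn X U" using U(1) by (simp add: affine_open_def)
 let ?R = "osec X U"
 have R: "domain ?R" using integral_schemeD(4)[OF X oU] U(2) by blast
 interpret R: domain ?R by (rule R)
 obtain f k where f: "bij_mor (open_sub X U) (Spec ?R) f"
  and 1: "ALL Y. opn X Y & Y <= U --> opn (Spec ?R) {q : pts (Spec ?R). k q : Y}"
  and 3: "ALL x:U. mpt f x : pts (Spec ?R) & k (mpt f x) = x"
  by (rule affine_transport[OF U(1)]) (rule that)
 note pf = bij_morD(1)[OF f]
 let ?N = "{q : pts (Spec ?R). k q : N Int U}"
 have oN: "opn (Spec ?R) ?N" using 1 N(1) oU by auto
 obtain T where T: "T <= carrier ?R" "?N = {q. primeideal q ?R & \<not> T <= q}" using oN unfolding Spec_opn[OF R.is_cring] by (elim exE conjE) (rule that)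
 have "mpt f p : ?N" using 3 U(2) N(2) by auto
 \<comment> \<open>One of the elements that define the given neighbourhood. Its basic open set
   contains the point and lies inside the neighbourhood.\<close>
 then obtain x where x: "x : T" "x \<notin> mpt f p" unfolding T(2) by blast
 have xR: "x : carrier ?R" using x T by auto
 define D where "D = {q. primeideal q ?R & x \<notin> q}"
 have oD: "opn (Spec ?R) D" unfolding D_def Spec_opn[OF R.is_cring] by (rule exI[of _ "{x}"]) (use xR in simp)
 have pD: "mpt f p : D" using 3 U(2) x(2) by (simp add: D_def Spec_pts[OF R.is_cring])
 have DN: "D <= ?N" unfolding T(2) D_def using x(1) by blast
 let ?W = "preim (open_sub X U) f D"
 have W': "opn (open_sub X U) ?W" by (rule pre_homD(1)[OF pf oD])
 hence W: "opn X ?W" "?W <= U" using open_sub_opn[OF oU] by simp_all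
 have pW: "p : ?W" using pD U(2) openin_subset[OF oU] by (auto simp: preim_def)
 have WN: "?W <= N"
 proof
  fix y assume "y : ?W"
  hence y: "y : U" "mpt f y : D" using W(2) by (auto simp: preim_def)
  hence "k (mpt f y) : N" using DN by auto
  thus "y : N" using 3 y(1) by simp
 qed
 let ?S = "osec X ?W"
 have S: "domain ?S" using integral_schemeD(4)[OF X W(1)] pW by blast
 interpret S: domain ?S by (rule S)
 have mh: "mco f D : ring_hom (osec (Spec ?R) D) ?S" using pre_homD(3)[OF pf oD] by simp
 have mb: "bij_betw (mco f D) (Os (Spec ?R) D) (carrier ?S)" using bij_morD(2)[OF f oD] by simp
 have prR: "pre_ring (Spec ?R)" by (rule Spec_pre_ring[OF R.is_cring])
 have Dp: "prime_at q ?R" if "q : D" for q using that by (simp add: D_def prime_at_def)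
 have sec: "(\<lambda>q\<in>D. lfrac ?R q (a, t)) : Os (Spec ?R) D" if at: "!!q. q : D ==> (a, t) : loc_pairs ?R q" for a t
  unfolding Spec_section
 proof (intro conjI ballI)
  fix q assume q: "q : D"
  show "EX W b u. opn (Spec ?R) W & q : W & W <= D & (ALL r:W. (b, u) : loc_pairs ?R r & (\<lambda>q\<in>D. lfrac ?R q (a, t)) r = lfrac ?R r (b, u))"
   using oD q at by (intro exI[of _ D] exI[of _ a] exI[of _ t]) simp
 qed simp
 define c where "c r = (\<lambda>q\<in>D. lfrac ?R q (r, 1[?R]))" for r
 have cp: "(r, 1[?R]) : loc_pairs ?R q" if "r : carrier ?R" "q : D" for r q
  using that prime_at.one_notin[OF Dp] by (simp add: loc_pairs_def)
 have cin: "c r : Os (Spec ?R) D" if "r : carrier ?R" for r unfolding c_def by (rule sec[OF cp[OF that]])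
 have chom: "c : ring_hom ?R (osec (Spec ?R) D)"
 proof (rule ring_hom_memI[OF cin])
  fix r r' assume r: "r : carrier ?R" "r' : carrier ?R"
  show "c (r *[?R] r') = c r *[osec (Spec ?R) D] c r'"
  proof (rule ext)
   fix q show "c (r *[?R] r') q = (c r *[osec (Spec ?R) D] c r') q"
    using prime_at.frac_mult[OF Dp cp[OF r(1)] cp[OF r(2)], of q] by (cases "q : D") (simp_all add: Spec_sel c_def)
  qed
  show "c (r +[?R] r') = c r +[osec (Spec ?R) D] c r'"
  proof (rule ext)
   fix q show "c (r +[?R] r') q = (c r +[osec (Spec ?R) D] c r') q"
    using prime_at.frac_add[OF Dp cp[OF r(1)] cp[OF r(2)], of q] r by (cases "q : D") (simp_all add: Spec_sel c_def)
  qed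
 qed (simp_all add: c_def Spec_sel)
 \<comment> \<open>An element r of the ring goes to the fraction r/1 over the basic open set, and
   from there to a section over the corresponding subset of \<open>X\<close>.\<close>
 let ?i = "%r. mco f D (c r)"
 have i: "?i : ring_hom ?R ?S" using ring_hom_trans[OF chom mh] by (simp add: comp_def)
 interpret bo: basic_open ?R ?S ?i x
 proof (unfold_locales, rule i)
  show "inj_on ?i (carrier ?R)"
  proof (rule inj_onI)
   fix r r' assume r: "r : carrier ?R" "r' : carrier ?R" "?i r = ?i r'"
   have "c r = c r'" using inj_onD[OF bij_betw_imp_inj_on[OF mb] r(3) cin[OF r(1)] cin[OF r(2)]] .
   hence "c r (mpt f p) = c r' (mpt f p)" by (rule fun_cong)
   hence "lfrac ?R (mpt f p) (r, 1[?R]) = lfrac ?R (mpt f p) (r', 1[?R])" using pD by (simp add: c_def)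
   thus "r = r'" using lfrac_eq_domain[OF R Dp[OF pD] cp[OF r(1) pD] cp[OF r(2) pD]] r by simp
  qed
  show "x : carrier ?R" by (rule xR)
  \<comment> \<open>The section 1/x, which becomes the inverse of the image of
    \<open>x\<close>.\<close>
  let ?j = "\<lambda>q\<in>D. lfrac ?R q (1[?R], x)"
  have xp: "(1[?R], x) : loc_pairs ?R q" if "q : D" for q using that xR by (simp add: D_def loc_pairs_def)
  have jin: "?j : Os (Spec ?R) D" by (rule sec[OF xp])
  have "?j *[osec (Spec ?R) D] c x = 1[osec (Spec ?R) D]"
  proof (rule ext)
   fix q show "(?j *[osec (Spec ?R) D] c x) q = 1[osec (Spec ?R) D] q"
   proof (cases "q : D")
    case q: True
    have 1: "(1[?R] *[?R] x, x *[?R] 1[?R]) : loc_pairs ?R q" by (rule prime_at.loc_pairs_ops(1)[OF Dp[OF q] xp[OF q] cp[OF xR q]])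
    have "lfrac ?R q (1[?R] *[?R] x, x *[?R] 1[?R]) = lfrac ?R q (1[?R], 1[?R])"
     unfolding lfrac_eq_domain[OF R Dp[OF q] 1 cp[OF R.one_closed q]] using xR by simp
    thus ?thesis using q prime_at.frac_mult[OF Dp[OF q] xp[OF q] cp[OF xR q]] by (simp add: Spec_sel c_def)
   qed (simp add: Spec_sel)
  qed
  hence "mco f D ?j *[?S] ?i x = 1[?S]" using ring_hom_mult[OF mh jin cin[OF xR]] ring_hom_one[OF mh] by simp
  moreover have "mco f D ?j : carrier ?S" "?i x : carrier ?S" using ring_hom_closed[OF mh] jin cin[OF xR] by simp_all
  ultimately show "?i x : Units ?S" using S.m_comm unfolding Units_def by (auto intro!: bexI[of _ "mco f D ?j"])
  fix s q assume s: "s : carrier ?S" and "primeideal q ?R" "x \<notin> q"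
  hence q: "q : D" by (simp add: D_def)
  obtain \<sigma> where \<sigma>: "\<sigma> : Os (Spec ?R) D" "s = mco f D \<sigma>" using s mb unfolding bij_betw_def by blast
  obtain Y a t where "q : Y" "ALL r:Y. (a, t) : loc_pairs ?R r & \<sigma> r = lfrac ?R r (a, t)"
   by (rule Spec_section_at[OF \<sigma>(1) q]) (rule that, auto)
  hence at: "(a, t) : loc_pairs ?R q" "\<sigma> q = lfrac ?R q (a, t)" by auto
  have ac: "a : carrier ?R" "t : carrier ?R - q" using at(1) by (auto simp: loc_pairs_def)
  have tc: "t : carrier ?R" using ac by simp
  have "c t *[osec (Spec ?R) D] \<sigma> = c a"
  proof (rule Spec_sections_eq[OF R pre_ringD(3)[OF prR oD cin[OF tc] \<sigma>(1)] cin[OF ac(1)] q])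
   have 1: "(t *[?R] a, 1[?R] *[?R] t) : loc_pairs ?R q" by (rule prime_at.loc_pairs_ops(1)[OF Dp[OF q] cp[OF tc q] at(1)])
   have "lfrac ?R q (t *[?R] a, 1[?R] *[?R] t) = lfrac ?R q (a, 1[?R])"
    unfolding lfrac_eq_domain[OF R Dp[OF q] 1 cp[OF ac(1) q]] using ac(1) tc by (simp add: R.m_comm)
   thus "(c t *[osec (Spec ?R) D] \<sigma>) q = c a q"
    using q prime_at.frac_mult[OF Dp[OF q] cp[OF tc q] at(1)] at(2) by (simp add: Spec_sel c_def)
  qed
  hence "?i t *[?S] s = ?i a" using ring_hom_mult[OF mh cin[OF tc] \<sigma>(1)] \<sigma>(2) by simp
  thus "EX a t. a : carrier ?R & t : carrier ?R - q & ?i t *[?S] s = ?i a" using ac by (intro exI[of _ a] exI[of _ t] conjI)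
 qed
 have DD: "D = bo.D" by (simp add: D_def bo.D_def)
 have prD: "pre_ring (open_sub (Spec ?R) D)" by (rule open_sub_pre_ring[OF prR oD])
 have prS: "pre_ring (Spec ?S)" by (rule Spec_pre_ring[OF S.is_cring])
 have "lrs_iso (Spec ?S) (open_sub (Spec ?R) D) (Spec_map ?R ?S ?i)"
  by (rule bij_mor_lrs_iso[OF prS prD]) (use bo.bij DD in simp)
 from lrs_iso_sym[OF this] obtain g where "lrs_iso (open_sub (Spec ?R) D) (Spec ?S) g" by (elim exE) (rule that)
 note g = lrs_iso_bij_mor[OF this]
 have eq: "open_sub (open_sub X U) ?W = open_sub X ?W"
  using W(2) by (simp add: open_sub_def subtopology_subtopology Int_absorb1)
 have "bij_mor (open_sub X ?W) (open_sub (Spec ?R) D) f" using bij_mor_restrict[OF f oD] unfolding eq .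
 from bij_mor_lrs_iso[OF open_sub_pre_ring[OF pre_ring_X W(1)] prS bij_mor_comp[OF this g]]
 have "affine_open X ?W" using W(1) unfolding affine_open_def by (intro conjI exI)
 thus ?thesis by (rule that[OF _ pW WN])
qed

section \<open>Homomorphisms of sheaves of modules\<close>

lemma mod_homD:
 assumes "f : mod_hom X F G" "opn X U"
 shows "s : Ms F U ==> f U s : Ms G U"
  "[|s : Ms F U; t : Ms F U|] ==> f U (s +[msec F U] t) = f U s +[msec G U] f U t"
  "[|a : Os X U; s : Ms F U|] ==> f U (a *.[msec F U] s) = a *.[msec G U] f U s"
  "[|opn X W; W <= U; s : Ms F U|] ==> f W (mres F U W s) = mres G U W (f U s)"
 using assms unfolding mod_hom_def by (auto simp: PiE_iff)

lemma mod_hom_eqI: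
 assumes f: "f : mod_hom X F G" and g: "g : mod_hom X F G"
  and eq: "!!U s. opn X U ==> s : Ms F U ==> f U s = g U s"
 shows "f = g"
proof
 fix U show "f U = g U"
 proof (cases "opn X U")
  case True
  have "f U : Ms F U \<rightarrow>\<^sub>E Ms G U" "g U : Ms F U \<rightarrow>\<^sub>E Ms G U"
   using f g True unfolding mod_hom_def by auto
  thus ?thesis using eq[OF True] by (rule PiE_ext)
 next
  case False
  have "f : extensional {U. opn X U}" "g : extensional {U. opn X U}" using f g unfolding mod_hom_def by auto
  thus ?thesis using False unfolding extensional_def by auto
 qed
qed

lemma mod_homI:
 assumes "!!U s. [|opn X U; s : Ms F U|] ==> \<phi> U s : Ms G U"
  "!!U s t. [|opn X U; s : Ms F U; t : Ms F U|] ==> \<phi> U (s +[msec F U] t) = \<phi> U s +[msec G U] \<phi> U t"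
  "!!U a s. [|opn X U; a : Os X U; s : Ms F U|] ==> \<phi> U (a *.[msec F U] s) = a *.[msec G U] \<phi> U s"
  "!!U W s. [|opn X U; opn X W; W <= U; s : Ms F U|] ==> \<phi> W (mres F U W s) = mres G U W (\<phi> U s)"
  and F: "ring_sheaf X" "mod_sheaf X F"
 shows "(\<lambda>U\<in>{U. opn X U}. \<lambda>s\<in>Ms F U. \<phi> U s) : mod_hom X F G"
proof -
 interpret F: modsheaf X F by unfold_locales (fact F)+
 show ?thesis unfolding mod_hom_def using assms(1-4)
  by (auto simp: F.add_closed F.smult_closed F.res_closed)
qed

lemma hom_apply:
 assumes "opn X U" "s : Ms F U"
 shows "hom_id X F U s = s" "hom_comp X F g f U s = g U (f U s)"
  "hom_add X F G f g U s = f U s +[msec G U] g U s"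
  "hom_smult X F G a f U s = ores X (pts X) U a *.[msec G U] f U s"
 using assms by (simp_all add: hom_id_def hom_comp_def hom_add_def hom_smult_def)

section \<open>Operations on homomorphisms\<close>

context rsheaf begin

lemma hom_id_in: "mod_sheaf X F ==> hom_id X F : mod_hom X F F"
 unfolding hom_id_def by (rule mod_homI) (auto intro: rs)

lemma hom_comp_in:
 assumes "mod_sheaf X F" and f: "f : mod_hom X F G" and g: "g : mod_hom X G H"
 shows "hom_comp X F g f : mod_hom X F H"
 unfolding hom_comp_def
 by (rule mod_homI[OF _ _ _ _ rs assms(1)]) (simp_all add: mod_homD[OF f] mod_homD[OF g])

lemma hom_add_in:
 assumes F: "mod_sheaf X F" and G: "mod_sheaf X G" and f: "f : mod_hom X F G" and g: "g : mod_hom X F G"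
 shows "hom_add X F G f g : mod_hom X F G"
proof -
 interpret G: modsheaf X G by unfold_locales (fact G)
 show ?thesis unfolding hom_add_def
 proof (rule mod_homI[OF _ _ _ _ rs F])
  fix U s assume U: "opn X U" and s: "s : Ms F U"
  interpret M: module "osec X U" "msec G U" by (rule G.md[OF U])
  note fs = mod_homD(1)[OF f U] mod_homD(1)[OF g U]
  show "f U s +[msec G U] g U s : Ms G U" using fs s by simp
  { fix t assume t: "t : Ms F U"
   show "f U (s +[msec F U] t) +[msec G U] g U (s +[msec F U] t) = f U s +[msec G U] g U s +[msec G U] (f U t +[msec G U] g U t)"
    using fs s t mod_homD(2)[OF f U s t] mod_homD(2)[OF g U s t] by (simp add: M.M.add.m_ac) }
  { fix a assume a: "a : Os X U"
   show "f U (a *.[msec F U] s) +[msec G U] g U (a *.[msec F U] s) = a *.[msec G U] (f U s +[msec G U] g U s)"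
    using fs s a mod_homD(3)[OF f U a s] mod_homD(3)[OF g U a s] by (simp add: M.smult_r_distr) }
  { fix W assume W: "opn X W" "W <= U"
   show "f W (mres F U W s) +[msec G W] g W (mres F U W s) = mres G U W (f U s +[msec G U] g U s)"
    using mod_homD(4)[OF f U W s] mod_homD(4)[OF g U W s] G.res_add[OF U W fs(1)[OF s] fs(2)[OF s]] by simp }
 qed
qed

lemma hom_smult_in:
 assumes F: "mod_sheaf X F" and G: "mod_sheaf X G" and f: "f : mod_hom X F G" and c: "c : Os X (pts X)"
 shows "hom_smult X F G c f : mod_hom X F G"
proof -
 interpret G: modsheaf X G by unfold_locales (fact G)
 show ?thesis unfolding hom_smult_def
 proof (rule mod_homI[OF _ _ _ _ rs F])
  fix U s assume U: "opn X U" and s: "s : Ms F U"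
  interpret M: module "osec X U" "msec G U" by (rule G.md[OF U])
  note UX = openin_subset[OF U]
  note cU = ores_in[OF openin_pts U UX c]
  note fs = mod_homD(1)[OF f U]
  show "ores X (pts X) U c *.[msec G U] f U s : Ms G U" using fs s cU by simp
  { fix t assume t: "t : Ms F U"
   show "ores X (pts X) U c *.[msec G U] f U (s +[msec F U] t) = ores X (pts X) U c *.[msec G U] f U s +[msec G U] ores X (pts X) U c *.[msec G U] f U t"
    using fs s t cU mod_homD(2)[OF f U s t] by (simp add: M.smult_r_distr) }
  { fix a assume a: "a : Os X U"
   show "ores X (pts X) U c *.[msec G U] f U (a *.[msec F U] s) = a *.[msec G U] (ores X (pts X) U c *.[msec G U] f U s)"
    using fs s a cU mod_homD(3)[OF f U a s] by (simp add: M.smult_assoc1[symmetric] M.R.m_comm) }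
  { fix W assume W: "opn X W" "W <= U"
   show "ores X (pts X) W c *.[msec G W] f W (mres F U W s) = mres G U W (ores X (pts X) U c *.[msec G U] f U s)"
    using mod_homD(4)[OF f U W s] G.res_smult[OF U W cU fs(1)[OF s]] ores_ores[OF openin_pts U W(1,2) UX c] by simp }
 qed
qed

lemma line_bundle_modsheaf: "line_bundle X F ==> modsheaf X F"
 unfolding line_bundle_def by unfold_locales (elim conjE)

text \<open>On a set with generator e the endomorphism is multiplication by the coefficient c with
  f(e) = c e. On overlaps two such scalars act in the same way on a generator, hence agree, and they
  glue to a global function.\<close>

lemma line_bundle_endo:
 assumes F: "line_bundle X F" and f: "f : mod_hom X F F"
 obtains a where "a : Os X (pts X)" "f = hom_smult X F F a (hom_id X F)"
proof -
 interpret F: modsheaf X F by (rule line_bundle_modsheaf[OF F])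
 let ?I = "{(U, e). free_gen X F U e}"
 have ex: "EX c. c : Os X U & f U e = c *.[msec F U] e" if h: "free_gen X F U e" for U e
 proof -
  note U = free_genD(1,2)[OF h]
  obtain c where "c : Os X U" "f U e = c *.[msec F U] mres F U U e"
   by (rule free_gen_coef[OF h U(1) order_refl mod_homD(1)[OF f U]])
  thus ?thesis using F.res_id[OF U] by auto
 qed
 define c where "c = (%(U, e). SOME c. c : Os X U & f U e = c *.[msec F U] e)"
 have c: "c (U, e) : Os X U" "f U e = c (U, e) *.[msec F U] e" if h: "free_gen X F U e" for U e
  using someI_ex[OF ex[OF h]] by (auto simp: c_def)
 \<comment> \<open>A section over a subset of \<open>U\<close> is a multiple of the generator, so
   linearity and commutativity make \<open>f\<close> act on it by the same scalar.\<close>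
 have act: "f W s = ores X U W (c (U, e)) *.[msec F W] s"
  if h: "free_gen X F U e" "opn X W" "W <= U" "s : Ms F W" for U e W s
 proof -
  note U = free_genD(1,2)[OF h(1)]
  obtain d where d: "d : Os X W" "s = d *.[msec F W] mres F U W e"
   by (rule free_gen_coef[OF h])
  interpret M: module "osec X W" "msec F W" by (rule F.md[OF h(2)])
  note eW = F.res_closed[OF U(1) h(2,3) U(2)]
  note cW = ores_in[OF U(1) h(2,3) c(1)[OF h(1)]]
  have "f W s = d *.[msec F W] mres F U W (f U e)"
   unfolding d(2) mod_homD(3)[OF f h(2) d(1) eW] mod_homD(4)[OF f U(1) h(2,3) U(2)] ..
  also have "... = d *.[msec F W] (ores X U W (c (U, e)) *.[msec F W] mres F U W e)"
   unfolding c(2)[OF h(1)] F.res_smult[OF U(1) h(2,3) c(1)[OF h(1)] U(2)] ..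
  also have "... = ores X U W (c (U, e)) *.[msec F W] s"
   unfolding d(2) using M.smult_assoc1[OF d(1) cW eW] M.smult_assoc1[OF cW d(1) eW] M.R.m_comm[OF d(1) cW] by simp
  finally show ?thesis .
 qed
 obtain a where a: "a : Os X (pts X)" "!!i. i : ?I ==> ores X (pts X) (fst i) a = c i"
 proof (rule sheaf_glue[OF osh, of ?I fst c "pts X"])
  fix i assume i: "i : ?I"
  obtain U e where ie: "i = (U, e)" "free_gen X F U e" using i by auto
  show "opn X (fst i)" "c i : Os X (fst i)" using ie free_genD(1)[OF ie(2)] c(1)[OF ie(2)] by auto
  fix j assume j: "j : ?I"
  obtain W e' where je: "j = (W, e')" "free_gen X F W e'" using j by auto
  note U = free_genD(1,2)[OF ie(2)] and W = free_genD(1,2)[OF je(2)]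
  have Z: "opn X (U Int W)" "U Int W <= U" "U Int W <= W" using U W by auto
  note eZ = F.res_closed[OF U(1) Z(1,2) U(2)]
  note cZ = ores_in[OF U(1) Z(1,2) c(1)[OF ie(2)]]
  have "ores X U (U Int W) (c (U, e)) *.[msec F (U Int W)] mres F U (U Int W) e = ores X W (U Int W) (c (W, e')) *.[msec F (U Int W)] mres F U (U Int W) e"
   using act[OF ie(2) Z(1,2) eZ] act[OF je(2) Z(1,3) eZ] by simp
  hence "ores X U (U Int W) (c (U, e)) = ores X W (U Int W) (c (W, e'))"
   by (rule free_gen_unique[OF ie(2) Z(1,2) cZ ores_in[OF W(1) Z(1,3) c(1)[OF je(2)]] _ F.smult_closed[OF Z(1) cZ eZ]])
  thus "ores X (fst i) (fst i Int fst j) (c i) = ores X (fst j) (fst i Int fst j) (c j)" using ie je by simp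
 next
  show "pts X = (UN i:?I. fst i)"
  proof
   show "pts X <= (UN i:?I. fst i)"
   proof
    fix p assume p: "p : pts X"
    have "EX U e. p : U & free_gen X F U e" using F p unfolding line_bundle_def by blast
    then obtain U e where "p : U" "free_gen X F U e" by (elim exE conjE) (rule that)
    thus "p : (UN i:?I. fst i)" by (intro UN_I[of "(U, e)"]) simp_all
   qed
   show "(UN i:?I. fst i) <= pts X" using openin_subset[OF free_genD(1)] by fastforce
  qed
 next
  fix t assume t: "t : Os X (pts X)" "!!i. i : ?I ==> ores X (pts X) (fst i) t = c i"
  show thesis by (rule that[OF t])
 qed
 have "f = hom_smult X F F a (hom_id X F)"
 proof (rule mod_hom_eqI[OF f hom_smult_in[OF F.ms F.ms hom_id_in[OF F.ms] a(1)]])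
  fix U s assume U: "opn X U" and s: "s : Ms F U"
  note UX = openin_subset[OF U]
  note aU = ores_in[OF openin_pts U UX a(1)]
  have "f U s = ores X (pts X) U a *.[msec F U] s"
  proof (rule sheaf_eqI[OF F.msh U mod_homD(1)[OF f U s] F.smult_closed[OF U aU s]])
   fix p assume p: "p : U"
   have "EX W e. p : W & free_gen X F W e" using F p UX unfolding line_bundle_def by blast
   then obtain W e where W: "p : W" "free_gen X F W e" by (elim exE conjE) (rule that)
   note oW = free_genD(1,2)[OF W(2)]
   have Z: "opn X (U Int W)" "U Int W <= U" "U Int W <= W" using U oW by auto
   have WX: "W <= pts X" by (rule openin_subset[OF oW(1)])
   note sZ = F.res_closed[OF U Z(1,2) s]
   have "mres F U (U Int W) (f U s) = ores X W (U Int W) (c (W, e)) *.[msec F (U Int W)] mres F U (U Int W) s"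
    using act[OF W(2) Z(1,3) sZ] mod_homD(4)[OF f U Z(1,2) s] by simp
   also have "... = mres F U (U Int W) (ores X (pts X) U a *.[msec F U] s)"
    using F.res_smult[OF U Z(1,2) aU s] a(2)[of "(W, e)"] W(2) ores_ores[OF openin_pts U Z(1,2) UX a(1)]
     ores_ores[OF openin_pts oW(1) Z(1,3) WX a(1)] by simp
   finally show "EX W. opn X W & p : W & W <= U & mres F U W (f U s) = mres F U W (ores X (pts X) U a *.[msec F U] s)"
    using Z p W(1) by (intro exI[of _ "U Int W"]) simp
  qed
  thus "f U s = hom_smult X F F a (hom_id X F) U s" using hom_apply[OF U s] by simp
 qed
 with a(1) show thesis by (rule that)
qed

end

section \<open>Polynomials in many variables\<close>

lemma mpoly_ring_sel [simp]:
 "carrier (mpoly_ring S) = {q. ALL m:keys q. keys m <= S}"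
 "monoid.mult (mpoly_ring S) = (*)" "monoid.one (mpoly_ring S) = 1" "ring.zero (mpoly_ring S) = 0" "ring.add (mpoly_ring S) = (+)"
 by (simp_all add: mpoly_ring_def)

lemma mpoly_ring_closed:
 assumes "p : carrier (mpoly_ring S)" "q : carrier (mpoly_ring S)"
 shows "p + q : carrier (mpoly_ring S)" "p * q : carrier (mpoly_ring S)" "- p : carrier (mpoly_ring S)"
  "p - q : carrier (mpoly_ring S)"
proof -
 show "p + q : carrier (mpoly_ring S)" using assms keys_add[of p q] by auto
 have "keys m <= S" if h: "m : keys (p * q)" for m
 proof -
  obtain a b where ab: "m = a + b" "a : keys p" "b : keys q"
   using subsetD[OF keys_mult h] by auto
  have "keys a <= S" "keys b <= S" using ab assms by auto
  thus ?thesis using keys_add[of a b] ab(1) by auto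
 qed
 thus "p * q : carrier (mpoly_ring S)" by auto
 show "- p : carrier (mpoly_ring S)" using assms by simp
 show "p - q : carrier (mpoly_ring S)" using assms keys_diff[of p q] by auto
qed

lemma mpoly_ring_elems:
 "0 : carrier (mpoly_ring S)" "1 : carrier (mpoly_ring S)" "mConst c : carrier (mpoly_ring S)"
 "v : S ==> mVar v : carrier (mpoly_ring S)"
 "keys m <= S ==> single m c : carrier (mpoly_ring S)"
 by (auto simp: mConst_def mVar_def single_one[symmetric] simp del: single_one split: if_splits)

lemma mpoly_ring_cring: "cring (mpoly_ring S)"
proof (rule cringI)
 show "abelian_group (mpoly_ring S)"
 proof (rule abelian_groupI)
  fix x assume x: "x : carrier (mpoly_ring S)"
  show "EX y:carrier (mpoly_ring S). y +[mpoly_ring S] x = 0[mpoly_ring S]"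
   by (rule bexI[OF _ mpoly_ring_closed(3)[OF x x]]) simp
 qed (use mpoly_ring_closed(1) mpoly_ring_elems(1) in \<open>simp_all add: add_ac del: mpoly_ring_sel(1)\<close>)
 show "comm_monoid (mpoly_ring S)"
  by (rule comm_monoidI) (use mpoly_ring_closed(2) mpoly_ring_elems(2) in \<open>simp_all add: mult_ac del: mpoly_ring_sel(1)\<close>)
qed (simp add: distrib_right)

lemma mpoly_ring_minus:
 assumes "p : carrier (mpoly_ring S)" "q : carrier (mpoly_ring S)"
 shows "p \<ominus>\<^bsub>mpoly_ring S\<^esub> q = p - q"
proof -
 interpret P: cring "mpoly_ring S" by (rule mpoly_ring_cring)
 have "\<ominus>\<^bsub>mpoly_ring S\<^esub> q = - q"
  by (rule P.minus_equality) (use assms mpoly_ring_closed(3)[OF assms(2,2)] in simp_all)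
 thus ?thesis by (simp add: a_minus_def)
qed

text \<open>The value of the monomial \<open>m\<close> at the point \<open>w\<close>. It has two
  uses: with torus weights for \<open>w\<close> it is the character of the monomial, and with the
  constant 2 it is 2 to the power of the degree, a measure for inductions.\<close>

definition mono_prod :: "('v => 'c::comm_semiring_1) => ('v \<Rightarrow>\<^sub>0 nat) => 'c"
 where "mono_prod w m = (PROD v:keys m. w v ^ lookup m v)"

lemma mono_prod_add: "mono_prod w (m + m') = mono_prod w m * mono_prod w m'"
proof -
 let ?K = "keys m Un keys m'"
 have *: "mono_prod w r = (PROD v:?K. w v ^ lookup r v)" if "keys r <= ?K" for r
  unfolding mono_prod_def using that by (intro prod.mono_neutral_left) (auto simp: in_keys_iff)
 show ?thesis using *[of m] *[of m'] *[OF keys_add] by (simp add: lookup_add power_add prod.distrib)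
qed

lemma mono_prod_single: "mono_prod w (single v 1) = w v" "mono_prod w 0 = 1"
 by (simp_all add: mono_prod_def)

lemma mono_split:
 fixes m :: "'v \<Rightarrow>\<^sub>0 nat"
 assumes "v : keys m"
 obtains r where "m = single v 1 + r" "keys r <= keys m"
  "!!v'. v' ~= v ==> v' : keys m ==> v' : keys r"
  "mono_prod (%_. 2::nat) r < mono_prod (%_. 2::nat) m"
proof (rule that)
 let ?r = "m - single v 1"
 show eq: "m = single v 1 + ?r"
  using assms by (intro poly_mapping_eqI) (auto simp: lookup_add lookup_minus lookup_single when_def in_keys_iff)
 show "keys ?r <= keys m" by (auto simp: in_keys_iff lookup_minus)
 show "!!v'. v' ~= v ==> v' : keys m ==> v' : keys ?r"
  by (auto simp: in_keys_iff lookup_minus lookup_single when_def)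
 have "mono_prod (%_. 2::nat) m = 2 * mono_prod (%_. 2::nat) ?r"
  using mono_prod_add[of "%_. 2::nat" "single v 1" ?r] mono_prod_single(1)[of "%_. 2::nat" v] eq by simp
 moreover have "mono_prod (%_. 2::nat) ?r > 0" unfolding mono_prod_def by (rule prod_pos) simp
 ultimately show "mono_prod (%_. 2::nat) ?r < mono_prod (%_. 2::nat) m" by simp
qed

lemma mono_induct:
 assumes "keys m <= S" and z: "P 0"
  and s: "!!v m. [|v : S; keys m <= S; P m|] ==> P (single v (1::nat) + m)"
 shows "P m"
 using assms(1)
proof (induction "mono_prod (%_. 2::nat) m" arbitrary: m rule: less_induct)
 case less
 show ?case
 proof (cases "m = 0")
  case False
  then obtain v where v: "v : keys m" by (metis ex_in_conv keys_eq_empty)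
  obtain r where r: "m = single v 1 + r" "keys r <= keys m"
   "mono_prod (%_. 2::nat) r < mono_prod (%_. 2::nat) m" by (rule mono_split[OF v])
  have "P r" using less.hyps[OF r(3)] r(2) less.prems by simp
  thus ?thesis unfolding r(1) using v r(2) less.prems by (intro s) auto
 qed (simp add: z)
qed

lemma mpol_induct:
 fixes q :: "('v, 'k::field) mpol"
 assumes "q : carrier (mpoly_ring S)"
  and s: "!!m c. keys m <= S ==> P (single m c)"
  and a: "!!p q. [|p : carrier (mpoly_ring S); q : carrier (mpoly_ring S); P p; P q|] ==> P (p + q)"
 shows "P q"
proof -
 have eq: "(SUM m:keys q. single m (lookup q m)) = q"
  by (rule poly_mapping_eqI) (simp add: lookup_sum lookup_single when_def in_keys_iff)
 have "(SUM m:K. single m (lookup q m)) : carrier (mpoly_ring S) &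
   P (SUM m:K. single m (lookup q m))" if h: "K <= keys q" for K
  using finite_subset[OF h finite_keys] h
 proof (induction K)
  case empty
  show ?case using s[of 0 0] mpoly_ring_elems(1)[of S] by (simp del: mpoly_ring_sel)
 next
  case (insert m K)
  have m: "keys m <= S" using insert.prems assms(1) by auto
  have IH: "(SUM m:K. single m (lookup q m)) : carrier (mpoly_ring S)"
   "P (SUM m:K. single m (lookup q m))" using insert.IH insert.prems by blast+
  show ?case unfolding sum.insert[OF insert.hyps]
   by (intro conjI mpoly_ring_closed(1) a mpoly_ring_elems(5) m IH s)
 qed
 thus ?thesis using eq by (metis order_refl)
qed

section \<open>Evaluation of polynomials in a ring\<close>

lemma const_hom:
 fixes c :: "'k::field => 'a"
 assumes R: "cring R" and c: "c : ring_hom k_ring R"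
 shows "c a : carrier R" "c (a + b) = c a +[R] c b" "c (a * b) = c a *[R] c b" "c 1 = 1[R]" "c 0 = 0[R]"
proof -
 interpret R: cring R by (rule R)
 show cl: "c a : carrier R" for a using ring_hom_closed[OF c, of a] by (simp add: k_ring_def)
 show ad: "c (a + b) = c a +[R] c b" for a b using ring_hom_add[OF c, of a b] by (simp add: k_ring_def)
 show "c (a * b) = c a *[R] c b" using ring_hom_mult[OF c, of a b] by (simp add: k_ring_def)
 show "c 1 = 1[R]" using ring_hom_one[OF c] by (simp add: k_ring_def)
 show "c 0 = 0[R]" using ad[of 0 0] cl[of 0] by (simp add: R.add.r_cancel_one)
qed

context
 fixes c :: "'k::field => 'a" and R :: "'a ring" and x :: "'v => 'a" and S :: "'v set"
 assumes R: "cring R" and c: "c : ring_hom k_ring R" and x: "x : S \<rightarrow> carrier R"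
begin

interpretation R: cring R by (rule R)

private lemmas chom = const_hom[OF R c]

private abbreviation X :: "('v \<Rightarrow>\<^sub>0 nat) => 'a" where "X m \<equiv> finprod R (%v. x v ^[R] lookup m v) (keys m)"

private lemma xS: "v : S ==> x v : carrier R" using x by auto

private lemma X_in: "keys m <= S ==> X m : carrier R"
 by (rule R.finprod_closed) (use xS in auto)

private lemma X_add:
 assumes "keys m <= S" "keys m' <= S"
 shows "X (m + m') = X m *[R] X m'"
proof -
 let ?K = "keys m Un keys m'"
 have *: "X r = finprod R (%v. x v ^[R] lookup r v) ?K" if h: "keys r <= ?K" for r
  by (rule R.finprod_mono_neutral_cong_left) (use h assms xS in \<open>auto simp: in_keys_iff\<close>)
 have cl: "(%v. x v ^[R] lookup r v) : ?K \<rightarrow> carrier R" for r :: "'v \<Rightarrow>\<^sub>0 nat" using assms xS by auto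
 have "X (m + m') = finprod R (%v. x v ^[R] lookup m v *[R] x v ^[R] lookup m' v) ?K"
  unfolding *[OF keys_add] using assms xS
  by (intro R.finprod_cong') (auto simp: lookup_add R.nat_pow_mult)
 also have "... = X m *[R] X m'"
  unfolding *[OF Un_upper1] *[OF Un_upper2] by (rule R.finprod_multf[OF cl cl])
 finally show ?thesis .
qed

text \<open>The sum may be extended from the support of \<open>q\<close> to any larger finite set,
  so that two polynomials and their sum can be evaluated over one index set.\<close>

private lemma T:
 assumes "finite K" "keys q <= K" "!!m. m : K ==> keys m <= S"
 shows "mp_eval c R x q = finsum R (%m. c (lookup q m) *[R] X m) K"
 unfolding mp_eval_def
 by (rule R.add.finprod_mono_neutral_cong_left[OF assms(1,2)])
  (use assms(3) X_in chom in \<open>auto simp: in_keys_iff\<close>)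

private lemma ev_closed: "q : carrier (mpoly_ring S) ==> mp_eval c R x q : carrier R"
 unfolding mp_eval_def by (rule R.finsum_closed) (use X_in chom in auto)

private lemma ev_add:
 assumes "p : carrier (mpoly_ring S)" "q : carrier (mpoly_ring S)"
 shows "mp_eval c R x (p + q) = mp_eval c R x p +[R] mp_eval c R x q"
proof -
 let ?K = "keys p Un keys q"
 have K: "finite ?K" "!!m. m : ?K ==> keys m <= S" using assms by auto
 note T' = T[OF K(1) _ K(2)]
 have cl: "(%m. c (lookup r m) *[R] X m) : ?K \<rightarrow> carrier R" for r
  using X_in[OF K(2)] chom(1) by auto
 have "mp_eval c R x (p + q) = finsum R (%m. c (lookup (p + q) m) *[R] X m) ?K" by (rule T'[OF keys_add])
 also have "... = finsum R (%m. c (lookup p m) *[R] X m +[R] c (lookup q m) *[R] X m) ?K"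
 proof (rule R.finsum_cong')
  show "(%m. c (lookup p m) *[R] X m +[R] c (lookup q m) *[R] X m) : ?K \<rightarrow> carrier R"
   using cl[of p] cl[of q] by auto
  fix m assume "m : ?K"
  from X_in[OF K(2)[OF this]] show "c (lookup (p + q) m) *[R] X m =
    c (lookup p m) *[R] X m +[R] c (lookup q m) *[R] X m"
   unfolding lookup_add chom(2) by (intro R.l_distr chom(1))
 qed simp
 also have "... = finsum R (%m. c (lookup p m) *[R] X m) ?K +[R] finsum R (%m. c (lookup q m) *[R] X m) ?K"
  by (rule R.finsum_addf[OF cl cl])
 also have "... = mp_eval c R x p +[R] mp_eval c R x q"
  using T'[OF Un_upper1] T'[OF Un_upper2] by simp
 finally show ?thesis .
qed

private lemma ev_single:
 assumes "keys m <= S"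
 shows "mp_eval c R x (single m a) = c a *[R] X m"
 using T[of "{m}" "single m a"] assms X_in[OF assms] chom(1) by (simp add: R.finsum_singleton)

lemma mp_eval_mConst: "mp_eval c R x (mConst a) = c a"
 using ev_single[of 0 a] chom(1) by (simp add: mConst_def)

lemma mp_eval_mVar: "v : S ==> mp_eval c R x (mVar v) = x v"
 using ev_single[of "single v 1" 1] chom xS by (simp add: mVar_def R.finprod_singleton)

text \<open>Multiplicativity is additive in each factor, so two inductions reduce it to products of
  monomials.\<close>

lemma mp_eval_hom: "mp_eval c R x : ring_hom (mpoly_ring S) R"
proof (rule ring_hom_memI)
 show "mp_eval c R x 1[mpoly_ring S] = 1[R]"
  using mp_eval_mConst[of 1] chom by (simp add: mConst_def)
 show "mp_eval c R x p : carrier R" if "p : carrier (mpoly_ring S)" for p by (rule ev_closed[OF that])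
 fix p q :: "('v, 'k) mpol" assume p: "p : carrier (mpoly_ring S)" and q: "q : carrier (mpoly_ring S)"
 show "mp_eval c R x (p +[mpoly_ring S] q) = mp_eval c R x p +[R] mp_eval c R x q" using ev_add[OF p q] by simp
 have "mp_eval c R x (p * q) = mp_eval c R x p *[R] mp_eval c R x q"
  using p
 proof (rule mpol_induct)
  fix m :: "'v \<Rightarrow>\<^sub>0 nat" and a :: 'k assume m: "keys m <= S"
  note sm = mpoly_ring_elems(5)[OF m, of a]
  show "mp_eval c R x (single m a * q) = mp_eval c R x (single m a) *[R] mp_eval c R x q"
   using q
  proof (rule mpol_induct)
   fix m' :: "'v \<Rightarrow>\<^sub>0 nat" and b :: 'k assume m': "keys m' <= S"
   have mm: "keys (m + m') <= S" using m m' keys_add[of m m'] by auto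
   show "mp_eval c R x (single m a * single m' b) = mp_eval c R x (single m a) *[R] mp_eval c R x (single m' b)"
    unfolding mult_single ev_single[OF m] ev_single[OF m'] ev_single[OF mm] X_add[OF m m'] chom(3)
    using chom(1)[of a] chom(1)[of b] X_in[OF m] X_in[OF m'] by (simp add: R.m_ac)
  next
   fix r s :: "('v, 'k) mpol" assume h: "r : carrier (mpoly_ring S)" "s : carrier (mpoly_ring S)"
    "mp_eval c R x (single m a * r) = mp_eval c R x (single m a) *[R] mp_eval c R x r"
    "mp_eval c R x (single m a * s) = mp_eval c R x (single m a) *[R] mp_eval c R x s"
   show "mp_eval c R x (single m a * (r + s)) = mp_eval c R x (single m a) *[R] mp_eval c R x (r + s)"
    unfolding distrib_left ev_add[OF mpoly_ring_closed(2)[OF sm h(1)] mpoly_ring_closed(2)[OF sm h(2)]] ev_add[OF h(1,2)] h(3,4)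
    using R.r_distr[OF ev_closed[OF h(1)] ev_closed[OF h(2)] ev_closed[OF sm]] by simp
  qed
 next
  fix r s :: "('v, 'k) mpol" assume h: "r : carrier (mpoly_ring S)" "s : carrier (mpoly_ring S)"
   "mp_eval c R x (r * q) = mp_eval c R x r *[R] mp_eval c R x q"
   "mp_eval c R x (s * q) = mp_eval c R x s *[R] mp_eval c R x q"
  show "mp_eval c R x ((r + s) * q) = mp_eval c R x (r + s) *[R] mp_eval c R x q"
   unfolding distrib_right ev_add[OF mpoly_ring_closed(2)[OF h(1) q] mpoly_ring_closed(2)[OF h(2) q]] ev_add[OF h(1,2)] h(3,4)
   using R.l_distr[OF ev_closed[OF h(1)] ev_closed[OF h(2)] ev_closed[OF q]] by simp
 qed
 thus "mp_eval c R x (p *[mpoly_ring S] q) = mp_eval c R x p *[R] mp_eval c R x q" by simp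
qed

end

lemma genideal_hom_zero:
 assumes P: "cring P" and S: "cring S" and h: "h : ring_hom P S" and G: "G <= carrier P"
  "!!r. r : G ==> h r = 0[S]" and q: "q : genideal P G"
 shows "h q = 0[S]"
proof -
 interpret P: cring P by (rule P)
 interpret S: cring S by (rule S)
 interpret ring_hom_ring P S h by (rule ring_hom_ringI2[OF P.ring_axioms S.ring_axioms h])
 have "G <= a_kernel P S h" using G unfolding a_kernel_def' by auto
 from subsetD[OF P.genideal_minimal[OF kernel_is_ideal this] q] show ?thesis unfolding a_kernel_def' by auto
qed

text \<open>A root of 1 - x + x^(N+1) is not zero, and x^N = 1 would turn the equation into 1 = 0.
  The element serves as a torus coordinate that detects the nonzero weight \<open>N\<close>.\<close>

lemma ex_power_ne_one:
 assumes "N > 0"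
 shows "EX c::'k::alg_closed_field. c ~= 0 & c ^ N ~= 1"
proof -
 let ?f = "%k. if k = 0 then 1 else if k = 1 then - 1 else if k = Suc N then 1 else (0::'k)"
 obtain x where x: "(\<Sum>k\<le>Suc N. ?f k * x ^ k) = 0" using alg_closed[of "Suc N" ?f] assms by auto
 have "(\<Sum>k\<le>Suc N. ?f k * x ^ k) = (SUM k:{0, 1, Suc N}. ?f k * x ^ k)"
  using assms by (intro sum.mono_neutral_right) auto
 also have "... = 1 - x + x ^ Suc N" using assms by simp
 finally have e: "1 - x + x ^ Suc N = 0" using x by simp
 have "x ~= 0" using e by auto
 moreover have "x ^ N ~= 1" using e by auto
 ultimately show ?thesis by blast
qed

declare mpoly_ring_sel(1) [simp del]

lemma lookup_mConst: "lookup (mConst d * q) m = d * lookup q m"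
proof -
 have "q : carrier (mpoly_ring UNIV)" by (simp add: mpoly_ring_sel(1))
 thus ?thesis
  by (rule mpol_induct) (simp_all add: mConst_def mult_single lookup_single when_def distrib_left lookup_add)
qed

lemma mConst_mult: "mConst a * mConst b = mConst (a * b)" by (simp add: mConst_def mult_single)

lemma mConst_one: "mConst 1 = 1" by (simp add: mConst_def)

lemma (in domain) finprod_nonzero:
 assumes "finite B" "!!i. i : B ==> h i : carrier R" "!!i. i : B ==> h i ~= \<zero>"
 shows "finprod R h B ~= \<zero>"
 using assms
proof (induction B)
 case (insert i B)
 have c: "h i : carrier R" "h : B \<rightarrow> carrier R" using insert by auto
 have "finprod R h B ~= \<zero>" using insert by blast
 moreover have "h i ~= \<zero>" using insert by blast
 ultimately show ?case using finprod_insert[OF insert.hyps(1,2) c(2,1)] integral[OF _ c(1) finprod_closed[OF c(2)]] by auto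
qed simp

section \<open>Invariant functions on the representation space\<close>

text \<open>The interface between geometry and algebra. The ampleness of the dual of L reaches the
  invariant theory in the form of \<open>loops\<close>, and the structure of the total space in the
  form of \<open>dom\<close>.\<close>

locale bondal = rsheaf V for V :: "('v, 'b) rspace" +
 fixes \<kappa> :: "'k::alg_closed_field => 'b" and n :: nat and F :: "int => ('v, 'b, 'n) msheaf"
 assumes kap: "\<kappa> : ring_hom k_ring (osec V (pts V))"
  and lb: "i : {1..int n} ==> line_bundle V (F i)"
  and n: "n \<ge> 1"
  and dom: "domain (osec V (pts V))"
  and loops: "i : {1..int n} ==> EX f g h. f : mod_hom V (F 1) (F i) & g : mod_hom V (F i) (F 1) &
   h : Os V (pts V) & h ~= 0[osec V (pts V)] &
   hom_comp V (F 1) g f = hom_smult V (F 1) (F 1) h (hom_id V (F 1))"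
begin

abbreviation N where "N \<equiv> {1..int n}"
abbreviation A where "A \<equiv> osec V (pts V)"
abbreviation S where "S \<equiv> bondal_vars V n F"
abbreviation P :: "(('v, 'n) bvar, 'k) mpol ring" where "P \<equiv> mpoly_ring S"
abbreviation I where "I \<equiv> genideal P (bondal_relations \<kappa> V n F)"
abbreviation Q where "Q \<equiv> rep_ring \<kappa> V n F"
abbreviation cl where "cl q \<equiv> I +>\<^bsub>P\<^esub> q"
abbreviation \<theta> :: "(int => 'k) => (('v, 'n) bvar, 'k) mpol => (('v, 'n) bvar, 'k) mpol" where "\<theta> \<equiv> torus_act V n F"
abbreviation loop where "loop i a \<equiv> (i, i, hom_smult V (F i) (F i) a (hom_id V (F i)))"

lemma N1: "1 : N" using n by simp

lemma Fms: "i : N ==> mod_sheaf V (F i)" using lb unfolding line_bundle_def by blast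

lemma S_iff: "(i, j, f) : S \<longleftrightarrow> i : N & j : N & f : mod_hom V (F i) (F j)" by (auto simp: bondal_vars_def)

lemmas kappa = const_hom[OF cr[OF openin_pts] kap]

lemma S_ops:
 "(i, j, f) : S ==> (i, j, g) : S ==> (i, j, hom_add V (F i) (F j) f g) : S"
 "(i, j, f) : S ==> a : carrier A ==> (i, j, hom_smult V (F i) (F j) a f) : S"
 "i : N ==> (i, i, hom_id V (F i)) : S"
 "(i, j, f) : S ==> (j, l, g) : S ==> (i, l, hom_comp V (F i) g f) : S"
 "i : N ==> a : carrier A ==> loop i a : S"
 unfolding S_iff by ((elim conjE)?, intro conjI hom_add_in hom_smult_in hom_id_in hom_comp_in Fms; assumption)+

lemma rel_sub: "bondal_relations \<kappa> V n F <= carrier P"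
proof
 fix r assume "r : bondal_relations \<kappa> V n F"
 thus "r : carrier P"
  by cases (auto intro!: mpoly_ring_closed mpoly_ring_elems S_ops kappa)
qed

interpretation P: cring P by (rule mpoly_ring_cring)

lemma I_ideal: "ideal I P" by (rule P.genideal_ideal[OF rel_sub])

interpretation I: ideal I P by (rule I_ideal)

lemma Q_eq: "Q = P Quot I" by (simp add: rep_ring_def)

lemma Q_cring: "cring Q" unfolding Q_eq by (rule I.quotient_is_cring[OF P.is_cring])

interpretation Q: cring Q by (rule Q_cring)

lemma cl_hom: "cl : ring_hom P Q" unfolding Q_eq by (rule I.rcos_ring_hom)

lemma cl_ops:
 assumes "p : carrier P" "q : carrier P"
 shows "cl p : carrier Q" "cl (p * q) = cl p *[Q] cl q" "cl (p + q) = cl p +[Q] cl q"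
 using ring_hom_closed[OF cl_hom assms(1)] ring_hom_mult[OF cl_hom assms] ring_hom_add[OF cl_hom assms] by simp_all

lemma cl_one: "cl 1 = 1[Q]" using ring_hom_one[OF cl_hom] by simp

lemma cl_zero: "cl 0 = 0[Q]" using ring_hom_zero[OF cl_hom P.ring_axioms Q.ring_axioms] by simp

lemma cl_surj:
 assumes "b : carrier Q"
 obtains q where "q : carrier P" "b = cl q"
 using assms unfolding Q_eq FactRing_def A_RCOSETS_def' by auto

lemma cl_eq: "p : carrier P ==> q : carrier P ==> cl p = cl q \<longleftrightarrow> p - q : I"
 using P.quotient_eq_iff_same_a_r_cos[OF I_ideal, of p q] mpoly_ring_minus[of p S q] by auto

lemma cl_mem:
 assumes "q : carrier P"
 shows "r : cl q \<longleftrightarrow> (EX i:I. r = i + q)"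
 by (auto simp: a_r_coset_def')

lemma I_carrier: "q : I ==> q : carrier P" by (rule I.a_Hcarr)

lemma rel_I: "r : bondal_relations \<kappa> V n F ==> r : I" using P.genideal_self[OF rel_sub] by auto

lemma cl_rels:
 "(i, j, f) : S ==> (i, j, g) : S ==> cl (mVar (i, j, hom_add V (F i) (F j) f g)) = cl (mVar (i, j, f)) +[Q] cl (mVar (i, j, g))"
 "(i, j, f) : S ==> cl (mVar (i, j, hom_smult V (F i) (F j) (\<kappa> c) f)) = cl (mConst c) *[Q] cl (mVar (i, j, f))"
 "i : N ==> cl (mVar (i, i, hom_id V (F i))) = 1[Q]"
 "(i, j, f) : S ==> (j, l, g) : S ==> cl (mVar (i, l, hom_comp V (F i) g f)) = cl (mVar (i, j, f)) *[Q] cl (mVar (j, l, g))"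
proof -
 have V: "v : S ==> (mVar v :: (('v, 'n) bvar, 'k) mpol) : carrier P" for v by (rule mpoly_ring_elems(4))
 show "cl (mVar (i, j, hom_add V (F i) (F j) f g)) = cl (mVar (i, j, f)) +[Q] cl (mVar (i, j, g))"
  if h: "(i, j, f) : S" "(i, j, g) : S" for i j f g
  unfolding cl_ops(3)[OF V[OF h(1)] V[OF h(2)], symmetric]
  by (subst cl_eq[OF V[OF S_ops(1)[OF h]] mpoly_ring_closed(1)[OF V[OF h(1)] V[OF h(2)]]])
   (use rel_I[OF bondal_relations.add[OF h]] in \<open>simp add: diff_diff_eq\<close>)
 show "cl (mVar (i, j, hom_smult V (F i) (F j) (\<kappa> c) f)) = cl (mConst c) *[Q] cl (mVar (i, j, f))"
  if h: "(i, j, f) : S" for i j f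
  unfolding cl_ops(2)[OF mpoly_ring_elems(3) V[OF h], symmetric]
  by (subst cl_eq[OF V[OF S_ops(2)[OF h kappa(1)]] mpoly_ring_closed(2)[OF mpoly_ring_elems(3) V[OF h]]])
   (rule rel_I[OF bondal_relations.smult[OF h]])
 show "cl (mVar (i, i, hom_id V (F i))) = 1[Q]" if h: "i : N" for i
  unfolding cl_one[symmetric]
  by (subst cl_eq[OF V[OF S_ops(3)[OF h]] mpoly_ring_elems(2)]) (rule rel_I[OF bondal_relations.ident[OF h]])
 show "cl (mVar (i, l, hom_comp V (F i) g f)) = cl (mVar (i, j, f)) *[Q] cl (mVar (j, l, g))"
  if h: "(i, j, f) : S" "(j, l, g) : S" for i j l f g
  unfolding cl_ops(2)[OF V[OF h(1)] V[OF h(2)], symmetric]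
  by (subst cl_eq[OF V[OF S_ops(4)[OF h]] mpoly_ring_closed(2)[OF V[OF h(1)] V[OF h(2)]]])
   (rule rel_I[OF bondal_relations.comp[OF h]])
qed

section \<open>The torus action on polynomials and on the quotient ring\<close>

definition wt :: "(int => 'k) => ('v, 'n) bvar => 'k"
 where "wt g = (%(i, j, f). g i * inverse (g j))"

abbreviation valid :: "(int => 'k) => bool" where "valid g \<equiv> ALL i:N. g i ~= 0"

lemma mConst_hom: "mConst : ring_hom (k_ring :: 'k ring) P"
 by (rule ring_hom_memI) (auto simp: k_ring_def mConst_one mConst_mult mpoly_ring_elems(3), simp add: mConst_def single_add)

lemma theta_x: "(%(i, j, f). mConst (g i * inverse (g j)) * mVar (i, j, f)) : S \<rightarrow> carrier P"
 by (auto intro!: mpoly_ring_closed mpoly_ring_elems)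

lemma theta_hom: "\<theta> g : ring_hom P P"
 unfolding torus_act_def by (rule mp_eval_hom[OF P.is_cring mConst_hom theta_x])

lemma theta_ops:
 assumes "p : carrier P" "q : carrier P"
 shows "\<theta> g p : carrier P" "\<theta> g (p * q) = \<theta> g p * \<theta> g q" "\<theta> g (p + q) = \<theta> g p + \<theta> g q"
 using ring_hom_closed[OF theta_hom assms(1)] ring_hom_mult[OF theta_hom assms] ring_hom_add[OF theta_hom assms] by simp_all

lemma theta_const: "\<theta> g (mConst c) = mConst c"
 unfolding torus_act_def by (rule mp_eval_mConst[OF P.is_cring mConst_hom theta_x])

lemma theta_var: "v : S ==> \<theta> g (mVar v) = mConst (wt g v) * mVar v"
 unfolding torus_act_def wt_def using mp_eval_mVar[OF P.is_cring mConst_hom theta_x, of v g] by (cases v) simp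

lemma theta_single:
 assumes "keys m <= S"
 shows "\<theta> g (single m c) = single m (mono_prod (wt g) m * c)"
 using assms
proof (rule mono_induct)
 show "\<theta> g (single 0 c) = single 0 (mono_prod (wt g) 0 * c)"
  using theta_const[of g c] by (simp add: mConst_def mono_prod_single)
 fix v m assume h: "v : S" "keys m <= S" "\<theta> g (single m c) = single m (mono_prod (wt g) m * c)"
 have "single (single v 1 + m) c = mVar v * single m c"
  by (simp add: mVar_def mult_single)
 thus "\<theta> g (single (single v 1 + m) c) =
   single (single v 1 + m) (mono_prod (wt g) (single v 1 + m) * c)"
  using theta_ops(2)[OF mpoly_ring_elems(4)[OF h(1)] mpoly_ring_elems(5)[OF h(2)], of g c] h(3) theta_var[OF h(1)]
  by (simp add: mVar_def mConst_def mult_single mono_prod_add mono_prod_single(1)[simplified] mult.assoc)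
qed

text \<open>Monomials are eigenvectors, so the action multiplies each coefficient by a number.
  Identities for \<theta> can thus be checked coefficient by coefficient.\<close>

lemma theta_lookup:
 assumes "q : carrier P"
 shows "lookup (\<theta> g q) m = mono_prod (wt g) m * lookup q m"
 using assms
 by (rule mpol_induct) (simp_all add: theta_single theta_ops lookup_single when_def lookup_add distrib_left)

lemma theta_diff:
 assumes "p : carrier P" "q : carrier P"
 shows "\<theta> g (p - q) = \<theta> g p - \<theta> g q"
 by (rule poly_mapping_eqI)
  (simp add: theta_lookup[OF mpoly_ring_closed(4)[OF assms]] theta_lookup[OF assms(1)] theta_lookup[OF assms(2)]
    lookup_minus right_diff_distrib)

text \<open>Makes the action of a torus point surjective; this is what turns the image of a coset
  into a whole coset.\<close>

lemma theta_inverse: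
 assumes q: "q : carrier P" and g: "valid g"
 shows "\<theta> g (\<theta> (%i. inverse (g i)) q) = q"
proof (rule poly_mapping_eqI)
 fix m
 let ?g = "%i. inverse (g i)"
 have "lookup (\<theta> g (\<theta> ?g q)) m = mono_prod (wt g) m * mono_prod (wt ?g) m * lookup q m"
  using theta_lookup[OF theta_ops(1)[OF q q]] theta_lookup[OF q] by simp
 also have "... = lookup q m"
 proof (cases "m : keys q")
  case True
  hence mS: "keys m <= S" using q by (simp add: mpoly_ring_sel(1))
  have w: "wt g v * wt ?g v = 1" if "v : S" for v
  proof -
   obtain i j f where v: "v = (i, j, f)" by (cases v)
   have "g i ~= 0" "g j ~= 0" using that g unfolding v S_iff by auto
   thus ?thesis by (simp add: wt_def v field_simps)
  qed
  have "mono_prod (wt g) m * mono_prod (wt ?g) m = (PROD v:keys m. (wt g v * wt ?g v) ^ lookup m v)"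
   unfolding mono_prod_def prod.distrib[symmetric] power_mult_distrib ..
  also have "... = 1" using mS w by (intro prod.neutral) auto
  finally show ?thesis by simp
 qed (simp add: in_keys_iff)
 finally show "lookup (\<theta> g (\<theta> ?g q)) m = lookup q m" .
qed

text \<open>Every relation is an eigenvector. All its terms are walks with the same endpoints i and
  l and have the same character g_i / g_l, the factors at an intermediate node cancelling.\<close>

lemma theta_rel:
 assumes "r : bondal_relations \<kappa> V n F" and g: "valid g"
 shows "\<theta> g r : I"
proof -
 have "EX d. \<theta> g r = mConst d * r" using assms(1)
 proof cases
  case (add i j f h)
  note E = mpoly_ring_elems(4)[OF add(2)] mpoly_ring_elems(4)[OF add(3)] mpoly_ring_elems(4)[OF S_ops(1)[OF add(2,3)]]
  show ?thesis unfolding add(1)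
   by (rule exI[of _ "g i * inverse (g j)"])
    (simp add: theta_diff[OF mpoly_ring_closed(4)[OF E(3,1)] E(2)] theta_diff[OF E(3,1)] theta_var[OF add(2)] theta_var[OF add(3)]
      theta_var[OF S_ops(1)[OF add(2,3)]] wt_def right_diff_distrib)
 next
  case (smult i j f c)
  note s = S_ops(2)[OF smult(2) kappa(1), of c]
  note E = mpoly_ring_elems(4)[OF smult(2)] mpoly_ring_elems(4)[OF s] mpoly_ring_elems(3)[of c S]
  show ?thesis unfolding smult(1)
   by (rule exI[of _ "g i * inverse (g j)"])
    (simp add: theta_diff[OF E(2) mpoly_ring_closed(2)[OF E(3,1)]] theta_ops(2)[OF E(3,1)] theta_var[OF smult(2)] theta_var[OF s]
      theta_const wt_def right_diff_distrib mult.left_commute)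
 next
  case (ident i)
  note s = S_ops(3)[OF ident(2)]
  have "g i ~= 0" using g ident(2) by simp
  thus ?thesis unfolding ident(1)
   by (intro exI[of _ 1])
    (simp add: theta_diff[OF mpoly_ring_elems(4)[OF s] mpoly_ring_elems(2)] theta_var[OF s] wt_def mConst_one theta_const[of g 1, unfolded mConst_one])
 next
  case (comp i j f l h)
  note s = S_ops(4)[OF comp(2,3)]
  note E = mpoly_ring_elems(4)[OF comp(2)] mpoly_ring_elems(4)[OF comp(3)] mpoly_ring_elems(4)[OF s]
  have j: "g j ~= 0" using comp(2) g unfolding S_iff by auto
  have "\<theta> g (mVar (i, j, f) * mVar (j, l, h)) = (mConst (g i * inverse (g j)) * mConst (g j * inverse (g l))) * (mVar (i, j, f) * mVar (j, l, h))"
   unfolding theta_ops(2)[OF E(1,2)] theta_var[OF comp(2)] theta_var[OF comp(3)] wt_def by (simp add: mult_ac)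
  also have "mConst (g i * inverse (g j)) * mConst (g j * inverse (g l)) = (mConst (g i * inverse (g l)) :: (('v, 'n) bvar, 'k) mpol)"
   unfolding mConst_mult using j by (simp add: field_simps)
  finally show ?thesis unfolding comp(1)
   by (intro exI[of _ "g i * inverse (g l)"])
    (simp add: theta_diff[OF E(3) mpoly_ring_closed(2)[OF E(1,2)]] theta_var[OF s] wt_def right_diff_distrib)
 qed
 then obtain d where "\<theta> g r = mConst d * r" by (elim exE)
 thus ?thesis using I.I_l_closed[OF rel_I[OF assms(1)] mpoly_ring_elems(3)[of d S]] by simp
qed

lemma cl_zero_iff: "q : carrier P ==> cl q = 0[Q] \<longleftrightarrow> q : I"
 using cl_eq[of q 0] mpoly_ring_elems(1)[of S] unfolding cl_zero by simp

lemma theta_I: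
 assumes "q : I" "valid g"
 shows "\<theta> g q : I"
proof -
 have h: "cl \<circ> \<theta> g : ring_hom P Q" by (rule ring_hom_trans[OF theta_hom cl_hom])
 have "(cl \<circ> \<theta> g) q = 0[Q]"
 proof (rule genideal_hom_zero[OF P.is_cring Q_cring h rel_sub _ assms(1)])
  fix r assume r: "r : bondal_relations \<kappa> V n F"
  have "r : carrier P" using rel_sub r by auto
  thus "(cl \<circ> \<theta> g) r = 0[Q]" using theta_rel[OF r assms(2)] cl_zero_iff theta_ops(1) by auto
 qed
 thus ?thesis using cl_zero_iff[OF theta_ops(1)[OF I_carrier[OF assms(1)] I_carrier[OF assms(1)]]] by simp
qed

text \<open>In \<open>inv_ring\<close> the torus acts on a class by taking the image of a coset.
  That image is again a coset, because \<theta> maps the ideal of relations onto itself.\<close>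

lemma theta_cl:
 assumes q: "q : carrier P" and g: "valid g"
 shows "\<theta> g ` cl q = cl (\<theta> g q)"
proof -
 have g': "valid (%i. inverse (g i))" using g by simp
 show ?thesis
 proof (rule Set.set_eqI)
  fix r
  have "r : \<theta> g ` cl q \<longleftrightarrow> (EX i:I. r = \<theta> g (i + q))" unfolding image_iff Bex_def cl_mem[OF q] by auto
  also have "... \<longleftrightarrow> (EX i:I. r = \<theta> g i + \<theta> g q)" using theta_ops(3)[OF I_carrier q] by auto
  also have "... \<longleftrightarrow> (EX i:I. r = i + \<theta> g q)"
  proof
   assume "EX i:I. r = \<theta> g i + \<theta> g q"
   then obtain i where "i : I" "r = \<theta> g i + \<theta> g q" by (elim bexE)
   thus "EX i:I. r = i + \<theta> g q" using theta_I[OF _ g] by (intro bexI[of _ "\<theta> g i"])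
  next
   assume "EX i:I. r = i + \<theta> g q"
   then obtain i where i: "i : I" "r = i + \<theta> g q" by (elim bexE)
   show "EX i:I. r = \<theta> g i + \<theta> g q"
    by (rule bexI[OF _ theta_I[OF i(1) g']]) (simp add: theta_inverse[OF I_carrier[OF i(1)] g] i(2))
  qed
  also have "... \<longleftrightarrow> r : cl (\<theta> g q)" using cl_mem[OF theta_ops(1)[OF q q]] by simp
  finally show "r : \<theta> g ` cl q \<longleftrightarrow> r : cl (\<theta> g q)" .
 qed
qed

abbreviation R where "R \<equiv> inv_ring \<kappa> V n F"

lemma R_sel: "monoid.mult R = monoid.mult Q" "ring.add R = ring.add Q" "monoid.one R = monoid.one Q" "ring.zero R = ring.zero Q"
 "carrier R <= carrier Q" "R = Q\<lparr>carrier := carrier R\<rparr>"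
 by (auto simp: inv_ring_def)

lemma R_cl:
 assumes "q : carrier P"
 shows "cl q : carrier R \<longleftrightarrow> (ALL g. valid g --> cl (\<theta> g q) = cl q)"
 using theta_cl[OF assms] cl_ops(1)[OF assms assms] unfolding inv_ring_def by auto

lemma R_cring: "cring R"
proof -
 have "subring (carrier R) Q"
 proof (rule Q.subringI)
  show "carrier R <= carrier Q" by (rule R_sel(5))
  have "cl 1 : carrier R" using theta_const[of _ 1] by (simp add: R_cl[OF mpoly_ring_elems(2)] mConst_one)
  thus "1[Q] : carrier R" by (simp add: cl_one)
  fix b assume b: "b : carrier R"
  obtain q where q: "q : carrier P" "b = cl q" using cl_surj b R_sel(5) by blast
  note iq = b[unfolded q(2) R_cl[OF q(1)]]
  have m1: "cl (mConst (- 1)) : carrier R" by (simp add: R_cl[OF mpoly_ring_elems(3)] theta_const)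
  { fix b' assume b': "b' : carrier R"
   obtain q' where q': "q' : carrier P" "b' = cl q'" using cl_surj b' R_sel(5) by blast
   note iq' = b'[unfolded q'(2) R_cl[OF q'(1)]]
   have T: "\<theta> g q : carrier P" "\<theta> g q' : carrier P" for g using theta_ops(1)[OF q(1) q(1)] theta_ops(1)[OF q'(1) q'(1)] by auto
   show "b *[Q] b' : carrier R"
    unfolding q(2) q'(2) cl_ops(2)[OF q(1) q'(1), symmetric] R_cl[OF mpoly_ring_closed(2)[OF q(1) q'(1)]]
     theta_ops(2)[OF q(1) q'(1)] cl_ops(2)[OF T] using iq iq' by (simp add: cl_ops(2)[OF q(1) q'(1)])
   show "b +[Q] b' : carrier R"
    unfolding q(2) q'(2) cl_ops(3)[OF q(1) q'(1), symmetric] R_cl[OF mpoly_ring_closed(1)[OF q(1) q'(1)]]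
     theta_ops(3)[OF q(1) q'(1)] cl_ops(3)[OF T] using iq iq' by (simp add: cl_ops(3)[OF q(1) q'(1)]) }
  have mq: "- q : carrier P" by (rule mpoly_ring_closed(3)[OF q(1) q(1)])
  have "\<ominus>\<^bsub>Q\<^esub> b = cl (- q)"
   by (rule Q.minus_equality) (use cl_ops(3)[OF mq q(1)] cl_zero cl_ops(1)[OF mq mq] cl_ops(1)[OF q(1) q(1)] q(2) in simp_all)
  moreover have "cl (- q) : carrier R" unfolding R_cl[OF mq]
  proof (intro allI impI)
   fix g assume g: "valid g"
   note Tq = theta_ops(1)[OF q(1) q(1), of g]
   have e: "\<theta> g (- q) = - \<theta> g q" using theta_diff[OF mpoly_ring_elems(1) q(1), of g] theta_diff[OF q(1) q(1), of g] by simp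
   have "\<theta> g q - q : I" using cl_eq[OF Tq q(1)] iq g by simp
   hence "mConst (- 1) * (\<theta> g q - q) : I" using I.I_l_closed[OF _ mpoly_ring_elems(3)[of "- 1" S]] by simp
   moreover have "mConst (- 1) * (\<theta> g q - q) = - \<theta> g q - - q"
    by (rule poly_mapping_eqI) (simp add: lookup_mConst lookup_minus)
   ultimately show "cl (\<theta> g (- q)) = cl (- q)" unfolding e using cl_eq[OF mpoly_ring_closed(3)[OF Tq Tq] mq] by simp
  qed
  ultimately show "\<ominus>\<^bsub>Q\<^esub> b : carrier R" by simp
 qed
 hence "subcring (carrier R) Q" by (rule Q.subcringI')
 thus ?thesis using Q.subcring_iff[OF R_sel(5)] R_sel(6) by simp
qed

text \<open>Applying \<open>(\<theta>\<^sub>g - \<chi>(g)) / (1 - \<chi>(g))\<close> to an invariant class does not change it, but removes the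
  monomials of character \<open>\<chi>\<close>.\<close>

lemma weight_zero_rep:
 assumes "q : carrier P" "cl q : carrier R"
 shows "EX r : carrier P. cl r = cl q & (ALL m:keys r. ALL g. valid g --> mono_prod (wt g) m = 1)"
 using assms
proof (induction "card {m : keys q. EX g. valid g & mono_prod (wt g) m ~= 1}" arbitrary: q rule: less_induct)
 case less
 let ?B = "%q. {m : keys q. EX g. valid g & mono_prod (wt g) m ~= 1}"
 show ?case
 proof (cases "?B q = {}")
  case True
  thus ?thesis using less.prems(1) by (intro bexI[of _ q]) auto
 next
  case False
  then obtain m g where m: "m : ?B q" "valid g" "mono_prod (wt g) m ~= 1" by auto
  note q = less.prems(1)
  define x where "x = mono_prod (wt g) m"
  define d where "d = inverse (1 - x)"
  define r where "r = mConst d * (\<theta> g q - mConst x * q)"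
  have x: "1 - x ~= 0" using m(3) by (simp add: x_def)
  note Tq = theta_ops(1)[OF q q, of g]
  have r: "r : carrier P" unfolding r_def
   by (intro mpoly_ring_closed(2,4) mpoly_ring_elems(3) Tq q)
  have lr: "lookup r m' = d * (mono_prod (wt g) m' - x) * lookup q m'" for m'
   unfolding r_def by (simp add: lookup_mConst lookup_minus theta_lookup[OF q] left_diff_distrib right_diff_distrib mult.assoc)
  have "\<theta> g q - q : I" using cl_eq[OF Tq q] less.prems(2) m(2) R_cl[OF q] by simp
  hence "mConst d * (\<theta> g q - q) : I" using I.I_l_closed[OF _ mpoly_ring_elems(3)[of d S]] by simp
  moreover have "mConst d * (\<theta> g q - q) = r - q"
  proof (rule poly_mapping_eqI)
   fix m'
   let ?y = "mono_prod (wt g) m'" and ?l = "lookup q m'"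
   have "d * (?y * ?l - ?l) = d * (?y - x) * ?l - d * (1 - x) * ?l" by (simp add: algebra_simps)
   moreover have "d * (1 - x) = 1" using x by (simp add: d_def)
   ultimately show "lookup (mConst d * (\<theta> g q - q)) m' = lookup (r - q) m'"
    by (simp add: lookup_mConst lookup_minus theta_lookup[OF q] lr)
  qed
  ultimately have rq: "cl r = cl q" using cl_eq[OF r q] by simp
  \<comment> \<open>The coefficients of \<open>r\<close> are multiples of those of \<open>q\<close>,
    so no monomial is added, and the factor at \<open>m\<close> is zero. The number of monomials
    with nontrivial character drops.\<close>
  have "?B r <= ?B q - {m}" using lr by (auto simp: in_keys_iff x_def)
  hence "?B r \<subset> ?B q" using m(1) by blast
  hence "card (?B r) < card (?B q)" by (intro psubset_card_mono) simp_all
  from less.hyps[OF this r] show ?thesis using less.prems(2) rq by simp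
 qed
qed

section \<open>The tautological map in local frames\<close>

abbreviation frame where "frame U e \<equiv> opn V U & (ALL i:N. free_gen V (F i) U (e i))"
abbreviation ev :: "'v set => (int => 'n) => (('v, 'n) bvar, 'k) mpol => 'b"
 where "ev U e \<equiv> mp_eval (k_const \<kappa> V U) (osec V U) (taut_coord V F U e)"

text \<open>One generator is added at a time, the neighbourhood shrinking at each step; the bundles
  are finite in number, so it stays open.\<close>

lemma frames_cover:
 assumes p: "p : pts V"
 obtains U e where "frame U e" "p : U"
proof -
 have "EX U e. opn V U & p : U & (ALL i:J. free_gen V (F i) U (e i))" if "finite J" "J <= N" for J
  using that
 proof (induction J)
  case empty
  show ?case using p by (intro exI[of _ "pts V"]) simp
 next
  case (insert j J)
  have "EX U e. opn V U & p : U & (ALL i:J. free_gen V (F i) U (e i))" using insert by simp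
  then obtain U e where U: "opn V U" "p : U" "!!i. i : J ==> free_gen V (F i) U (e i)"
   by (elim exE conjE) (rule that, auto)
  have "EX W e. p : W & free_gen V (F j) W e" using lb[of j] insert.prems p unfolding line_bundle_def by auto
  then obtain W e' where W: "p : W" "free_gen V (F j) W e'" by (elim exE conjE) (rule that)
  have Z: "opn V (U Int W)" "U Int W <= U" "U Int W <= W" using U(1) free_genD(1)[OF W(2)] by auto
  have "free_gen V (F i) (U Int W) (mres (F i) U (U Int W) (e i))" if h: "i : J" for i
  proof -
   interpret modsheaf V "F i" by (rule line_bundle_modsheaf[OF lb]) (use h insert.prems in auto)
   show ?thesis by (rule free_gen_res[OF U(3)[OF h] Z(1,2)])
  qed
  moreover have "free_gen V (F j) (U Int W) (mres (F j) W (U Int W) e')"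
  proof -
   interpret modsheaf V "F j" by (rule line_bundle_modsheaf[OF lb]) (use insert.prems in auto)
   show ?thesis by (rule free_gen_res[OF W(2) Z(1,3)])
  qed
  ultimately show ?case using Z(1) U(2) W(1)
   by (intro exI[of _ "U Int W"] exI[of _ "%i. if i = j then mres (F j) W (U Int W) e' else mres (F i) U (U Int W) (e i)"]) auto
 qed
 from this[of N] show thesis using that by auto
qed

lemma k_const_hom: "opn V U ==> k_const \<kappa> V U : ring_hom k_ring (osec V U)"
 using ring_hom_trans[OF kap res_ring_hom[OF openin_pts _ openin_subset]] by (simp add: k_const_def[abs_def] comp_def)

lemma taut_coord:
 assumes fr: "frame U e" and v: "(i, j, f) : S"
 shows "taut_coord V F U e (i, j, f) : Os V U"
  "f U (e i) = taut_coord V F U e (i, j, f) *.[msec (F j) U] e j"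
  "!!c. c : Os V U ==> f U (e i) = c *.[msec (F j) U] e j ==> taut_coord V F U e (i, j, f) = c"
proof -
 have ij: "i : N" "j : N" "f : mod_hom V (F i) (F j)" using v by (auto simp: S_iff)
 interpret modsheaf V "F j" by (rule line_bundle_modsheaf[OF lb[OF ij(2)]])
 have U: "opn V U" and gi: "free_gen V (F i) U (e i)" and gj: "free_gen V (F j) U (e j)" using fr ij by auto
 have "EX! a. a : Os V U & f U (e i) = a *.[msec (F j) U] mres (F j) U U (e j)"
  by (rule free_genD(3)[OF gj U order_refl mod_homD(1)[OF ij(3) U free_genD(2)[OF gi]]])
 hence ex: "EX! a. a : Os V U & f U (e i) = a *.[msec (F j) U] e j"
  unfolding res_id[OF U free_genD(2)[OF gj]] .
 have eq: "taut_coord V F U e (i, j, f) = (THE c. c : Os V U & f U (e i) = c *.[msec (F j) U] e j)"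
  by (simp add: taut_coord_def)
 from theI'[OF ex] show "taut_coord V F U e (i, j, f) : Os V U"
  "f U (e i) = taut_coord V F U e (i, j, f) *.[msec (F j) U] e j" unfolding eq by auto
 show "!!c. c : Os V U ==> f U (e i) = c *.[msec (F j) U] e j ==> taut_coord V F U e (i, j, f) = c"
  unfolding eq by (rule the1_equality[OF ex]) simp
qed

lemma taut_x: "frame U e ==> taut_coord V F U e : S \<rightarrow> Os V U"
 using taut_coord(1) by (auto simp: bondal_vars_def)

lemma ev_hom: assumes "frame U e" shows "ev U e : ring_hom P (osec V U)"
 by (rule mp_eval_hom[OF cr k_const_hom taut_x]) (use assms in auto)

lemma ev_var:
 assumes "frame U e" "v : S" shows "ev U e (mVar v) = taut_coord V F U e v"
 by (rule mp_eval_mVar[OF cr k_const_hom taut_x]) (use assms in auto)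

lemma ev_const:
 assumes "frame U e" shows "ev U e (mConst c) = k_const \<kappa> V U c"
 by (rule mp_eval_mConst[OF cr k_const_hom taut_x]) (use assms in auto)

text \<open>The coordinates c with f(e_i) = c e_j come from actual homomorphisms. They respect sums,
  scalars, identities and compositions, each by uniqueness of the coordinate, so they define a point
  of the representation space over \<open>U\<close>.\<close>

lemma ev_rel:
 assumes fr: "frame U e" and r: "r : bondal_relations \<kappa> V n F"
 shows "ev U e r = 0[osec V U]"
proof -
 have U: "opn V U" using fr by simp
 interpret O: cring "osec V U" by (rule cr[OF U])
 note UX = openin_subset[OF U]
 \<comment> \<open>The relations are written as differences, so that they vanish once both terms
   have the same value.\<close>
 have z: "ev U e (x - y) = 0[osec V U]" if h: "x : carrier P" "y : carrier P" "ev U e x = ev U e y" for x y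
 proof -
  note d = mpoly_ring_closed(4)[OF h(1,2)]
  have "ev U e x = ev U e (x - y) +[osec V U] ev U e y"
   using ring_hom_add[OF ev_hom[OF fr] d h(2)] by simp
  thus ?thesis using h(3) O.add.r_cancel_one'[OF ring_hom_closed[OF ev_hom[OF fr] h(2)] ring_hom_closed[OF ev_hom[OF fr] d]] by simp
 qed
 have E: "v : S ==> (mVar v :: (('v, 'n) bvar, 'k) mpol) : carrier P" for v by (rule mpoly_ring_elems(4))
 note T = taut_coord[OF fr]
 have gi: "e i : Ms (F i) U" if "i : N" for i
  by (rule free_genD(2)[OF bspec[OF conjunct2[OF fr] that]])
 from r show ?thesis
 proof cases
  case (add i j f g)
  note s = S_ops(1)[OF add(2,3)]
  have ij: "i : N" "j : N" using add(2) by (auto simp: S_iff)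
  interpret M: module "osec V U" "msec (F j) U" by (rule modsheaf.md[OF line_bundle_modsheaf[OF lb[OF ij(2)]] U])
  have "taut_coord V F U e (i, j, hom_add V (F i) (F j) f g) = taut_coord V F U e (i, j, f) +[osec V U] taut_coord V F U e (i, j, g)"
  proof (rule T(3)[OF s])
   show "hom_add V (F i) (F j) f g U (e i) = (taut_coord V F U e (i, j, f) +[osec V U] taut_coord V F U e (i, j, g)) *.[msec (F j) U] e j"
    unfolding hom_apply(3)[OF U gi[OF ij(1)]] T(2)[OF add(2)] T(2)[OF add(3)]
    by (rule M.smult_l_distr[OF T(1)[OF add(2)] T(1)[OF add(3)] gi[OF ij(2)], symmetric])
  qed (use T(1)[OF add(2)] T(1)[OF add(3)] in simp)
  thus ?thesis unfolding add(1) diff_diff_eq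
   by (intro z E s mpoly_ring_closed(1) add(2,3))
    (use ring_hom_add[OF ev_hom[OF fr] E[OF add(2)] E[OF add(3)]] in \<open>simp add: ev_var[OF fr s] ev_var[OF fr add(2)] ev_var[OF fr add(3)]\<close>)
 next
  case (smult i j f c)
  note s = S_ops(2)[OF smult(2) kappa(1), of c]
  have ij: "i : N" "j : N" using smult(2) by (auto simp: S_iff)
  interpret M: module "osec V U" "msec (F j) U" by (rule modsheaf.md[OF line_bundle_modsheaf[OF lb[OF ij(2)]] U])
  note k = ores_in[OF openin_pts U UX kappa(1), of c]
  have "taut_coord V F U e (i, j, hom_smult V (F i) (F j) (\<kappa> c) f) = k_const \<kappa> V U c *[osec V U] taut_coord V F U e (i, j, f)"
  proof (rule T(3)[OF s])
   show "hom_smult V (F i) (F j) (\<kappa> c) f U (e i) = (k_const \<kappa> V U c *[osec V U] taut_coord V F U e (i, j, f)) *.[msec (F j) U] e j"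
    unfolding hom_apply(4)[OF U gi[OF ij(1)]] T(2)[OF smult(2)] k_const_def
    by (rule M.smult_assoc1[OF k T(1)[OF smult(2)] gi[OF ij(2)], symmetric])
  qed (use T(1)[OF smult(2)] k in \<open>simp add: k_const_def\<close>)
  thus ?thesis unfolding smult(1)
   by (intro z E s mpoly_ring_closed(2) mpoly_ring_elems(3) smult(2))
    (use ring_hom_mult[OF ev_hom[OF fr] mpoly_ring_elems(3) E[OF smult(2)]] in \<open>simp add: ev_var[OF fr s] ev_var[OF fr smult(2)] ev_const[OF fr]\<close>)
 next
  case (ident i)
  note s = S_ops(3)[OF ident(2)]
  interpret M: module "osec V U" "msec (F i) U" by (rule modsheaf.md[OF line_bundle_modsheaf[OF lb[OF ident(2)]] U])
  have "taut_coord V F U e (i, i, hom_id V (F i)) = 1[osec V U]"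
   by (rule T(3)[OF s]) (use hom_apply(1)[OF U gi[OF ident(2)]] gi[OF ident(2)] in simp_all)
  thus ?thesis unfolding ident(1)
   by (intro z E s mpoly_ring_elems(2)) (use ring_hom_one[OF ev_hom[OF fr]] in \<open>simp add: ev_var[OF fr s]\<close>)
 next
  case (comp i j f l g)
  note s = S_ops(4)[OF comp(2,3)]
  have ij: "i : N" "j : N" "l : N" "g : mod_hom V (F j) (F l)" using comp(2,3) by (auto simp: S_iff)
  interpret M: module "osec V U" "msec (F l) U" by (rule modsheaf.md[OF line_bundle_modsheaf[OF lb[OF ij(3)]] U])
  have "taut_coord V F U e (i, l, hom_comp V (F i) g f) = taut_coord V F U e (i, j, f) *[osec V U] taut_coord V F U e (j, l, g)"
  proof (rule T(3)[OF s])
   show "hom_comp V (F i) g f U (e i) = (taut_coord V F U e (i, j, f) *[osec V U] taut_coord V F U e (j, l, g)) *.[msec (F l) U] e l"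
    unfolding hom_apply(2)[OF U gi[OF ij(1)]] T(2)[OF comp(2)] mod_homD(3)[OF ij(4) U T(1)[OF comp(2)] gi[OF ij(2)]]
     T(2)[OF comp(3)]
    by (rule M.smult_assoc1[OF T(1)[OF comp(2)] T(1)[OF comp(3)] gi[OF ij(3)], symmetric])
  qed (use T(1)[OF comp(2)] T(1)[OF comp(3)] in simp)
  thus ?thesis unfolding comp(1)
   by (intro z E s mpoly_ring_closed(2) comp(2,3))
    (use ring_hom_mult[OF ev_hom[OF fr] E[OF comp(2)] E[OF comp(3)]] in \<open>simp add: ev_var[OF fr s] ev_var[OF fr comp(2)] ev_var[OF fr comp(3)]\<close>)
 qed
qed

lemma ev_cl:
 assumes fr: "frame U e" and q: "q : carrier P" and r: "r : cl q"
 shows "ev U e r = ev U e q"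
proof -
 have U: "opn V U" using fr by simp
 interpret O: cring "osec V U" by (rule cr[OF U])
 obtain i where i: "i : I" "r = i + q" using r cl_mem[OF q] by blast
 have "ev U e i = 0[osec V U]"
  by (rule genideal_hom_zero[OF P.is_cring O.is_cring ev_hom[OF fr] rel_sub ev_rel[OF fr] i(1)])
 thus ?thesis unfolding i(2) using ring_hom_add[OF ev_hom[OF fr] I_carrier[OF i(1)] q] ring_hom_closed[OF ev_hom[OF fr] q] by simp
qed

section \<open>Loop functions and a common denominator\<close>

abbreviation chi where "chi i a \<equiv> cl (mVar (loop i a))"

lemma loop_eqI:
 assumes i: "i : N" and f: "f : mod_hom V (F i) (F i)" and a: "a : carrier A"
  and eq: "!!U s. [|opn V U; s : Ms (F i) U|] ==> f U s = ores V (pts V) U a *.[msec (F i) U] s"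
 shows "f = hom_smult V (F i) (F i) a (hom_id V (F i))"
 by (rule mod_hom_eqI[OF f hom_smult_in[OF Fms[OF i] Fms[OF i] hom_id_in[OF Fms[OF i]] a]])
  (simp add: hom_apply eq)

lemma loop_hom: "i : N ==> a : carrier A ==> hom_smult V (F i) (F i) a (hom_id V (F i)) : mod_hom V (F i) (F i)"
 by (intro hom_smult_in hom_id_in Fms)

lemma loop_apply:
 "[|opn V U; s : Ms (F i) U|] ==> hom_smult V (F i) (F i) a (hom_id V (F i)) U s = ores V (pts V) U a *.[msec (F i) U] s"
 by (simp add: hom_apply)

lemma chi_in: "i : N ==> a : carrier A ==> chi i a : carrier Q"
 by (rule cl_ops(1)[OF mpoly_ring_elems(4) mpoly_ring_elems(4)]) (rule S_ops(5); assumption)+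

text \<open>Addition and composition of scalar endomorphisms of \<open>F i\<close> are addition and
  multiplication in \<open>A\<close>. The two claims are the corresponding relations of the quotient
  ring.\<close>

lemma chi_ops:
 assumes i: "i : N" and a: "a : carrier A" and b: "b : carrier A"
 shows "chi i (a +[A] b) = chi i a +[Q] chi i b" "chi i (a *[A] b) = chi i a *[Q] chi i b"
proof -
 interpret A: cring A by (rule cr[OF openin_pts])
 interpret modsheaf V "F i" by (rule line_bundle_modsheaf[OF lb[OF i]])
 let ?f = "hom_smult V (F i) (F i) a (hom_id V (F i))" and ?g = "hom_smult V (F i) (F i) b (hom_id V (F i))"
 note S = S_ops(5)[OF i a] S_ops(5)[OF i b]
 have "hom_add V (F i) (F i) ?f ?g = hom_smult V (F i) (F i) (a +[A] b) (hom_id V (F i))"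
 proof (rule loop_eqI[OF i hom_add_in[OF ms ms loop_hom[OF i a] loop_hom[OF i b]] A.a_closed[OF a b]])
  fix U s assume U: "opn V U" and s: "s : Ms (F i) U"
  interpret M: module "osec V U" "msec (F i) U" by (rule md[OF U])
  note r = ores_in[OF openin_pts U openin_subset[OF U]]
  show "hom_add V (F i) (F i) ?f ?g U s = ores V (pts V) U (a +[A] b) *.[msec (F i) U] s"
   unfolding hom_apply(3)[OF U s] loop_apply[OF U s] ores_ops(1)[OF openin_pts U openin_subset[OF U] a b]
   by (rule M.smult_l_distr[OF r[OF a] r[OF b] s, symmetric])
 qed
 thus "chi i (a +[A] b) = chi i a +[Q] chi i b" using cl_rels(1)[OF S] by simp
 have "hom_comp V (F i) ?g ?f = hom_smult V (F i) (F i) (a *[A] b) (hom_id V (F i))"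
 proof (rule loop_eqI[OF i hom_comp_in[OF ms loop_hom[OF i a] loop_hom[OF i b]] A.m_closed[OF a b]])
  fix U s assume U: "opn V U" and s: "s : Ms (F i) U"
  interpret M: module "osec V U" "msec (F i) U" by (rule md[OF U])
  note r = ores_in[OF openin_pts U openin_subset[OF U]]
  have "ores V (pts V) U b *.[msec (F i) U] (ores V (pts V) U a *.[msec (F i) U] s) = (ores V (pts V) U a *[osec V U] ores V (pts V) U b) *.[msec (F i) U] s"
   using M.smult_assoc1[OF r[OF b] r[OF a] s] M.R.m_comm[OF r[OF a] r[OF b]] by simp
  thus "hom_comp V (F i) ?g ?f U s = ores V (pts V) U (a *[A] b) *.[msec (F i) U] s"
   unfolding hom_apply(2)[OF U s] loop_apply[OF U s] loop_apply[OF U M.smult_closed[OF r[OF a] s]]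
    ores_ops(2)[OF openin_pts U openin_subset[OF U] a b] .
 qed
 thus "chi i (a *[A] b) = chi i a *[Q] chi i b" using cl_rels(4)[OF S] by simp
qed

lemma chi_const: "i : N ==> chi i (\<kappa> c) = cl (mConst c)"
 using cl_rels(2)[OF S_ops(3), of i c] cl_rels(3)[of i] cl_ops(1)[OF mpoly_ring_elems(3) mpoly_ring_elems(3), of c] by simp

lemma chi_zero: "i : N ==> chi i 0[A] = 0[Q]"
 using chi_const[of i 0] kappa(5) cl_zero by (simp add: mConst_def)

lemma chi_one: "i : N ==> chi i 1[A] = 1[Q]"
 using chi_const[of i 1] kappa(4) cl_one by (simp add: mConst_one)

text \<open>A loop at i has the character g_i / g_i = 1.\<close>

lemma chi_R:
 assumes "i : N" "a : carrier A"
 shows "chi i a : carrier R"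
 unfolding R_cl[OF mpoly_ring_elems(4)[OF S_ops(5)[OF assms]]] theta_var[OF S_ops(5)[OF assms]]
 using assms(1) by (simp add: wt_def mConst_one)

text \<open>Moving a scalar through \<open>f : F\<^sub>1 \<rightarrow> F\<^sub>i\<close> shows that all the \<open>\<chi>\<^sub>i\<close> agree after multiplication with
  \<open>\<chi>\<^sub>1(h)\<close>, where \<open>h\<close> is a composition \<open>F\<^sub>1 \<rightarrow> F\<^sub>i \<rightarrow> F\<^sub>1\<close>.\<close>

lemma chi_move:
 assumes i: "i : N" and f: "f : mod_hom V (F 1) (F i)" and g: "g : mod_hom V (F i) (F 1)" and h: "h : carrier A"
  and gf: "hom_comp V (F 1) g f = hom_smult V (F 1) (F 1) h (hom_id V (F 1))" and a: "a : carrier A"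
 shows "chi 1 h *[Q] chi i a = chi 1 h *[Q] chi 1 a"
proof -
 have S: "(1, i, f) : S" "(i, 1, g) : S" using i f g N1 by (auto simp: S_iff)
 let ?l = "%i. hom_smult V (F i) (F i) a (hom_id V (F i))"
 have "hom_comp V (F 1) (?l i) f = hom_comp V (F 1) f (?l 1)"
 proof (rule mod_hom_eqI)
  show "hom_comp V (F 1) (?l i) f : mod_hom V (F 1) (F i)" by (rule hom_comp_in[OF Fms[OF N1] f loop_hom[OF i a]])
  show "hom_comp V (F 1) f (?l 1) : mod_hom V (F 1) (F i)" by (rule hom_comp_in[OF Fms[OF N1] loop_hom[OF N1 a] f])
  fix U s assume U: "opn V U" and s: "s : Ms (F 1) U"
  show "hom_comp V (F 1) (?l i) f U s = hom_comp V (F 1) f (?l 1) U s"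
   unfolding hom_apply(2)[OF U s] loop_apply[OF U s] loop_apply[OF U mod_homD(1)[OF f U s]]
   by (rule mod_homD(3)[OF f U ores_in[OF openin_pts U openin_subset[OF U] a] s, symmetric])
 qed
 hence e: "cl (mVar (1, i, f)) *[Q] chi i a = chi 1 a *[Q] cl (mVar (1, i, f))"
  using cl_rels(4)[OF S(1) S_ops(5)[OF i a]] cl_rels(4)[OF S_ops(5)[OF N1 a] S(1)] by simp
 have h1: "chi 1 h = cl (mVar (1, i, f)) *[Q] cl (mVar (i, 1, g))" using cl_rels(4)[OF S] gf by simp
 note c = cl_ops(1)[OF mpoly_ring_elems(4)[OF S(1)] mpoly_ring_elems(4)[OF S(1)]]
  cl_ops(1)[OF mpoly_ring_elems(4)[OF S(2)] mpoly_ring_elems(4)[OF S(2)]] chi_in[OF i a] chi_in[OF N1 a]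
 have "chi 1 h *[Q] chi i a = cl (mVar (i, 1, g)) *[Q] (cl (mVar (1, i, f)) *[Q] chi i a)"
  unfolding h1 using c by (simp add: Q.m_ac)
 also have "... = chi 1 h *[Q] chi 1 a" unfolding e h1 using c by (simp add: Q.m_ac)
 finally show ?thesis .
qed

text \<open>Each node i has its own denominator \<open>h i\<close>. Their product is a multiple of
  each of them, so it serves all nodes at once, and it is not zero because \<open>A\<close> is a
  domain.\<close>

lemma universal_denominator:
 "EX H. H : carrier A & H ~= 0[A] & (ALL i:N. ALL a:carrier A. chi 1 H *[Q] chi i a = chi 1 H *[Q] chi 1 a)"
proof -
 interpret A: domain A by (rule dom)
 have "ALL i:N. EX h. h : carrier A & h ~= 0[A] & (ALL a:carrier A. chi 1 h *[Q] chi i a = chi 1 h *[Q] chi 1 a)"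
 proof
  fix i assume i: "i : N"
  from loops[OF i] obtain f g h where "f : mod_hom V (F 1) (F i)" "g : mod_hom V (F i) (F 1)" "h : carrier A" "h ~= 0[A]"
   "hom_comp V (F 1) g f = hom_smult V (F 1) (F 1) h (hom_id V (F 1))" by (elim exE conjE) (rule that)
  thus "EX h. h : carrier A & h ~= 0[A] & (ALL a:carrier A. chi 1 h *[Q] chi i a = chi 1 h *[Q] chi 1 a)"
   using chi_move[OF i] by (intro exI[of _ h] conjI ballI)
 qed
 from bchoice[OF this] obtain h where hh: "ALL i:N. h i : carrier A & h i ~= 0[A] &
   (ALL a:carrier A. chi 1 (h i) *[Q] chi i a = chi 1 (h i) *[Q] chi 1 a)" by (elim exE)
 have h1: "h i : carrier A" if "i : N" for i by (rule conjunct1[OF bspec[OF hh that]])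
 have h2: "h i ~= 0[A]" if "i : N" for i by (rule conjunct1[OF conjunct2[OF bspec[OF hh that]]])
 note h = h1 h2
 have h3: "chi 1 (h i) *[Q] chi i a = chi 1 (h i) *[Q] chi 1 a" if "i : N" "a : carrier A" for i a
  by (rule bspec[OF conjunct2[OF conjunct2[OF bspec[OF hh that(1)]]] that(2)])
 let ?H = "finprod A h N"
 show ?thesis
 proof (intro exI[of _ ?H] conjI ballI)
  show "?H : carrier A" using h(1) by (intro A.finprod_closed) auto
  show "?H ~= 0[A]" using h(1,2) by (intro A.finprod_nonzero) auto
  fix i a assume i: "i : N" and a: "a : carrier A"
  \<comment> \<open>The factor \<open>h i\<close> is split off from the product. It makes the
    replacement at node i possible, and the remaining factor is carried along.\<close>
  let ?r = "finprod A h (N - {i})"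
  have r: "?r : carrier A" using h(1) by (intro A.finprod_closed) auto
  have "finprod A h (insert i (N - {i})) = h i *[A] ?r" using h(1) i by (intro A.finprod_insert) auto
  hence H: "?H = h i *[A] ?r" using i by (simp add: insert_absorb)
  note c = chi_in[OF N1 h(1)[OF i]] chi_in[OF N1 r] chi_in[OF i a] chi_in[OF N1 a]
  have "chi 1 ?H *[Q] chi i a = chi 1 ?r *[Q] (chi 1 (h i) *[Q] chi i a)"
   unfolding H chi_ops(2)[OF N1 h(1)[OF i] r] using c by (simp add: Q.m_ac)
  also have "... = chi 1 ?H *[Q] chi 1 a"
   unfolding H chi_ops(2)[OF N1 h(1)[OF i] r] h3[OF i a] using c by (simp add: Q.m_ac)
  finally show "chi 1 ?H *[Q] chi i a = chi 1 ?H *[Q] chi 1 a" .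
 qed
qed

definition denom :: 'b where "denom = (SOME H. H : carrier A & H ~= 0[A] &
  (ALL i:N. ALL a:carrier A. chi 1 H *[Q] chi i a = chi 1 H *[Q] chi 1 a))"

abbreviation u where "u \<equiv> chi 1 denom"

lemma denom: "denom : carrier A" "denom ~= 0[A]" "[|i : N; a : carrier A|] ==> u *[Q] chi i a = u *[Q] chi 1 a"
proof -
 note d = someI_ex[OF universal_denominator, folded denom_def]
 show "denom : carrier A" "denom ~= 0[A]" by (rule conjunct1[OF d], rule conjunct1[OF conjunct2[OF d]])
 show "[|i : N; a : carrier A|] ==> u *[Q] chi i a = u *[Q] chi 1 a"
  by (rule bspec[OF bspec[OF conjunct2[OF conjunct2[OF d]]]])
qed

text \<open>The function \<open>a\<close> is the pullback of the class of \<open>q\<close>, and the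
  class itself equals \<open>chi 1 a\<close> after multiplication by \<open>u\<close>. The two
  statements are proved together because the same reduction to closed walks yields both: the first
  computes the pullback, the second shows that \<open>u\<close> kills its kernel.\<close>

definition represents :: "(('v, 'n) bvar, 'k) mpol => 'b => bool"
 where "represents q a \<longleftrightarrow> a : carrier A & u *[Q] cl q = u *[Q] chi 1 a &
  (ALL U e. frame U e --> ev U e q = ores V (pts V) U a)"

lemma representsD:
 assumes "represents q a"
 shows "a : carrier A" "u *[Q] cl q = u *[Q] chi 1 a" "frame U e ==> ev U e q = ores V (pts V) U a"
 using assms unfolding represents_def by blast+

lemma u_in: "u : carrier Q" by (rule chi_in[OF N1 denom(1)])

lemma represents_ops:
 assumes p: "p : carrier P" "represents p a" and q: "q : carrier P" "represents q b"
 shows "represents (p + q) (a +[A] b)" "represents (p * q) (a *[A] b)"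
proof -
 interpret A: cring A by (rule cr[OF openin_pts])
 note a = representsD(1)[OF p(2)] and b = representsD(1)[OF q(2)]
 note c = cl_ops(1)[OF p(1) p(1)] cl_ops(1)[OF q(1) q(1)] chi_in[OF N1 a] chi_in[OF N1 b] u_in
 note ua = representsD(2)[OF p(2)] and ub = representsD(2)[OF q(2)]
 show "represents (p + q) (a +[A] b)" unfolding represents_def
 proof (intro conjI allI impI A.a_closed a b)
  show "u *[Q] cl (p + q) = u *[Q] chi 1 (a +[A] b)"
   unfolding chi_ops(1)[OF N1 a b] cl_ops(3)[OF p(1) q(1)] Q.r_distr[OF c(1,2,5)] Q.r_distr[OF c(3,4,5)] ua ub ..
  fix U e assume fr: "frame U e"
  hence U: "opn V U" by simp
  show "ev U e (p + q) = ores V (pts V) U (a +[A] b)"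
   unfolding ores_ops(1)[OF openin_pts U openin_subset[OF U] a b]
   using ring_hom_add[OF ev_hom[OF fr] p(1) q(1)] representsD(3)[OF p(2) fr] representsD(3)[OF q(2) fr] by simp
 qed
 show "represents (p * q) (a *[A] b)" unfolding represents_def
 proof (intro conjI allI impI A.m_closed a b)
  have "u *[Q] (cl p *[Q] cl q) = (u *[Q] cl p) *[Q] cl q" using c by (simp add: Q.m_assoc)
  also have "... = chi 1 a *[Q] (u *[Q] cl q)" unfolding ua using c by (simp add: Q.m_ac)
  also have "... = u *[Q] (chi 1 a *[Q] chi 1 b)" unfolding ub using c by (simp add: Q.m_ac)
  finally show "u *[Q] cl (p * q) = u *[Q] chi 1 (a *[A] b)"
   unfolding chi_ops(2)[OF N1 a b] cl_ops(2)[OF p(1) q(1)] .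
  fix U e assume fr: "frame U e"
  hence U: "opn V U" by simp
  show "ev U e (p * q) = ores V (pts V) U (a *[A] b)"
   unfolding ores_ops(2)[OF openin_pts U openin_subset[OF U] a b]
   using ring_hom_mult[OF ev_hom[OF fr] p(1) q(1)] representsD(3)[OF p(2) fr] representsD(3)[OF q(2) fr] by simp
 qed
qed

lemma represents_const: "represents (mConst c) (\<kappa> c)"
 unfolding represents_def using kappa(1) chi_const[OF N1] ev_const by (auto simp: k_const_def)

lemma represents_loop:
 assumes i: "i : N" and a: "a : carrier A"
 shows "represents (mVar (loop i a)) a"
 unfolding represents_def
proof (intro conjI allI impI a denom(3)[OF i a])
 fix U e assume fr: "frame U e"
 hence U: "opn V U" by simp
 have ei: "e i : Ms (F i) U" by (rule free_genD(2)[OF bspec[OF conjunct2[OF fr] i]])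
 show "ev U e (mVar (loop i a)) = ores V (pts V) U a"
  unfolding ev_var[OF fr S_ops(5)[OF i a]]
  by (rule taut_coord(3)[OF fr S_ops(5)[OF i a] ores_in[OF openin_pts U openin_subset[OF U] a] loop_apply[OF U ei]])
qed

lemma represents_cl:
 assumes p: "p : carrier P" and q: "q : carrier P" and pq: "cl p = cl q" and r: "represents q a"
 shows "represents p a"
 unfolding represents_def
proof (intro conjI allI impI)
 show "a : carrier A" "u *[Q] cl p = u *[Q] chi 1 a" using representsD(1,2)[OF r] pq by simp_all
 fix U e assume fr: "frame U e"
 have "0 : I" using I.zero_closed by simp
 hence "p : cl p" using cl_mem[OF p] by force
 thus "ev U e p = ores V (pts V) U a" using ev_cl[OF fr q] pq representsD(3)[OF r fr] by simp
qed

text \<open>A monomial of weight zero is a product of closed walks: if \<open>(i, j, f)\<close> occurs with \<open>i \<noteq> j\<close>, then so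
  does some \<open>(j, l, g)\<close>, and the two contract to \<open>(i, l, g \<circ> f)\<close>.\<close>

lemma represents_mono:
 assumes "keys m <= S" "!!g. valid g ==> mono_prod (wt g) m = 1"
 shows "EX a. represents (single m 1) a"
 using assms
proof (induction "mono_prod (%_. 2::nat) m" arbitrary: m rule: less_induct)
 case less
 show ?case
 proof (cases "m = 0")
  case True
  show ?thesis unfolding True using represents_const[of 1] unfolding mConst_def by (rule exI)
 next
  case False
  then obtain v where v: "v : keys m" by (metis ex_in_conv keys_eq_empty)
  obtain i j f where vd: "v = (i, j, f)" by (cases v)
  obtain r where r: "m = single v 1 + r" "keys r <= keys m"
   "!!v'. v' ~= v ==> v' : keys m ==> v' : keys r"
   "mono_prod (%_. 2::nat) r < mono_prod (%_. 2::nat) m" using mono_split[OF v] by metis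
  have vS: "v : S" using v less.prems(1) by auto
  have rS: "keys r <= S" using r(2) less.prems(1) by auto
  have sm: "single m 1 = mVar v * (single r 1 :: (('v, 'n) bvar, 'k) mpol)"
   unfolding r(1) mVar_def by (simp add: mult_single)
  have ij: "i : N" "j : N" "f : mod_hom V (F i) (F j)" using vS unfolding vd S_iff by auto
  have wr: "mono_prod (wt g) m = wt g v * mono_prod (wt g) r" for g
   using mono_prod_add[of "wt g" "single v 1" r] mono_prod_single(1)[of "wt g" v] r(1) by simp
  show ?thesis
  proof (cases "i = j")
   case True
   \<comment> \<open>A loop of the walk is an endomorphism of a line bundle, hence multiplication by
     a global function.\<close>
   obtain a where a: "a : carrier A" "f = hom_smult V (F i) (F i) a (hom_id V (F i))"
    by (rule line_bundle_endo[OF lb[OF ij(1)]]) (use ij(3) True in auto)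
   have w1: "mono_prod (wt g) r = 1" if h: "valid g" for g
   proof -
    have "g i ~= 0" using h ij(1) by blast
    hence "wt g v = 1" using True by (simp add: vd wt_def)
    thus ?thesis using wr[of g] less.prems(2)[OF h] by simp
   qed
   have "EX b. represents (single r 1) b" by (rule less.hyps[OF r(4) rS]) (rule w1)
   then obtain b where b: "represents (single r 1) b" by (elim exE)
   have "represents (mVar v) a" using represents_loop[OF ij(1) a(1)] True a(2) vd by simp
   from represents_ops(2)[OF mpoly_ring_elems(4)[OF vS] this mpoly_ring_elems(5)[OF rS] b]
   show ?thesis unfolding sm by (rule exI)
  next
   case False
   \<comment> \<open>Suppose that no variable in \<open>m\<close> starts at j. The torus point that
     is c at j and 1 elsewhere then has weight c^(-M) on \<open>m\<close>, where M > 0 counts with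
     multiplicity the variables ending at j. As c is chosen with c^M different from 1, this
     contradicts weight zero.\<close>
   have "EX l h. (j, l, h) : keys m"
   proof (rule ccontr)
    assume no: "\<nexists>l h. (j, l, h) : keys m"
    let ?J = "{v : keys m. fst (snd v) = j}"
    define M where "M = (SUM v:?J. lookup m v)"
    have "v : ?J" using v vd by simp
    hence "lookup m v \<le> M" unfolding M_def by (intro member_le_sum) auto
    moreover have "lookup m v > 0" using v by (simp add: in_keys_iff)
    ultimately have "M > 0" by simp
    then obtain c :: 'k where c: "c ~= 0" "c ^ M ~= 1" using ex_power_ne_one by blast
    let ?g = "%i. if i = j then c else 1"
    have w: "wt ?g v' = (if fst (snd v') = j then inverse c else 1)" if h: "v' : keys m" for v'
    proof -
     obtain i' j' f' where v': "v' = (i', j', f')" by (cases v')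
     have "i' ~= j" using no h unfolding v' by blast
     thus ?thesis by (simp add: v' wt_def)
    qed
    have "mono_prod (wt ?g) m = (PROD v':keys m. if fst (snd v') = j then inverse c ^ lookup m v' else 1)"
     unfolding mono_prod_def by (rule prod.cong) (auto simp: w)
    also have "... = (PROD v':?J. inverse c ^ lookup m v')"
     by (rule prod.inter_filter[symmetric]) simp
    also have "... = inverse c ^ M" unfolding M_def by (simp add: power_sum)
    finally have "inverse c ^ M = 1" using less.prems(2)[of ?g] c(1) by simp
    thus False using c by (simp add: power_inverse)
   qed
   then obtain l h where w: "(j, l, h) : keys m" by (elim exE)
   have wr': "(j, l, h) : keys r" using r(3)[OF _ w] False vd by auto
   obtain t where t: "r = single (j, l, h) 1 + t" "keys t <= keys r"
    "mono_prod (%_. 2::nat) t < mono_prod (%_. 2::nat) r" using mono_split[OF wr'] by metis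
   have wS: "(j, l, h) : S" using w less.prems(1) by auto
   have tS: "keys t <= S" using t(2) rS by auto
   note vS' = vS[unfolded vd]
   let ?w = "(i, l, hom_comp V (F i) h f)"
   note cS = S_ops(4)[OF vS' wS]
   let ?m = "single ?w 1 + t"
   have mS: "keys ?m <= S" using keys_add[of "single ?w 1" t] tS cS by auto
   have P2: "mono_prod x (single y 1 + z) = x y * mono_prod x z" for x :: "('v, 'n) bvar => 'c::comm_semiring_1" and y z
    using mono_prod_add[of x "single y 1" z] mono_prod_single(1)[of x y] by simp
   \<comment> \<open>Two variables are replaced by one, so the degree drops by 1 and the measure is
     halved.\<close>
   have lt: "mono_prod (%_. 2::nat) ?m < mono_prod (%_. 2::nat) m"
    using r(4) t(3) P2[of "%_. 2::nat" ?w t] P2[of "%_. 2::nat" "(j, l, h)" t] P2[of "%_. 2::nat" v r] t(1) r(1) by simp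
   have w1: "mono_prod (wt g) ?m = 1" if hg: "valid g" for g
   proof -
    have "g j ~= 0" using hg ij(2) by blast
    hence "wt g ?w = wt g v * wt g (j, l, h)" by (simp add: vd wt_def)
    hence "mono_prod (wt g) ?m = mono_prod (wt g) m"
     unfolding P2 wr t(1) by (simp add: mult.assoc)
    thus ?thesis using less.prems(2)[OF hg] by simp
   qed
   have "EX a. represents (single ?m 1) a" by (rule less.hyps[OF lt mS]) (rule w1)
   then obtain a where a: "represents (single ?m 1) a" by (elim exE)
   note E = mpoly_ring_elems(4)[OF vS'] mpoly_ring_elems(4)[OF wS] mpoly_ring_elems(4)[OF cS] mpoly_ring_elems(5)[OF tS]
   have s1: "single m 1 = (mVar (i, j, f) * mVar (j, l, h)) * (single t 1 :: (('v, 'n) bvar, 'k) mpol)"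
    unfolding sm t(1) vd mVar_def by (simp add: mult_single add.assoc)
   have s2: "single ?m 1 = mVar ?w * (single t 1 :: (('v, 'n) bvar, 'k) mpol)"
    unfolding mVar_def by (simp add: mult_single)
   have "cl (single m 1) = cl (single ?m 1)"
    unfolding s1 s2 cl_ops(2)[OF E(3,4)] cl_ops(2)[OF mpoly_ring_closed(2)[OF E(1,2)] E(4)] cl_ops(2)[OF E(1,2)] cl_rels(4)[OF vS' wS] ..
   from represents_cl[OF mpoly_ring_elems(5)[OF less.prems(1)] mpoly_ring_elems(5)[OF mS] this a]
   show ?thesis by (rule exI)
  qed
 qed
qed

section \<open>The pullback of invariant functions\<close>

lemma represents_ex:
 assumes q: "q : carrier P" and inv: "cl q : carrier R"
 shows "EX a. represents q a"
proof -
 obtain r where r: "r : carrier P" "cl r = cl q"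
  "ALL m:keys r. ALL g. valid g --> mono_prod (wt g) m = 1"
  using weight_zero_rep[OF q inv] by (elim bexE conjE) (rule that)
 \<comment> \<open>Every monomial of \<open>r\<close> has weight zero and is therefore represented;
   scalar multiples and sums follow.\<close>
 have eq: "(SUM m:keys r. mConst (lookup r m) * single m 1) = r"
  by (rule poly_mapping_eqI) (simp add: lookup_sum lookup_mConst lookup_single when_def in_keys_iff if_distrib[of "(*) _"] cong: if_cong)
 have "(SUM m:K. mConst (lookup r m) * single m 1) : carrier P &
   (EX a. represents (SUM m:K. mConst (lookup r m) * single m 1) a)"
  if h: "K <= keys r" for K
  using finite_subset[OF h finite_keys] h
 proof (induction K)
  case empty
  show ?case using represents_const[of 0] mpoly_ring_elems(1)[of S] by (auto simp: mConst_def)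
 next
  case (insert m K)
  let ?s = "SUM m:K. mConst (lookup r m) * (single m 1 :: (('v, 'n) bvar, 'k) mpol)"
  have m: "keys m <= S" using insert.prems r(1) by (auto simp: mpoly_ring_sel(1))
  have "EX a. represents (single m 1) a"
   by (rule represents_mono[OF m]) (use r(3) insert.prems in blast)
  then obtain a where a: "represents (single m 1) a" by (elim exE)
  have "?s : carrier P" "EX b. represents ?s b" using insert.IH insert.prems by auto
  then obtain b where b: "?s : carrier P" "represents ?s b" by (elim exE) (rule that)
  note E = mpoly_ring_closed(2)[OF mpoly_ring_elems(3) mpoly_ring_elems(5)[OF m]]
  from represents_ops(1)[OF E represents_ops(2)[OF mpoly_ring_elems(3) represents_const mpoly_ring_elems(5)[OF m] a] b]
  show ?case unfolding sum.insert[OF insert.hyps] by (intro conjI mpoly_ring_closed(1) E b(1)) (rule exI)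
 qed
 from this[OF order_refl] obtain a where "represents r a" unfolding eq by blast
 thus ?thesis using represents_cl[OF q r(1) r(2)[symmetric]] by blast
qed

text \<open>\<open>taut_pullback\<close> is a definite description. Existence is part of
  \<open>represents\<close>; uniqueness holds because the frames cover \<open>V\<close>, so that a
  global function is determined by its values in frames.\<close>

lemma taut_eq:
 assumes q: "q : carrier P" and a: "represents q a"
 shows "taut_pullback \<kappa> V n F (cl q) = a"
 unfolding taut_pullback_def
proof (rule the_equality)
 show "a : carrier A & (ALL U e. frame U e --> (ALL r:cl q. ores V (pts V) U a = ev U e r))"
 proof (intro conjI allI impI ballI)
  show "a : carrier A" by (rule representsD(1)[OF a])
  fix U e r assume fr: "frame U e" and r: "r : cl q"
  show "ores V (pts V) U a = ev U e r" using ev_cl[OF fr q r] representsD(3)[OF a fr] by simp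
 qed
 fix b assume b: "b : carrier A & (ALL U e. frame U e --> (ALL r:cl q. ores V (pts V) U b = ev U e r))"
 have "0 : I" using I.zero_closed by simp
 hence qq: "q : cl q" using cl_mem[OF q] by force
 show "b = a"
 proof (rule sheaf_eqI[OF osh openin_pts])
  show "b : carrier A" "a : carrier A" using b representsD(1)[OF a] by simp_all
  fix p assume "p : pts V"
  then obtain U e where fr: "frame U e" and p: "p : U" by (rule frames_cover)
  have "ores V (pts V) U b = ores V (pts V) U a" using bspec[OF mp[OF spec[OF spec[OF conjunct2[OF b]]] fr] qq] representsD(3)[OF a fr] by (rule trans)
  thus "EX W. opn V W & p : W & W <= pts V & ores V (pts V) W b = ores V (pts V) W a"
   using fr p openin_subset by (intro exI[of _ U]) auto
 qed
qed

lemma R_rep: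
 assumes "b : carrier R"
 obtains q a where "q : carrier P" "b = cl q" "represents q a" "taut_pullback \<kappa> V n F b = a"
proof -
 obtain q where q: "q : carrier P" "b = cl q" using cl_surj assms R_sel(5) by blast
 obtain a where "represents q a" using represents_ex[OF q(1)] assms q(2) by blast
 thus thesis using that[OF q] taut_eq[OF q(1)] q(2) by blast
qed

lemma taut_chi: "a : carrier A ==> taut_pullback \<kappa> V n F (chi 1 a) = a"
 by (rule taut_eq[OF mpoly_ring_elems(4)[OF S_ops(5)[OF N1]] represents_loop[OF N1]])

lemma generic: "generic_kernel R A (taut_pullback \<kappa> V n F) u"
proof (rule generic_kernel.intro)
 show "cring R" by (rule R_cring)
 show "domain A" by (rule dom)
 show "taut_pullback \<kappa> V n F : ring_hom R A"
 proof (rule ring_hom_memI)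
  fix b assume b: "b : carrier R"
  obtain q a where q: "q : carrier P" "b = cl q" "represents q a" "taut_pullback \<kappa> V n F b = a" by (rule R_rep[OF b])
  show "taut_pullback \<kappa> V n F b : carrier A" using representsD(1)[OF q(3)] q(4) by simp
  fix b' assume b': "b' : carrier R"
  obtain q' a' where q': "q' : carrier P" "b' = cl q'" "represents q' a'" "taut_pullback \<kappa> V n F b' = a'" by (rule R_rep[OF b'])
  note o = represents_ops[OF q(1,3) q'(1,3)]
  show "taut_pullback \<kappa> V n F (b *[R] b') = taut_pullback \<kappa> V n F b *[A] taut_pullback \<kappa> V n F b'"
   unfolding R_sel(1-4) q(4) q'(4) unfolding q(2) q'(2) cl_ops(2)[OF q(1) q'(1), symmetric]
   by (rule taut_eq[OF mpoly_ring_closed(2)[OF q(1) q'(1)] o(2)])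
  show "taut_pullback \<kappa> V n F (b +[R] b') = taut_pullback \<kappa> V n F b +[A] taut_pullback \<kappa> V n F b'"
   unfolding R_sel(1-4) q(4) q'(4) unfolding q(2) q'(2) cl_ops(3)[OF q(1) q'(1), symmetric]
   by (rule taut_eq[OF mpoly_ring_closed(1)[OF q(1) q'(1)] o(1)])
 next
  interpret A: domain A by (rule dom)
  show "taut_pullback \<kappa> V n F 1[R] = 1[A]" using taut_chi[OF A.one_closed] chi_one[OF N1] by (simp add: R_sel(1-4))
 qed
 show "taut_pullback \<kappa> V n F ` carrier R = carrier A"
 proof
  show "taut_pullback \<kappa> V n F ` carrier R <= carrier A" using R_rep representsD(1) by blast
  show "carrier A <= taut_pullback \<kappa> V n F ` carrier R"
  proof
   fix a assume a: "a : carrier A"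
   show "a : taut_pullback \<kappa> V n F ` carrier R" using imageI[OF chi_R[OF N1 a], of "taut_pullback \<kappa> V n F"] unfolding taut_chi[OF a] .
  qed
 qed
 show "u : carrier R" by (rule chi_R[OF N1 denom(1)])
 show "taut_pullback \<kappa> V n F u ~= 0[A]" using taut_chi[OF denom(1)] denom(2) by simp
 fix b assume b: "b : carrier R" "taut_pullback \<kappa> V n F b = 0[A]"
 obtain q a where q: "q : carrier P" "b = cl q" "represents q a" "taut_pullback \<kappa> V n F b = a" by (rule R_rep[OF b(1)])
 \<comment> \<open>Here \<open>a = 0\<close>, so \<open>u b\<close> equals \<open>u\<close> times
   the loop function of 0, which is zero.\<close>
 show "u *[R] b = 0[R]" using representsD(2)[OF q(3)] q(2,4) b(2) chi_zero[OF N1] u_in by (simp add: R_sel(1-4))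
qed

theorem iso_onto_component:
 "EX Z. irreducible_component (tp (M\<^sub>0 \<kappa> V n F)) Z & iso_onto_closed (V\<^sub>0 V) R (\<phi>\<^sub>0 \<kappa> V n F) (reduced_ideal Z) &
  iso_onto_closed (V\<^sub>0 V) R (\<phi>\<^sub>0 \<kappa> V n F) (component_ideal R Z)"
proof -
 interpret generic_kernel R A "taut_pullback \<kappa> V n F" u "{p. primeideal p R & a_kernel R A (taut_pullback \<kappa> V n F) <= p}"
  by (rule generic)
 let ?Z = "{p. primeideal p R & a_kernel R A (taut_pullback \<kappa> V n F) <= p}"
 show ?thesis unfolding M\<^sub>0_def V\<^sub>0_def \<phi>\<^sub>0_def reduced_ideal_def
  by (intro exI[of _ ?Z] conjI component_Z) (simp_all only: Inter_Z component_ideal_Z iso_onto)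
qed

end

section \<open>Homomorphisms defined on a dense open set\<close>

context irr begin

text \<open>In a local generator two sections become functions, and a function is determined by its
  restriction to the dense open set \<open>U\<close>.\<close>

lemma sections_inj:
 assumes G: "line_bundle X G" and W: "opn X W" and U: "opn X U" "U ~= {}"
  and r: "r : Ms G W" "r' : Ms G W" and eq: "mres G W (W Int U) r = mres G W (W Int U) r'"
 shows "r = r'"
proof -
 interpret G: modsheaf X G by (rule line_bundle_modsheaf[OF G])
 show ?thesis
 proof (rule sheaf_eqI[OF G.msh W r])
  fix p assume p: "p : W"
  have "p : pts X" using p openin_subset[OF W] by auto
  then obtain Z \<eta> where Z: "p : Z" "free_gen X G Z \<eta>" using line_bundleD(2)[OF G] by blast
  note Zo = free_genD(1,2)[OF Z(2)]
  let ?Y = "W Int Z"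
  have Y: "opn X ?Y" "?Y <= W" "?Y <= Z" "?Y ~= {}" using W Zo p Z(1) by auto
  have D: "opn X (?Y Int U)" "?Y Int U <= ?Y" "?Y Int U <= W Int U" "?Y Int U <= Z" "?Y Int U ~= {}" "opn X (W Int U)" "W Int U <= W"
   using Y U W meet[OF Y(1) U(1) Y(4) U(2)] by auto
  note rY = G.res_closed[OF W Y(1,2) r(1)] G.res_closed[OF W Y(1,2) r(2)]
  obtain y where y: "y : Os X ?Y" "mres G W ?Y r = y *.[msec G ?Y] mres G Z ?Y \<eta>" by (rule free_gen_coef[OF Z(2) Y(1,3) rY(1)])
  obtain y' where y': "y' : Os X ?Y" "mres G W ?Y r' = y' *.[msec G ?Y] mres G Z ?Y \<eta>" by (rule free_gen_coef[OF Z(2) Y(1,3) rY(2)])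
  note e = G.res_closed[OF Zo(1) Y(1,3) Zo(2)] and e' = G.res_closed[OF Zo(1) D(1,4) Zo(2)]
  have "mres G ?Y (?Y Int U) (mres G W ?Y r) = mres G ?Y (?Y Int U) (mres G W ?Y r')"
   using G.res_res[OF W Y(1) D(1,2) Y(2) r(1)] G.res_res[OF W Y(1) D(1,2) Y(2) r(2)]
    G.res_res[OF W D(6,1,3,7) r(1)] G.res_res[OF W D(6,1,3,7) r(2)] eq by simp
  hence "ores X ?Y (?Y Int U) y *.[msec G (?Y Int U)] mres G Z (?Y Int U) \<eta> = ores X ?Y (?Y Int U) y' *.[msec G (?Y Int U)] mres G Z (?Y Int U) \<eta>"
   unfolding y(2) y'(2) G.res_smult[OF Y(1) D(1,2) y(1) e] G.res_smult[OF Y(1) D(1,2) y'(1) e] G.res_res[OF Zo(1) Y(1) D(1,2) Y(3) Zo(2)] .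
  hence "ores X ?Y (?Y Int U) y = ores X ?Y (?Y Int U) y'"
   by (rule free_gen_unique[OF Z(2) D(1,4) ores_in[OF Y(1) D(1,2) y(1)] ores_in[OF Y(1) D(1,2) y'(1)]])
    (rule G.smult_closed[OF D(1) ores_in[OF Y(1) D(1,2) y(1)] e'])
  hence "y = y'" by (rule sections_eq[OF Y(1) D(1,2,5) y(1) y'(1)])
  hence "mres G W ?Y r = mres G W ?Y r'" using y(2) y'(2) by simp
  thus "EX Y. opn X Y & p : Y & Y <= W & mres G W Y r = mres G W Y r'" using Y p Z(1) by (intro exI[of _ ?Y]) simp
 qed
qed

end

text \<open>A homomorphism from \<open>F\<close> to \<open>G\<close> over \<open>U\<close> is
  determined by the image of \<open>e0\<close> over the dense part of \<open>U\<close> inside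
  \<open>U0\<close>. Homomorphisms will be recorded by this section of \<open>G\<close>.\<close>

locale homs = irr X for X :: "('p, 'a) rspace" +
 fixes F :: "('p, 'a, 'm) msheaf" and G :: "('p, 'a, 'n) msheaf" and U0 e0
 assumes F: "line_bundle X F" and G: "line_bundle X G" and e0: "free_gen X F U0 e0" and ne: "U0 ~= {}"

sublocale homs \<subseteq> F: modsheaf X F by (rule line_bundle_modsheaf[OF F])
sublocale homs \<subseteq> G: modsheaf X G by (rule line_bundle_modsheaf[OF G])

section \<open>Coordinates relative to a fixed generator and extension of homomorphisms\<close>

context homs begin

lemma U0: "opn X U0" "e0 : Ms F U0" using free_genD[OF e0] by simp_all

lemma oI: "opn X U ==> opn X (U Int U0)" using U0 by blast

lemma Isub: "U Int U0 <= U" "U Int U0 <= U0" "W <= U ==> W Int U0 <= U Int U0" by auto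

lemmas G_inj = sections_inj[OF G _ U0(1) ne]

text \<open>The function \<open>c\<close> is the coordinate of \<open>x\<close> with respect to
  \<open>e0\<close>. It is defined over the part of \<open>W\<close> inside \<open>U0\<close> only,
  since \<open>e0\<close> need not generate elsewhere.\<close>

definition rel where "rel W x c \<longleftrightarrow> c : Os X (W Int U0) &
  mres F W (W Int U0) x = c *.[msec F (W Int U0)] mres F U0 (W Int U0) e0"

lemma relD: "rel W x c ==> c : Os X (W Int U0)"
 "rel W x c ==> mres F W (W Int U0) x = c *.[msec F (W Int U0)] mres F U0 (W Int U0) e0"
 unfolding rel_def by blast+

lemma e0_in: "opn X W ==> mres F U0 (W Int U0) e0 : Ms F (W Int U0)"
 by (rule F.res_closed[OF U0(1) oI Isub(2) U0(2)])

lemma rel_ex: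
 assumes "opn X W" "x : Ms F W"
 obtains c where "rel W x c"
proof -
 obtain c where "c : Os X (W Int U0)" "mres F W (W Int U0) x = c *.[msec F (W Int U0)] mres F U0 (W Int U0) e0"
  by (rule free_gen_coef[OF e0 oI[OF assms(1)] Isub(2) F.res_closed[OF assms(1) oI[OF assms(1)] Isub(1) assms(2)]])
 thus thesis using that unfolding rel_def by blast
qed

lemma rel_unique:
 assumes "opn X W" "rel W x c" "rel W x c'"
 shows "c = c'"
proof -
 note r = relD[OF assms(2)] relD[OF assms(3)]
 show ?thesis
  by (rule free_gen_unique[OF e0 oI[OF assms(1)] Isub(2) r(1,3) _ F.smult_closed[OF oI[OF assms(1)] r(1) e0_in[OF assms(1)]]])
   (use r(2,4) in simp)
qed

lemma rel_res:
 assumes W: "opn X W" "opn X Z" "Z <= W" and x: "x : Ms F W" and r: "rel W x c"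
 shows "rel Z (mres F W Z x) (ores X (W Int U0) (Z Int U0) c)"
proof -
 note o = oI[OF W(1)] oI[OF W(2)] Isub(3)[OF W(3)]
 have "mres F Z (Z Int U0) (mres F W Z x) = mres F (W Int U0) (Z Int U0) (mres F W (W Int U0) x)"
  using F.res_res[OF W(1,2) o(2) Isub(1) W(3) x] F.res_res[OF W(1) o Isub(1) x] by simp
 also have "... = ores X (W Int U0) (Z Int U0) c *.[msec F (Z Int U0)] mres F U0 (Z Int U0) e0"
  unfolding relD(2)[OF r] F.res_smult[OF o relD(1)[OF r] e0_in[OF W(1)]] F.res_res[OF U0(1) o Isub(2) U0(2)] ..
 finally show ?thesis unfolding rel_def using ores_in[OF o relD(1)[OF r]] by blast
qed

lemma rel_ops:
 assumes W: "opn X W" and x: "x : Ms F W" "rel W x c"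
 shows "[|y : Ms F W; rel W y d|] ==> rel W (x +[msec F W] y) (c +[osec X (W Int U0)] d)"
  "a : Os X W ==> rel W (a *.[msec F W] x) (ores X W (W Int U0) a *[osec X (W Int U0)] c)"
proof -
 note o = oI[OF W]
 interpret M: module "osec X (W Int U0)" "msec F (W Int U0)" by (rule F.md[OF o])
 note c = relD[OF x(2)]
 show "rel W (x +[msec F W] y) (c +[osec X (W Int U0)] d)" if y: "y : Ms F W" "rel W y d"
  unfolding rel_def F.res_add[OF W o Isub(1) x(1) y(1)] c(2) relD(2)[OF y(2)]
  using M.smult_l_distr[OF c(1) relD(1)[OF y(2)] e0_in[OF W]] c(1) relD(1)[OF y(2)] by simp
 show "rel W (a *.[msec F W] x) (ores X W (W Int U0) a *[osec X (W Int U0)] c)" if a: "a : Os X W"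
  unfolding rel_def F.res_smult[OF W o Isub(1) a x(1)] c(2)
  using M.smult_assoc1[OF ores_in[OF W o Isub(1) a] c(1) e0_in[OF W]] ores_in[OF W o Isub(1) a] c(1) by simp
qed

text \<open>\<open>ext U s\<close>: the homomorphism \<open>e\<^sub>0 \<mapsto> s\<close> on \<open>U \<inter> U\<^sub>0\<close> extends to \<open>U\<close>. As \<open>U\<^sub>0\<close> is dense, the
  extension is unique, so that everything can be checked on \<open>U\<^sub>0\<close>.\<close>

definition ext where "ext U s \<longleftrightarrow> s : Ms G (U Int U0) &
  (ALL W x c. opn X W & W <= U & x : Ms F W & rel W x c -->
   (EX r:Ms G W. mres G W (W Int U0) r = c *.[msec G (W Int U0)] mres G (U Int U0) (W Int U0) s))"

lemma extD: "ext U s ==> s : Ms G (U Int U0)"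
 unfolding ext_def by blast

lemma ext_val:
 assumes "ext U s" "opn X W" "W <= U" "x : Ms F W" "rel W x c"
 obtains r where "r : Ms G W" "mres G W (W Int U0) r = c *.[msec G (W Int U0)] mres G (U Int U0) (W Int U0) s"
 using assms unfolding ext_def by blast

lemma extI:
 assumes "s : Ms G (U Int U0)" "!!W x c. [|opn X W; W <= U; x : Ms F W; rel W x c|] ==>
   EX r:Ms G W. mres G W (W Int U0) r = c *.[msec G (W Int U0)] mres G (U Int U0) (W Int U0) s"
 shows "ext U s"
 unfolding ext_def
proof (intro conjI allI impI)
 fix W x c assume "opn X W & W <= U & x : Ms F W & rel W x c"
 thus "EX r:Ms G W. mres G W (W Int U0) r = c *.[msec G (W Int U0)] mres G (U Int U0) (W Int U0) s"
  by (elim conjE) (rule assms(2))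
qed (rule assms(1))

lemma s_in: "[|opn X U; opn X W; W <= U; s : Ms G (U Int U0)|] ==>
  mres G (U Int U0) (W Int U0) s : Ms G (W Int U0)"
 by (rule G.res_closed[OF oI oI Isub(3)])

lemma ext_res:
 assumes "ext U s" "opn X U" "opn X W" "W <= U"
 shows "ext W (mres G (U Int U0) (W Int U0) s)"
proof (rule extI[OF s_in[OF assms(2-4) extD[OF assms(1)]]])
 fix Z x c assume h: "opn X Z" "Z <= W" "x : Ms F Z" "rel Z x c"
 have "Z <= U" using h(2) assms(4) by simp
 then obtain r where "r : Ms G Z" "mres G Z (Z Int U0) r = c *.[msec G (Z Int U0)] mres G (U Int U0) (Z Int U0) s"
  by (rule ext_val[OF assms(1) h(1) _ h(3,4)])
 thus "EX r:Ms G Z. mres G Z (Z Int U0) r = c *.[msec G (Z Int U0)] mres G (W Int U0) (Z Int U0) (mres G (U Int U0) (W Int U0) s)"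
  using G.res_res[OF oI[OF assms(2)] oI[OF assms(3)] oI[OF h(1)] Isub(3)[OF h(2)] Isub(3)[OF assms(4)] extD[OF assms(1)]]
  by (intro bexI[of _ r]) simp
qed

text \<open>Extendability can be tested on one local generator. The image of \<epsilon> has to be c
  s over the dense part; if this extends to \<open>r\<close> over \<open>U\<close>, then y
  \<epsilon> is sent to y r.\<close>

lemma ext_gen:
 assumes \<epsilon>: "free_gen X F U \<epsilon>" and s: "s : Ms G (U Int U0)" and c: "rel U \<epsilon> c"
  and r: "r : Ms G U" "mres G U (U Int U0) r = c *.[msec G (U Int U0)] s"
 shows "ext U s"
proof (rule extI[OF s])
 note U = free_genD(1,2)[OF \<epsilon>]
 fix W x c' assume W: "opn X W" "W <= U" and x: "x : Ms F W" "rel W x c'"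
 obtain y where y: "y : Os X W" "x = y *.[msec F W] mres F U W \<epsilon>" by (rule free_gen_coef[OF \<epsilon> W x(1)])
 note o = oI[OF W(1)] and oU = oI[OF U(1)]
 note eW = F.res_closed[OF U(1) W U(2)] and rW = G.res_closed[OF U(1) W r(1)]
 let ?y = "ores X W (W Int U0) y" and ?c = "ores X (U Int U0) (W Int U0) c"
 have c': "c' = ?y *[osec X (W Int U0)] ?c"
  by (rule rel_unique[OF W(1) x(2)]) (use rel_ops(2)[OF W(1) eW rel_res[OF U(1) W U(2) c] y(1)] y(2) in simp)
 interpret M: module "osec X (W Int U0)" "msec G (W Int U0)" by (rule G.md[OF o])
 note yc = ores_in[OF W(1) o Isub(1) y(1)] ores_in[OF oU o Isub(3)[OF W(2)] relD(1)[OF c]]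
 have "mres G W (W Int U0) (y *.[msec G W] mres G U W r) = ?y *.[msec G (W Int U0)] mres G U (W Int U0) r"
  unfolding G.res_smult[OF W(1) o Isub(1) y(1) rW] G.res_res[OF U(1) W(1) o Isub(1) W(2) r(1)] ..
 also have "mres G U (W Int U0) r = ?c *.[msec G (W Int U0)] mres G (U Int U0) (W Int U0) s"
  using G.res_res[OF U(1) oU o Isub(3)[OF W(2)] Isub(1) r(1)] G.res_smult[OF oU o Isub(3)[OF W(2)] relD(1)[OF c] s] r(2) by simp
 also have "?y *.[msec G (W Int U0)] ... = c' *.[msec G (W Int U0)] mres G (U Int U0) (W Int U0) s"
  unfolding c' by (rule M.smult_assoc1[OF yc s_in[OF U(1) W s], symmetric])
 finally show "EX r:Ms G W. mres G W (W Int U0) r = c' *.[msec G (W Int U0)] mres G (U Int U0) (W Int U0) s"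
  by (rule bexI[OF _ G.smult_closed[OF W(1) y(1) rW]])
qed

text \<open>Over the members of the cover values exist by assumption. On overlaps they restrict to
  the same section over the dense part, hence agree, and they glue.\<close>

lemma ext_local:
 assumes U: "opn X U" and s: "s : Ms G (U Int U0)"
  and loc: "!!p. p : U ==> EX Z. opn X Z & p : Z & Z <= U & ext Z (mres G (U Int U0) (Z Int U0) s)"
 shows "ext U s"
proof (rule extI[OF s])
 fix W x c assume W: "opn X W" "W <= U" and x: "x : Ms F W" "rel W x c"
 let ?I = "{Z. opn X Z & Z <= U & ext Z (mres G (U Int U0) (Z Int U0) s)}"
 let ?cs = "c *.[msec G (W Int U0)] mres G (U Int U0) (W Int U0) s"
 note oW = oI[OF W(1)]
 have cs: "?cs : Ms G (W Int U0)" by (rule G.smult_closed[OF oW relD(1)[OF x(2)] s_in[OF U W s]])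
 have ex: "ALL Z:?I. EX r. r : Ms G (W Int Z) & mres G (W Int Z) (W Int Z Int U0) r = mres G (W Int U0) (W Int Z Int U0) ?cs"
 proof
  fix Z assume "Z : ?I"
  hence Z: "opn X Z" "Z <= U" "ext Z (mres G (U Int U0) (Z Int U0) s)" by auto
  have WZ: "opn X (W Int Z)" "W Int Z <= W" "W Int Z <= Z" "W Int Z <= U" using W Z by auto
  note o = oI[OF WZ(1)]
  obtain r where r: "r : Ms G (W Int Z)" "mres G (W Int Z) (W Int Z Int U0) r =
    ores X (W Int U0) (W Int Z Int U0) c *.[msec G (W Int Z Int U0)] mres G (Z Int U0) (W Int Z Int U0) (mres G (U Int U0) (Z Int U0) s)"
   by (rule ext_val[OF Z(3) WZ(1,3) F.res_closed[OF W(1) WZ(1,2) x(1)] rel_res[OF W(1) WZ(1,2) x]])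
  have "mres G (Z Int U0) (W Int Z Int U0) (mres G (U Int U0) (Z Int U0) s) = mres G (W Int U0) (W Int Z Int U0) (mres G (U Int U0) (W Int U0) s)"
   using G.res_res[OF oI[OF U] oI[OF Z(1)] o Isub(3)[OF WZ(3)] Isub(3)[OF Z(2)] s] G.res_res[OF oI[OF U] oW o Isub(3)[OF WZ(2)] Isub(3)[OF W(2)] s] by simp
  hence "mres G (W Int Z) (W Int Z Int U0) r = mres G (W Int U0) (W Int Z Int U0) ?cs"
   unfolding r(2) G.res_smult[OF oW o Isub(3)[OF WZ(2)] relD(1)[OF x(2)] s_in[OF U W s]] by simp
  thus "EX r. r : Ms G (W Int Z) & mres G (W Int Z) (W Int Z Int U0) r = mres G (W Int U0) (W Int Z Int U0) ?cs"
   using r(1) by (intro exI[of _ r] conjI)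
 qed
 from bchoice[OF this] obtain r where r: "ALL Z:?I. r Z : Ms G (W Int Z) &
   mres G (W Int Z) (W Int Z Int U0) (r Z) = mres G (W Int U0) (W Int Z Int U0) ?cs" by (elim exE)
 have Io: "opn X (W Int Z)" "W Int Z <= W" "W Int Z Int U0 <= W Int U0" if "Z : ?I" for Z using that W by auto
 have r1: "r Z : Ms G (W Int Z)" and r2: "mres G (W Int Z) (W Int Z Int U0) (r Z) = mres G (W Int U0) (W Int Z Int U0) ?cs"
  if "Z : ?I" for Z using bspec[OF r that] by (rule conjunct1, rule conjunct2)
 have pI: "EX Z. Z : ?I & p : Z" if h: "p : W" for p
 proof -
  have "p : U" using h W(2) by auto
  from loc[OF this] obtain Z where "opn X Z & p : Z & Z <= U & ext Z (mres G (U Int U0) (Z Int U0) s)" by (elim exE)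
  thus ?thesis by (intro exI[of _ Z]) simp
 qed
 have cov: "W = (UN Z:?I. W Int Z)"
 proof
  show "W <= (UN Z:?I. W Int Z)"
  proof
   fix p assume p: "p : W"
   from pI[OF p] obtain Z where "Z : ?I" "p : Z" by (elim exE conjE)
   thus "p : (UN Z:?I. W Int Z)" using p by (intro UN_I[of Z]) simp_all
  qed
 qed (rule UN_least, rule Int_lower1)
 obtain t where t: "t : Ms G W" "!!Z. Z : ?I ==> mres G W (W Int Z) t = r Z"
 proof (rule sheaf_glue[OF G.msh, of ?I "%Z. W Int Z" r W])
  fix Z assume Z: "Z : ?I"
  show "opn X (W Int Z)" by (rule Io(1)[OF Z])
  show "r Z : Ms G (W Int Z)" by (rule r1[OF Z])
  fix Z' assume Z': "Z' : ?I"
  let ?Y = "(W Int Z) Int (W Int Z')"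
  have Y: "opn X ?Y" "?Y <= W Int Z" "?Y <= W Int Z'" using Io(1)[OF Z] Io(1)[OF Z'] by auto
  \<comment> \<open>Any local value, restricted to the dense part of the overlap, is the restriction
    of \<open>?cs\<close>, whichever member of the cover it comes from.\<close>
  have *: "mres G ?Y (?Y Int U0) (mres G (W Int B) ?Y (r B)) = mres G (W Int U0) (?Y Int U0) ?cs"
   if B: "B : ?I" "?Y <= W Int B" for B
   using G.res_res[OF Io(1)[OF B(1)] Y(1) oI[OF Y(1)] Isub(1) B(2) r1[OF B(1)]]
    G.res_res[OF Io(1)[OF B(1)] oI[OF Io(1)[OF B(1)]] oI[OF Y(1)] Isub(3)[OF B(2)] Isub(1) r1[OF B(1)]]
    G.res_res[OF oW oI[OF Io(1)[OF B(1)]] oI[OF Y(1)] Isub(3)[OF B(2)] Io(3)[OF B(1)] cs] r2[OF B(1)] by simp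
  show "mres G (W Int Z) ?Y (r Z) = mres G (W Int Z') ?Y (r Z')"
   by (rule G_inj[OF Y(1) G.res_closed[OF Io(1)[OF Z] Y(1,2) r1[OF Z]] G.res_closed[OF Io(1)[OF Z'] Y(1,3) r1[OF Z']]])
    (use *[OF Z Y(2)] *[OF Z' Y(3)] in simp)
 next
  fix t assume t: "t : Ms G W" "!!Z. Z : ?I ==> mres G W (W Int Z) t = r Z"
  show thesis by (rule that[OF t])
 qed (rule cov)
 have "mres G W (W Int U0) t = ?cs"
 proof (rule sheaf_eqI[OF G.msh oW G.res_closed[OF W(1) oW Isub(1) t(1)] cs])
  fix p assume p: "p : W Int U0"
  from pI[OF IntD1[OF p]] obtain Z where Z: "Z : ?I" "p : Z" by (elim exE conjE)
  note o = oI[OF Io(1)[OF Z(1)]]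
  have "mres G (W Int U0) (W Int Z Int U0) (mres G W (W Int U0) t) = mres G (W Int U0) (W Int Z Int U0) ?cs"
   using G.res_res[OF W(1) oW o Io(3)[OF Z(1)] Isub(1) t(1)] G.res_res[OF W(1) Io(1)[OF Z(1)] o Isub(1) Io(2)[OF Z(1)] t(1)]
    t(2)[OF Z(1)] r2[OF Z(1)] by simp
  thus "EX Y. opn X Y & p : Y & Y <= W Int U0 & mres G (W Int U0) Y (mres G W (W Int U0) t) = mres G (W Int U0) Y ?cs"
   using o p Z(2) Io(3)[OF Z(1)] by (intro exI[of _ "W Int Z Int U0"]) simp
 qed
 thus "EX r:Ms G W. mres G W (W Int U0) r = ?cs" by (rule bexI[OF _ t(1)])
qed

text \<open>The value at a section is determined over the dense set, so it is unique. Additivity,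
  linearity and compatibility with restriction follow because both sides are values at the same
  section.\<close>

lemma ext_hom:
 assumes s: "s : Ms G U0" and ext: "ext (pts X) s"
 shows "EX \<phi>:mod_hom X F G. \<phi> U0 e0 = s"
proof -
 have P0: "pts X Int U0 = U0" using openin_subset[OF U0(1)] by auto
 \<comment> \<open>\<open>v U x r\<close> says that \<open>r\<close> is the value of the extended
   homomorphism at the section \<open>x\<close> over \<open>U\<close>.\<close>
 define v where "v U x r \<longleftrightarrow> r : Ms G U & (EX c. rel U x c & mres G U (U Int U0) r = c *.[msec G (U Int U0)] mres G U0 (U Int U0) s)" for U x r
 have v_ex: "EX r. v U x r" if h: "opn X U" "x : Ms F U" for U x
 proof -
  obtain c where c: "rel U x c" by (rule rel_ex[OF h])
  obtain r where "r : Ms G U" "mres G U (U Int U0) r = c *.[msec G (U Int U0)] mres G (pts X Int U0) (U Int U0) s"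
   by (rule ext_val[OF ext h(1) openin_subset[OF h(1)] h(2) c])
  thus ?thesis unfolding v_def P0 using c by blast
 qed
 have v_un: "r = r'" if h: "opn X U" "v U x r" "v U x r'" for U x r r'
 proof -
  obtain c where c: "r : Ms G U" "rel U x c" "mres G U (U Int U0) r = c *.[msec G (U Int U0)] mres G U0 (U Int U0) s"
   using h(2) unfolding v_def by (elim exE conjE) (rule that)
  obtain d where d: "r' : Ms G U" "rel U x d" "mres G U (U Int U0) r' = d *.[msec G (U Int U0)] mres G U0 (U Int U0) s"
   using h(3) unfolding v_def by (elim exE conjE) (rule that)
  show ?thesis by (rule G_inj[OF h(1) c(1) d(1)]) (simp only: c(3) d(3) rel_unique[OF h(1) c(2) d(2)])
 qed
 define \<phi> where "\<phi> U x = (SOME r. v U x r)" for U x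
 have ph: "v U x (\<phi> U x)" if "opn X U" "x : Ms F U" for U x
  unfolding \<phi>_def by (rule someI_ex[OF v_ex[OF that]])
 have ph_eq: "\<phi> U x = r" if h: "opn X U" "x : Ms F U" "v U x r" for U x r
  by (rule v_un[OF h(1) ph[OF h(1,2)] h(3)])
 note sU = G.res_closed[OF U0(1) oI Isub(2) s]
 have "(\<lambda>U\<in>{U. opn X U}. \<lambda>x\<in>Ms F U. \<phi> U x) : mod_hom X F G"
 proof (rule mod_homI[OF _ _ _ _ rs F.ms])
  fix U x assume U: "opn X U" and x: "x : Ms F U"
  note o = oI[OF U]
  interpret M: module "osec X (U Int U0)" "msec G (U Int U0)" by (rule G.md[OF o])
  obtain c where p: "\<phi> U x : Ms G U" and c: "rel U x c"
   and e: "mres G U (U Int U0) (\<phi> U x) = c *.[msec G (U Int U0)] mres G U0 (U Int U0) s"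
   using ph[OF U x] unfolding v_def by (elim exE conjE) (rule that)
  show "\<phi> U x : Ms G U" by (rule p)
  { fix y assume y: "y : Ms F U"
   obtain d where q: "\<phi> U y : Ms G U" and d: "rel U y d"
    and e': "mres G U (U Int U0) (\<phi> U y) = d *.[msec G (U Int U0)] mres G U0 (U Int U0) s"
    using ph[OF U y] unfolding v_def by (elim exE conjE) (rule that)
   have "v U (x +[msec F U] y) (\<phi> U x +[msec G U] \<phi> U y)" unfolding v_def
    by (intro conjI exI[of _ "c +[osec X (U Int U0)] d"] G.add_closed[OF U p q] rel_ops(1)[OF U x c y d])
     (simp add: G.res_add[OF U o Isub(1) p q] e e' M.smult_l_distr[OF relD(1)[OF c] relD(1)[OF d] sU[OF U]])
   thus "\<phi> U (x +[msec F U] y) = \<phi> U x +[msec G U] \<phi> U y" by (rule ph_eq[OF U F.add_closed[OF U x y]]) }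
  { fix a assume a: "a : Os X U"
   have "v U (a *.[msec F U] x) (a *.[msec G U] \<phi> U x)" unfolding v_def
    by (intro conjI exI[of _ "ores X U (U Int U0) a *[osec X (U Int U0)] c"] G.smult_closed[OF U a p] rel_ops(2)[OF U x c a])
     (simp add: G.res_smult[OF U o Isub(1) a p] e M.smult_assoc1[OF ores_in[OF U o Isub(1) a] relD(1)[OF c] sU[OF U]])
   thus "\<phi> U (a *.[msec F U] x) = a *.[msec G U] \<phi> U x" by (rule ph_eq[OF U F.smult_closed[OF U a x]]) }
  { fix W assume W: "opn X W" "W <= U"
   note oW = oI[OF W(1)]
   have "mres G W (W Int U0) (mres G U W (\<phi> U x)) = mres G (U Int U0) (W Int U0) (mres G U (U Int U0) (\<phi> U x))"
    using G.res_res[OF U W(1) oW Isub(1) W(2) p] G.res_res[OF U o oW Isub(3)[OF W(2)] Isub(1) p] by simp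
   also have "... = ores X (U Int U0) (W Int U0) c *.[msec G (W Int U0)] mres G U0 (W Int U0) s"
    unfolding e G.res_smult[OF o oW Isub(3)[OF W(2)] relD(1)[OF c] sU[OF U]] G.res_res[OF U0(1) o oW Isub(3)[OF W(2)] Isub(2) s] ..
   finally have "v W (mres F U W x) (mres G U W (\<phi> U x))" unfolding v_def
    using rel_res[OF U W x c] G.res_closed[OF U W p] by blast
   thus "\<phi> W (mres F U W x) = mres G U W (\<phi> U x)" by (rule ph_eq[OF W(1) F.res_closed[OF U W x]]) }
 qed
 moreover have "\<phi> U0 e0 = s"
 proof (rule ph_eq[OF U0])
  interpret O: cring "osec X U0" by (rule cr[OF U0(1)])
  interpret MF: module "osec X U0" "msec F U0" by (rule F.md[OF U0(1)])
  interpret MG: module "osec X U0" "msec G U0" by (rule G.md[OF U0(1)])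
  show "v U0 e0 s" unfolding v_def rel_def
   using s U0 F.res_id[OF U0] G.res_id[OF U0(1) s] by (intro conjI exI[of _ "1[osec X U0]"]) simp_all
 qed
 ultimately show ?thesis using U0 by (intro bexI) simp_all
qed

text \<open>The sheaf Hom(F, G), a homomorphism being recorded by the image of \<open>e0\<close>
  over the part of the open set inside \<open>U0\<close>. Its sections have the same type as those
  of \<open>G\<close>, as is necessary for applying an ampleness condition that quantifies over
  sheaves with sections in one type.\<close>

definition HG :: "('p, 'a, 'n) msheaf"
 where "HG = \<lparr>msec = (%U. \<lparr>carrier = {s. ext U s}, monoid.mult = undefined, monoid.one = undefined,
   ring.zero = 0[msec G (U Int U0)], ring.add = ring.add (msec G (U Int U0)),
   module.smult = (%a s. ores X U (U Int U0) a *.[msec G (U Int U0)] s)\<rparr>),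
  mres = (%U W. mres G (U Int U0) (W Int U0))\<rparr>"

lemma HG_sel: "Ms HG U = {s. ext U s}" "0[msec HG U] = 0[msec G (U Int U0)]"
 "s +[msec HG U] t = s +[msec G (U Int U0)] t" "a *.[msec HG U] s = ores X U (U Int U0) a *.[msec G (U Int U0)] s"
 "mres HG U W = mres G (U Int U0) (W Int U0)"
 by (simp_all add: HG_def)

lemma ext_ops:
 assumes U: "opn X U" and s: "ext U s"
 shows "ext U t ==> ext U (s +[msec G (U Int U0)] t)"
  "a : Os X U ==> ext U (ores X U (U Int U0) a *.[msec G (U Int U0)] s)"
proof -
 note oU = oI[OF U]
 note sc = extD[OF s]
 show "ext U (s +[msec G (U Int U0)] t)" if t: "ext U t"
 proof (rule extI[OF G.add_closed[OF oU sc extD[OF t]]])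
  fix W x c assume W: "opn X W" "W <= U" and x: "x : Ms F W" "rel W x c"
  note o = oI[OF W(1)]
  interpret M: module "osec X (W Int U0)" "msec G (W Int U0)" by (rule G.md[OF o])
  obtain r where r: "r : Ms G W" "mres G W (W Int U0) r = c *.[msec G (W Int U0)] mres G (U Int U0) (W Int U0) s" by (rule ext_val[OF s W x])
  obtain r' where r': "r' : Ms G W" "mres G W (W Int U0) r' = c *.[msec G (W Int U0)] mres G (U Int U0) (W Int U0) t" by (rule ext_val[OF t W x])
  show "EX r:Ms G W. mres G W (W Int U0) r = c *.[msec G (W Int U0)] mres G (U Int U0) (W Int U0) (s +[msec G (U Int U0)] t)"
   by (rule bexI[OF _ G.add_closed[OF W(1) r(1) r'(1)]])
    (simp add: G.res_add[OF W(1) o Isub(1) r(1) r'(1)] r(2) r'(2) G.res_add[OF oU o Isub(3)[OF W(2)] sc extD[OF t]]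
      M.smult_r_distr[OF relD(1)[OF x(2)] s_in[OF U W sc] s_in[OF U W extD[OF t]]])
 qed
 show "ext U (ores X U (U Int U0) a *.[msec G (U Int U0)] s)" if a: "a : Os X U"
 proof (rule extI[OF G.smult_closed[OF oU ores_in[OF U oU Isub(1) a] sc]])
  fix W x c assume W: "opn X W" "W <= U" and x: "x : Ms F W" "rel W x c"
  note o = oI[OF W(1)]
  interpret M: module "osec X (W Int U0)" "msec G (W Int U0)" by (rule G.md[OF o])
  obtain r where r: "r : Ms G W" "mres G W (W Int U0) r = c *.[msec G (W Int U0)] mres G (U Int U0) (W Int U0) s" by (rule ext_val[OF s W x])
  note aW = ores_in[OF U W a] and aU = ores_in[OF U oU Isub(1) a]
  let ?a = "ores X U (W Int U0) a"
  have a1: "ores X W (W Int U0) (ores X U W a) = ?a" "ores X (U Int U0) (W Int U0) (ores X U (U Int U0) a) = ?a"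
   using ores_ores[OF U W(1) o Isub(1) W(2) a] ores_ores[OF U oU o Isub(3)[OF W(2)] Isub(1) a] by simp_all
  have ac: "?a : Os X (W Int U0)" using a1(1) ores_in[OF W(1) o Isub(1) aW] by simp
  have "?a *.[msec G (W Int U0)] (c *.[msec G (W Int U0)] mres G (U Int U0) (W Int U0) s) = c *.[msec G (W Int U0)] (?a *.[msec G (W Int U0)] mres G (U Int U0) (W Int U0) s)"
   using M.smult_assoc1[OF ac relD(1)[OF x(2)] s_in[OF U W sc]] M.smult_assoc1[OF relD(1)[OF x(2)] ac s_in[OF U W sc]] M.R.m_comm[OF ac relD(1)[OF x(2)]] by simp
  thus "EX r:Ms G W. mres G W (W Int U0) r = c *.[msec G (W Int U0)] mres G (U Int U0) (W Int U0) (ores X U (U Int U0) a *.[msec G (U Int U0)] s)"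
   by (intro bexI[OF _ G.smult_closed[OF W(1) aW r(1)]])
    (simp add: G.res_smult[OF W(1) o Isub(1) aW r(1)] r(2) G.res_smult[OF oU o Isub(3)[OF W(2)] aU sc] a1)
 qed
qed

lemma ext_zero: assumes U: "opn X U" shows "ext U 0[msec G (U Int U0)]"
proof (rule extI[OF G.zero_closed[OF oI[OF U]]])
 fix W x c assume W: "opn X W" "W <= U" and x: "x : Ms F W" "rel W x c"
 interpret M: module "osec X (W Int U0)" "msec G (W Int U0)" by (rule G.md[OF oI[OF W(1)]])
 show "EX r:Ms G W. mres G W (W Int U0) r = c *.[msec G (W Int U0)] mres G (U Int U0) (W Int U0) 0[msec G (U Int U0)]"
  by (rule bexI[OF _ G.zero_closed[OF W(1)]])
   (simp add: G.res_zero[OF W(1) oI[OF W(1)] Isub(1)] G.res_zero[OF oI[OF U] oI[OF W(1)] Isub(3)[OF W(2)]] M.smult_r_null[OF relD(1)[OF x(2)]])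
qed

lemma HG_module: assumes U: "opn X U" shows "module (osec X U) (msec HG U)"
proof -
 note o = oI[OF U]
 interpret M: module "osec X (U Int U0)" "msec G (U Int U0)" by (rule G.md[OF o])
 interpret O: cring "osec X U" by (rule cr[OF U])
 note a = ores_in[OF U o Isub(1)]
 show ?thesis
 proof (rule moduleI)
  show "cring (osec X U)" by (rule O.is_cring)
  show "abelian_group (msec HG U)"
  proof (rule abelian_groupI, unfold HG_sel mem_Collect_eq)
   fix s assume s: "ext U s"
   \<comment> \<open>The negative of \<open>s\<close> is taken as -1 times \<open>s\<close>, which
     extends because extendability is stable under scalars.\<close>
   have m: "\<ominus>\<^bsub>osec X U\<^esub> 1[osec X U] : Os X U" by simp
   let ?m = "ores X U (U Int U0) (\<ominus>\<^bsub>osec X U\<^esub> 1[osec X U])"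
   have "?m +[osec X (U Int U0)] 1[osec X (U Int U0)] = 0[osec X (U Int U0)]"
    using ores_ops(1)[OF U o Isub(1) m O.one_closed] ores_ops(3,4)[OF U o Isub(1)] O.l_neg[OF O.one_closed] by simp
   hence "?m *.[msec G (U Int U0)] s +[msec G (U Int U0)] s = 0[msec G (U Int U0)]"
    using M.smult_l_distr[OF a[OF m] M.R.one_closed extD[OF s]] M.smult_one[OF extD[OF s]] M.smult_l_null[OF extD[OF s]] by simp
   thus "EX t:{s. ext U s}. t +[msec G (U Int U0)] s = 0[msec G (U Int U0)]"
    by (rule bexI) (rule CollectI, rule ext_ops(2)[OF U s m])
  qed (use ext_ops(1)[OF U] ext_zero[OF U] extD in \<open>auto simp: M.M.a_ac\<close>)
 next
  fix c s assume c: "c : Os X U" and s: "s : Ms HG U"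
  have s: "ext U s" using s by (simp add: HG_sel)
  note sc = extD[OF s]
  show "c *.[msec HG U] s : Ms HG U" using ext_ops(2)[OF U s c] by (simp add: HG_sel)
  { fix d assume d: "d : Os X U"
   show "(c +[osec X U] d) *.[msec HG U] s = c *.[msec HG U] s +[msec HG U] d *.[msec HG U] s"
    unfolding HG_sel ores_ops(1)[OF U o Isub(1) c d] by (rule M.smult_l_distr[OF a[OF c] a[OF d] sc])
   show "(c *[osec X U] d) *.[msec HG U] s = c *.[msec HG U] (d *.[msec HG U] s)"
    unfolding HG_sel ores_ops(2)[OF U o Isub(1) c d] by (rule M.smult_assoc1[OF a[OF c] a[OF d] sc]) }
  { fix t assume t: "t : Ms HG U"
   have "ext U t" using t by (simp add: HG_sel)
   from extD[OF this] show "c *.[msec HG U] (s +[msec HG U] t) = c *.[msec HG U] s +[msec HG U] c *.[msec HG U] t"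
    unfolding HG_sel by (rule M.smult_r_distr[OF a[OF c] sc]) }
 next
  fix s assume "s : Ms HG U"
  hence "ext U s" by (simp add: HG_sel)
  from extD[OF this] show "1[osec X U] *.[msec HG U] s = s"
   unfolding HG_sel ores_ops(3)[OF U o Isub(1)] by (rule M.smult_one)
 qed
qed

lemma HG_mod_sheaf: "mod_sheaf X HG"
 unfolding mod_sheaf_def
proof (intro conjI allI impI ballI)
 show "module (osec X U) (msec HG U)" if "opn X U" for U by (rule HG_module[OF that])
 fix U W assume "opn X U & opn X W & W <= U"
 hence W: "opn X U" "opn X W" "W <= U" by auto
 note o = oI[OF W(1)] oI[OF W(2)] Isub(3)[OF W(3)]
 { fix s t assume "s : Ms HG U" "t : Ms HG U"
  hence "s : Ms G (U Int U0)" "t : Ms G (U Int U0)" using extD by (auto simp: HG_sel)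
  thus "mres HG U W (s +[msec HG U] t) = mres HG U W s +[msec HG W] mres HG U W t"
   unfolding HG_sel by (rule G.res_add[OF o]) }
 { fix a s assume as: "a : Os X U" "s : Ms HG U"
  hence s: "s : Ms G (U Int U0)" using extD by (auto simp: HG_sel)
  show "mres HG U W (a *.[msec HG U] s) = ores X U W a *.[msec HG W] mres HG U W s"
   unfolding HG_sel G.res_smult[OF o ores_in[OF W(1) o(1) Isub(1) as(1)] s]
    ores_ores[OF W(1) o Isub(1) as(1)] ores_ores[OF W(1,2) o(2) Isub(1) W(3) as(1)] .. }
next
 show "is_sheaf (tp X) (%U. Ms HG U) (mres HG)"
 proof (rule is_sheafI)
  show "is_presheaf (tp X) (%U. Ms HG U) (mres HG)"
   unfolding is_presheaf_def HG_sel
  proof (intro conjI allI impI ballI)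
   fix U W assume "opn X U & opn X W & W <= U"
   thus "mres G (U Int U0) (W Int U0) : {s. ext U s} \<rightarrow> {s. ext W s}"
    by (elim conjE, intro Pi_I CollectI) (rule ext_res, erule CollectD)
  next
   fix U s assume U: "opn X U" and s: "s : {s. ext U s}"
   show "mres G (U Int U0) (U Int U0) s = s" by (rule G.res_id[OF oI[OF U] extD[OF CollectD[OF s]]])
  next
   fix U W Z s assume h: "opn X U & opn X W & opn X Z & Z <= W & W <= U" and s: "s : {s. ext U s}"
   hence o: "opn X U" "opn X W" "opn X Z" "Z <= W" "W <= U" by auto
   show "mres G (W Int U0) (Z Int U0) (mres G (U Int U0) (W Int U0) s) = mres G (U Int U0) (Z Int U0) s"
    by (rule G.res_res[OF oI[OF o(1)] oI[OF o(2)] oI[OF o(3)] Isub(3)[OF o(4)] Isub(3)[OF o(5)] extD[OF CollectD[OF s]]])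
  qed
  fix \<C> s assume A: "!!U. U : \<C> ==> opn X U & s U : Ms HG U"
   and eq: "!!U W. U : \<C> ==> W : \<C> ==> mres HG U (U Int W) (s U) = mres HG W (U Int W) (s W)"
  have C: "opn X U" "ext U (s U)" if "U : \<C>" for U using A[OF that] by (auto simp: HG_sel)
  have oC: "opn X (\<Union>\<C>)" using C(1) by blast
  obtain t where t: "t : Ms G (\<Union>\<C> Int U0)" "!!U. U : \<C> ==> mres G (\<Union>\<C> Int U0) (U Int U0) t = s U"
  proof (rule sheaf_glue[OF G.msh, of \<C> "%U. U Int U0" s "\<Union>\<C> Int U0"])
   fix U assume U: "U : \<C>"
   show "opn X (U Int U0)" by (rule oI[OF C(1)[OF U]])
   show "s U : Ms G (U Int U0)" by (rule extD[OF C(2)[OF U]])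
   fix W assume W: "W : \<C>"
   have "(U Int U0) Int (W Int U0) = (U Int W) Int U0" by auto
   thus "mres G (U Int U0) ((U Int U0) Int (W Int U0)) (s U) = mres G (W Int U0) ((U Int U0) Int (W Int U0)) (s W)"
    using eq[OF U W] unfolding HG_sel by simp
  next
   show "\<Union>\<C> Int U0 = (UN U:\<C>. U Int U0)" by auto
   fix t assume t: "t : Ms G (\<Union>\<C> Int U0)" "!!U. U : \<C> ==> mres G (\<Union>\<C> Int U0) (U Int U0) t = s U"
   show thesis by (rule that[OF t])
  qed
  have ext: "ext (\<Union>\<C>) t"
  proof (rule ext_local[OF oC t(1)])
   fix p assume "p : \<Union>\<C>"
   then obtain U where U: "U : \<C>" "p : U" by blast
   show "EX Z. opn X Z & p : Z & Z <= \<Union>\<C> & ext Z (mres G (\<Union>\<C> Int U0) (Z Int U0) t)"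
    using C[OF U(1)] U t(2)[OF U(1)] by (intro exI[of _ U] conjI) auto
  qed
  show "EX! t. t : Ms HG (\<Union>\<C>) & (ALL U:\<C>. mres HG (\<Union>\<C>) U t = s U)"
  proof (rule ex1I[of _ t])
   show "t : Ms HG (\<Union>\<C>) & (ALL U:\<C>. mres HG (\<Union>\<C>) U t = s U)" using ext t(2) by (simp add: HG_sel)
   fix t' assume t': "t' : Ms HG (\<Union>\<C>) & (ALL U:\<C>. mres HG (\<Union>\<C>) U t' = s U)"
   show "t' = t"
   proof (rule sheaf_eqI[OF G.msh oI[OF oC] _ t(1)])
    show "t' : Ms G (\<Union>\<C> Int U0)" using t' extD by (auto simp: HG_sel)
    fix p assume "p : \<Union>\<C> Int U0"
    then obtain U where U: "U : \<C>" "p : U" "p : U0" by blast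
    show "EX W. opn X W & p : W & W <= \<Union>\<C> Int U0 & mres G (\<Union>\<C> Int U0) W t' = mres G (\<Union>\<C> Int U0) W t"
     using U oI[OF C(1)[OF U(1)]] t' t(2)[OF U(1)] by (intro exI[of _ "U Int U0"] conjI) (auto simp: HG_sel)
   qed
  qed
 qed
qed

text \<open>The section is the record of the homomorphism with \<epsilon> -> \<eta>: as e0 = a
  \<epsilon>, it sends e0 to a \<eta>. It generates because a homomorphism is determined by the
  image of \<epsilon>, which is a unique multiple of \<eta>.\<close>

lemma HG_gen:
 assumes \<epsilon>: "free_gen X F U \<epsilon>" and \<eta>: "free_gen X G U \<eta>" and a: "a : Os X (U Int U0)"
  and e: "mres F U0 (U Int U0) e0 = a *.[msec F (U Int U0)] mres F U (U Int U0) \<epsilon>"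
 shows "free_gen X HG U (a *.[msec G (U Int U0)] mres G U (U Int U0) \<eta>)"
proof -
 note U = free_genD(1,2)[OF \<epsilon>] and e = assms(4) and h = free_genD(2)[OF \<eta>]
 note oU = oI[OF U(1)]
 interpret N: module "osec X (U Int U0)" "msec F (U Int U0)" by (rule F.md[OF oU])
 interpret M: module "osec X (U Int U0)" "msec G (U Int U0)" by (rule G.md[OF oU])
 obtain c where c: "rel U \<epsilon> c" by (rule rel_ex[OF U])
 note hU = G.res_closed[OF U(1) oU Isub(1) h] and cc = relD(1)[OF c]
 let ?s = "a *.[msec G (U Int U0)] mres G U (U Int U0) \<eta>"
 \<comment> \<open>Over the part inside \<open>U0\<close> each generator is a multiple of the other,
   \<epsilon> = c e0 and e0 = a \<epsilon>, so the coefficients are mutually inverse.\<close>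
 have ca: "c *[osec X (U Int U0)] a = 1[osec X (U Int U0)]"
 proof (rule free_gen_unique[OF \<epsilon> oU Isub(1)])
  note eU = F.res_closed[OF U(1) oU Isub(1) U(2)]
  show "c *[osec X (U Int U0)] a : Os X (U Int U0)" "1[osec X (U Int U0)] : Os X (U Int U0)" using cc a by simp_all
  show "(c *[osec X (U Int U0)] a) *.[msec F (U Int U0)] mres F U (U Int U0) \<epsilon> = 1[osec X (U Int U0)] *.[msec F (U Int U0)] mres F U (U Int U0) \<epsilon>"
   using relD(2)[OF c] e N.smult_assoc1[OF cc a eU] N.smult_one[OF eU] by simp
  show "(c *[osec X (U Int U0)] a) *.[msec F (U Int U0)] mres F U (U Int U0) \<epsilon> : Ms F (U Int U0)" using cc a eU by simp
 qed
 have sc: "?s : Ms G (U Int U0)" using a hU by simp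
 have ext: "ext U ?s"
  by (rule ext_gen[OF \<epsilon> sc c h]) (use M.smult_assoc1[OF cc a hU] ca M.smult_one[OF hU] in simp)
 show ?thesis unfolding free_gen_def
 proof (intro conjI allI impI ballI)
  show "opn X U" by fact
  show "?s : Ms HG U" using ext by (simp add: HG_sel)
  fix W t assume "opn X W & W <= U" and t: "t : Ms HG W"
  hence W: "opn X W" "W <= U" by auto
  have t: "ext W t" using t by (simp add: HG_sel)
  note o = oI[OF W(1)]
  interpret W: module "osec X (W Int U0)" "msec G (W Int U0)" by (rule G.md[OF o])
  let ?c = "ores X (U Int U0) (W Int U0) c" and ?a = "ores X (U Int U0) (W Int U0) a" and ?h = "mres G U (W Int U0) \<eta>"
  have hW: "?h : Ms G (W Int U0)" by (rule G.res_closed[OF U(1) o _ h]) (use W in auto)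
  note acW = ores_in[OF oU o Isub(3)[OF W(2)] a] ores_in[OF oU o Isub(3)[OF W(2)] cc]
  have ca': "?a *[osec X (W Int U0)] ?c = 1[osec X (W Int U0)]"
   using ores_ops(2)[OF oU o Isub(3)[OF W(2)] cc a] ca ores_ops(3)[OF oU o Isub(3)[OF W(2)]] W.R.m_comm[OF acW] by simp
  have sW: "mres G (U Int U0) (W Int U0) ?s = ?a *.[msec G (W Int U0)] ?h"
   unfolding G.res_smult[OF oU o Isub(3)[OF W(2)] a hU] G.res_res[OF U(1) oU o Isub(3)[OF W(2)] Isub(1) h] ..
  have val: "y *.[msec HG W] mres HG U W ?s = ?a *.[msec G (W Int U0)] (ores X W (W Int U0) y *.[msec G (W Int U0)] ?h)"
   if y: "y : Os X W" for y
   unfolding HG_sel sW using W.smult_assoc1[OF ores_in[OF W(1) o Isub(1) y] acW(1) hW]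
    W.smult_assoc1[OF acW(1) ores_in[OF W(1) o Isub(1) y] hW] W.R.m_comm[OF acW(1) ores_in[OF W(1) o Isub(1) y]] by simp
  \<comment> \<open>The value of the homomorphism \<open>t\<close> at \<epsilon>. Its coordinate
    \<open>y\<close> with respect to \<eta> will be the coefficient of \<open>t\<close>.\<close>
  obtain r where r: "r : Ms G W" "mres G W (W Int U0) r = ?c *.[msec G (W Int U0)] mres G (W Int U0) (W Int U0) t"
   by (rule ext_val[OF t W(1) order_refl F.res_closed[OF U(1) W U(2)] rel_res[OF U(1) W U(2) c]])
  obtain y where y: "y : Os X W" "r = y *.[msec G W] mres G U W \<eta>" by (rule free_gen_coef[OF \<eta> W r(1)])
  have ry: "mres G W (W Int U0) (z *.[msec G W] mres G U W \<eta>) = ores X W (W Int U0) z *.[msec G (W Int U0)] ?h" if z: "z : Os X W" for z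
   unfolding G.res_smult[OF W(1) o Isub(1) z G.res_closed[OF U(1) W h]] G.res_res[OF U(1) W(1) o Isub(1) W(2) h] ..
  have "t = ?a *.[msec G (W Int U0)] (?c *.[msec G (W Int U0)] t)"
   using W.smult_assoc1[OF acW extD[OF t]] ca' W.smult_one[OF extD[OF t]] by simp
  also have "?c *.[msec G (W Int U0)] t = ores X W (W Int U0) y *.[msec G (W Int U0)] ?h"
   using r(2) ry[OF y(1)] y(2) G.res_id[OF o extD[OF t]] by simp
  also have "?a *.[msec G (W Int U0)] ... = y *.[msec HG W] mres HG U W ?s" by (rule val[OF y(1), symmetric])
  finally have ty: "t = y *.[msec HG W] mres HG U W ?s" .
  show "EX! y. y : Os X W & t = y *.[msec HG W] mres HG U W ?s"
  proof (rule ex1I[of _ y])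
   show "y : Os X W & t = y *.[msec HG W] mres HG U W ?s" using y(1) ty by (intro conjI)
   fix z assume "z : Os X W & t = z *.[msec HG W] mres HG U W ?s"
   hence z: "z : Os X W" "t = z *.[msec HG W] mres HG U W ?s" by blast+
   note zy = ores_in[OF W(1) o Isub(1) z(1)] ores_in[OF W(1) o Isub(1) y(1)]
   have m: "?c *.[msec G (W Int U0)] (?a *.[msec G (W Int U0)] w) = w" if w: "w : Ms G (W Int U0)" for w
    using W.smult_assoc1[OF acW(2,1) w] ca' W.R.m_comm[OF acW] W.smult_one[OF w] by simp
   have "?a *.[msec G (W Int U0)] (ores X W (W Int U0) z *.[msec G (W Int U0)] ?h) = ?a *.[msec G (W Int U0)] (ores X W (W Int U0) y *.[msec G (W Int U0)] ?h)"
    using trans[OF z(2)[symmetric] ty] unfolding val[OF z(1)] val[OF y(1)] .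
   hence "ores X W (W Int U0) z *.[msec G (W Int U0)] ?h = ores X W (W Int U0) y *.[msec G (W Int U0)] ?h"
    using m[OF W.smult_closed[OF zy(1) hW]] m[OF W.smult_closed[OF zy(2) hW]] by (metis (no_types))
   hence e2: "mres G W (W Int U0) (z *.[msec G W] mres G U W \<eta>) = mres G W (W Int U0) (y *.[msec G W] mres G U W \<eta>)"
    unfolding ry[OF z(1)] ry[OF y(1)] .
   note cl = G.smult_closed[OF W(1) z(1) G.res_closed[OF U(1) W h]] G.smult_closed[OF W(1) y(1) G.res_closed[OF U(1) W h]]
   show "z = y" by (rule free_gen_unique[OF \<eta> W z(1) y(1) G_inj[OF W(1) cl e2] cl(1)])
  qed
 qed
qed

lemma common_gens:
 assumes "p : pts X"
 obtains U \<epsilon> \<eta> where "p : U" "free_gen X F U \<epsilon>" "free_gen X G U \<eta>"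
proof -
 obtain U \<epsilon> where U: "p : U" "free_gen X F U \<epsilon>" using line_bundleD(2)[OF F assms] by (elim exE conjE) (rule that)
 obtain W \<eta> where W: "p : W" "free_gen X G W \<eta>" using line_bundleD(2)[OF G assms] by (elim exE conjE) (rule that)
 have o: "opn X (U Int W)" using free_genD(1)[OF U(2)] free_genD(1)[OF W(2)] by blast
 show thesis
  by (rule that[of "U Int W", OF _ F.free_gen_res[OF U(2) o] G.free_gen_res[OF W(2) o]]) (use U(1) W(1) in auto)
qed

lemma HG_line_bundle: "line_bundle X HG"
 unfolding line_bundle_def
proof (intro conjI ballI HG_mod_sheaf)
 fix p assume "p : pts X"
 then obtain U \<epsilon> \<eta> where U: "p : U" "free_gen X F U \<epsilon>" "free_gen X G U \<eta>" by (rule common_gens)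
 note o = oI[OF free_genD(1)[OF U(2)]]
 obtain a where a: "a : Os X (U Int U0)" "mres F U0 (U Int U0) e0 = a *.[msec F (U Int U0)] mres F U (U Int U0) \<epsilon>"
  by (rule free_gen_coef[OF U(2) o Isub(1) e0_in[OF free_genD(1)[OF U(2)]]])
 show "EX U e. p : U & free_gen X HG U e" using HG_gen[OF U(2,3) a] U(1) by blast
qed

end

section \<open>Coherence and isomorphisms of line bundles\<close>

lemma (in module) finsum_smult_left:
 assumes "finite B" "!!i. i : B ==> d i : carrier R" "x : carrier M"
 shows "finsum M (%i. d i *.[M] x) B = finsum R d B *.[M] x"
 using assms
proof (induction B)
 case (insert i B)
 have d: "d : B \<rightarrow> carrier R" "d i : carrier R" "(%i. d i *.[M] x) : B \<rightarrow> carrier M" using insert.prems by auto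
 show ?case unfolding R.finsum_insert[OF insert.hyps d(1,2)] M.finsum_insert[OF insert.hyps d(3) smult_closed[OF d(2) insert.prems(2)]]
  using insert.IH insert.prems smult_l_distr[OF d(2) R.finsum_closed[OF d(1)] insert.prems(2)] by simp
qed (simp add: smult_l_null)

context rsheaf begin

lemma gen_smult_zero:
 assumes G: "mod_sheaf X G" and g: "free_gen X G W g" and Z: "opn X Z" "Z <= W" and d: "d : Os X Z"
 shows "d *.[msec G Z] mres G W Z g = 0[msec G Z] \<longleftrightarrow> d = 0[osec X Z]"
proof -
 interpret G: modsheaf X G by unfold_locales (rule G)
 interpret M: module "osec X Z" "msec G Z" by (rule G.md[OF Z(1)])
 note gZ = G.res_closed[OF free_genD(1)[OF g] Z free_genD(2)[OF g]]
 note z = M.smult_l_null[OF gZ]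
 show ?thesis
 proof
  assume "d *.[msec G Z] mres G W Z g = 0[msec G Z]"
  hence "d *.[msec G Z] mres G W Z g = 0[osec X Z] *.[msec G Z] mres G W Z g" using z by simp
  thus "d = 0[osec X Z]" by (rule free_gen_unique[OF g Z d M.R.zero_closed _ M.smult_closed[OF d gZ]])
 qed (simp add: z)
qed

text \<open>In a local generator a linear relation between sections is the same relation between
  their coordinates. This depends on the line bundle only through the coordinates.\<close>

lemma lin_comb_zero_iff:
 assumes G: "mod_sheaf X G" and g: "free_gen X G W g" and U: "opn X U" "W <= U" and Z: "opn X Z" "Z <= W"
  and s: "s : {..<n} \<rightarrow> Ms G U" and b: "b : {..<n} \<rightarrow> Os X Z"
  and c: "!!i. i < n ==> c i : Os X W" "!!i. i < n ==> mres G U W (s i) = c i *.[msec G W] g"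
 shows "lin_comb G U Z n b s = 0[msec G Z] \<longleftrightarrow> finsum (osec X Z) (%i. b i *[osec X Z] ores X W Z (c i)) {..<n} = 0[osec X Z]"
proof -
 interpret G: modsheaf X G by unfold_locales (rule G)
 interpret M: module "osec X Z" "msec G Z" by (rule G.md[OF Z(1)])
 note W = free_genD(1,2)[OF g]
 note gZ = G.res_closed[OF W(1) Z W(2)]
 let ?d = "%i. b i *[osec X Z] ores X W Z (c i)"
 have cZ: "ores X W Z (c i) : Os X Z" if "i < n" for i by (rule ores_in[OF W(1) Z c(1)[OF that]])
 have bi: "b i : Os X Z" if "i < n" for i using b that by auto
 have t: "b i *.[msec G Z] mres G U Z (s i) = ?d i *.[msec G Z] mres G W Z g" if i: "i < n" for i
 proof -
  have si: "s i : Ms G U" using s i by auto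
  have "mres G U Z (s i) = ores X W Z (c i) *.[msec G Z] mres G W Z g"
   using G.res_res[OF U(1) W(1) Z U(2) si] c(2)[OF i] G.res_smult[OF W(1) Z c(1)[OF i] W(2)] by simp
  thus ?thesis using M.smult_assoc1[OF bi[OF i] cZ[OF i] gZ] by simp
 qed
 have d: "?d i : Os X Z" if "i : {..<n}" for i using bi cZ that by simp
 have "lin_comb G U Z n b s = finsum (msec G Z) (%i. ?d i *.[msec G Z] mres G W Z g) {..<n}"
  unfolding lin_comb_def by (rule M.M.finsum_cong') (use t d gZ in auto)
 also have "... = finsum (osec X Z) ?d {..<n} *.[msec G Z] mres G W Z g"
  by (rule M.finsum_smult_left[OF _ d gZ]) simp
 finally show ?thesis using gen_smult_zero[OF G g Z, of "finsum (osec X Z) ?d {..<n}"] M.R.finsum_closed[of ?d "{..<n}"] d by auto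
qed

text \<open>Finite type is clear from local generators. For the relations, given sections of
  \<open>G\<close> are replaced locally by the sections of \<open>F\<close> with the same
  coordinates: both families have the same relations, and those of \<open>F\<close> are finitely
  generated.\<close>

lemma coherent_line_bundle:
 assumes F: "line_bundle X F" "coherent X F" and G: "line_bundle X G"
 shows "coherent X G"
 unfolding coherent_def
proof (intro conjI allI impI ballI)
 interpret F: modsheaf X F by (rule line_bundle_modsheaf[OF F(1)])
 interpret G: modsheaf X G by (rule line_bundle_modsheaf[OF G])
 show "mod_sheaf X G" by (rule G.ms)
 show "finite_type X G" unfolding finite_type_def
 proof
  fix p assume "p : pts X"
  then obtain U e where U: "p : U" "free_gen X G U e" using line_bundleD(2)[OF G] by blast
  note o = free_genD(1,2)[OF U(2)]
  have loc: "EX Z a. opn X Z & q : Z & Z <= W & a : {..<1} \<rightarrow> Os X Z & mres G W Z t = lin_comb G U Z 1 a (%_. e)"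
   if W: "opn X W & W <= U" "t : Ms G W" "q : W" for W t q
  proof -
   have W': "opn X W" "W <= U" using W(1) by auto
   interpret M: module "osec X W" "msec G W" by (rule G.md[OF W'(1)])
   obtain a where a: "a : Os X W" "t = a *.[msec G W] mres G U W e" by (rule free_gen_coef[OF U(2) W' W(2)])
   have "lin_comb G U W 1 (%_. a) (%_. e) = t" unfolding lin_comb_def
    using a(2) W(2) by (simp add: lessThan_Suc M.M.finsum_singleton)
   thus ?thesis using W' W(2,3) a(1) G.res_id[OF W'(1) W(2)] by (intro exI[of _ W] exI[of _ "%_. a"]) simp
  qed
  show "EX U n s. opn X U & p : U & s : {..<n} \<rightarrow> Ms G U &
   (ALL W. opn X W & W <= U --> (ALL t:Ms G W. ALL q:W. EX Z a.
   opn X Z & q : Z & Z <= W & a : {..<n} \<rightarrow> Os X Z & mres G W Z t = lin_comb G U Z n a s))"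
  proof (rule exI[of _ U], rule exI[of _ 1], rule exI[of _ "%_. e"], intro conjI allI impI ballI)
   fix W t q assume "opn X W & W <= U" "t : Ms G W" "q : W"
   thus "EX Z a. opn X Z & q : Z & Z <= W & a : {..<1} \<rightarrow> Os X Z & mres G W Z t = lin_comb G U Z 1 a (%_. e)"
    by (rule loc)
  qed (use U(1) o in simp_all)
 qed
 fix U s p and n :: nat assume "opn X U & s : {..<n} \<rightarrow> Ms G U" and p: "p : U"
 hence U: "opn X U" and s: "s : {..<n} \<rightarrow> Ms G U" by auto
 have "p : pts X" using p openin_subset[OF U] by auto
 then obtain W1 f1 W2 g2 where 1: "p : W1" "free_gen X F W1 f1" and 2: "p : W2" "free_gen X G W2 g2"
  using line_bundleD(2)[OF F(1)] line_bundleD(2)[OF G] by meson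
 let ?W = "U Int (W1 Int W2)"
 have W: "opn X ?W" "?W <= U" "?W <= W1" "?W <= W2" "p : ?W" using U 1 2 free_genD(1)[OF 1(2)] free_genD(1)[OF 2(2)] p by auto
 define f where "f = mres F W1 ?W f1"
 define g where "g = mres G W2 ?W g2"
 have f: "free_gen X F ?W f" unfolding f_def by (rule F.free_gen_res[OF 1(2) W(1,3)])
 have g: "free_gen X G ?W g" unfolding g_def by (rule G.free_gen_res[OF 2(2) W(1,4)])
 note fc = free_genD(2)[OF f] and gc = free_genD(2)[OF g]
 have "ALL i:{..<n}. EX c. c : Os X ?W & mres G U ?W (s i) = c *.[msec G ?W] g"
 proof
  fix i assume "i : {..<n}"
  hence si: "s i : Ms G U" using s by auto
  obtain c where "c : Os X ?W" "mres G U ?W (s i) = c *.[msec G ?W] mres G ?W ?W g"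
   by (rule free_gen_coef[OF g W(1) order_refl G.res_closed[OF U W(1,2) si]])
  thus "EX c. c : Os X ?W & mres G U ?W (s i) = c *.[msec G ?W] g" unfolding G.res_id[OF W(1) gc] by blast
 qed
 from bchoice[OF this] obtain c where c0: "ALL i:{..<n}. c i : Os X ?W & mres G U ?W (s i) = c i *.[msec G ?W] g" by (elim exE)
 have c: "c i : Os X ?W" "mres G U ?W (s i) = c i *.[msec G ?W] g" if "i < n" for i using bspec[OF c0, of i] that by simp_all
 \<comment> \<open>The sections of \<open>F\<close> whose coordinates in \<open>f\<close> are those
   of the given sections in \<open>g\<close>.\<close>
 let ?s = "%i. c i *.[msec F ?W] f"
 have s': "?s : {..<n} \<rightarrow> Ms F ?W" using c(1) F.smult_closed[OF W(1) _ fc] by auto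
 have c': "mres F ?W ?W (?s i) = c i *.[msec F ?W] f" if "i < n" for i by (rule F.res_id[OF W(1) F.smult_closed[OF W(1) c(1)[OF that] fc]])
 have iff: "lin_comb G U Z n b s = 0[msec G Z] \<longleftrightarrow> lin_comb F ?W Z n b ?s = 0[msec F Z]"
  if Z: "opn X Z" "Z <= ?W" and b: "b : {..<n} \<rightarrow> Os X Z" for Z b
  by (rule trans[OF lin_comb_zero_iff[OF G.ms g U W(2) Z s b c] lin_comb_zero_iff[OF F.ms f W(1) order_refl Z s' b c(1) c', symmetric]])
 have "EX W (m::nat) r. opn X W & p : W & W <= ?W &
    (ALL j<m. r j : {..<n} \<rightarrow> Os X W & lin_comb F ?W W n (r j) ?s = 0[msec F W]) &
    (ALL Z b. opn X Z & Z <= W & b : {..<n} \<rightarrow> Os X Z & lin_comb F ?W Z n b ?s = 0[msec F Z] -->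
     (ALL q:Z. EX Y c. opn X Y & q : Y & Y <= Z & c : {..<m} \<rightarrow> Os X Y &
       (ALL i<n. ores X Z Y (b i) = finsum (osec X Y) (%j. c j *[osec X Y] ores X W Y (r j i)) {..<m})))"
  by (rule bspec[OF mp[OF spec[OF spec[OF spec[OF conjunct2[OF conjunct2[OF F(2)[unfolded coherent_def]]]]]] conjI[OF W(1) s']] W(5)])
 then obtain Y and m :: nat and r where Y: "opn X Y" "p : Y" "Y <= ?W"
   and r: "ALL j<m. r j : {..<n} \<rightarrow> Os X Y & lin_comb F ?W Y n (r j) ?s = 0[msec F Y]"
   and k: "ALL Z b. opn X Z & Z <= Y & b : {..<n} \<rightarrow> Os X Z & lin_comb F ?W Z n b ?s = 0[msec F Z] -->
     (ALL q:Z. EX Y' c. opn X Y' & q : Y' & Y' <= Z & c : {..<m} \<rightarrow> Os X Y' &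
       (ALL i<n. ores X Z Y' (b i) = finsum (osec X Y') (%j. c j *[osec X Y'] ores X Y Y' (r j i)) {..<m}))"
  by (elim exE conjE) (rule that)
 show "EX W (m::nat) r. opn X W & p : W & W <= U &
    (ALL j<m. r j : {..<n} \<rightarrow> Os X W & lin_comb G U W n (r j) s = 0[msec G W]) &
    (ALL Z b. opn X Z & Z <= W & b : {..<n} \<rightarrow> Os X Z & lin_comb G U Z n b s = 0[msec G Z] -->
     (ALL q:Z. EX Y c. opn X Y & q : Y & Y <= Z & c : {..<m} \<rightarrow> Os X Y &
       (ALL i<n. ores X Z Y (b i) = finsum (osec X Y) (%j. c j *[osec X Y] ores X W Y (r j i)) {..<m})))"
 proof (rule exI[of _ Y], rule exI[of _ m], rule exI[of _ r], intro conjI)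
  show "opn X Y" "p : Y" by fact+
  show "Y <= U" using Y(3) by auto
  show "ALL j<m. r j : {..<n} \<rightarrow> Os X Y & lin_comb G U Y n (r j) s = 0[msec G Y]"
   using r iff[OF Y(1,3)] by simp
  show "ALL Z b. opn X Z & Z <= Y & b : {..<n} \<rightarrow> Os X Z & lin_comb G U Z n b s = 0[msec G Z] -->
     (ALL q:Z. EX Y' c. opn X Y' & q : Y' & Y' <= Z & c : {..<m} \<rightarrow> Os X Y' &
       (ALL i<n. ores X Z Y' (b i) = finsum (osec X Y') (%j. c j *[osec X Y'] ores X Y Y' (r j i)) {..<m}))"
  proof (rule allI, rule allI, rule impI)
   fix Z b assume h: "opn X Z & Z <= Y & b : {..<n} \<rightarrow> Os X Z & lin_comb G U Z n b s = 0[msec G Z]"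
   have "Z <= ?W" using h Y(3) by auto
   hence "opn X Z & Z <= Y & b : {..<n} \<rightarrow> Os X Z & lin_comb F ?W Z n b ?s = 0[msec F Z]" using h iff[of Z b] by simp
   thus "ALL q:Z. EX Y' c. opn X Y' & q : Y' & Y' <= Z & c : {..<m} \<rightarrow> Os X Y' &
       (ALL i<n. ores X Z Y' (b i) = finsum (osec X Y') (%j. c j *[osec X Y'] ores X Y Y' (r j i)) {..<m})"
    by (rule mp[OF spec[OF spec[OF k]]])
  qed
 qed
qed

lemma iso_free_gen:
 assumes F: "mod_sheaf X F" and h: "\<phi> : mod_hom X F G" and bij: "!!U. opn X U ==> bij_betw (\<phi> U) (Ms F U) (Ms G U)"
  and e: "e : Ms F U" and g: "free_gen X G U (\<phi> U e)"
 shows "free_gen X F U e"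
 unfolding free_gen_def
proof (intro conjI allI impI ballI)
 interpret F: modsheaf X F by unfold_locales (rule F)
 note U = free_genD(1)[OF g]
 show "opn X U" "e : Ms F U" by fact+
 fix W s assume "opn X W & W <= U" and s: "s : Ms F W"
 hence W: "opn X W" "W <= U" by auto
 note eW = F.res_closed[OF U W e] and inj = inj_onD[OF bij_betw_imp_inj_on[OF bij[OF W(1)]]]
 have eq: "s = a *.[msec F W] mres F U W e \<longleftrightarrow> \<phi> W s = a *.[msec G W] mres G U W (\<phi> U e)" if a: "a : Os X W" for a
  using inj[OF _ s F.smult_closed[OF W(1) a eW]] mod_homD(3)[OF h W(1) a eW] mod_homD(4)[OF h U W e] by auto
 have "EX! a. a : Os X W & \<phi> W s = a *.[msec G W] mres G U W (\<phi> U e)"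
  by (rule free_genD(3)[OF g W mod_homD(1)[OF h W(1) s]])
 thus "EX! a. a : Os X W & s = a *.[msec F W] mres F U W e"
  using eq by (simp cong: conj_cong)
qed

end

section \<open>Twisting by an ample line bundle\<close>

lemma preim_id: "opn X U ==> preim X mor_id U = U"
 using openin_subset[of "tp X" U] by (auto simp: preim_def mor_id_def)

text \<open>The sheaf \<open>P m\<close> is the m-th twist only up to isomorphism, so it cannot be
  computed with directly. What survives is a generator \<open>w\<close> over \<open>U0\<close> and
  its transition functions: if w0 = b \<omega> and t0 = d t on the overlap with \<open>U\<close>,
  then w = b d^m \<omega>' for some generator \<omega>' over \<open>U\<close>. This says that w
  behaves like w0 t0^m.\<close>

lemma twist:
 assumes lX: "lrs X" and A: "line_bundle X A" and P0: "line_bundle X (P 0)"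
  and P: "!!m. mod_sheaf X (P m) & mod_iso X (P (Suc m)) (tensor X (P m) A)"
  and w0: "free_gen X (P 0) U0 w0" and t0: "free_gen X A U0 t0"
 shows "line_bundle X (P m) & (EX w. free_gen X (P m) U0 w &
  (ALL U \<omega> t b d. free_gen X (P 0) U \<omega> & free_gen X A U t & b : Os X (U Int U0) & d : Os X (U Int U0) &
   mres (P 0) U0 (U Int U0) w0 = b *.[msec (P 0) (U Int U0)] mres (P 0) U (U Int U0) \<omega> &
   mres A U0 (U Int U0) t0 = d *.[msec A (U Int U0)] mres A U (U Int U0) t -->
   (EX \<omega>'. free_gen X (P m) U \<omega>' & mres (P m) U0 (U Int U0) w =
    (b *[osec X (U Int U0)] d ^[osec X (U Int U0)] m) *.[msec (P m) (U Int U0)] mres (P m) U (U Int U0) \<omega>')))"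
proof (induction m)
 case 0
 interpret rsheaf X by unfold_locales (use lX in \<open>simp add: lrs_def\<close>)
 have "EX \<omega>'. free_gen X (P 0) U \<omega>' & mres (P 0) U0 (U Int U0) w0 = (b *[osec X (U Int U0)] d ^[osec X (U Int U0)] (0::nat)) *.[msec (P 0) (U Int U0)] mres (P 0) U (U Int U0) \<omega>'"
  if h: "free_gen X (P 0) U \<omega>" "b : Os X (U Int U0)"
   "mres (P 0) U0 (U Int U0) w0 = b *.[msec (P 0) (U Int U0)] mres (P 0) U (U Int U0) \<omega>" for U \<omega> b d
 proof -
  interpret cring "osec X (U Int U0)" by (rule cr) (use free_genD(1)[OF h(1)] free_genD(1)[OF w0] in blast)
  show ?thesis using h by (intro exI[of _ \<omega>]) simp
 qed
 thus ?case using P0 w0 by blast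
next
 case (Suc m)
 interpret rsheaf X by unfold_locales (use lX in \<open>simp add: lrs_def\<close>)
 have lP: "line_bundle X (P m)" using Suc.IH by (rule conjunct1)
 interpret T: gpl X X mor_id "P m" A by (rule gpl.intro[OF lX lX mor_id_pre_hom[OF rs] lP A])
 let ?T = "gp X X mor_id (P m) A"
 have "mod_iso X (P (Suc m)) ?T" using conjunct2[OF P[of m]] unfolding tensor_eq_gp[OF lX lP A] .
 then obtain \<phi> where h: "\<phi> : mod_hom X (P (Suc m)) ?T"
  and bij': "ALL U. opn X U --> bij_betw (\<phi> U) (Ms (P (Suc m)) U) (Ms ?T U)" unfolding mod_iso_def by (elim bexE)
 note bij = mp[OF spec[OF bij']]
 have Pm: "mod_sheaf X (P (Suc m))" using P by blast
 interpret S: modsheaf X "P (Suc m)" by unfold_locales (rule Pm)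
 \<comment> \<open>Generators of the explicit tensor product are carried back along the
   isomorphism.\<close>
 have lift: "EX e. e : Ms (P (Suc m)) U & \<phi> U e = g & free_gen X (P (Suc m)) U e" if g: "free_gen X ?T U g" for U g
 proof -
  have "g : \<phi> U ` Ms (P (Suc m)) U"
   unfolding bij_betw_imp_surj_on[OF bij[OF free_genD(1)[OF g]]] by (rule free_genD(2)[OF g])
  then obtain e where e: "g = \<phi> U e" "e : Ms (P (Suc m)) U" by (rule imageE)
  have "free_gen X (P (Suc m)) U e" by (rule iso_free_gen[OF Pm h bij e(2) g[unfolded e(1)]])
  thus ?thesis using e by (intro exI[of _ e] conjI) simp_all
 qed
 let ?c = "%U x t. (\<lambda>q\<in>U. T.cls U x U t q)"
 have cg: "free_gen X ?T U (?c U x t)" if "free_gen X (P m) U x" "free_gen X A U t" for U x t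
  using T.psec_free_gen[OF free_genD(1)[OF that(1)] _ that] preim_id[OF free_genD(1)[OF that(1)]] by simp
 have LB: "line_bundle X (P (Suc m))" unfolding line_bundle_def
 proof (intro conjI ballI Pm)
  fix p assume "p : pts X"
  then obtain U g where "p : U" "free_gen X ?T U g" using line_bundleD(2)[OF T.gp_line_bundle] by blast
  thus "EX U e. p : U & free_gen X (P (Suc m)) U e" using lift by blast
 qed
 obtain w where w: "free_gen X (P m) U0 w" and IH: "ALL U \<omega> t b d. free_gen X (P 0) U \<omega> & free_gen X A U t & b : Os X (U Int U0) & d : Os X (U Int U0) &
   mres (P 0) U0 (U Int U0) w0 = b *.[msec (P 0) (U Int U0)] mres (P 0) U (U Int U0) \<omega> &
   mres A U0 (U Int U0) t0 = d *.[msec A (U Int U0)] mres A U (U Int U0) t -->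
   (EX \<omega>'. free_gen X (P m) U \<omega>' & mres (P m) U0 (U Int U0) w =
    (b *[osec X (U Int U0)] d ^[osec X (U Int U0)] m) *.[msec (P m) (U Int U0)] mres (P m) U (U Int U0) \<omega>')"
  using conjunct2[OF Suc.IH] by (elim exE conjE) (rule that)
 obtain v where v: "v : Ms (P (Suc m)) U0" "\<phi> U0 v = ?c U0 w t0" "free_gen X (P (Suc m)) U0 v"
  using lift[OF cg[OF w t0]] by (elim exE conjE) (rule that)
 note o0 = free_genD(1,2)[OF w] free_genD(2)[OF t0]
 have ST: "EX \<omega>''. free_gen X (P (Suc m)) U \<omega>'' & mres (P (Suc m)) U0 (U Int U0) v =
    (b *[osec X (U Int U0)] d ^[osec X (U Int U0)] Suc m) *.[msec (P (Suc m)) (U Int U0)] mres (P (Suc m)) U (U Int U0) \<omega>''"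
  if g: "free_gen X (P 0) U \<omega> & free_gen X A U t & b : Os X (U Int U0) & d : Os X (U Int U0) &
   mres (P 0) U0 (U Int U0) w0 = b *.[msec (P 0) (U Int U0)] mres (P 0) U (U Int U0) \<omega> &
   mres A U0 (U Int U0) t0 = d *.[msec A (U Int U0)] mres A U (U Int U0) t" for U \<omega> t b d
 proof -
  let ?D = "U Int U0"
  note g1 = conjunct2[OF g] note g2 = conjunct2[OF g1] note g3 = conjunct2[OF g2]
  note t = conjunct1[OF g1] and b = conjunct1[OF g2] and d = conjunct1[OF g3] and td = conjunct2[OF conjunct2[OF g3]]
  from mp[OF spec[OF spec[OF spec[OF spec[OF spec[OF IH]]]]] g] obtain y where y: "free_gen X (P m) U y"
   and wy: "mres (P m) U0 ?D w = (b *[osec X ?D] d ^[osec X ?D] m) *.[msec (P m) ?D] mres (P m) U ?D y" by (elim exE conjE)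
  obtain z where z: "z : Ms (P (Suc m)) U" "\<phi> U z = ?c U y t" "free_gen X (P (Suc m)) U z"
   using lift[OF cg[OF y t]] by (elim exE conjE) (rule that)
  note oU = free_genD(1,2)[OF y] free_genD(2)[OF t]
  have D: "opn X ?D" "?D <= U" "?D <= U0" "?D <= preim X mor_id ?D" using oU(1) o0(1) preim_id[of X ?D] by auto
  interpret O: cring "osec X ?D" by (rule cr[OF D(1)])
  interpret MA: module "osec X ?D" "msec A ?D" by (rule T.G.md[OF D(1)])
  let ?b = "b *[osec X ?D] d ^[osec X ?D] m"
  have bc: "?b : Os X ?D" using b d by simp
  note yD = T.F.free_gen_res[OF y D(1,2)] and tD = T.G.res_closed[OF oU(1) D(1,2) oU(3)]
  have b1: "ores X (preim X mor_id ?D) ?D (mco mor_id ?D ?b) = ?b"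
   unfolding preim_id[OF D(1)] using ores_self[OF D(1) bc] by (simp add: mor_id_def)
  \<comment> \<open>Over the overlap w (x) t0 = (b d^m y) (x) (d t) = b d^(m+1) (y (x) t).\<close>
  have "mres ?T U0 ?D (?c U0 w t0) = (\<lambda>q\<in>?D. T.cls ?D (mres (P m) U0 ?D w) ?D (mres A U0 ?D t0) q)"
   by (rule T.psec_res[OF o0(1) D(1,3,4) o0(3) o0(1) D(1,3) o0(2)])
  also have "... = (\<lambda>q\<in>?D. T.cls ?D (mres (P m) U ?D y) ?D (?b *.[msec A ?D] (d *.[msec A ?D] mres A U ?D t)) q)"
   unfolding wy td using T.psec_balance[OF D(1,4) MA.smult_closed[OF d tD] D(1) free_genD(2)[OF yD] bc] unfolding b1 .
  also have "?b *.[msec A ?D] (d *.[msec A ?D] mres A U ?D t) = (b *[osec X ?D] d ^[osec X ?D] Suc m) *.[msec A ?D] mres A U ?D t"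
   using MA.smult_assoc1[OF bc d tD] b d by (simp add: O.m_assoc)
  also have "(\<lambda>q\<in>?D. T.cls ?D (mres (P m) U ?D y) ?D ((b *[osec X ?D] d ^[osec X ?D] Suc m) *.[msec A ?D] mres A U ?D t) q)
    = (b *[osec X ?D] d ^[osec X ?D] Suc m) *.[msec ?T ?D] (\<lambda>q\<in>?D. T.cls ?D (mres (P m) U ?D y) ?D (mres A U ?D t) q)"
   by (rule T.psec_smult[OF D(1,4) yD tD]) (use b d in simp)
  also have "(\<lambda>q\<in>?D. T.cls ?D (mres (P m) U ?D y) ?D (mres A U ?D t) q) = mres ?T U ?D (?c U y t)"
   by (rule T.psec_res[OF oU(1) D(1,2,4) oU(3) oU(1) D(1,2) oU(2), symmetric])
  finally have e: "\<phi> ?D (mres (P (Suc m)) U0 ?D v) = (b *[osec X ?D] d ^[osec X ?D] Suc m) *.[msec ?T ?D] \<phi> ?D (mres (P (Suc m)) U ?D z)"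
   unfolding mod_homD(4)[OF h o0(1) D(1,3) v(1)] mod_homD(4)[OF h oU(1) D(1,2) z(1)] v(2) z(2) .
  have bs: "b *[osec X ?D] d ^[osec X ?D] Suc m : Os X ?D" using b d by simp
  note zD = S.res_closed[OF oU(1) D(1,2) z(1)]
  have "mres (P (Suc m)) U0 ?D v = (b *[osec X ?D] d ^[osec X ?D] Suc m) *.[msec (P (Suc m)) ?D] mres (P (Suc m)) U ?D z"
   by (rule inj_onD[OF bij_betw_imp_inj_on[OF bij[OF D(1)]] _ S.res_closed[OF o0(1) D(1,3) v(1)] S.smult_closed[OF D(1) bs zD]])
    (use e mod_homD(3)[OF h D(1) bs zD] in simp)
  thus ?thesis using z(3) by (intro exI[of _ z] conjI)
 qed
 show ?case by (rule conjI[OF LB], rule exI[of _ v], rule conjI[OF v(3)], intro allI impI) (rule ST)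
qed

text \<open>If every global section used to generate \<open>w\<close> near \<open>p\<close> vanished
  on \<open>U0\<close>, then \<open>w\<close> would vanish near \<open>p\<close>, although it is a
  free generator and 1 is not 0 there.\<close>

lemma (in rsheaf) nonzero_global_section:
 assumes P: "line_bundle X P" and gg: "globally_generated X P" and w: "free_gen X P U0 w" and ne: "p : U0"
  and nz: "!!W. opn X W ==> W ~= {} ==> 1[osec X W] ~= 0[osec X W]"
 obtains \<tau> \<xi> where "\<tau> : Ms P (pts X)" "\<xi> : Os X U0" "\<xi> ~= 0[osec X U0]" "mres P (pts X) U0 \<tau> = \<xi> *.[msec P U0] w"
proof -
 interpret P: modsheaf X P by (rule line_bundle_modsheaf[OF P])
 note U0 = free_genD(1,2)[OF w]
 note sub = openin_subset[OF U0(1)]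
 interpret M0: module "osec X U0" "msec P U0" by (rule P.md[OF U0(1)])
 have "EX W n t a. opn X W & p : W & W <= U0 & t : {..<n} \<rightarrow> Ms P (pts X) &
   a : {..<n} \<rightarrow> Os X W & mres P U0 W w = lin_comb P (pts X) W n a t"
  using gg U0 ne unfolding globally_generated_def by simp
 then obtain W and n :: nat and t a where W: "opn X W" "p : W" "W <= U0" and t: "t : {..<n} \<rightarrow> Ms P (pts X)"
  and a: "a : {..<n} \<rightarrow> Os X W" and eq: "mres P U0 W w = lin_comb P (pts X) W n a t" by (elim exE conjE) (rule that)
 interpret M: module "osec X W" "msec P W" by (rule P.md[OF W(1)])
 have "EX i<n. mres P (pts X) U0 (t i) ~= 0[msec P U0]"
 proof (rule ccontr)
  assume "\<not> (EX i<n. mres P (pts X) U0 (t i) ~= 0[msec P U0])"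
  hence z: "mres P (pts X) U0 (t i) = 0[msec P U0]" if "i < n" for i using that by blast
  have "a i *.[msec P W] mres P (pts X) W (t i) = 0[msec P W]" if i: "i : {..<n}" for i
  proof -
   have ti: "t i : Ms P (pts X)" "a i : Os X W" using t a i by auto
   have "mres P (pts X) W (t i) = 0[msec P W]"
    using P.res_res[OF openin_pts U0(1) W(1,3) sub ti(1)] z[of i] i P.res_zero[OF U0(1) W(1,3)] by simp
   thus ?thesis using M.smult_r_null[OF ti(2)] by simp
  qed
  hence "lin_comb P (pts X) W n a t = 0[msec P W]" unfolding lin_comb_def by (rule M.M.add.finprod_one_eqI)
  hence "mres P U0 W w = 0[msec P W]" using eq by simp
  hence "1[osec X W] *.[msec P W] mres P U0 W w = 0[msec P W]" by (simp add: M.smult_r_null)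
  hence "1[osec X W] = 0[osec X W]" using gen_smult_zero[OF P.ms w W(1,3) M.R.one_closed] by simp
  thus False using nz[OF W(1)] W(2) by auto
 qed
 then obtain i where i: "i < n" "mres P (pts X) U0 (t i) ~= 0[msec P U0]" by (elim exE conjE)
 have ti: "t i : Ms P (pts X)" using t i(1) by auto
 obtain \<xi> where x: "\<xi> : Os X U0" "mres P (pts X) U0 (t i) = \<xi> *.[msec P U0] mres P U0 U0 w"
  by (rule free_gen_coef[OF w U0(1) order_refl P.res_closed[OF openin_pts U0(1) sub ti]])
 have "\<xi> ~= 0[osec X U0]" using i(2) x(2) M0.smult_l_null P.res_id[OF U0] U0(2) by auto
 thus thesis using that[OF ti x(1)] x(2) P.res_id[OF U0] by simp
qed

section \<open>The total space\<close>

lemma osheaf_one_gen: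
 assumes rs: "ring_sheaf V" and W: "opn V W"
 shows "free_gen V (osheaf V) W 1[osec V W]"
proof -
 interpret rsheaf V by unfold_locales (rule rs)
 have "EX! a. a : Os V Z & s = a *[osec V Z] ores V W Z 1[osec V W]"
  if Z: "opn V Z" "Z <= W" "s : Os V Z" for Z s
 proof -
  interpret Z: cring "osec V Z" by (rule cr[OF Z(1)])
  show ?thesis unfolding ores_ops(3)[OF W Z(1,2)] using Z(3) by (intro ex1I[of _ s]) auto
 qed
 thus ?thesis unfolding free_gen_def using W ring.ring_simprules(6)[OF cring.axioms(1)[OF cr[OF W]]] by simp
qed

lemma osheaf_line_bundle: "ring_sheaf V ==> line_bundle V (osheaf V)"
 unfolding line_bundle_def using mod_sheaf_osheaf[of V] osheaf_one_gen[of V "pts V"] by auto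

lemma domain_transport:
 assumes P: "domain P" and S: "cring S" and h: "h : ring_hom P S" and surj: "carrier S <= h ` carrier P"
  and inj: "!!p. p : carrier P ==> h p = 0[S] ==> p = 0[P]"
 shows "domain S"
proof -
 interpret P: domain P by (rule P)
 interpret S: cring S by (rule S)
 have h0: "h 0[P] = 0[S]" by (rule ring_hom_zero[OF h P.ring_axioms S.ring_axioms])
 show ?thesis
 proof (rule domainI[OF S])
  show "1[S] ~= 0[S]" using inj[OF P.one_closed] ring_hom_one[OF h] P.one_not_zero by auto
  fix a b assume ab: "a *[S] b = 0[S]" "a : carrier S" "b : carrier S"
  obtain p where p: "p : carrier P" "a = h p" using ab(2) surj by blast
  obtain q where q: "q : carrier P" "b = h q" using ab(3) surj by blast
  have "h (p *[P] q) = 0[S]" using ring_hom_mult[OF h p(1) q(1)] ab(1) p(2) q(2) by simp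
  hence "p = 0[P] \<or> q = 0[P]" using inj P.integral p(1) q(1) by blast
  thus "a = 0[S] \<or> b = 0[S]" using h0 p(2) q(2) by auto
 qed
qed

locale tot =
 fixes X :: "('p, 'a) rspace" and L :: "('p, 'a, 'l) msheaf" and V :: "('v, 'b) rspace"
  and \<pi> :: "('v, 'b, 'p, 'a) rmor" and \<sigma> :: "'p set => ('p set => 'l => 'a) => 'b"
 assumes X: "integral_scheme X" and lA: "line_bundle X (dual X L)" and ts: "total_space X L V \<pi> \<sigma>"
begin

abbreviation A where "A \<equiv> dual X L"
abbreviation pr where "pr \<equiv> preim V \<pi>"

lemma tsD: "lrs V" "pre_hom V X \<pi>" "affine_open X U ==> affine_open V (pr U)" "\<sigma> : mod_hom X A (pushforward_osheaf V \<pi>)"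
 "[|affine_open X U; free_gen X A U t; s : Os V (pr U)|] ==>
  EX! c :: nat => 'a. c : UNIV \<rightarrow> Os X U & finite {m. c m ~= 0[osec X U]} & s = finsum (osec V (pr U))
   (%m. mco \<pi> U (c m) *[osec V (pr U)] \<sigma> U t ^[osec V (pr U)] m) {m. c m ~= 0[osec X U]}"
proof -
 note T = ts[unfolded total_space_def]
 show "lrs V" using T by (simp add: scheme_def)
 note T1 = conjunct2[OF T] note T2 = conjunct2[OF T1] note T3 = conjunct2[OF T2]
 show "pre_hom V X \<pi>" using conjunct1[OF T1] by (simp add: lrs_hom_iff)
 show "affine_open X U ==> affine_open V (pr U)" using conjunct1[OF T2] by simp
 show "\<sigma> : mod_hom X A (pushforward_osheaf V \<pi>)" by (rule conjunct1[OF T3])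
 assume h: "affine_open X U" "free_gen X A U t" "s : Os V (pr U)"
 show "EX! c :: nat => 'a. c : UNIV \<rightarrow> Os X U & finite {m. c m ~= 0[osec X U]} & s = finsum (osec V (pr U))
   (%m. mco \<pi> U (c m) *[osec V (pr U)] \<sigma> U t ^[osec V (pr U)] m) {m. c m ~= 0[osec X U]}"
  by (rule bspec[OF mp[OF spec[OF spec[OF conjunct2[OF T3]]] conjI[OF h(1,2)]] h(3)])
qed

lemma rsV: "ring_sheaf V" using tsD(1) by (simp add: lrs_def)

sublocale rX: irr X by (rule integral_irr[OF X])
sublocale rV: rsheaf V by unfold_locales (rule rsV)

lemma pr_opn: "opn X U ==> opn V (pr U)" by (rule pre_homD(1)[OF tsD(2)])

lemma mc:
 assumes "opn X U"
 shows "mco \<pi> U : ring_hom (osec X U) (osec V (pr U))" by (rule pre_homD(3)[OF tsD(2) assms])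

lemma sigma_in: "opn X U ==> t : Ms A U ==> \<sigma> U t : Os V (pr U)"
 using mod_homD(1)[OF tsD(4)] by (simp add: pushforward_osheaf_def)

lemma sigma_smult: "opn X U ==> a : Os X U ==> t : Ms A U ==>
  \<sigma> U (a *.[msec A U] t) = mco \<pi> U a *[osec V (pr U)] \<sigma> U t"
 using mod_homD(3)[OF tsD(4)] by (simp add: pushforward_osheaf_def)

lemma sigma_res: "opn X U ==> opn X W ==> W <= U ==> t : Ms A U ==>
  \<sigma> W (mres A U W t) = ores V (pr U) (pr W) (\<sigma> U t)"
 using mod_homD(4)[OF tsD(4)] by (simp add: pushforward_osheaf_def)

section \<open>The polynomial ring over an affine open set\<close>

context
 fixes U t assumes U: "affine_open X U" "U ~= {}" and t: "free_gen X A U t"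
begin

private lemma oU: "opn X U" by (rule free_genD(1)[OF t])
private lemma domU: "domain (osec X U)" by (rule integral_schemeD(4)[OF X oU U(2)])

interpretation R: domain "osec X U" by (rule domU)
interpretation S: cring "osec V (pr U)" by (rule rV.cr[OF pr_opn[OF oU]])
interpretation h: ring_hom_cring "osec X U" "osec V (pr U)" "mco \<pi> U"
 by (intro ring_hom_cring.intro R.is_cring S.is_cring ring_hom_cring_axioms.intro mc[OF oU])
interpretation UP: UP_domain "osec X U" "UP (osec X U)" by unfold_locales simp
interpretation UP_pre_univ_prop "osec X U" "osec V (pr U)" "mco \<pi> U" "UP (osec X U)" by unfold_locales

private lemma T: "\<sigma> U t : Os V (pr U)" by (rule sigma_in[OF oU free_genD(2)[OF t]])

text \<open>Otherwise the sequence with the single entry \<xi> in degree m and the zero sequence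
  would be two systems of coefficients of the function 0.\<close>

lemma monomial_nonzero:
 assumes x: "\<xi> : Os X U" "\<xi> ~= 0[osec X U]"
 shows "mco \<pi> U \<xi> *[osec V (pr U)] \<sigma> U t ^[osec V (pr U)] (m::nat) ~= 0[osec V (pr U)]"
proof
 let ?f = "%c (m::nat). mco \<pi> U (c m) *[osec V (pr U)] \<sigma> U t ^[osec V (pr U)] m"
 let ?P = "%c. c : UNIV \<rightarrow> Os X U & finite {m. c m ~= 0[osec X U]} &
   0[osec V (pr U)] = finsum (osec V (pr U)) (?f c) {m. c m ~= 0[osec X U]}"
 let ?c = "%k. if k = m then \<xi> else 0[osec X U]"
 assume z: "mco \<pi> U \<xi> *[osec V (pr U)] \<sigma> U t ^[osec V (pr U)] m = 0[osec V (pr U)]"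
 have "{k. ?c k ~= 0[osec X U]} = {m}" using x(2) by auto
 hence 1: "?P ?c" using x(1) z by (auto simp: S.finsum_singleton)
 have 2: "?P (%_. 0[osec X U])" by simp
 have "EX! c. ?P c" by (rule tsD(5)[OF U(1) t S.zero_closed])
 hence "?c = (%_. 0[osec X U])" using 1 2 by blast
 thus False using x(2) fun_cong[of ?c "%_. 0[osec X U]" m] by simp
qed

text \<open>Evaluation at \<sigma>(t) is a homomorphism from the polynomial ring over the domain of
  functions on \<open>U\<close>. Existence of coefficients makes it surjective, and their uniqueness
  for the function 0 makes it injective.\<close>

lemma domain_preim: "domain (osec V (pr U))"
proof (rule domain_transport[OF UP.UP_domain S.is_cring eval_ring_hom[OF T]])
 let ?f = "%c (m::nat). mco \<pi> U (c m) *[osec V (pr U)] \<sigma> U t ^[osec V (pr U)] m"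
 let ?ev = "eval (osec X U) (osec V (pr U)) (mco \<pi> U) (\<sigma> U t)"
 \<comment> \<open>Elements of \<open>UP\<close> are sequences bounded by some index, whereas
   \<open>total_space\<close> speaks of finitely supported sequences; the two notions agree.\<close>
 have up: "p : carrier (UP (osec X U)) \<longleftrightarrow> (ALL m. p m : Os X U) & finite {m. p m ~= 0[osec X U]}" for p
 proof -
  have "(EX n. bound 0[osec X U] n p) \<longleftrightarrow> finite {m. p m ~= 0[osec X U]}"
  proof
   assume "EX n. bound 0[osec X U] n p"
   then obtain n where "bound 0[osec X U] n p" by (elim exE)
   hence "{m. p m ~= 0[osec X U]} <= {..n}" using bound_below by fastforce
   thus "finite {m. p m ~= 0[osec X U]}" by (rule finite_subset) simp
  next
   assume "finite {m. p m ~= 0[osec X U]}"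
   then obtain n where "ALL m:{m. p m ~= 0[osec X U]}. m \<le> n" using finite_nat_set_iff_bounded_le by blast
   hence "bound 0[osec X U] n p" by (intro bound.intro) (use not_le in blast)
   thus "EX n. bound 0[osec X U] n p" by (rule exI)
  qed
  thus ?thesis by (auto simp: UP_def up_def)
 qed
 have co: "coeff (UP (osec X U)) p = p" if "p : carrier (UP (osec X U))" for p using that by (simp add: UP_def)
 have ev: "?ev p = finsum (osec V (pr U)) (?f p) {m. p m ~= 0[osec X U]}" if p: "p : carrier (UP (osec X U))" for p
 proof -
  have pm: "p m : Os X U" for m using p up by blast
  have "{m. p m ~= 0[osec X U]} <= {..deg (osec X U) p}"
   using UP.deg_aboveD[OF _ p] unfolding co[OF p] by (auto simp: not_le[symmetric])
  hence "finsum (osec V (pr U)) (?f p) {m. p m ~= 0[osec X U]} = finsum (osec V (pr U)) (?f p) {..deg (osec X U) p}"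
   by (intro S.add.finprod_mono_neutral_cong_left) (use T pm in auto)
  thus ?thesis unfolding UP.eval_on_carrier[OF p] co[OF p] by simp
 qed
 show "Os V (pr U) <= ?ev ` carrier (UP (osec X U))"
 proof
  fix s assume s: "s : Os V (pr U)"
  obtain c :: "nat => 'a" where c: "c : UNIV \<rightarrow> Os X U" "finite {m. c m ~= 0[osec X U]}" "s = finsum (osec V (pr U)) (?f c) {m. c m ~= 0[osec X U]}"
   using tsD(5)[OF U(1) t s] by (elim ex1E conjE) (rule that)
  have "c : carrier (UP (osec X U))" using c(1,2) up by auto
  thus "s : ?ev ` carrier (UP (osec X U))" using ev c(3) by (intro image_eqI[of _ _ c]) simp_all
 qed
 fix p assume p: "p : carrier (UP (osec X U))" "?ev p = 0[osec V (pr U)]"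
 let ?P = "%c. c : UNIV \<rightarrow> Os X U & finite {m. c m ~= 0[osec X U]} &
   0[osec V (pr U)] = finsum (osec V (pr U)) (?f c) {m. c m ~= 0[osec X U]}"
 have 1: "?P p" using p ev[OF p(1)] up by auto
 have 2: "?P (%_. 0[osec X U])" by simp
 have "EX! c. ?P c" by (rule tsD(5)[OF U(1) t S.zero_closed])
 hence "p = (%_. 0[osec X U])" using 1 2 by blast
 thus "p = 0[UP (osec X U)]" by (simp add: UP_def)
qed

text \<open>The ring of sections over the empty set is zero and thus not a domain.\<close>

lemma preim_nonempty: "pr U ~= {}"
proof
 interpret D: domain "osec V (pr U)" by (rule domain_preim)
 assume e: "pr U = {}"
 have "1[osec V (pr U)] = 0[osec V (pr U)]"
  unfolding e by (rule rV.osec_empty) (use S.one_closed S.zero_closed in \<open>simp_all only: e\<close>)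
 thus False using D.one_not_zero by simp
qed

end

lemma affine_gen:
 assumes "opn X N" "p : N"
 obtains U t where "affine_open X U" "p : U" "U <= N" "free_gen X A U t"
proof -
 interpret A: modsheaf X A by (rule rX.line_bundle_modsheaf[OF lA])
 have "p : pts X" using assms openin_subset by blast
 then obtain W t where W: "p : W" "free_gen X A W t" using line_bundleD(2)[OF lA] by blast
 have "opn X (N Int W)" "p : N Int W" using assms W free_genD(1)[OF W(2)] by auto
 then obtain U where U: "affine_open X U" "p : U" "U <= N Int W" by (rule affine_base[OF X])
 have "free_gen X A U (mres A W U t)" by (rule A.free_gen_res[OF W(2)]) (use U in \<open>auto simp: affine_open_def\<close>)
 thus thesis using U by (intro that[of U]) auto
qed

text \<open>\<open>V\<close> is covered by the preimages of nonempty affine open sets on which the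
  dual of \<open>L\<close> has a generator. Their rings are domains, and two of them meet because
  below the intersection lies another set of this kind.\<close>

lemma irrV: "irr V"
proof (rule irrI[OF rsV])
 let ?U = "{pr U |U t. affine_open X U & U ~= {} & free_gen X A U t}"
 show "affine_open V W" "domain (osec V W)" if "W : ?U" for W using that tsD(3) domain_preim by blast+
 show "EX W:?U. p : W" if p: "p : pts V" for p
 proof -
  have "mpt \<pi> p : pts X" by (rule pre_homD(2)[OF tsD(2) p])
  then obtain U t where U: "affine_open X U" "mpt \<pi> p : U" "U <= pts X" "free_gen X A U t" by (rule affine_gen[OF openin_topspace])
  have "p : pr U" "U ~= {}" using p U(2) by (auto simp: preim_def)
  thus ?thesis using U(1,4) by blast
 qed
 fix W W' assume "W : ?U" "W' : ?U"
 then obtain U t U' t' where U: "W = pr U" "affine_open X U" "U ~= {}" and U': "W' = pr U'" "affine_open X U'" "U' ~= {}" by blast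
 have o: "opn X U" "opn X U'" using U(2) U'(2) by (auto simp: affine_open_def)
 obtain p where p: "p : U Int U'" using rX.meet[OF o U(3) U'(3)] by blast
 have "opn X (U Int U')" using o by blast
 \<comment> \<open>An affine set with a generator inside the intersection; its preimage is not empty
   and lies in both members of the cover.\<close>
 then obtain Z s where Z: "affine_open X Z" "p : Z" "Z <= U Int U'" "free_gen X A Z s" by (rule affine_gen[OF _ p])
 have "Z ~= {}" using Z(2) by blast
 from preim_nonempty[OF Z(1) this Z(4)] show "W Int W' ~= {}"
  using preim_mono[OF Z(3), of V \<pi>] unfolding U(1) U'(1) preim_Int by blast
qed

text \<open>The pulled-back section e (x) 1 over the preimage of \<open>U\<close>.\<close>

definition st :: "('p, 'a, 'm) msheaf => 'p set => 'm => 'v => (('p set \<times> 'm) set \<times> ('v set \<times> 'b) set \<Rightarrow>\<^sub>0 int) set"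
 where "st E U e = (\<lambda>q\<in>pr U. gp_cls V X \<pi> E (osheaf V) U e (pr U) 1[osec V (pr U)] q)"

lemma gpl_E: "line_bundle X E ==> gpl V X \<pi> E (osheaf V)"
 by (rule gpl.intro[OF tsD(1) integral_schemeD(1)[OF X] tsD(2) _ osheaf_line_bundle[OF rsV]])

lemma pb_line_bundle: "line_bundle X E ==> line_bundle V (pullback V X \<pi> E)"
 unfolding pullback_eq_gp by (rule gpl.gp_line_bundle[OF gpl_E])

lemma st_gen:
 assumes "line_bundle X E" "free_gen X E U e"
 shows "free_gen V (pullback V X \<pi> E) (pr U) (st E U e)"
 unfolding pullback_eq_gp st_def
 by (rule gpl.psec_free_gen[OF gpl_E[OF assms(1)] pr_opn[OF free_genD(1)[OF assms(2)]] order_refl assms(2)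
   osheaf_one_gen[OF rsV pr_opn[OF free_genD(1)[OF assms(2)]]]])

text \<open>Transition functions pull back along \<pi>: the coefficient \<open>a\<close> moves to
  the second factor, where it acts on 1.\<close>

lemma st_res:
 assumes E: "line_bundle X E" and e: "free_gen X E U e" and e': "free_gen X E U' e'"
  and W: "opn X W" "W <= U" "W <= U'" and a: "a : Os X W" and eq: "mres E U W e = a *.[msec E W] mres E U' W e'"
 shows "mres (pullback V X \<pi> E) (pr U) (pr W) (st E U e) =
  mco \<pi> W a *.[msec (pullback V X \<pi> E) (pr W)] mres (pullback V X \<pi> E) (pr U') (pr W) (st E U' e')"
proof -
 interpret T: gpl V X \<pi> E "osheaf V" by (rule gpl_E[OF E])
 note U = free_genD(1,2)[OF e] and U' = free_genD(1,2)[OF e']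
 note o = pr_opn[OF W(1)] pr_opn[OF U(1)] pr_opn[OF U'(1)]
 interpret O: cring "osec V (pr W)" by (rule rV.cr[OF o(1)])
 have one: "1[osec V (pr Y)] : Ms (osheaf V) (pr Y)" if "opn X Y" for Y
  using free_genD(2)[OF osheaf_one_gen[OF rsV pr_opn[OF that]]] .
 have r1: "mres (osheaf V) (pr Y) (pr W) 1[osec V (pr Y)] = 1[osec V (pr W)]" if "opn X Y" "W <= Y" for Y
  using rV.ores_ops(3)[OF pr_opn[OF that(1)] o(1) preim_mono[OF that(2)]] by simp
 have ac: "mco \<pi> W a : Os V (pr W)" by (rule ring_hom_closed[OF mc[OF W(1)] a])
 note eW = T.F.free_gen_res[OF e' W(1,3)]
 let ?S = "%x v. (\<lambda>q\<in>pr W. T.cls W x (pr W) v q)"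
 have "mres (gp V X \<pi> E (osheaf V)) (pr U) (pr W) (st E U e) = ?S (mres E U W e) 1[osec V (pr W)]"
  unfolding st_def T.psec_res[OF o(2,1) preim_mono[OF W(2)] order_refl one[OF U(1)] U(1) W(1,2) U(2)] r1[OF U(1) W(2)] ..
 also have "... = ?S (mres E U' W e') (ores V (pr W) (pr W) (mco \<pi> W a) *.[msec (osheaf V) (pr W)] 1[osec V (pr W)])"
  unfolding eq by (rule T.psec_balance[OF o(1) order_refl one[OF W(1)] W(1) free_genD(2)[OF eW] a])
 also have "... = mco \<pi> W a *.[msec (gp V X \<pi> E (osheaf V)) (pr W)] ?S (mres E U' W e') 1[osec V (pr W)]"
  unfolding rV.ores_self[OF o(1) ac] by (rule T.psec_smult[OF o(1) order_refl eW one[OF W(1)] ac])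
 also have "?S (mres E U' W e') 1[osec V (pr W)] = mres (gp V X \<pi> E (osheaf V)) (pr U') (pr W) (st E U' e')"
  unfolding st_def T.psec_res[OF o(3,1) preim_mono[OF W(3)] order_refl one[OF U'(1)] U'(1) W(1,3) U'(2)] r1[OF U'(1) W(3)] ..
 finally show ?thesis unfolding pullback_eq_gp .
qed

end

section \<open>Homomorphisms between the pullbacks\<close>

context tot begin

text \<open>For some \<open>m\<close> the m-th twist of the Hom sheaf has a global section \<tau>
  that is not zero over \<open>U0\<close>. There \<tau> reads \<xi> times the generator that stands
  for (e0 -> f0) t0^m. On \<open>V\<close> the power of t0 becomes a function, and the homomorphism
  sends e0 to \<xi> \<sigma>(t0)^m f0. It extends to all of \<open>V\<close> because \<tau> is
  global: over any other trivializing set \<tau> has a regular coefficient \<psi>, and \<psi>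
  \<sigma>(t)^m describes the same homomorphism there.\<close>

lemma hom_exists:
 fixes Ei Ej :: "('p, 'a, 'm) msheaf"
 assumes amp: "ample TYPE('m) X A" and Ei: "line_bundle X Ei" and Ej: "line_bundle X Ej" and coh: "coherent X Ej"
  and U0: "affine_open X U0" "p0 : U0" and e0: "free_gen X Ei U0 e0" and f0: "free_gen X Ej U0 f0" and t0: "free_gen X A U0 t0"
 shows "EX \<phi>:mod_hom V (pullback V X \<pi> Ei) (pullback V X \<pi> Ej). EX \<theta>:Os V (pr U0).
  \<theta> ~= 0[osec V (pr U0)] & \<phi> (pr U0) (st Ei U0 e0) = \<theta> *.[msec (pullback V X \<pi> Ej) (pr U0)] st Ej U0 f0"
proof -
 let ?Fi = "pullback V X \<pi> Ei" and ?Fj = "pullback V X \<pi> Ej"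
 have ne: "U0 ~= {}" using U0(2) by blast
 note o0 = free_genD(1)[OF e0]
 interpret h: homs X Ei Ej U0 e0 by unfold_locales (fact Ei Ej e0 ne)+
 interpret AA: modsheaf X A by (rule rX.line_bundle_modsheaf[OF lA])
 have one: "1[osec X W] ~= 0[osec X W]" if "opn X W" "W ~= {}" for W
  using domain.one_not_zero[OF integral_schemeD(4)[OF X that]] .
 \<comment> \<open>Over \<open>U0\<close> the section f0 records the homomorphism e0 -> f0, which
   generates the Hom sheaf there; the coefficient of e0 with respect to itself is 1.\<close>
 have f0': "free_gen X h.HG U0 f0"
 proof -
  interpret M: module "osec X U0" "msec Ej U0" by (rule h.G.md[OF o0])
  interpret N: module "osec X U0" "msec Ei U0" by (rule h.F.md[OF o0])
  have "free_gen X h.HG U0 (1[osec X (U0 Int U0)] *.[msec Ej (U0 Int U0)] mres Ej U0 (U0 Int U0) f0)"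
   by (rule h.HG_gen[OF e0 f0]) (use h.F.res_closed[OF o0 o0 order_refl h.U0(2)] in simp_all)
  thus ?thesis using h.G.res_id[OF o0 free_genD(2)[OF f0]] free_genD(2)[OF f0] by simp
 qed
 have "coherent X h.HG" by (rule rX.coherent_line_bundle[OF Ej coh h.HG_line_bundle])
 then obtain P m where P0: "P 0 = h.HG" and P: "ALL m. mod_sheaf X (P m) & mod_iso X (P (Suc m)) (tensor X (P m) A)"
  and gg: "globally_generated X (P m)" using amp unfolding ample_def by (metis order_refl)
 have lP0: "line_bundle X (P 0)" and w0: "free_gen X (P 0) U0 f0" using P0 h.HG_line_bundle f0' by simp_all
 note tw = twist[OF integral_schemeD(1)[OF X] lA lP0 spec[OF P] w0 t0, of m]
 note lP = conjunct1[OF tw]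
 interpret Pm: modsheaf X "P m" by (rule rX.line_bundle_modsheaf[OF lP])
 obtain w where w: "free_gen X (P m) U0 w" and tw2: "ALL U \<omega> t b d. free_gen X (P 0) U \<omega> & free_gen X A U t & b : Os X (U Int U0) & d : Os X (U Int U0) &
   mres (P 0) U0 (U Int U0) f0 = b *.[msec (P 0) (U Int U0)] mres (P 0) U (U Int U0) \<omega> &
   mres A U0 (U Int U0) t0 = d *.[msec A (U Int U0)] mres A U (U Int U0) t -->
   (EX \<omega>'. free_gen X (P m) U \<omega>' & mres (P m) U0 (U Int U0) w =
    (b *[osec X (U Int U0)] d ^[osec X (U Int U0)] m) *.[msec (P m) (U Int U0)] mres (P m) U (U Int U0) \<omega>')"
  using conjunct2[OF tw] by (elim exE conjE) (rule that)
 obtain \<tau> \<xi> where \<tau>: "\<tau> : Ms (P m) (pts X)" and \<xi>: "\<xi> : Os X U0" "\<xi> ~= 0[osec X U0]"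
  and \<tau>\<xi>: "mres (P m) (pts X) U0 \<tau> = \<xi> *.[msec (P m) U0] w"
  by (rule rX.nonzero_global_section[OF lP gg w U0(2) one])
 define V0 where "V0 = pr U0"
 have oV0: "opn V V0" unfolding V0_def by (rule pr_opn[OF o0])
 interpret O0: cring "osec V V0" by (rule rV.cr[OF oV0])
 note t0c = free_genD(2)[OF t0]
 \<comment> \<open>The coefficient of the homomorphism over the preimage of \<open>U0\<close>. It is
   a nonzero monomial in the fibre coordinate.\<close>
 define \<theta> where "\<theta> = mco \<pi> U0 \<xi> *[osec V V0] \<sigma> U0 t0 ^[osec V V0] m"
 have mx: "mco \<pi> U0 \<xi> : Os V V0" unfolding V0_def by (rule ring_hom_closed[OF mc[OF o0] \<xi>(1)])
 have st0: "\<sigma> U0 t0 : Os V V0" unfolding V0_def by (rule sigma_in[OF o0 t0c])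
 have "\<theta> : Os V V0" using mx st0 by (simp add: \<theta>_def)
 moreover have "\<theta> ~= 0[osec V V0]" using monomial_nonzero[OF U0(1) ne t0 \<xi>, of m] by (simp add: \<theta>_def V0_def)
 ultimately have \<theta>: "\<theta> : Os V V0" "\<theta> ~= 0[osec V V0]" by auto
 interpret iV: irr V by (rule irrV)
 have gi: "free_gen V ?Fi V0 (st Ei U0 e0)" and gj: "free_gen V ?Fj V0 (st Ej U0 f0)"
  unfolding V0_def by (rule st_gen[OF Ei e0], rule st_gen[OF Ej f0])
 interpret v: homs V ?Fi ?Fj V0 "st Ei U0 e0"
  by unfold_locales (use pb_line_bundle[OF Ei] pb_line_bundle[OF Ej] gi preim_nonempty[OF U0(1) ne t0] in \<open>simp_all add: V0_def\<close>)
 let ?s = "\<theta> *.[msec ?Fj V0] st Ej U0 f0"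
 have sc: "?s : Ms ?Fj V0" by (rule v.G.smult_closed[OF oV0 \<theta>(1) free_genD(2)[OF gj]])
 have P0': "pts V Int V0 = V0" using openin_subset[OF oV0] by auto
 have "v.ext (pts V) ?s"
 \<comment> \<open>Extension is checked near each point of \<open>V\<close>, over the preimage of an
   affine set \<open>U\<close> on which Ei, Ej and the dual of L have generators \<epsilon>, \<eta>
   and t. The comparison with \<open>U0\<close> takes place over the overlap
   \<open>D\<close>.\<close>
 proof (rule v.ext_local[OF openin_topspace])
  show "?s : Ms ?Fj (pts V Int V0)" unfolding P0' by (rule sc)
  fix p assume p: "p : pts V"
  have pX: "mpt \<pi> p : pts X" by (rule pre_homD(2)[OF tsD(2) p])
  obtain U1 \<epsilon>1 \<eta>1 where 1: "mpt \<pi> p : U1" "free_gen X Ei U1 \<epsilon>1" "free_gen X Ej U1 \<eta>1" by (rule h.common_gens[OF pX])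
  obtain U t where U: "mpt \<pi> p : U" "U <= U1" and t: "free_gen X A U t"
   by (rule affine_gen[OF free_genD(1)[OF 1(2)] 1(1)])
  note oU = free_genD(1)[OF t] and tc = free_genD(2)[OF t]
  define \<epsilon> where "\<epsilon> = mres Ei U1 U \<epsilon>1"
  define \<eta> where "\<eta> = mres Ej U1 U \<eta>1"
  have \<epsilon>: "free_gen X Ei U \<epsilon>" unfolding \<epsilon>_def by (rule h.F.free_gen_res[OF 1(2) oU U(2)])
  have \<eta>: "free_gen X Ej U \<eta>" unfolding \<eta>_def by (rule h.G.free_gen_res[OF 1(3) oU U(2)])
  define D where "D = U Int U0"
  have D: "opn X D" "D <= U" "D <= U0" "D Int U0 = D" unfolding D_def using oU o0 by auto
  interpret O: cring "osec X D" by (rule rX.cr[OF D(1)])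
  note resE = h.F.res_closed[OF oU D(1,2) free_genD(2)[OF \<epsilon>]] and resH = h.G.res_closed[OF oU D(1,2) free_genD(2)[OF \<eta>]]
   and rese = h.F.res_closed[OF o0 D(1,3) free_genD(2)[OF e0]] and resf = h.G.res_closed[OF o0 D(1,3) free_genD(2)[OF f0]]
  obtain a where a: "a : Os X D" "mres Ei U D \<epsilon> = a *.[msec Ei D] mres Ei U0 D e0" by (rule free_gen_coef[OF e0 D(1,3) resE])
  obtain a' where a': "a' : Os X D" "mres Ei U0 D e0 = a' *.[msec Ei D] mres Ei U D \<epsilon>" by (rule free_gen_coef[OF \<epsilon> D(1,2) rese])
  obtain b where b: "b : Os X D" "mres Ej U0 D f0 = b *.[msec Ej D] mres Ej U D \<eta>" by (rule free_gen_coef[OF \<eta> D(1,2) resf])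
  obtain d where d: "d : Os X D" "mres A U0 D t0 = d *.[msec A D] mres A U D t"
   by (rule free_gen_coef[OF t D(1,2) AA.res_closed[OF o0 D(1,3) t0c]])
  interpret Mi: module "osec X D" "msec Ei D" by (rule h.F.md[OF D(1)])
  interpret Mj: module "osec X D" "msec Ej D" by (rule h.G.md[OF D(1)])
  interpret Mp: module "osec X D" "msec (P m) D" by (rule Pm.md[OF D(1)])
  have aa: "a' *[osec X D] a = 1[osec X D]"
  proof (rule free_gen_unique[OF e0 D(1,3)])
   show "(a' *[osec X D] a) *.[msec Ei D] mres Ei U0 D e0 = 1[osec X D] *.[msec Ei D] mres Ei U0 D e0"
    unfolding Mi.smult_assoc1[OF a'(1) a(1) rese] a(2)[symmetric] a'(2)[symmetric] Mi.smult_one[OF rese] ..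
  qed (use a(1) a'(1) rese in simp_all)
  \<comment> \<open>The record of the homomorphism \<epsilon> -> \<eta>, which sends e0 = a'
    \<epsilon> to a' \<eta>.\<close>
  define \<omega> where "\<omega> = a' *.[msec Ej D] mres Ej U D \<eta>"
  have wc: "\<omega> : Ms Ej D" unfolding \<omega>_def using a'(1) resH by simp
  have \<omega>: "free_gen X (P 0) U \<omega>" unfolding P0 \<omega>_def D_def
   by (rule h.HG_gen[OF \<epsilon> \<eta> a'(1)[unfolded D_def] a'(2)[unfolded D_def]])
  let ?b = "a *[osec X D] b"
  have bc: "?b : Os X D" using a(1) b(1) by simp
  \<comment> \<open>The homomorphism e0 -> f0 sends \<epsilon> = a e0 to a f0 = a b \<eta>, so it is
    a b times the homomorphism \<epsilon> -> \<eta>.\<close>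
  have "mres Ej U0 D f0 = ?b *.[msec Ej D] \<omega>"
  proof -
   have "?b *[osec X D] a' = b" using aa a(1) a'(1) b(1) O.m_comm O.m_assoc by (metis O.l_one)
   thus ?thesis unfolding b(2) \<omega>_def using Mj.smult_assoc1[OF bc a'(1) resH] by simp
  qed
  hence wb: "mres (P 0) U0 D f0 = ?b *.[msec (P 0) D] mres (P 0) U D \<omega>"
   unfolding P0 h.HG_sel D(4) Int_absorb D_def[symmetric] h.G.res_id[OF D(1) wc] rX.ores_self[OF D(1) bc] .
  from mp[OF spec[OF spec[OF spec[OF spec[OF spec[OF tw2]]]]], of U \<omega> t ?b d, folded D_def]
  have "EX \<omega>'. free_gen X (P m) U \<omega>' & mres (P m) U0 D w = (?b *[osec X D] d ^[osec X D] m) *.[msec (P m) D] mres (P m) U D \<omega>'"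
   using \<omega> t bc d wb by blast
  then obtain y where y: "free_gen X (P m) U y" and wy: "mres (P m) U0 D w = (?b *[osec X D] d ^[osec X D] m) *.[msec (P m) D] mres (P m) U D y"
   by (elim exE conjE)
  note sU = openin_subset[OF oU] and sU0 = openin_subset[OF o0]
  obtain \<psi> where \<psi>: "\<psi> : Os X U" "mres (P m) (pts X) U \<tau> = \<psi> *.[msec (P m) U] mres (P m) U U y"
   by (rule free_gen_coef[OF y oU order_refl Pm.res_closed[OF openin_topspace oU sU \<tau>]])
  let ?x = "ores X U0 D \<xi>" and ?y = "ores X U D \<psi>"
  have xy: "?x : Os X D" "?y : Os X D" by (rule rX.ores_in[OF o0 D(1,3) \<xi>(1)], rule rX.ores_in[OF oU D(1,2) \<psi>(1)])
  let ?k = "?b *[osec X D] d ^[osec X D] m"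
  have kc: "?k : Os X D" using bc d(1) by simp
  note yc = free_genD(2)[OF y] and wwc = free_genD(2)[OF w]
  note yD = Pm.res_closed[OF oU D(1,2) yc]
  \<comment> \<open>The global section \<tau> restricted to \<open>D\<close> is computed from both
    sides: it is \<psi> y over \<open>U\<close> and \<xi> w over \<open>U0\<close>, with w = a b d^m
    y.\<close>
  have psi: "?y = ?x *[osec X D] ?k"
  proof (rule free_gen_unique[OF y D(1,2) xy(2)])
   have "?y *.[msec (P m) D] mres (P m) U D y = mres (P m) (pts X) D \<tau>"
    using Pm.res_res[OF openin_topspace oU D(1,2) sU \<tau>] \<psi>(2) Pm.res_id[OF oU yc] Pm.res_smult[OF oU D(1,2) \<psi>(1) yc] by simp
   also have "... = ?x *.[msec (P m) D] mres (P m) U0 D w"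
    using Pm.res_res[OF openin_topspace o0 D(1,3) sU0 \<tau>] \<tau>\<xi> Pm.res_smult[OF o0 D(1,3) \<xi>(1) wwc] by simp
   also have "... = (?x *[osec X D] ?k) *.[msec (P m) D] mres (P m) U D y"
    unfolding wy by (rule Mp.smult_assoc1[OF xy(1) kc yD, symmetric])
   finally show "?y *.[msec (P m) D] mres (P m) U D y = (?x *[osec X D] ?k) *.[msec (P m) D] mres (P m) U D y" .
  qed (use xy kc yD in simp_all)
  define Z where "Z = pr U"
  have Z: "opn V Z" "p : Z" "Z Int V0 = pr D" "pr D <= Z" "pr D <= V0" "opn V (pr D)"
   using pr_opn[OF oU] p U(1) pr_opn[OF D(1)] preim_mono[OF D(2)] preim_mono[OF D(3)]
   by (auto simp: Z_def V0_def D_def preim_Int preim_def)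
  interpret W: cring "osec V (pr D)" by (rule rV.cr[OF Z(6)])
  interpret mD: ring_hom_cring "osec X D" "osec V (pr D)" "mco \<pi> D"
   by (intro ring_hom_cring.intro O.is_cring W.is_cring ring_hom_cring_axioms.intro mc[OF D(1)])
  interpret ZU: cring "osec V Z" by (rule rV.cr[OF Z(1)])
  interpret MW: module "osec V (pr D)" "msec ?Fj (pr D)" by (rule v.G.md[OF Z(6)])
  let ?T = "\<sigma> D (mres A U D t)"
  have Tc: "?T : Os V (pr D)" by (rule sigma_in[OF D(1) AA.res_closed[OF oU D(1,2) tc]])
  have stU: "\<sigma> U t : Os V Z" unfolding Z_def by (rule sigma_in[OF oU tc])
  have myc: "mco \<pi> U \<psi> : Os V Z" unfolding Z_def by (rule ring_hom_closed[OF mc[OF oU] \<psi>(1)])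
  \<comment> \<open>The coefficient of the homomorphism over the preimage of \<open>U\<close>: the
    local coefficient of \<tau> times the m-th power of the fibre coordinate.\<close>
  define c where "c = mco \<pi> U \<psi> *[osec V Z] \<sigma> U t ^[osec V Z] m"
  have cc: "c : Os V Z" unfolding c_def using stU myc by simp
  have c1: "ores V Z (pr D) (mco \<pi> U \<psi>) = mco \<pi> D ?y" unfolding Z_def by (rule pre_homD(4)[OF tsD(2) oU D(1,2) \<psi>(1), symmetric])
  have c2: "ores V Z (pr D) (\<sigma> U t) = ?T" unfolding Z_def by (rule sigma_res[OF oU D(1,2) tc, symmetric])
  have cD: "ores V Z (pr D) c = mco \<pi> D ?y *[osec V (pr D)] ?T ^[osec V (pr D)] m"
   unfolding c_def rV.ores_ops(2)[OF Z(1,6,4) myc ZU.nat_pow_closed[OF stU]] rV.ores_ops(5)[OF Z(1,6,4) stU] c1 c2 ..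
  have dT: "\<sigma> D (mres A U0 D t0) = mco \<pi> D d *[osec V (pr D)] ?T"
   unfolding d(2) by (rule sigma_smult[OF D(1) d(1) AA.res_closed[OF oU D(1,2) tc]])
  have d1: "ores V V0 (pr D) (mco \<pi> U0 \<xi>) = mco \<pi> D ?x" unfolding V0_def by (rule pre_homD(4)[OF tsD(2) o0 D(1,3) \<xi>(1), symmetric])
  have d2: "ores V V0 (pr D) (\<sigma> U0 t0) = mco \<pi> D d *[osec V (pr D)] ?T" unfolding V0_def sigma_res[OF o0 D(1,3) t0c, symmetric] by (rule dT)
  have thD: "ores V V0 (pr D) \<theta> = mco \<pi> D ?x *[osec V (pr D)] (mco \<pi> D d *[osec V (pr D)] ?T) ^[osec V (pr D)] m"
   unfolding \<theta>_def rV.ores_ops(2)[OF oV0 Z(6,5) mx O0.nat_pow_closed[OF st0]] rV.ores_ops(5)[OF oV0 Z(6,5) st0] d1 d2 ..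
  have f0D: "mres ?Fj V0 (pr D) (st Ej U0 f0) = mco \<pi> D b *.[msec ?Fj (pr D)] mres ?Fj Z (pr D) (st Ej U \<eta>)"
   unfolding V0_def Z_def by (rule st_res[OF Ej f0 \<eta> D(1,3,2) b])
  have g\<eta>: "free_gen V ?Fj Z (st Ej U \<eta>)" and g\<epsilon>: "free_gen V ?Fi Z (st Ei U \<epsilon>)" unfolding Z_def by (rule st_gen[OF Ej \<eta>], rule st_gen[OF Ei \<epsilon>])
  let ?h = "mres ?Fj Z (pr D) (st Ej U \<eta>)"
  have hc: "?h : Ms ?Fj (pr D)" by (rule v.G.res_closed[OF Z(1,6,4) free_genD(2)[OF g\<eta>]])
  note thc = rV.ores_in[OF oV0 Z(6,5) \<theta>(1)]
  have ma: "mco \<pi> D a : Os V (pr D)" "mco \<pi> D b : Os V (pr D)" "mco \<pi> D d : Os V (pr D)" "mco \<pi> D ?x : Os V (pr D)"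
   using a(1) b(1) d(1) xy(1) by simp_all
  \<comment> \<open>With T the fibre coordinate over \<open>D\<close>, the left side is \<xi> a b
    d^m T^m, and the right side is a times \<xi> (d T)^m times b.\<close>
  have ring_eq: "mco \<pi> D ?y *[osec V (pr D)] ?T ^[osec V (pr D)] m =
    mco \<pi> D a *[osec V (pr D)] (ores V V0 (pr D) \<theta> *[osec V (pr D)] mco \<pi> D b)"
  proof -
   have "mco \<pi> D ?y = mco \<pi> D ?x *[osec V (pr D)] ((mco \<pi> D a *[osec V (pr D)] mco \<pi> D b) *[osec V (pr D)] mco \<pi> D d ^[osec V (pr D)] m)"
    unfolding psi using xy(1) a(1) b(1) d(1) by (simp add: mD.hom_pow)
   thus ?thesis unfolding thD W.nat_pow_distrib[OF ma(3) Tc] using ma W.nat_pow_closed[OF ma(3), of m] W.nat_pow_closed[OF Tc, of m]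
    by (simp add: W.m_ac)
  qed
  have ext: "v.ext Z (mres ?Fj (pts V Int V0) (Z Int V0) ?s)"
  proof (rule v.ext_gen[OF g\<epsilon>])
   show "mres ?Fj (pts V Int V0) (Z Int V0) ?s : Ms ?Fj (Z Int V0)"
    unfolding P0' Z(3) by (rule v.G.res_closed[OF oV0 Z(6,5) sc])
   show "v.rel Z (st Ei U \<epsilon>) (mco \<pi> D a)" unfolding v.rel_def Z(3)
   proof (rule conjI[OF ma(1)])
    show "mres ?Fi Z (pr D) (st Ei U \<epsilon>) = mco \<pi> D a *.[msec ?Fi (pr D)] mres ?Fi V0 (pr D) (st Ei U0 e0)"
     unfolding V0_def Z_def by (rule st_res[OF Ei \<epsilon> e0 D(1,2,3) a])
   qed
   show "c *.[msec ?Fj Z] st Ej U \<eta> : Ms ?Fj Z" by (rule v.G.smult_closed[OF Z(1) cc free_genD(2)[OF g\<eta>]])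
   have "mres ?Fj Z (pr D) (c *.[msec ?Fj Z] st Ej U \<eta>) = (mco \<pi> D ?y *[osec V (pr D)] ?T ^[osec V (pr D)] m) *.[msec ?Fj (pr D)] ?h"
    unfolding v.G.res_smult[OF Z(1,6,4) cc free_genD(2)[OF g\<eta>]] cD ..
   also have "... = mco \<pi> D a *.[msec ?Fj (pr D)] (ores V V0 (pr D) \<theta> *.[msec ?Fj (pr D)] (mco \<pi> D b *.[msec ?Fj (pr D)] ?h))"
    unfolding ring_eq using MW.smult_assoc1[OF ma(1) W.m_closed[OF thc ma(2)] hc] MW.smult_assoc1[OF thc ma(2) hc] by simp
   also have "ores V V0 (pr D) \<theta> *.[msec ?Fj (pr D)] (mco \<pi> D b *.[msec ?Fj (pr D)] ?h) = mres ?Fj V0 (pr D) ?s"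
    unfolding v.G.res_smult[OF oV0 Z(6,5) \<theta>(1) free_genD(2)[OF gj]] f0D ..
   finally show "mres ?Fj Z (Z Int V0) (c *.[msec ?Fj Z] st Ej U \<eta>) = mco \<pi> D a *.[msec ?Fj (Z Int V0)] mres ?Fj (pts V Int V0) (Z Int V0) ?s"
    unfolding P0' Z(3) .
  qed
  show "EX Z. opn V Z & p : Z & Z <= pts V & v.ext Z (mres ?Fj (pts V Int V0) (Z Int V0) ?s)"
   using Z(1,2) openin_subset[OF Z(1)] ext by (intro exI[of _ Z] conjI)
 qed
 from v.ext_hom[OF sc this] show ?thesis using \<theta> unfolding V0_def by blast
qed

text \<open>Nonzero maps exist in both directions, with coefficients \<theta> and \<eta> over the
  preimage of one affine set. Their composition is multiplication by a global \<open>h\<close>,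
  which restricts to the product of \<theta> and \<eta> in a domain and is therefore not
  zero.\<close>

lemma loop_exists:
 fixes Ei Ej :: "('p, 'a, 'm) msheaf"
 assumes amp: "ample TYPE('m) X A" and Ei: "line_bundle X Ei" "coherent X Ei" and Ej: "line_bundle X Ej" "coherent X Ej"
 defines "Fi \<equiv> pullback V X \<pi> Ei" and "Fj \<equiv> pullback V X \<pi> Ej"
 shows "EX f g h. f : mod_hom V Fi Fj & g : mod_hom V Fj Fi & h : Os V (pts V) & h ~= 0[osec V (pts V)] &
  hom_comp V Fi g f = hom_smult V Fi Fi h (hom_id V Fi)"
proof -
 interpret Ei: modsheaf X Ei by (rule rX.line_bundle_modsheaf[OF Ei(1)])
 interpret Ej: modsheaf X Ej by (rule rX.line_bundle_modsheaf[OF Ej(1)])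
 obtain p where p: "p : pts X" using integral_schemeD(3)[OF X] by blast
 obtain W e where W: "p : W" "free_gen X Ei W e" using line_bundleD(2)[OF Ei(1) p] by (elim exE conjE) (rule that)
 obtain W' f where W': "p : W'" "free_gen X Ej W' f" using line_bundleD(2)[OF Ej(1) p] by (elim exE conjE) (rule that)
 have "opn X (W Int W')" "p : W Int W'" using W W' free_genD(1)[OF W(2)] free_genD(1)[OF W'(2)] by auto
 then obtain U t where U: "affine_open X U" "p : U" "U <= W Int W'" and t: "free_gen X A U t" by (rule affine_gen)
 note o = free_genD(1)[OF t]
 have sub: "U <= W" "U <= W'" "U ~= {}" using U by auto
 note e = Ei.free_gen_res[OF W(2) o sub(1)] and f = Ej.free_gen_res[OF W'(2) o sub(2)]
 let ?e = "st Ei U (mres Ei W U e)" and ?f = "st Ej U (mres Ej W' U f)"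
 obtain \<phi> where \<phi>: "\<phi> : mod_hom V Fi Fj" and \<phi>': "EX \<theta>:Os V (pr U). \<theta> ~= 0[osec V (pr U)] & \<phi> (pr U) ?e = \<theta> *.[msec Fj (pr U)] ?f"
  using hom_exists[OF amp Ei(1) Ej U(1,2) e f t] unfolding Fi_def Fj_def by (rule bexE)
 obtain \<theta> where \<theta>1: "\<theta> : Os V (pr U)" and \<theta>2: "\<theta> ~= 0[osec V (pr U)] & \<phi> (pr U) ?e = \<theta> *.[msec Fj (pr U)] ?f"
  using \<phi>' by (rule bexE)
 note \<theta> = \<theta>1 conjunct1[OF \<theta>2] and e\<phi> = conjunct2[OF \<theta>2]
 obtain \<chi> where \<chi>: "\<chi> : mod_hom V Fj Fi" and \<chi>': "EX \<eta>:Os V (pr U). \<eta> ~= 0[osec V (pr U)] & \<chi> (pr U) ?f = \<eta> *.[msec Fi (pr U)] ?e"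
  using hom_exists[OF amp Ej(1) Ei U(1,2) f e t] unfolding Fi_def Fj_def by (rule bexE)
 obtain \<eta> where \<eta>1: "\<eta> : Os V (pr U)" and \<eta>2: "\<eta> ~= 0[osec V (pr U)] & \<chi> (pr U) ?f = \<eta> *.[msec Fi (pr U)] ?e"
  using \<chi>' by (rule bexE)
 note \<eta> = \<eta>1 conjunct1[OF \<eta>2] and e\<chi> = conjunct2[OF \<eta>2]
 note oP = pr_opn[OF o]
 have lF: "line_bundle V Fi" unfolding Fi_def by (rule pb_line_bundle[OF Ei(1)])
 interpret F: modsheaf V Fi by (rule rV.line_bundle_modsheaf[OF lF])
 note comp = rV.hom_comp_in[OF F.ms \<phi> \<chi>]
 obtain h where h: "h : Os V (pts V)" "hom_comp V Fi \<chi> \<phi> = hom_smult V Fi Fi h (hom_id V Fi)"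
  by (rule rV.line_bundle_endo[OF lF comp])
 have ge: "free_gen V Fi (pr U) ?e" unfolding Fi_def by (rule st_gen[OF Ei(1) e])
 have gf: "free_gen V Fj (pr U) ?f" unfolding Fj_def by (rule st_gen[OF Ej(1) f])
 interpret D: domain "osec V (pr U)" by (rule domain_preim[OF U(1) sub(3) t])
 interpret M: module "osec V (pr U)" "msec Fi (pr U)" by (rule F.md[OF oP])
 note ec = free_genD(2)[OF ge]
 note hU = rV.ores_in[OF openin_topspace oP openin_subset[OF oP] h(1)]
 have "ores V (pts V) (pr U) h *.[msec Fi (pr U)] ?e = hom_comp V Fi \<chi> \<phi> (pr U) ?e"
  unfolding h(2) by (simp add: hom_apply[OF oP ec])
 also have "... = (\<theta> *[osec V (pr U)] \<eta>) *.[msec Fi (pr U)] ?e"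
  unfolding hom_apply(2)[OF oP ec] e\<phi> mod_homD(3)[OF \<chi> oP \<theta>(1) free_genD(2)[OF gf]] e\<chi> by (rule M.smult_assoc1[OF \<theta>(1) \<eta>(1) ec, symmetric])
 finally have "ores V (pts V) (pr U) h *.[msec Fi (pr U)] mres Fi (pr U) (pr U) ?e = (\<theta> *[osec V (pr U)] \<eta>) *.[msec Fi (pr U)] mres Fi (pr U) (pr U) ?e"
  unfolding F.res_id[OF oP ec] .
 hence "ores V (pts V) (pr U) h = \<theta> *[osec V (pr U)] \<eta>"
  by (rule free_gen_unique[OF ge oP order_refl hU D.m_closed[OF \<theta>(1) \<eta>(1)]]) (use hU ec F.res_id[OF oP ec] in simp)
 hence "ores V (pts V) (pr U) h ~= 0[osec V (pr U)]" using D.integral[OF _ \<theta>(1) \<eta>(1)] \<theta>(2) \<eta>(2) by auto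
 hence "h ~= 0[osec V (pts V)]" using rV.ores_ops(4)[OF openin_topspace oP openin_subset[OF oP]] by auto
 thus ?thesis using \<phi> \<chi> h by (intro exI[of _ \<phi>] exI[of _ \<chi>] exI[of _ h] conjI)
qed

text \<open>Global functions embed into the polynomial ring over one nonempty affine open
  set.\<close>

lemma domain_global: "domain (osec V (pts V))"
proof -
 interpret iV: irr V by (rule irrV)
 obtain p where p: "p : pts X" using integral_schemeD(3)[OF X] by blast
 obtain U t where U: "affine_open X U" "p : U" "free_gen X A U t" by (rule affine_gen[OF openin_topspace p])
 have ne: "U ~= {}" using U(2) by blast
 note o = pr_opn[OF free_genD(1)[OF U(3)]]
 show ?thesis
  by (rule iV.domain_sections[OF openin_topspace o openin_subset[OF o] preim_nonempty[OF U(1) ne U(3)] domain_preim[OF U(1) ne U(3)]])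
qed

end

theorem corollary3p2:
  fixes \<kappa> :: "'k::alg_closed_field \<Rightarrow> 'a"
    and X :: "('p, 'a) rspace"
    and L :: "('p, 'a, 'l) msheaf"
    and E :: "int \<Rightarrow> ('p, 'a, 'm) msheaf"
    and n :: nat
    and V :: "('v, 'b) rspace"
    and \<pi> :: "('v, 'b, 'p, 'a) rmor"
    and \<sigma> :: "'p set \<Rightarrow> ('p set \<Rightarrow> 'l \<Rightarrow> 'a) \<Rightarrow> 'b"
  assumes "smooth_projective_variety \<kappa> X"
    and "line_bundle X L"
    and "ample TYPE('m) X (dual X L)"
    and "n \<ge> 1"
    and "\<forall>i\<in>{1..int n}. line_bundle X (E i)"
    and "exceptional_collection \<kappa> X n E"
    and "full_collection X n E"
    and "strong_collection X n E"
    and "simple_spiral X L n E"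
    and "total_space X L V \<pi> \<sigma>"
  defines "\<kappa>\<^sub>V \<equiv> (\<lambda>c. mco \<pi> (pts X) (\<kappa> c))"
    and "F \<equiv> (\<lambda>i. pullback V X \<pi> (E i))"
  shows "(\<exists>Z. irreducible_component (tp (M\<^sub>0 \<kappa>\<^sub>V V n F)) Z \<and>
           iso_onto_closed (V\<^sub>0 V) (inv_ring \<kappa>\<^sub>V V n F) (\<phi>\<^sub>0 \<kappa>\<^sub>V V n F) (reduced_ideal Z)) \<and>
         (reduced_scheme (M\<^sub>0 \<kappa>\<^sub>V V n F) \<longrightarrow>
           (\<exists>Z. irreducible_component (tp (M\<^sub>0 \<kappa>\<^sub>V V n F)) Z \<and>
             iso_onto_closed (V\<^sub>0 V) (inv_ring \<kappa>\<^sub>V V n F) (\<phi>\<^sub>0 \<kappa>\<^sub>V V n F)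
               (component_ideal (inv_ring \<kappa>\<^sub>V V n F) Z)))"
proof -
 have X: "integral_scheme X" and kX: "\<kappa> : ring_hom k_ring (osec X (pts X))"
  using assms(1) by (simp_all add: smooth_projective_variety_def k_scheme_def)
 have lA: "line_bundle X (dual X L)" using assms(3) unfolding ample_def by (rule conjunct1)
 interpret tot X L V \<pi> \<sigma> by (rule tot.intro[OF X lA assms(10)])
 have E: "line_bundle X (E i)" "coherent X (E i)" if "i : {1..int n}" for i
  using assms(5,6) that by (simp_all add: exceptional_collection_def exceptional_object_def)
 \<comment> \<open>Node 1 is the base point through which all the loops pass.\<close>
 have n1: "1 : {1..int n}" using assms(4) by simp
 have "bondal V \<kappa>\<^sub>V n F"
 proof (rule bondal.intro[OF rV.rsheaf_axioms bondal_axioms.intro])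
  show "\<kappa>\<^sub>V : ring_hom k_ring (osec V (pts V))"
   using ring_hom_trans[OF kX mc[OF openin_topspace]] unfolding \<kappa>\<^sub>V_def preim_pts[OF tsD(2)] comp_def .
  show "line_bundle V (F i)" if "i : {1..int n}" for i unfolding F_def by (rule pb_line_bundle[OF E(1)[OF that]])
  show "EX f g h. f : mod_hom V (F 1) (F i) & g : mod_hom V (F i) (F 1) & h : Os V (pts V) & h ~= 0[osec V (pts V)] &
    hom_comp V (F 1) g f = hom_smult V (F 1) (F 1) h (hom_id V (F 1))" if i: "i : {1..int n}" for i
   unfolding F_def by (rule loop_exists[OF assms(3) E[OF n1] E[OF i]])
 qed (fact assms(4) domain_global)+
 from bondal.iso_onto_component[OF this] show ?thesis by blast
qed

end
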